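(* Let $\mathcal{G}$ be a c-groupoid of dimension $\geq 2$ and let $n\geq 2$ be an integer. Then, the homomorphism $F^a:PB^a_n(\mathcal{G})\to PB^a_{n-1}(\mathcal{G})$ is an a-fibration, and the homomorphism $F^b:PB^b_n(\mathcal{G})\to PB^b_{n-1}(\mathcal{G})$ is a b-fibration.
   Context: Conventions: all manifolds are smooth, Hausdorff and paracompact; maps between manifolds are smooth; a fibration means a Hurewicz fibration. A Lie groupoid $\mathcal{G}$ is a groupoid whose object space $\mathcal{G}_0$ and morphism space $\mathcal{G}_1$ are smooth manifolds, all structure maps (source $s$, target $t$, inverse, unit $u(x)=1_x=id_x$, composition) are smooth, and $s,t:\mathcal{G}_1\to\mathcal{G}_0$ are submersions. Its dimension is the dimension of $\mathcal{G}_0$. A homomorphism $f$ of Lie groupoids is a smooth functor, with object map $f_0$ and morphism map $f_1$. The orbit of $x\in\mathcal{G}_0$ is $t(s^{-1}(x))$; $|\mathcal{G}|$ is the space of orbits with the quotient topology. $\mathcal{G}$ is Hausdorff if $|\mathcal{G}|$ is Hausdorff. $\mathcal{G}$ is a c-groupoid if the quotient map $\mathcal{G}_0\to|\mathcal{G}|$ is a covering map (a c-groupoid is Hausdorff). Left $\mathcal{G}$-space: a manifold $M$ with a smooth map $\pi:M\to\mathcal{G}_0$ and a smooth action map $\mu:\mathcal{G}_1\times_{\mathcal{G}_0}M\to M$, defined on pairs $(\alpha,x)$ with $\pi(x)=s(\alpha)$, such that $\pi(\mu(\alpha,x))=t(\alpha)$, $\mu(1_{\pi(x)},x)=x$, and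 $\mu(\alpha,\mu(\beta,x))=\mu(\alpha\beta,x)$ for composable $\alpha,\beta$. Let $f:\mathcal{H}\to\mathcal{G}$ be a homomorphism of Lie groupoids such that $f_0:\mathcal{H}_0\to\mathcal{G}_0$ is both a submersion and a fibration. - $f$ is an a-fibration if $\mathcal{H}_0$ is a left $\mathcal{G}$-space with $\pi=f_0$, $\mathcal{H}_1=\mathcal{G}_1\times_{\mathcal{G}_0}\mathcal{H}_0$, $f_1$ is the first projection, and the source and target maps of $\mathcal{H}$ are respectively the second projection and the action map. - $f$ is a b-fibration if the map $\mathcal{H}_1\to\mathcal{G}_1\times_{\mathcal{G}_0}\mathcal{H}_0$, $\alpha\mapsto(f_1(\alpha),s(\alpha))$, is a surjective submersion. Configuration Lie groupoids of a Hausdorff Lie groupoid $\mathcal{G}$. For both types the object space is the open submanifold $$PB_n(\mathcal{G})_0=\{(x_1,\ldots,x_n)\in\mathcal{G}_0^n \mid x_i \text{ and } x_j \text{ have distinct orbits for all } i\neq j\}.$$ (a) $PB^a_1(\mathcal{G})=\mathcal{G}$, and inductively $PB^a_n(\mathcal{G})_1=PB^a_{n-1}(\mathcal{G})_1\times_{PB_{n-1}(\mathcal{G})_0}PB_n(\mathcal{G})_0$, the fibered product of the source map $s_{n-1}$ of $PB^a_{n-1}(\mathcal{G})$ and the projection $PB_n(\mathcal{G})_0\to PB_{n-1}(\mathcal{G})_0$ to the first $n-1$ coordinates. For $x=(x_1,\ldots,x_n)$ the structure maps are $s_n(\alpha_{n-1},x)=x$, $t_n(\alpha_{n-1},x)=(t_{n-1}(\alpha_{n-1}),x_n)$,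 $(\alpha_{n-1},x)^{-1}=(\alpha_{n-1}^{-1},t_n(\alpha_{n-1},x))$, unit $id_x=(id_{(x_1,\ldots,x_{n-1})},x)$, and composition $(\alpha'_{n-1},x')\circ(\alpha_{n-1},x)=(\alpha'_{n-1}\circ\alpha_{n-1},x)$ when $t_n(\alpha_{n-1},x)=x'$. (b) $PB^b_n(\mathcal{G})_1=(s^n,t^n)^{-1}(PB_n(\mathcal{G})_0\times PB_n(\mathcal{G})_0)\subset\mathcal{G}_1^n$, where $s^n,t^n:\mathcal{G}_1^n\to\mathcal{G}_0^n$ are coordinatewise $s,t$; all structure maps are coordinatewise. $F^a$ is given on objects by projection to the first $n-1$ coordinates and on morphisms by $(\alpha_{n-1},x)\mapsto\alpha_{n-1}$. $F^b$ is given on objects and on morphisms by projection to the first $n-1$ coordinates. *)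

theory Defs
  imports "HOL-Analysis.Analysis"
begin

section \<open>Smooth maps between open subsets of Euclidean spaces\<close>

text \<open>
  The model spaces are the library's \<^const>\<open>Euclidean_space\<close> \<open>k\<close>, whose points are
  the sequences of reals vanishing from index \<open>k\<close> on. Dimensions are thus natural
  numbers, so that \<open>n\<close>-fold products with variable \<open>n\<close> are available.
\<close>

definition partial :: "nat \<Rightarrow> ((nat \<Rightarrow> real) \<Rightarrow> real) \<Rightarrow> (nat \<Rightarrow> real) \<Rightarrow> real" where
  "partial i f x = deriv (\<lambda>t. f (x(i := t))) (x i)"

text \<open>\<open>Cr_on r k W f\<close>: all partial derivatives of \<open>f\<close> of order at most \<open>r\<close> exist and are
  continuous on \<open>W\<close>, a set which is open in \<open>k\<close>-space whenever this is used.\<close>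

fun Cr_on :: "nat \<Rightarrow> nat \<Rightarrow> (nat \<Rightarrow> real) set \<Rightarrow> ((nat \<Rightarrow> real) \<Rightarrow> real) \<Rightarrow> bool" where
  "Cr_on 0 k W f \<longleftrightarrow> continuous_map (subtopology (Euclidean_space k) W) euclideanreal f"
| "Cr_on (Suc r) k W f \<longleftrightarrow>
     continuous_map (subtopology (Euclidean_space k) W) euclideanreal f \<and>
     (\<forall>i<k. (\<forall>x\<in>W. (\<lambda>t. f (x(i := t))) differentiable (at (x i))) \<and> Cr_on r k W (partial i f))"

definition smooth_on ::
  "nat \<Rightarrow> (nat \<Rightarrow> real) set \<Rightarrow> nat \<Rightarrow> ((nat \<Rightarrow> real) \<Rightarrow> (nat \<Rightarrow> real)) \<Rightarrow> bool" where
  "smooth_on k W l F \<longleftrightarrow> (\<forall>j<l. \<forall>r. Cr_on r k W (\<lambda>x. F x j))"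


section \<open>Smooth manifolds\<close>

text \<open>A chart \<open>(k, U, \<phi>)\<close> has domain \<open>U\<close> and takes values in \<open>k\<close>-space. The dimension may
  depend on the connected component. Values of \<open>\<phi>\<close> outside \<open>U\<close> are irrelevant.\<close>

type_synonym 'a chart = "nat \<times> 'a set \<times> ('a \<Rightarrow> nat \<Rightarrow> real)"

record 'a manifold =
  mtop :: "'a topology"
  atlas :: "'a chart set"

abbreviation pts :: "'a manifold \<Rightarrow> 'a set" where
  "pts M \<equiv> topspace (mtop M)"

definition is_chart :: "'a topology \<Rightarrow> 'a chart \<Rightarrow> bool" where
  "is_chart X c \<longleftrightarrow> (case c of (k, U, \<phi>) \<Rightarrow>
     openin X U \<and> openin (Euclidean_space k) (\<phi> ` U) \<and>
     homeomorphic_map (subtopology X U) (subtopology (Euclidean_space k) (\<phi> ` U)) \<phi>)"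

definition compatible :: "'a chart \<Rightarrow> 'a chart \<Rightarrow> bool" where
  "compatible c c' \<longleftrightarrow> (case (c, c') of ((k, U, \<phi>), (l, V, \<psi>)) \<Rightarrow>
     smooth_on k (\<phi> ` (U \<inter> V)) l (\<psi> \<circ> inv_into U \<phi>) \<and>
     smooth_on l (\<psi> ` (U \<inter> V)) k (\<phi> \<circ> inv_into V \<psi>))"

definition paracompact_space :: "'a topology \<Rightarrow> bool" where
  "paracompact_space X \<longleftrightarrow>
     (\<forall>\<U>. (\<forall>U\<in>\<U>. openin X U) \<and> \<Union>\<U> = topspace X \<longrightarrow>
       (\<exists>\<V>. (\<forall>V\<in>\<V>. openin X V \<and> (\<exists>U\<in>\<U>. V \<subseteq> U)) \<and> \<Union>\<V> = topspace X \<and>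
            locally_finite_in X \<V>))"

definition smooth_manifold :: "'a manifold \<Rightarrow> bool" where
  "smooth_manifold M \<longleftrightarrow>
     Hausdorff_space (mtop M) \<and> paracompact_space (mtop M) \<and>
     (\<forall>c\<in>atlas M. is_chart (mtop M) c) \<and>
     (\<Union>(k, U, \<phi>)\<in>atlas M. U) = pts M \<and>
     (\<forall>c\<in>atlas M. \<forall>c'\<in>atlas M. compatible c c')"

definition has_dimension :: "'a manifold \<Rightarrow> nat \<Rightarrow> bool" where
  "has_dimension M d \<longleftrightarrow> (\<forall>(k, U, \<phi>)\<in>atlas M. U \<noteq> {} \<longrightarrow> k = d)"

definition maximal_atlas :: "'a manifold \<Rightarrow> 'a chart set" where
  "maximal_atlas M = {c. is_chart (mtop M) c \<and> (\<forall>c'\<in>atlas M. compatible c c')}"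

definition smooth_map :: "'a manifold \<Rightarrow> 'b manifold \<Rightarrow> ('a \<Rightarrow> 'b) \<Rightarrow> bool" where
  "smooth_map M N f \<longleftrightarrow>
     continuous_map (mtop M) (mtop N) f \<and>
     (\<forall>(k, U, \<phi>)\<in>atlas M. \<forall>(l, V, \<psi>)\<in>atlas N.
        smooth_on k (\<phi> ` (U \<inter> f -` V)) l (\<psi> \<circ> f \<circ> inv_into U \<phi>))"

definition diffeomorphism :: "'a manifold \<Rightarrow> 'b manifold \<Rightarrow> ('a \<Rightarrow> 'b) \<Rightarrow> bool" where
  "diffeomorphism M N f \<longleftrightarrow> smooth_map M N f \<and>
     (\<exists>g. smooth_map N M g \<and> (\<forall>x\<in>pts M. g (f x) = x) \<and> (\<forall>y\<in>pts N. f (g y) = y))"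

text \<open>The differential is surjective at every point: in charts, the Jacobian matrix defines
  a surjective linear map from \<open>k\<close>-space to \<open>l\<close>-space.\<close>

definition submersion :: "'a manifold \<Rightarrow> 'b manifold \<Rightarrow> ('a \<Rightarrow> 'b) \<Rightarrow> bool" where
  "submersion M N f \<longleftrightarrow> smooth_map M N f \<and>
     (\<forall>(k, U, \<phi>)\<in>atlas M. \<forall>(l, V, \<psi>)\<in>atlas N. \<forall>x\<in>U \<inter> f -` V.
        \<forall>w\<in>topspace (Euclidean_space l). \<exists>v\<in>topspace (Euclidean_space k).
          \<forall>j<l. (\<Sum>i<k. partial i (\<lambda>y. (\<psi> \<circ> f \<circ> inv_into U \<phi>) y j) (\<phi> x) * v i) = w j)"


subsection \<open>Constructions\<close>

definition open_submanifold :: "'a manifold \<Rightarrow> 'a set \<Rightarrow> 'a manifold" where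
  "open_submanifold M W =
     \<lparr>mtop = subtopology (mtop M) W, atlas = {(k, U \<inter> W, \<phi>) |k U \<phi>. (k, U, \<phi>) \<in> atlas M}\<rparr>"

text \<open>The structure of an embedded submanifold, given by slice charts: the charts of \<open>M\<close>
  in whose coordinates \<open>S\<close> is the zero locus of all coordinates from index \<open>r\<close> on.\<close>

definition embedded_submanifold :: "'a manifold \<Rightarrow> 'a set \<Rightarrow> 'a manifold" where
  "embedded_submanifold M S =
     \<lparr>mtop = subtopology (mtop M) S,
      atlas = {(r, U \<inter> S, \<phi>) |r k U \<phi>. (k, U, \<phi>) \<in> maximal_atlas M \<and> r \<le> k \<and>
                 \<phi> ` (U \<inter> S) = \<phi> ` U \<inter> topspace (Euclidean_space r)}\<rparr>"

definition prod_manifold :: "'a manifold \<Rightarrow> 'b manifold \<Rightarrow> ('a \<times> 'b) manifold" where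
  "prod_manifold M N =
     \<lparr>mtop = prod_topology (mtop M) (mtop N),
      atlas = {(k + l, U \<times> V, \<lambda>(x, y) m. if m < k then \<phi> x m else \<psi> y (m - k))
                |k U \<phi> l V \<psi>. (k, U, \<phi>) \<in> atlas M \<and> (l, V, \<psi>) \<in> atlas N}\<rparr>"

text \<open>\<open>n\<close>-tuples are the extensional functions on \<open>{1..n}\<close>. A chart of the \<open>n\<close>-fold power is a
  product of charts \<open>c 1, \<dots>, c n\<close>, the bijection \<open>\<beta>\<close> listing all the coordinates in some order.\<close>

definition power_manifold :: "'a manifold \<Rightarrow> nat \<Rightarrow> (nat \<Rightarrow> 'a) manifold" where
  "power_manifold M n =
     \<lparr>mtop = product_topology (\<lambda>_. mtop M) {1..n},
      atlas = {(K, Pi\<^sub>E {1..n} U,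
                \<lambda>x m. if m < K then (case \<beta> m of (i, j) \<Rightarrow> \<phi> i (x i) j) else 0)
                |K k U \<phi> \<beta>. (\<forall>i\<in>{1..n}. (k i, U i, \<phi> i) \<in> atlas M) \<and>
                   bij_betw \<beta> {..<K} (SIGMA i:{1..n}. {..<k i})}\<rparr>"

definition fibre_product ::
  "'a manifold \<Rightarrow> ('a \<Rightarrow> 'c) \<Rightarrow> 'b manifold \<Rightarrow> ('b \<Rightarrow> 'c) \<Rightarrow> ('a \<times> 'b) manifold" where
  "fibre_product M f N g =
     embedded_submanifold (prod_manifold M N) {(x, y). x \<in> pts M \<and> y \<in> pts N \<and> f x = g y}"

text \<open>Transport of structure to the set \<open>A\<close> along a map \<open>h\<close> restricting to a bijection
  from \<open>A\<close> onto the points of \<open>M\<close>.\<close>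

definition transport :: "'b set \<Rightarrow> ('b \<Rightarrow> 'a) \<Rightarrow> 'a manifold \<Rightarrow> 'b manifold" where
  "transport A h M =
     \<lparr>mtop = pullback_topology A h (mtop M),
      atlas = {(k, h -` U \<inter> A, \<phi> \<circ> h) |k U \<phi>. (k, U, \<phi>) \<in> atlas M}\<rparr>"


section \<open>Fibrations and coverings\<close>

text \<open>Homotopy lifting with respect to all spaces on the type \<open>'y\<close>. A theorem with this
  conclusion for a type variable \<open>'y\<close> asserts it with respect to all spaces.\<close>

definition hurewicz_fibration ::
  "'y itself \<Rightarrow> 'a topology \<Rightarrow> 'b topology \<Rightarrow> ('a \<Rightarrow> 'b) \<Rightarrow> bool" where
  "hurewicz_fibration _ E B p \<longleftrightarrow> continuous_map E B p \<and>
     (\<forall>(Y :: 'y topology) h g.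
        continuous_map (prod_topology (top_of_set {0..1::real}) Y) B h \<and>
        continuous_map Y E g \<and> (\<forall>y\<in>topspace Y. p (g y) = h (0, y)) \<longrightarrow>
        (\<exists>k. continuous_map (prod_topology (top_of_set {0..1}) Y) E k \<and>
             (\<forall>y\<in>topspace Y. k (0, y) = g y) \<and>
             (\<forall>t\<in>{0..1}. \<forall>y\<in>topspace Y. p (k (t, y)) = h (t, y))))"

definition covering_map :: "'a topology \<Rightarrow> 'b topology \<Rightarrow> ('a \<Rightarrow> 'b) \<Rightarrow> bool" where
  "covering_map X Y p \<longleftrightarrow> continuous_map X Y p \<and> p ` topspace X = topspace Y \<and>
     (\<forall>y\<in>topspace Y. \<exists>T. y \<in> T \<and> openin Y T \<and>
        (\<exists>\<V>. \<Union>\<V> = topspace X \<inter> p -` T \<and> (\<forall>V\<in>\<V>. openin X V) \<and> pairwise disjnt \<V> \<and>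
             (\<forall>V\<in>\<V>. homeomorphic_map (subtopology X V) (subtopology Y T) p)))"


section \<open>Lie groupoids\<close>

text \<open>\<open>gcomp G \<alpha> \<beta>\<close> is the composite \<open>\<alpha>\<beta>\<close> (first \<open>\<beta>\<close>, then \<open>\<alpha>\<close>), meaningful
  when \<open>src G \<alpha> = tgt G \<beta>\<close>.\<close>

record ('o, 'm) groupoid_data =
  Ob :: "'o manifold"
  Mor :: "'m manifold"
  src :: "'m \<Rightarrow> 'o"
  tgt :: "'m \<Rightarrow> 'o"
  ident :: "'o \<Rightarrow> 'm"
  ginv :: "'m \<Rightarrow> 'm"
  gcomp :: "'m \<Rightarrow> 'm \<Rightarrow> 'm"

definition groupoid :: "('o, 'm) groupoid_data \<Rightarrow> bool" where
  "groupoid G \<longleftrightarrow>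
     (\<forall>\<alpha>\<in>pts (Mor G). src G \<alpha> \<in> pts (Ob G) \<and> tgt G \<alpha> \<in> pts (Ob G)) \<and>
     (\<forall>x\<in>pts (Ob G). ident G x \<in> pts (Mor G) \<and> src G (ident G x) = x \<and> tgt G (ident G x) = x) \<and>
     (\<forall>\<alpha>\<in>pts (Mor G). \<forall>\<beta>\<in>pts (Mor G). src G \<alpha> = tgt G \<beta> \<longrightarrow>
        gcomp G \<alpha> \<beta> \<in> pts (Mor G) \<and>
        src G (gcomp G \<alpha> \<beta>) = src G \<beta> \<and> tgt G (gcomp G \<alpha> \<beta>) = tgt G \<alpha>) \<and>
     (\<forall>\<alpha>\<in>pts (Mor G). \<forall>\<beta>\<in>pts (Mor G). \<forall>\<gamma>\<in>pts (Mor G).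
        src G \<alpha> = tgt G \<beta> \<and> src G \<beta> = tgt G \<gamma> \<longrightarrow>
        gcomp G (gcomp G \<alpha> \<beta>) \<gamma> = gcomp G \<alpha> (gcomp G \<beta> \<gamma>)) \<and>
     (\<forall>\<alpha>\<in>pts (Mor G). gcomp G \<alpha> (ident G (src G \<alpha>)) = \<alpha> \<and>
                       gcomp G (ident G (tgt G \<alpha>)) \<alpha> = \<alpha>) \<and>
     (\<forall>\<alpha>\<in>pts (Mor G). ginv G \<alpha> \<in> pts (Mor G) \<and>
        src G (ginv G \<alpha>) = tgt G \<alpha> \<and> tgt G (ginv G \<alpha>) = src G \<alpha> \<and>
        gcomp G (ginv G \<alpha>) \<alpha> = ident G (src G \<alpha>) \<and>
        gcomp G \<alpha> (ginv G \<alpha>) = ident G (tgt G \<alpha>))"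

definition lie_groupoid :: "('o, 'm) groupoid_data \<Rightarrow> bool" where
  "lie_groupoid G \<longleftrightarrow> groupoid G \<and>
     smooth_manifold (Ob G) \<and> smooth_manifold (Mor G) \<and>
     submersion (Mor G) (Ob G) (src G) \<and> submersion (Mor G) (Ob G) (tgt G) \<and>
     smooth_map (Ob G) (Mor G) (ident G) \<and> smooth_map (Mor G) (Mor G) (ginv G) \<and>
     smooth_map (fibre_product (Mor G) (src G) (Mor G) (tgt G)) (Mor G)
       (\<lambda>(\<alpha>, \<beta>). gcomp G \<alpha> \<beta>)"

definition lie_homomorphism ::
  "('p, 'k) groupoid_data \<Rightarrow> ('o, 'm) groupoid_data \<Rightarrow> ('p \<Rightarrow> 'o) \<Rightarrow> ('k \<Rightarrow> 'm) \<Rightarrow> bool" where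
  "lie_homomorphism H G f0 f1 \<longleftrightarrow> lie_groupoid H \<and> lie_groupoid G \<and>
     smooth_map (Ob H) (Ob G) f0 \<and> smooth_map (Mor H) (Mor G) f1 \<and>
     (\<forall>\<alpha>\<in>pts (Mor H). src G (f1 \<alpha>) = f0 (src H \<alpha>) \<and> tgt G (f1 \<alpha>) = f0 (tgt H \<alpha>)) \<and>
     (\<forall>x\<in>pts (Ob H). f1 (ident H x) = ident G (f0 x)) \<and>
     (\<forall>\<alpha>\<in>pts (Mor H). \<forall>\<beta>\<in>pts (Mor H). src H \<alpha> = tgt H \<beta> \<longrightarrow>
        f1 (gcomp H \<alpha> \<beta>) = gcomp G (f1 \<alpha>) (f1 \<beta>))"

definition orbit :: "('o, 'm) groupoid_data \<Rightarrow> 'o \<Rightarrow> 'o set" where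
  "orbit G x = tgt G ` {\<alpha> \<in> pts (Mor G). src G \<alpha> = x}"

definition orbit_space :: "('o, 'm) groupoid_data \<Rightarrow> 'o set topology" where
  "orbit_space G = topology (\<lambda>\<U>. \<U> \<subseteq> orbit G ` pts (Ob G) \<and>
     openin (mtop (Ob G)) {x \<in> pts (Ob G). orbit G x \<in> \<U>})"

lemma openin_orbit_space:
  "openin (orbit_space G) \<U> \<longleftrightarrow> \<U> \<subseteq> orbit G ` pts (Ob G) \<and>
     openin (mtop (Ob G)) {x \<in> pts (Ob G). orbit G x \<in> \<U>}"
proof -
  let ?P = "\<lambda>\<U>. \<U> \<subseteq> orbit G ` pts (Ob G) \<and>
     openin (mtop (Ob G)) {x \<in> pts (Ob G). orbit G x \<in> \<U>}"
  have "?P (S \<inter> T)" if "?P S" "?P T" for S T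
  proof -
    have "{x \<in> pts (Ob G). orbit G x \<in> S \<inter> T} =
      {x \<in> pts (Ob G). orbit G x \<in> S} \<inter> {x \<in> pts (Ob G). orbit G x \<in> T}" by auto
    then show ?thesis using that by (auto simp only: intro!: openin_Int)
  qed
  moreover have "?P (\<Union>K)" if "\<forall>S\<in>K. ?P S" for K
  proof -
    have "{x \<in> pts (Ob G). orbit G x \<in> \<Union>K} =
      (\<Union>S\<in>K. {x \<in> pts (Ob G). orbit G x \<in> S})" by auto
    moreover have "openin (mtop (Ob G)) (\<Union>S\<in>K. {x \<in> pts (Ob G). orbit G x \<in> S})"
      using that by (intro openin_Union) auto
    ultimately show ?thesis using that by (auto simp only: Union_iff subset_iff)
  qed
  ultimately have "istopology ?P"
    unfolding istopology_def by meson
  then show ?thesis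
    unfolding orbit_space_def by (simp add: topology_inverse')
qed

definition hausdorff_groupoid :: "('o, 'm) groupoid_data \<Rightarrow> bool" where
  "hausdorff_groupoid G \<longleftrightarrow> lie_groupoid G \<and> Hausdorff_space (orbit_space G)"

text \<open>Hausdorffness of the orbit space is part of the notion: it is needed for the
  configuration groupoids to be defined, and the covering condition alone does not imply it
  (consider the action of the integers on the punctured plane generated by
  \<open>(x, y) \<mapsto> (2 x, y / 2)\<close>).\<close>

definition c_groupoid :: "('o, 'm) groupoid_data \<Rightarrow> bool" where
  "c_groupoid G \<longleftrightarrow> hausdorff_groupoid G \<and> covering_map (mtop (Ob G)) (orbit_space G) (orbit G)"


subsection \<open>Actions and fibrations of Lie groupoids\<close>

definition left_space ::
  "('o, 'm) groupoid_data \<Rightarrow> 'a manifold \<Rightarrow> ('a \<Rightarrow> 'o) \<Rightarrow> ('m \<times> 'a \<Rightarrow> 'a) \<Rightarrow> bool" where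
  "left_space G M \<pi> \<mu> \<longleftrightarrow> smooth_manifold M \<and> smooth_map M (Ob G) \<pi> \<and>
     smooth_map (fibre_product (Mor G) (src G) M \<pi>) M \<mu> \<and>
     (\<forall>\<alpha>\<in>pts (Mor G). \<forall>x\<in>pts M. src G \<alpha> = \<pi> x \<longrightarrow> \<pi> (\<mu> (\<alpha>, x)) = tgt G \<alpha>) \<and>
     (\<forall>x\<in>pts M. \<mu> (ident G (\<pi> x), x) = x) \<and>
     (\<forall>\<alpha>\<in>pts (Mor G). \<forall>\<beta>\<in>pts (Mor G). \<forall>x\<in>pts M.
        src G \<alpha> = tgt G \<beta> \<and> src G \<beta> = \<pi> x \<longrightarrow> \<mu> (\<alpha>, \<mu> (\<beta>, x)) = \<mu> (gcomp G \<alpha> \<beta>, x))"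

text \<open>The equality between the morphism manifold of \<open>H\<close> and the fibre product is an
  identification \<open>\<Phi>\<close>, under which the structure maps are as prescribed.\<close>

definition a_fibration ::
  "'y itself \<Rightarrow> ('p, 'k) groupoid_data \<Rightarrow> ('o, 'm) groupoid_data \<Rightarrow>
   ('p \<Rightarrow> 'o) \<Rightarrow> ('k \<Rightarrow> 'm) \<Rightarrow> bool" where
  "a_fibration Y H G f0 f1 \<longleftrightarrow> lie_homomorphism H G f0 f1 \<and>
     submersion (Ob H) (Ob G) f0 \<and> hurewicz_fibration Y (mtop (Ob H)) (mtop (Ob G)) f0 \<and>
     (\<exists>\<mu> \<Phi>. left_space G (Ob H) f0 \<mu> \<and>
        diffeomorphism (Mor H) (fibre_product (Mor G) (src G) (Ob H) f0) \<Phi> \<and>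
        (\<forall>\<alpha>\<in>pts (Mor H). f1 \<alpha> = fst (\<Phi> \<alpha>) \<and> src H \<alpha> = snd (\<Phi> \<alpha>) \<and> tgt H \<alpha> = \<mu> (\<Phi> \<alpha>)))"

definition b_fibration ::
  "'y itself \<Rightarrow> ('p, 'k) groupoid_data \<Rightarrow> ('o, 'm) groupoid_data \<Rightarrow>
   ('p \<Rightarrow> 'o) \<Rightarrow> ('k \<Rightarrow> 'm) \<Rightarrow> bool" where
  "b_fibration Y H G f0 f1 \<longleftrightarrow> lie_homomorphism H G f0 f1 \<and>
     submersion (Ob H) (Ob G) f0 \<and> hurewicz_fibration Y (mtop (Ob H)) (mtop (Ob G)) f0 \<and>
     submersion (Mor H) (fibre_product (Mor G) (src G) (Ob H) f0) (\<lambda>\<alpha>. (f1 \<alpha>, src H \<alpha>)) \<and>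
     (\<lambda>\<alpha>. (f1 \<alpha>, src H \<alpha>)) ` pts (Mor H) = pts (fibre_product (Mor G) (src G) (Ob H) f0)"


section \<open>Configuration Lie groupoids\<close>

definition PB_ob :: "('o, 'm) groupoid_data \<Rightarrow> nat \<Rightarrow> (nat \<Rightarrow> 'o) manifold" where
  "PB_ob G n = open_submanifold (power_manifold (Ob G) n)
     {x. \<forall>i\<in>{1..n}. \<forall>j\<in>{1..n}. i \<noteq> j \<longrightarrow> orbit G (x i) \<noteq> orbit G (x j)}"

text \<open>\<open>Base \<alpha>\<close> is a morphism at stage 1; \<open>Ext \<beta> x\<close> is the pair \<open>(\<beta>, x)\<close> in the iterated
  fibred product, the datatype providing one type for all stages. Objects at stage 1 are
  1-tuples.\<close>

datatype ('o, 'm) pba_mor =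
  Base (base: 'm)
| Ext (prev: "('o, 'm) pba_mor") (point: "nat \<Rightarrow> 'o")

fun PBa :: "('o, 'm) groupoid_data \<Rightarrow> nat \<Rightarrow> (nat \<Rightarrow> 'o, ('o, 'm) pba_mor) groupoid_data" where
  "PBa G (Suc 0) =
     \<lparr>Ob = PB_ob G 1,
      Mor = transport (range Base) base (Mor G),
      src = (\<lambda>z. \<lambda>i\<in>{1..1}. src G (base z)),
      tgt = (\<lambda>z. \<lambda>i\<in>{1..1}. tgt G (base z)),
      ident = (\<lambda>x. Base (ident G (x 1))),
      ginv = (\<lambda>z. Base (ginv G (base z))),
      gcomp = (\<lambda>z' z. Base (gcomp G (base z') (base z)))\<rparr>"
| "PBa G (Suc (Suc m)) =
     (let n = Suc (Suc m); P = PBa G (n - 1); t = (\<lambda>z. (tgt P (prev z))(n := point z n)) in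
      \<lparr>Ob = PB_ob G n,
       Mor = transport (range (\<lambda>(\<beta>, x). Ext \<beta> x)) (\<lambda>z. (prev z, point z))
               (fibre_product (Mor P) (src P) (PB_ob G n) (\<lambda>x. restrict x {1..n - 1})),
       src = point,
       tgt = t,
       ident = (\<lambda>x. Ext (ident P (restrict x {1..n - 1})) x),
       ginv = (\<lambda>z. Ext (ginv P (prev z)) (t z)),
       gcomp = (\<lambda>z' z. Ext (gcomp P (prev z') (prev z)) (point z))\<rparr>)"

definition PBb :: "('o, 'm) groupoid_data \<Rightarrow> nat \<Rightarrow> (nat \<Rightarrow> 'o, nat \<Rightarrow> 'm) groupoid_data" where
  "PBb G n =
     \<lparr>Ob = PB_ob G n,
      Mor = open_submanifold (power_manifold (Mor G) n)
              {\<alpha>. (\<lambda>i\<in>{1..n}. src G (\<alpha> i)) \<in> pts (PB_ob G n) \<and>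
                  (\<lambda>i\<in>{1..n}. tgt G (\<alpha> i)) \<in> pts (PB_ob G n)},
      src = (\<lambda>\<alpha>. \<lambda>i\<in>{1..n}. src G (\<alpha> i)),
      tgt = (\<lambda>\<alpha>. \<lambda>i\<in>{1..n}. tgt G (\<alpha> i)),
      ident = (\<lambda>x. \<lambda>i\<in>{1..n}. ident G (x i)),
      ginv = (\<lambda>\<alpha>. \<lambda>i\<in>{1..n}. ginv G (\<alpha> i)),
      gcomp = (\<lambda>\<alpha> \<beta>. \<lambda>i\<in>{1..n}. gcomp G (\<alpha> i) (\<beta> i))\<rparr>"

text \<open>The four components of the forgetful homomorphisms from stage \<open>n\<close> to stage \<open>n - 1\<close>.\<close>

definition Fa_ob :: "nat \<Rightarrow> (nat \<Rightarrow> 'o) \<Rightarrow> (nat \<Rightarrow> 'o)" where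
  "Fa_ob n x = restrict x {1..n - 1}"

definition Fa_mor :: "('o, 'm) pba_mor \<Rightarrow> ('o, 'm) pba_mor" where
  "Fa_mor z = prev z"

definition Fb_ob :: "nat \<Rightarrow> (nat \<Rightarrow> 'o) \<Rightarrow> (nat \<Rightarrow> 'o)" where
  "Fb_ob n x = restrict x {1..n - 1}"

definition Fb_mor :: "nat \<Rightarrow> (nat \<Rightarrow> 'm) \<Rightarrow> (nat \<Rightarrow> 'm)" where
  "Fb_mor n \<alpha> = restrict \<alpha> {1..n - 1}"

end

theory Submission
  imports Defs
begin

text \<open>
  Both statements rest on the map forgetting the last point of a configuration. It is a submersion
  because submersions are the smooth maps with local sections, and keeping the last point is a local
  section. It is a fibration because it has local slicings: when finitely many points move
  within small evenly covered neighbourhoods of their orbits, a bump function in a chart pushes a point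
  out of the way of each of them. The push is made on all sheets of the covering at once, so it
  respects orbits, and it is the identity when nothing moves. Slicings over small open sets lift paths
  which are short, uniformly on compact sets; a locally finite system of weights on a second countable
  component of the base turns this into a lift of any homotopy, by slicing the time interval
  according to the weights.

  The groupoid of type a at stage \<open>n\<close> is the action groupoid of the one at stage \<open>n - 1\<close> acting on
  configurations of \<open>n\<close> points, which keeps the last point. That the moved configuration is again
  one needs that morphisms preserve orbits, so this is carried along the induction.
  For type b everything is done componentwise.
\<close>

section \<open>Functions of class \<open>C\<^sup>r\<close> on Euclidean spaces\<close>

text \<open>The space on which homotopies are tested is arbitrary, so nothing can be cut up there:
  the weights live on the base, and the step size is a minimum over the compact square of pairs of
  times, hence continuous in the parameter. A slicing leaves a point alone as long as its base point
  rests; this is what allows infinitely many steps, provided only finitely many act near each point.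
  The push need not be a homeomorphism. It is enough that a point which is not over the old position
  of a moving point does not land over the new one. It acts on objects, where the forgotten point
  has to move, and the covering condition lets a bump be copied from one sheet to all sheets over
  the same set. Submersions are given by Jacobians but used through local sections. The passage
  needs an inverse function theorem only for maps that alter a single coordinate, which comes down
  to monotone functions of one variable. Paracompactness is not inherited by products, so it is
  traded for a decomposition into second countable open pieces, which is.\<close>

abbreviation euc :: "nat \<Rightarrow> (nat \<Rightarrow> real) topology" where
  "euc \<equiv> Euclidean_space"

abbreviation euc_on :: "nat \<Rightarrow> (nat \<Rightarrow> real) set \<Rightarrow> (nat \<Rightarrow> real) topology" where
  "euc_on k \<equiv> subtopology (euc k)"

abbreviation espace :: "nat \<Rightarrow> (nat \<Rightarrow> real) set" where
  "espace k \<equiv> topspace (euc k)"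

lemma espace_iff: "x \<in> espace k \<longleftrightarrow> (\<forall>i\<ge>k. x i = 0)"
  by (simp add: topspace_Euclidean_space)

lemma Euclidean_space_top_of_set: "euc k = top_of_set (espace k)"
  by (simp add: Euclidean_space_def euclidean_product_topology topspace_Euclidean_space)

lemma continuous_map_local:
  assumes "\<And>x. x \<in> topspace X \<Longrightarrow> \<exists>V. openin X V \<and> x \<in> V \<and> continuous_map (subtopology X V) Y f"
  shows "continuous_map X Y f"
proof -
  obtain V where V: "\<And>x. x \<in> topspace X \<Longrightarrow> openin X (V x) \<and> x \<in> V x \<and> continuous_map (subtopology X (V x)) Y f"
    using assms by metis
  show ?thesis
    by (rule pasting_lemma[where I="topspace X" and T=V and f="\<lambda>_. f"]) (use V in auto)
qed

lemma continuous_map_coordinate_Euclidean: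
  "continuous_map (euc_on k W) euclideanreal (\<lambda>x. x i)"
  unfolding Euclidean_space_def subtopology_subtopology
  by (intro continuous_map_from_subtopology continuous_map_product_projection) simp

lemma continuous_map_into_Euclidean_space:
  "continuous_map X (euc k) f \<longleftrightarrow>
     (\<forall>i<k. continuous_map X euclideanreal (\<lambda>x. f x i)) \<and> f ` topspace X \<subseteq> espace k"
proof
  assume L: "continuous_map X (euc k) f"
  then have "f ` topspace X \<subseteq> espace k"
    by (rule continuous_map_image_subset_topspace)
  moreover have "continuous_map X euclideanreal (\<lambda>x. f x i)" for i
    using continuous_map_compose[OF L continuous_map_coordinate_Euclidean[of k UNIV i, simplified]]
    by (simp add: o_def)
  ultimately show "(\<forall>i<k. continuous_map X euclideanreal (\<lambda>x. f x i)) \<and> f ` topspace X \<subseteq> espace k"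
    by blast
next
  assume R: "(\<forall>i<k. continuous_map X euclideanreal (\<lambda>x. f x i)) \<and> f ` topspace X \<subseteq> espace k"
  have "continuous_map X euclideanreal (\<lambda>x. f x i)" for i
  proof (cases "i < k")
    case False
    then have "\<And>x. x \<in> topspace X \<Longrightarrow> f x i = 0"
      using R by (fastforce simp: espace_iff)
    then show ?thesis
      using continuous_map_eq[of X euclideanreal "\<lambda>_. 0" "\<lambda>x. f x i"] by simp
  qed (use R in auto)
  then show "continuous_map X (euc k) f"
    unfolding Euclidean_space_def continuous_map_in_subtopology
    using R by (auto simp: continuous_map_componentwise_UNIV espace_iff image_subset_iff)
qed

lemma openin_Euclidean_box:
  "openin (euc k) {y \<in> espace k. \<forall>i<k. \<bar>y i - x i\<bar> < e}"
proof -
  have c: "continuous_map (euc k) euclideanreal (\<lambda>y. \<bar>y i - x i\<bar>)" for i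
    using continuous_map_coordinate_Euclidean[of k UNIV i] by (intro continuous_intros) simp
  \<comment> \<open>The factor \<open>espace k\<close> gives the right set when there are no
    coordinates, where the intersection over \<open>i<k\<close> would be everything; openness of the
    intersection is available for non-empty index sets only, hence the case
    \<open>k = 0\<close>.\<close>
  have "{y \<in> espace k. \<forall>i<k. \<bar>y i - x i\<bar> < e} =
     espace k \<inter> (\<Inter>i<k. {y \<in> espace k. \<bar>y i - x i\<bar> \<in> {..<e}})" by auto
  also have "openin (euc k) \<dots>"
  proof (cases "k = 0")
    case False
    have "openin (euc k) (\<Inter>i<k. {y \<in> espace k. \<bar>y i - x i\<bar> \<in> {..<e}})"
    proof (intro openin_INT2)
      show "openin (euc k) {y \<in> espace k. \<bar>y i - x i\<bar> \<in> {..<e}}" for i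
        by (rule openin_continuous_map_preimage[OF c]) simp
    qed (use False in auto)
    then show ?thesis by (simp add: openin_Int)
  qed auto
  finally show ?thesis .
qed

lemma openin_Euclidean_contains_box:
  assumes "openin (euc k) W" "x \<in> W"
  obtains e where "e > 0" "\<And>y. y \<in> espace k \<Longrightarrow> (\<And>i. i < k \<Longrightarrow> \<bar>y i - x i\<bar> < e) \<Longrightarrow> y \<in> W"
proof -
  obtain T where T: "openin (powertop_real UNIV) T" "W = T \<inter> espace k"
    using assms by (auto simp: Euclidean_space_def openin_subtopology topspace_Euclidean_space)
  have "x \<in> T" "x \<in> espace k" using assms T by auto
  then obtain X where X: "x \<in> Pi\<^sub>E UNIV X" "\<And>i. open (X i)" "Pi\<^sub>E UNIV X \<subseteq> T"
    using product_topology_open_contains_basis[OF T(1), of x] by (metis open_openin)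
  have "\<exists>e>0. \<forall>t. \<bar>t - x i\<bar> < e \<longrightarrow> t \<in> X i" for i
  proof -
    have "x i \<in> X i" using X(1) by (simp add: PiE_iff)
    then show ?thesis using X(2)[of i] unfolding open_dist dist_real_def by blast
  qed
  then obtain e where e: "\<And>i. e i > 0" "\<And>i t. \<bar>t - x i\<bar> < e i \<Longrightarrow> t \<in> X i" by metis
  show thesis
  proof
    \<comment> \<open>Only the finitely many coordinates below \<open>k\<close> matter. The inserted
      1 keeps the set non-empty for \<open>k = 0\<close>.\<close>
    show "Min (insert 1 (e ` {..<k})) > 0" using e(1) by (auto simp: Min_gr_iff)
    fix y assume y: "y \<in> espace k" "\<And>i. i < k \<Longrightarrow> \<bar>y i - x i\<bar> < Min (insert 1 (e ` {..<k}))"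
    have "y i \<in> X i" for i
    proof (cases "i < k")
      case True
      then have "\<bar>y i - x i\<bar> < e i" using y(2)[OF True] by (auto simp: Min_gr_iff)
      then show ?thesis by (rule e)
    next
      case False
      then have "y i = x i" using y(1) \<open>x \<in> espace k\<close> by (auto simp: espace_iff)
      then show ?thesis using e(1)[of i] by (intro e(2)) auto
    qed
    then show "y \<in> W" using X(3) T y by auto
  qed
qed

lemma openin_Euclidean_upd_eventually:
  assumes "openin (euc k) W" "x \<in> W" "i < k"
  shows "\<forall>\<^sub>F t in nhds (x i). x(i := t) \<in> W"
proof -
  obtain e where e: "e > 0" "\<And>y. y \<in> espace k \<Longrightarrow> (\<And>i. i < k \<Longrightarrow> \<bar>y i - x i\<bar> < e) \<Longrightarrow> y \<in> W"
    using openin_Euclidean_contains_box[OF assms(1,2)] by blast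
  have "x \<in> espace k" using assms openin_subset by blast
  then have "x(i := t) \<in> W" if "dist t (x i) < e" for t
    using that assms e by (intro e(2)) (auto simp: espace_iff dist_real_def)
  then show ?thesis unfolding eventually_nhds_metric using e(1) by blast
qed

lemma partial_eqI:
  assumes "((\<lambda>t. f (x(i := t))) has_real_derivative D) (at (x i))"
  shows "partial i f x = D"
  using assms unfolding partial_def by (rule DERIV_imp_deriv)

lemma differentiable_partial:
  assumes "(\<lambda>t. f (x(i := t))) differentiable (at (x i))"
  shows "((\<lambda>t. f (x(i := t))) has_real_derivative partial i f x) (at (x i))"
  using assms unfolding partial_def by (simp add: DERIV_deriv_iff_real_differentiable)

lemma partial_cong:
  assumes "openin (euc k) W" "x \<in> W" "i < k" "\<And>x. x \<in> W \<Longrightarrow> f x = g x"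
  shows "partial i f x = partial i g x"
    and "(\<lambda>t. f (x(i := t))) differentiable (at (x i)) \<Longrightarrow> (\<lambda>t. g (x(i := t))) differentiable (at (x i))"
proof -
  have ev: "\<forall>\<^sub>F t in nhds (x i). f (x(i := t)) = g (x(i := t))"
    using openin_Euclidean_upd_eventually[OF assms(1-3)] by eventually_elim (use assms in auto)
  then show "partial i f x = partial i g x"
    unfolding partial_def by (intro deriv_cong_ev) auto
  show "(\<lambda>t. g (x(i := t))) differentiable (at (x i))"
    if "(\<lambda>t. f (x(i := t))) differentiable (at (x i))"
    using that DERIV_cong_ev[OF refl ev refl] by (auto simp: real_differentiable_def)
qed

text \<open>Openness of \<open>W\<close> is essential: a partial derivative depends on the values
  along a coordinate line near the point, and these stay in \<open>W\<close> for a while.\<close>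

lemma Cr_on_cong:
  assumes "openin (euc k) W" "\<And>x. x \<in> W \<Longrightarrow> f x = g x" "Cr_on r k W f"
  shows "Cr_on r k W g"
  using assms(2,3)
proof (induction r arbitrary: f g)
  case 0
  then show ?case by (auto elim!: continuous_map_eq)
next
  case (Suc r)
  have "continuous_map (euc_on k W) euclideanreal g"
    using Suc.prems by (auto elim!: continuous_map_eq)
  moreover have "Cr_on r k W (partial i g)" if "i < k" for i
    using Suc.IH[of "partial i f" "partial i g"] Suc.prems partial_cong(1)[OF assms(1) _ that, of _ f g] that
    by auto
  moreover have "(\<lambda>t. g (x(i := t))) differentiable (at (x i))" if "i < k" "x \<in> W" for i x
    using partial_cong(2)[OF assms(1) that(2,1), of f g] Suc.prems that by auto
  ultimately show ?case by simp
qed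

lemma Cr_on_mono:
  assumes "Cr_on r k W f" "V \<subseteq> W"
  shows "Cr_on r k V f"
  using assms(1)
  by (induction r arbitrary: f)
    (use assms(2) continuous_map_from_subtopology_mono[OF _ assms(2)] in auto)

lemma Cr_on_local:
  assumes "openin (euc k) W"
    and "\<And>x. x \<in> W \<Longrightarrow> \<exists>V. openin (euc k) V \<and> x \<in> V \<and> Cr_on r k V f"
  shows "Cr_on r k W f"
  using assms(2)
proof (induction r arbitrary: f)
  case 0
  show ?case unfolding Cr_on.simps
  proof (rule continuous_map_local)
    fix x assume "x \<in> topspace (euc_on k W)"
    then obtain V where V: "openin (euc k) V" "x \<in> V" "Cr_on 0 k V f"
      using 0 by (auto simp: )
    then show "\<exists>V. openin (euc_on k W) V \<and> x \<in> V \<and>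
           continuous_map (subtopology (euc_on k W) V) euclideanreal f"
      using \<open>x \<in> topspace _\<close>
      by (intro exI[of _ "W \<inter> V"])
         (auto simp: openin_subtopology_Int2 subtopology_subtopology intro: continuous_map_from_subtopology_mono)
  qed
next
  case (Suc r)
  have "continuous_map (euc_on k W) euclideanreal f"
  proof (rule continuous_map_local)
    fix x assume "x \<in> topspace (euc_on k W)"
    then obtain V where V: "openin (euc k) V" "x \<in> V" "Cr_on (Suc r) k V f"
      using Suc.prems[of x] by (auto simp del: Cr_on.simps)
    then show "\<exists>V. openin (euc_on k W) V \<and> x \<in> V \<and>
           continuous_map (subtopology (euc_on k W) V) euclideanreal f"
      using \<open>x \<in> topspace _\<close>
      by (intro exI[of _ "W \<inter> V"])
         (auto simp: openin_subtopology_Int2 subtopology_subtopology intro: continuous_map_from_subtopology_mono)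
  qed
  moreover have "Cr_on r k W (partial i f)" if "i < k" for i
    by (rule Suc.IH) (use Suc.prems that in fastforce)
  moreover have "(\<lambda>t. f (x(i := t))) differentiable (at (x i))" if "i < k" "x \<in> W" for i x
    using Suc.prems that by fastforce
  ultimately show ?case by simp
qed

lemma Cr_on_continuous: "Cr_on r k W f \<Longrightarrow> continuous_map (euc_on k W) euclideanreal f"
  by (cases r) auto

lemma Cr_on_Suc: "Cr_on (Suc r) k W f \<Longrightarrow> Cr_on r k W f"
  by (induction r arbitrary: f) auto

section \<open>Sums, products and reciprocals\<close>

lemma Cr_on_const: "Cr_on r k W (\<lambda>x. c)"
proof (induction r arbitrary: c)
  case (Suc r)
  have "partial i (\<lambda>x. c) = (\<lambda>x. 0)" for i by (auto simp: partial_def)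
  then show ?case using Suc by simp
qed simp

lemma DERIV_upd_coord:
  "((\<lambda>t. (x(i := t)) j) has_real_derivative (if i = j then 1 else 0)) (at (x i))"
  by (cases "i = j") auto

lemma Cr_on_coord: "Cr_on r k W (\<lambda>x. x j)"
proof (cases r)
  case (Suc r')
  have "partial i (\<lambda>x. x j) = (\<lambda>x. if i = j then 1 else 0)" for i
    by (rule ext, rule partial_eqI[OF DERIV_upd_coord])
  moreover have "(\<lambda>t. (x(i := t)) j) differentiable (at (x i))" for x :: "nat \<Rightarrow> real" and i
    using DERIV_upd_coord[of x i j] real_differentiable_def by blast
  ultimately show ?thesis using Suc Cr_on_const
    by (simp add: continuous_map_coordinate_Euclidean)
qed (simp add: continuous_map_coordinate_Euclidean)

lemma Cr_on_add:
  assumes W: "openin (euc k) W" and "Cr_on r k W f" "Cr_on r k W g"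
  shows "Cr_on r k W (\<lambda>x. f x + g x)"
  using assms(2,3)
proof (induction r arbitrary: f g)
  case (Suc r)
  have d: "((\<lambda>t. f (x(i := t)) + g (x(i := t))) has_real_derivative partial i f x + partial i g x) (at (x i))"
    if "i < k" "x \<in> W" for i x
    using Suc.prems that by (intro DERIV_add differentiable_partial) auto
  have pd: "partial i (\<lambda>x. f x + g x) x = partial i f x + partial i g x" if "i < k" "x \<in> W" for i x
    using d[OF that] by (rule partial_eqI)
  have "Cr_on r k W (partial i (\<lambda>x. f x + g x))" if i: "i < k" for i
  proof (rule Cr_on_cong[OF W])
    show "partial i f x + partial i g x = partial i (\<lambda>x. f x + g x) x" if "x \<in> W" for x
      using pd[OF i that] by simp
    show "Cr_on r k W (\<lambda>x. partial i f x + partial i g x)"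
      using Suc.prems i by (intro Suc.IH) auto
  qed
  moreover have "(\<lambda>t. f (x(i := t)) + g (x(i := t))) differentiable (at (x i))" if "i < k" "x \<in> W" for i x
    using d[OF that] real_differentiable_def by blast
  ultimately show ?case using Suc.prems by (auto intro: continuous_map_add)
qed (auto intro: continuous_map_add)

lemma Cr_on_mult:
  assumes W: "openin (euc k) W" and "Cr_on r k W f" "Cr_on r k W g"
  shows "Cr_on r k W (\<lambda>x. f x * g x)"
  using assms(2,3)
proof (induction r arbitrary: f g)
  case (Suc r)
  have d: "((\<lambda>t. f (x(i := t)) * g (x(i := t))) has_real_derivative partial i f x * g x + partial i g x * f x) (at (x i))"
    if "i < k" "x \<in> W" for i x
    using Suc.prems that DERIV_mult[OF differentiable_partial[of f x i] differentiable_partial[of g x i]] by simp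
  have pd: "partial i (\<lambda>x. f x * g x) x = partial i f x * g x + partial i g x * f x" if "i < k" "x \<in> W" for i x
    using d[OF that] by (rule partial_eqI)
  have "Cr_on r k W (partial i (\<lambda>x. f x * g x))" if i: "i < k" for i
  proof (rule Cr_on_cong[OF W])
    show "partial i f x * g x + partial i g x * f x = partial i (\<lambda>x. f x * g x) x" if "x \<in> W" for x
      using pd[OF i that] by simp
    show "Cr_on r k W (\<lambda>x. partial i f x * g x + partial i g x * f x)"
      using Suc.prems i Suc.prems[THEN Cr_on_Suc]
      by (intro Cr_on_add[OF W] Suc.IH) auto
  qed
  moreover have "(\<lambda>t. f (x(i := t)) * g (x(i := t))) differentiable (at (x i))" if "i < k" "x \<in> W" for i x
    using d[OF that] real_differentiable_def by blast
  ultimately show ?case using Suc.prems by (auto intro: continuous_map_real_mult)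
qed (auto intro: continuous_map_real_mult)

lemma Cr_on_uminus:
  assumes "openin (euc k) W" and "Cr_on r k W f"
  shows "Cr_on r k W (\<lambda>x. - f x)"
  using Cr_on_mult[OF assms(1) Cr_on_const[of r k W "-1"] assms(2)] by simp

lemma Cr_on_diff:
  assumes "openin (euc k) W" and "Cr_on r k W f" "Cr_on r k W g"
  shows "Cr_on r k W (\<lambda>x. f x - g x)"
  using Cr_on_add[OF assms(1,2) Cr_on_uminus[OF assms(1,3)]] by simp

lemma Cr_on_sum:
  assumes "openin (euc k) W" and "\<And>j. j \<in> J \<Longrightarrow> Cr_on r k W (f j)"
  shows "Cr_on r k W (\<lambda>x. \<Sum>j\<in>J. f j x)"
  using assms(2)
proof (induction J rule: infinite_finite_induct)
  case (insert j J)
  then show ?case using Cr_on_add[OF assms(1), of r "f j" "\<lambda>x. \<Sum>j\<in>J. f j x"] by simp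
qed (auto simp: Cr_on_const)

text \<open>The derivative of \<open>1/f\<close> is a polynomial in \<open>f'\<close> and
  \<open>1/f\<close>, so order \<open>r\<close> for \<open>1/f\<close>, known by induction, suffices
  for order \<open>r + 1\<close>.\<close>

lemma Cr_on_inverse:
  assumes W: "openin (euc k) W" and "Cr_on r k W f" and nz: "\<And>x. x \<in> W \<Longrightarrow> f x \<noteq> 0"
  shows "Cr_on r k W (\<lambda>x. inverse (f x))"
  using assms(2)
proof (induction r)
  case 0
  then show ?case using nz by (auto intro!: continuous_map_real_inverse)
next
  case (Suc r)
  have d: "((\<lambda>t. inverse (f (x(i := t)))) has_real_derivative - (partial i f x * (inverse (f x) * inverse (f x)))) (at (x i))"
    if "i < k" "x \<in> W" for i x
    using Suc.prems that nz[of x] DERIV_inverse_fun[OF differentiable_partial[of f x i]]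
    by (simp add: numeral_2_eq_2 field_simps)
  have IH: "Cr_on r k W (\<lambda>x. inverse (f x))" using Suc Cr_on_Suc by blast
  have pd: "partial i (\<lambda>x. inverse (f x)) x = - (partial i f x * (inverse (f x) * inverse (f x)))" if "i < k" "x \<in> W" for i x
    using d[OF that] by (rule partial_eqI)
  have "Cr_on r k W (partial i (\<lambda>x. inverse (f x)))" if i: "i < k" for i
  proof (rule Cr_on_cong[OF W])
    show "- (partial i f x * (inverse (f x) * inverse (f x))) = partial i (\<lambda>x. inverse (f x)) x" if "x \<in> W" for x
      using pd[OF i that] by simp
    show "Cr_on r k W (\<lambda>x. - (partial i f x * (inverse (f x) * inverse (f x))))"
      using Suc.prems i IH by (intro Cr_on_uminus[OF W] Cr_on_mult[OF W]) auto
  qed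
  moreover have "(\<lambda>t. inverse (f (x(i := t)))) differentiable (at (x i))" if "i < k" "x \<in> W" for i x
    using d[OF that] real_differentiable_def by blast
  ultimately show ?case using Suc.prems nz by (auto intro!: continuous_map_real_inverse)
qed

text \<open>Passes from the topology of the model space to limits along a filter, so that difference
  quotients can be treated coordinate by coordinate. It rests on the boxes inside an open
  set.\<close>

lemma continuous_map_Euclidean_at:
  assumes "continuous_map (euc_on l V) euclideanreal f"
    and "openin (euc l) V" "y \<in> V"
    and "\<forall>\<^sub>F t in F. \<xi> t \<in> espace l" and "\<And>j. j < l \<Longrightarrow> ((\<lambda>t. \<xi> t j) \<longlongrightarrow> y j) F"
  shows "((\<lambda>t. f (\<xi> t)) \<longlongrightarrow> f y) F" "\<forall>\<^sub>F t in F. \<xi> t \<in> V"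
proof -
  have key: "\<forall>\<^sub>F t in F. \<xi> t \<in> W" if W: "openin (euc l) W" "y \<in> W" for W
  proof -
    obtain e where e: "e > 0" "\<And>z. z \<in> espace l \<Longrightarrow> (\<And>i. i < l \<Longrightarrow> \<bar>z i - y i\<bar> < e) \<Longrightarrow> z \<in> W"
      using openin_Euclidean_contains_box[OF W] by blast
    have "\<forall>\<^sub>F t in F. \<forall>j\<in>{..<l}. \<bar>\<xi> t j - y j\<bar> < e"
      using assms(5) e(1) by (intro eventually_ball_finite) (auto simp: tendsto_iff dist_real_def)
    then show ?thesis using assms(4) by eventually_elim (use e in auto)
  qed
  show "\<forall>\<^sub>F t in F. \<xi> t \<in> V" by (rule key[OF assms(2,3)])
  show "((\<lambda>t. f (\<xi> t)) \<longlongrightarrow> f y) F"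
  proof (rule topological_tendstoI)
    fix S :: "real set" assume S: "open S" "f y \<in> S"
    have "openin (euc_on l V) {x \<in> topspace (euc_on l V). f x \<in> S}"
      using S assms(1) by (intro openin_continuous_map_preimage) auto
    then have "openin (euc l) {x \<in> topspace (euc_on l V). f x \<in> S}"
      using assms(2) openin_open_subtopology by blast
    moreover have "y \<in> {x \<in> topspace (euc_on l V). f x \<in> S}"
      using assms(2,3) S openin_subset by auto
    ultimately show "\<forall>\<^sub>F t in F. f (\<xi> t) \<in> S"
      using key by (fastforce elim: eventually_mono)
  qed
qed

text \<open>The segment is unordered, so that the increment may have either sign; along a curve both
  signs occur.\<close>

lemma Cr_on_mvt:
  fixes x :: "nat \<Rightarrow> real"
  assumes f: "\<And>t. t \<in> closed_segment a b \<Longrightarrow> x(i := t) \<in> V"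
    and d: "\<And>z. z \<in> V \<Longrightarrow> (\<lambda>t. f (z(i := t))) differentiable (at (z i))"
  shows "\<exists>s\<in>closed_segment a b. f (x(i := b)) - f (x(i := a)) = partial i f (x(i := s)) * (b - a)"
proof -
  have der: "((\<lambda>t. f (x(i := t))) has_real_derivative partial i f (x(i := s))) (at s)"
    if "s \<in> closed_segment a b" for s
    using differentiable_partial[OF d[OF f[OF that]]] by (simp only: fun_upd_upd fun_upd_same)
  show ?thesis
  proof (cases a b rule: linorder_cases)
    case less
    then obtain z where "z > a" "z < b" "f (x(i := b)) - f (x(i := a)) = (b - a) * partial i f (x(i := z))"
      using MVT2[of a b "\<lambda>t. f (x(i := t))" "\<lambda>s. partial i f (x(i := s))"] der
      by (auto simp: closed_segment_eq_real_ivl)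
    then show ?thesis using less by (intro bexI[of _ z]) (auto simp: closed_segment_eq_real_ivl)
  next
    case greater
    then obtain z where "z > b" "z < a" "f (x(i := a)) - f (x(i := b)) = (a - b) * partial i f (x(i := z))"
      using MVT2[of b a "\<lambda>t. f (x(i := t))" "\<lambda>s. partial i f (x(i := s))"] der
      by (auto simp: closed_segment_eq_real_ivl)
    then show ?thesis using greater by (intro bexI[of _ z]) (auto simp: closed_segment_eq_real_ivl algebra_simps)
  qed auto
qed

text \<open>Total differentiability is not part of \<open>Cr_on\<close>, so the chain rule is
  derived from continuity of the partial derivatives: pass from \<open>c t0\<close> to
  \<open>c t\<close> one coordinate at a time, apply the mean value theorem to each move, and let
  the intermediate points converge. The curve has to be differentiable at \<open>t0\<close>
  only.\<close>

lemma Cr_on_chain_derivative: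
  assumes V: "openin (euc l) V" and f: "Cr_on 1 l V f"
    and c0: "c t0 \<in> V" and ce: "\<forall>\<^sub>F t in nhds t0. c t \<in> espace l"
    and c: "\<And>j. j < l \<Longrightarrow> ((\<lambda>t. c t j) has_real_derivative c' j) (at t0)"
  shows "((\<lambda>t. f (c t)) has_real_derivative (\<Sum>j<l. partial j f (c t0) * c' j)) (at t0)"
proof -
  \<comment> \<open>The path of corners: the first \<open>m\<close> coordinates have already been
    moved to \<open>c t\<close>, the others are still at \<open>c t0\<close>.\<close>
  define z where "z m t = (\<lambda>i. if i < m then c t i else c t0 i)" for m t
  have c0l: "c t0 \<in> espace l" using c0 V openin_subset by blast
  have lim: "((\<lambda>t. c t j) \<longlongrightarrow> c t0 j) (at t0)" for j
  proof (cases "j < l")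
    case True
    then show ?thesis using c[OF True] by (meson DERIV_isCont isCont_def)
  next
    case False
    have "\<forall>\<^sub>F t in at t0. c t j = c t0 j"
      using ce False c0l
      unfolding eventually_at_filter by (auto elim!: eventually_mono simp: espace_iff)
    then show ?thesis by (rule tendsto_eventually)
  qed
  have ce': "\<forall>\<^sub>F t in at t0. c t \<in> espace l"
    using ce by (simp add: eventually_at_filter eventually_mono)
  obtain e where e: "e > 0" "\<And>y. y \<in> espace l \<Longrightarrow> (\<And>i. i < l \<Longrightarrow> \<bar>y i - c t0 i\<bar> < e) \<Longrightarrow> y \<in> V"
    using openin_Euclidean_contains_box[OF V c0] by blast
  have step: "((\<lambda>t. (f (z (Suc m) t) - f (z m t)) / (t - t0)) \<longlongrightarrow> partial m f (c t0) * c' m) (at t0)"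
    if m: "m < l" for m
  proof -
    have "\<forall>\<^sub>F t in at t0. \<forall>j\<in>{..<l}. \<bar>c t j - c t0 j\<bar> < e"
      using lim e(1) by (intro eventually_ball_finite) (auto simp: tendsto_iff dist_real_def)
    then have "\<forall>\<^sub>F t in at t0. \<exists>s. s \<in> closed_segment (c t0 m) (c t m) \<and>
       f (z (Suc m) t) - f (z m t) = partial m f ((z m t)(m := s)) * (c t m - c t0 m)"
      using ce'
    proof eventually_elim
      case (elim t)
      have "\<bar>s - c t0 m\<bar> < e" if "s \<in> closed_segment (c t0 m) (c t m)" for s
      proof -
        have "\<bar>c t m - c t0 m\<bar> < e" using elim(1) m by blast
        then show ?thesis using that by (auto simp: closed_segment_eq_real_ivl split: if_splits)
      qed
      then have "(z m t)(m := s) \<in> V" if "s \<in> closed_segment (c t0 m) (c t m)" for s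
        using that elim m e(1) c0l by (intro e(2)) (auto simp: z_def espace_iff)
      moreover have "(z m t)(m := c t0 m) = z m t" "(z m t)(m := c t m) = z (Suc m) t"
        by (auto simp: z_def fun_eq_iff less_Suc_eq)
      ultimately show ?case
        using Cr_on_mvt[of "c t0 m" "c t m" "z m t" m V f] f m by auto
    qed
    \<comment> \<open>The intermediate points as a function of \<open>t\<close>. They are squeezed
      between the old and the new \<open>m\<close>-th coordinate and therefore converge.\<close>
    then obtain s where s: "\<forall>\<^sub>F t in at t0. s t \<in> closed_segment (c t0 m) (c t m) \<and>
       f (z (Suc m) t) - f (z m t) = partial m f ((z m t)(m := s t)) * (c t m - c t0 m)"
      unfolding eventually_ex by blast
    have "((\<lambda>t. s t - c t0 m) \<longlongrightarrow> 0) (at t0)"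
    proof (rule Lim_null_comparison)
      show "\<forall>\<^sub>F t in at t0. norm (s t - c t0 m) \<le> \<bar>c t m - c t0 m\<bar>"
        using s by eventually_elim (auto simp: closed_segment_eq_real_ivl split: if_splits)
      show "((\<lambda>t. \<bar>c t m - c t0 m\<bar>) \<longlongrightarrow> 0) (at t0)"
        using tendsto_rabs[OF LIM_zero[OF lim[of m]]] by simp
    qed
    then have slim: "(s \<longlongrightarrow> c t0 m) (at t0)" by (rule LIM_zero_cancel)
    have "((\<lambda>t. partial m f ((z m t)(m := s t))) \<longlongrightarrow> partial m f (c t0)) (at t0)"
    proof (rule continuous_map_Euclidean_at(1)[OF _ V c0])
      show "continuous_map (euc_on l V) euclideanreal (partial m f)"
        using f m by auto
      show "\<forall>\<^sub>F t in at t0. (z m t)(m := s t) \<in> espace l"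
        using ce' by eventually_elim (use c0l m in \<open>auto simp: z_def espace_iff\<close>)
      show "((\<lambda>t. ((z m t)(m := s t)) j) \<longlongrightarrow> c t0 j) (at t0)" for j
        using slim lim[of j] by (cases "j = m"; cases "j < m") (auto simp: z_def)
    qed
    then have "((\<lambda>t. partial m f ((z m t)(m := s t)) * ((c t m - c t0 m) / (t - t0))) \<longlongrightarrow> partial m f (c t0) * c' m) (at t0)"
      using c[OF m] by (intro tendsto_mult) (auto simp: has_field_derivative_iff)
    then show ?thesis
      by (rule Lim_transform_eventually) (use s in eventually_elim, auto)
  qed
  have "((\<lambda>t. \<Sum>m<l. (f (z (Suc m) t) - f (z m t)) / (t - t0)) \<longlongrightarrow> (\<Sum>j<l. partial j f (c t0) * c' j)) (at t0)"
    by (intro tendsto_sum step) auto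
  moreover have "\<forall>\<^sub>F t in at t0. (\<Sum>m<l. (f (z (Suc m) t) - f (z m t)) / (t - t0)) = (f (c t) - f (c t0)) / (t - t0)"
    using ce'
  proof eventually_elim
    case (elim t)
    have "z l t = c t" "z 0 t = c t0" using elim c0l by (auto simp: z_def fun_eq_iff espace_iff)
    then show ?case
      using sum_lessThan_telescope[of "\<lambda>m. f (z m t)" l] by (simp flip: sum_divide_distrib)
  qed
  ultimately show ?thesis
    unfolding has_field_derivative_iff by (rule Lim_transform_eventually)
qed

lemma Cr_on_mono_order: "Cr_on r k W f \<Longrightarrow> s \<le> r \<Longrightarrow> Cr_on s k W f"
  by (induction r) (auto simp: le_Suc_eq simp del: Cr_on.simps dest: Cr_on_Suc)

lemma partial_compose:
  assumes W: "openin (euc k) W" and V: "openin (euc l) V"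
    and f: "Cr_on 1 l V f" and F: "\<And>j. j < l \<Longrightarrow> Cr_on 1 k W (\<lambda>x. F x j)" and sub: "F ` W \<subseteq> V"
    and x: "x \<in> W" "i < k"
  shows "((\<lambda>t. f (F (x(i := t)))) has_real_derivative
    (\<Sum>j<l. partial j f (F x) * partial i (\<lambda>x. F x j) x)) (at (x i))"
proof -
  have "((\<lambda>t. f (F (x(i := t)))) has_real_derivative
    (\<Sum>j<l. partial j f (F (x(i := x i))) * partial i (\<lambda>x. F x j) x)) (at (x i))"
  proof (rule Cr_on_chain_derivative[OF V f])
    show "F (x(i := x i)) \<in> V" using x sub by auto
    show "\<forall>\<^sub>F t in nhds (x i). F (x(i := t)) \<in> espace l"
      using openin_Euclidean_upd_eventually[OF W x]
      by eventually_elim (use sub openin_subset[OF V] in blast)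
    show "((\<lambda>t. F (x(i := t)) j) has_real_derivative partial i (\<lambda>x. F x j) x) (at (x i))" if "j < l" for j
      using F[OF that] x by (intro differentiable_partial) auto
  qed
  then show ?thesis by simp
qed

text \<open>The induction varies \<open>f\<close> but keeps \<open>F\<close>: by the chain rule the
  derivative is a sum of products of some \<open>partial j f\<close> composed with the same
  \<open>F\<close> and of partial derivatives of \<open>F\<close>.\<close>

lemma Cr_on_compose:
  assumes W: "openin (euc k) W" and V: "openin (euc l) V"
    and "Cr_on r l V f" "\<And>j. j < l \<Longrightarrow> Cr_on r k W (\<lambda>x. F x j)" and sub: "F ` W \<subseteq> V"
  shows "Cr_on r k W (\<lambda>x. f (F x))"
  using assms(3,4)
proof (induction r arbitrary: f)
  case 0
  have "continuous_map (euc_on k W) (euc l) F"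
    unfolding continuous_map_into_Euclidean_space
    using 0 sub openin_subset[OF V] by (auto simp: image_subset_iff)
  then have "continuous_map (euc_on k W) (euc_on l V) F"
    using sub by (auto simp: continuous_map_in_subtopology)
  then show ?case using 0 continuous_map_compose[of _ _ F euclideanreal f] by (auto simp: o_def)
next
  case (Suc r)
  have F': "Cr_on r k W (\<lambda>x. F x j)" if "j < l" for j using Suc.prems(2)[OF that] by (rule Cr_on_Suc)
  have d: "((\<lambda>t. f (F (x(i := t)))) has_real_derivative
    (\<Sum>j<l. partial j f (F x) * partial i (\<lambda>x. F x j) x)) (at (x i))" if "x \<in> W" "i < k" for x i
    by (rule partial_compose[OF W V _ _ sub that])
       (use Suc.prems Cr_on_mono_order[of "Suc r" _ _ _ 1] in auto)
  have "Cr_on r k W (partial i (\<lambda>x. f (F x)))" if "i < k" for i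
  proof (rule Cr_on_cong[OF W])
    show "(\<Sum>j<l. partial j f (F x) * partial i (\<lambda>x. F x j) x) = partial i (\<lambda>x. f (F x)) x" if "x \<in> W" for x
      using partial_eqI[OF d[OF that \<open>i < k\<close>]] by simp
    show "Cr_on r k W (\<lambda>x. \<Sum>j<l. partial j f (F x) * partial i (\<lambda>x. F x j) x)"
    proof (rule Cr_on_sum[OF W])
      fix j assume j: "j \<in> {..<l}"
      have pf: "Cr_on r l V (partial j f)" using Suc.prems(1) j by simp
      have "Cr_on r k W (\<lambda>x. partial j f (F x))"
        using Suc.IH[OF pf F'] by simp
      moreover have "Cr_on r k W (partial i (\<lambda>x. F x j))"
        using Suc.prems(2)[of j] j that by simp
      ultimately show "Cr_on r k W (\<lambda>x. partial j f (F x) * partial i (\<lambda>x. F x j) x)"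
        by (rule Cr_on_mult[OF W])
    qed
  qed
  moreover have "(\<lambda>t. f (F (x(i := t)))) differentiable (at (x i))" if "i < k" "x \<in> W" for i x
    using d[OF that(2,1)] real_differentiable_def by blast
  moreover have "continuous_map (euc_on k W) euclideanreal (\<lambda>x. f (F x))"
    using Cr_on_continuous[OF Suc.IH[OF _ F']] Suc.prems(1) Cr_on_Suc by blast
  ultimately show ?case by simp
qed

lemma openin_Cr_on_preimage:
  assumes "openin (euc k) W" "Cr_on r k W h" "open S"
  shows "openin (euc k) {x \<in> W. h x \<in> S}"
proof -
  have "topspace (euc_on k W) = W"
    using openin_subset[OF assms(1)] by auto
  then have "openin (euc_on k W) {x \<in> W. h x \<in> S}"
    using openin_continuous_map_preimage[OF Cr_on_continuous[OF assms(2)], of S] assms(3)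
    by (simp only: open_openin)
  then show ?thesis using openin_trans_full[OF _ assms(1)] by blast
qed

section \<open>Inverse function theorem for a change of one coordinate\<close>

lemma Cr_on_upd:
  assumes "openin (euc k) W" "Cr_on r k W g"
  shows "Cr_on r k W (\<lambda>x. (x(i := g x)) j)"
  by (cases "j = i") (use assms Cr_on_coord in auto)

text \<open>The map alters the \<open>i\<close>-th coordinate only. On a box where
  \<open>partial i F\<close> keeps its sign it is strictly monotone on each line in direction
  \<open>i\<close>, hence injective; the intermediate value theorem gives an open image and a
  continuous inverse, and implicit differentiation gives the derivatives of the inverse in terms of
  the inverse itself, so that smoothness follows by bootstrapping.\<close>

lemma coordinate_change:
  assumes V: "openin (euc k) V" and F: "\<And>r. Cr_on r k V F"
    and i: "i < k" and x0: "x0 \<in> V" and nz: "partial i F x0 \<noteq> 0"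
  obtains U g where "openin (euc k) U" "x0 \<in> U" "U \<subseteq> V"
    "openin (euc k) ((\<lambda>x. x(i := F x)) ` U)"
    "\<And>x. x \<in> U \<Longrightarrow> g (x(i := F x)) = x i"
    "\<And>r. Cr_on r k ((\<lambda>x. x(i := F x)) ` U) g"
proof -
  \<comment> \<open>The sign reduces the decreasing case to the increasing one.\<close>
  define \<sigma> where "\<sigma> = sgn (partial i F x0)"
  have dF: "(\<lambda>t. F (z(j := t))) differentiable (at (z j))" if "z \<in> V" "j < k" for z j
    using F[of 1] that by auto
  have cF: "Cr_on r k V (partial j F)" if "j < k" for r j
    using F[of "Suc r"] that by simp
  have \<sigma>: "\<sigma> * partial i F x0 > 0" "\<sigma> \<noteq> 0"
    using nz by (auto simp: \<sigma>_def sgn_if)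
  have "openin (euc k) {x \<in> V. \<sigma> * partial i F x \<in> {0<..}}"
    by (intro openin_Cr_on_preimage[OF V, of 0] Cr_on_mult[OF V] Cr_on_const cF i) auto
  then obtain e where e: "e > 0" and
    eV: "\<And>y. y \<in> espace k \<Longrightarrow> (\<And>i. i < k \<Longrightarrow> \<bar>y i - x0 i\<bar> < e) \<Longrightarrow> y \<in> {x \<in> V. \<sigma> * partial i F x \<in> {0<..}}"
    by (rule openin_Euclidean_contains_box[where x=x0]) (use x0 \<sigma> in auto)
  define B where "B = {y \<in> espace k. \<forall>i<k. \<bar>y i - x0 i\<bar> < e}"
  have B: "openin (euc k) B" unfolding B_def by (rule openin_Euclidean_box)
  have BV: "B \<subseteq> V" and pos: "\<And>x. x \<in> B \<Longrightarrow> \<sigma> * partial i F x > 0"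
    using eV by (auto simp: B_def)
  have x0B: "x0 \<in> B" using x0 e openin_subset[OF V] by (auto simp: B_def)
  \<comment> \<open>In a box the condition on the \<open>i\<close>-th coordinate is independent of
    the others, so any admissible value \<open>a\<close> serves to test them.\<close>
  have Bupd: "x(i := t) \<in> B \<longleftrightarrow> x(i := a) \<in> B \<and> \<bar>t - x0 i\<bar> < e" if "\<bar>a - x0 i\<bar> < e" for x t a
    using that i by (auto simp: B_def espace_iff)
  have BI: "\<bar>x i - x0 i\<bar> < e" if "x \<in> B" for x using that i by (auto simp: B_def)
  have Bs: "x(i := t) \<in> B" if "x \<in> B" "\<bar>t - x0 i\<bar> < e" for x t
    using Bupd[OF BI[OF that(1)], of x t] that by simp
  have mono: "\<sigma> * F (x(i := a)) < \<sigma> * F (x(i := b))" if "x(i := a) \<in> B" "x(i := b) \<in> B" "a < b" for x a b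
  proof -
    have ab: "\<bar>a - x0 i\<bar> < e" "\<bar>b - x0 i\<bar> < e" using BI[OF that(1)] BI[OF that(2)] by auto
    have seg: "x(i := t) \<in> B" if "t \<in> closed_segment a b" for t
      using Bs[OF \<open>x(i := a) \<in> B\<close>, of t] that ab \<open>a < b\<close> by (auto simp: closed_segment_eq_real_ivl)
    obtain s where s: "s \<in> closed_segment a b" "F (x(i := b)) - F (x(i := a)) = partial i F (x(i := s)) * (b - a)"
      using Cr_on_mvt[of a b x i B F] seg dF BV i by blast
    have "\<sigma> * (F (x(i := b)) - F (x(i := a))) = \<sigma> * partial i F (x(i := s)) * (b - a)"
      using s(2) by simp
    also have "\<dots> > 0" using pos[OF seg[OF s(1)]] that(3) by simp
    finally show ?thesis by (simp add: algebra_simps)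
  qed
  define \<Psi> where "\<Psi> x = x(i := F x)" for x
  define G where "G = inv_into B \<Psi>"
  define g where "g y = G y i" for y
  have inj: "inj_on \<Psi> B"
  proof (rule inj_onI)
    fix x y assume xy: "x \<in> B" "y \<in> B" "\<Psi> x = \<Psi> y"
    have "x j = y j" if "j \<noteq> i" for j
      using fun_cong[OF xy(3), of j] that by (simp add: \<Psi>_def)
    then have eq: "x = y(i := x i)" "y = x(i := y i)" by auto
    have "F x = F y" using fun_cong[OF xy(3), of i] by (simp add: \<Psi>_def)
    then have "\<not> x i < y i" "\<not> y i < x i"
      using mono[of x "x i" "y i"] mono[of y "y i" "x i"] xy eq by auto
    then show "x = y" using eq by (metis fun_upd_triv linorder_neqE)
  qed
  have G: "G (\<Psi> x) = x" if "x \<in> B" for x unfolding G_def using inj that by simp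
  have GB: "G y \<in> B" "\<Psi> (G y) = y" if "y \<in> \<Psi> ` B" for y
    using that G by auto
  have yg: "y(i := g y) = G y" if "y \<in> \<Psi> ` B" for y
    using that by (auto simp: g_def G) (simp add: \<Psi>_def)
  \<comment> \<open>The signs of \<open>F - y i\<close> at the ends \<open>a\<close> and
    \<open>b\<close> of a line are open conditions on \<open>y\<close>. They hold at
    \<open>\<Psi> x\<close> by monotonicity, so for all nearby \<open>y\<close> the intermediate
    value theorem finds a preimage with \<open>i\<close>-th coordinate between \<open>a\<close> and
    \<open>b\<close>. This yields openness of the image and continuity of \<open>g\<close> at
    once.\<close>
  have key: "\<exists>N. openin (euc k) N \<and> \<Psi> x \<in> N \<and> (\<forall>y\<in>N. y \<in> \<Psi> ` B \<and> a < g y \<and> g y < b)"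
    if x: "x \<in> B" and ab: "a < x i" "x i < b" "\<bar>a - x0 i\<bar> < e" "\<bar>b - x0 i\<bar> < e" for x a b
  proof -
    define N0 where "N0 = {y \<in> espace k. y(i := a) \<in> B}"
    have N0: "openin (euc k) N0"
    proof -
      have "continuous_map (euc k) (euc k) (\<lambda>y. y(i := a))"
        using continuous_map_coordinate_Euclidean[of k UNIV] i
        by (auto simp: continuous_map_into_Euclidean_space espace_iff)
      then show ?thesis unfolding N0_def using B by (rule openin_continuous_map_preimage)
    qed
    have N0B: "y(i := t) \<in> B" if "y \<in> N0" "\<bar>t - x0 i\<bar> < e" for y t
      using Bupd[OF ab(3), of y t] that by (auto simp: N0_def)
    have cN: "Cr_on 0 k N0 (\<lambda>y. F (y(i := t)))" if "\<bar>t - x0 i\<bar> < e" for t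
    proof (rule Cr_on_compose[OF N0 V F])
      show "Cr_on 0 k N0 (\<lambda>y. (y(i := t)) j)" for j by (rule Cr_on_upd[OF N0 Cr_on_const])
      show "(\<lambda>y. y(i := t)) ` N0 \<subseteq> V" using N0B[OF _ that] BV by blast
    qed
    define N where "N = {y \<in> N0. \<sigma> * y i - \<sigma> * F (y(i := a)) \<in> {0<..}} \<inter> {y \<in> N0. \<sigma> * F (y(i := b)) - \<sigma> * y i \<in> {0<..}}"
    have "openin (euc k) N" unfolding N_def
      by (intro openin_Int openin_Cr_on_preimage[OF N0, of 0] Cr_on_diff[OF N0] Cr_on_mult[OF N0] Cr_on_const Cr_on_coord cN ab)
         auto
    moreover have "\<Psi> x \<in> N"
    proof -
      have "(\<Psi> x)(i := t) = x(i := t)" for t by (simp add: \<Psi>_def)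
      moreover have "\<Psi> x \<in> N0" using Bs[OF x ab(3)] x i by (auto simp: N0_def \<Psi>_def B_def espace_iff)
      moreover have "\<sigma> * F (x(i := a)) < \<sigma> * F x" "\<sigma> * F x < \<sigma> * F (x(i := b))"
        using mono[of x a "x i"] mono[of x "x i" b] Bs[OF x] ab x by auto
      ultimately show ?thesis by (auto simp: N_def) (auto simp: \<Psi>_def)
    qed
    moreover have "y \<in> \<Psi> ` B \<and> a < g y \<and> g y < b" if y: "y \<in> N" for y
    proof -
      have yN: "y \<in> N0" "\<sigma> * F (y(i := a)) < \<sigma> * y i" "\<sigma> * y i < \<sigma> * F (y(i := b))"
        using y by (auto simp: N_def)
      have seg: "y(i := t) \<in> B" if "a \<le> t" "t \<le> b" for t
        using N0B[OF yN(1), of t] that ab by auto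
      have "isCont (\<lambda>t. \<sigma> * F (y(i := t))) t" if "a \<le> t" "t \<le> b" for t
      proof -
        have "(\<lambda>s. F ((y(i := t))(i := s))) differentiable (at ((y(i := t)) i))"
          using seg[OF that] dF BV i by blast
        then have "isCont (\<lambda>s. F (y(i := s))) t"
          by (intro differentiable_imp_continuous_within) (simp only: fun_upd_upd fun_upd_same)
        then show ?thesis by (intro continuous_intros)
      qed
      then obtain s where s: "a \<le> s" "s \<le> b" "\<sigma> * F (y(i := s)) = \<sigma> * y i"
        using IVT[of "\<lambda>t. \<sigma> * F (y(i := t))" a "\<sigma> * y i" b] yN ab by (smt (verit))
      have "s \<noteq> a" "s \<noteq> b" using s yN by auto
      moreover have "\<Psi> (y(i := s)) = y" using s \<sigma> by (auto simp: \<Psi>_def)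
      moreover have "y(i := s) \<in> B" using seg s by auto
      ultimately show ?thesis using G[of "y(i := s)"] s by (force simp: g_def)
    qed
    ultimately show ?thesis by blast
  qed
  have key2: "\<exists>N. openin (euc k) N \<and> \<Psi> x \<in> N \<and> (\<forall>y\<in>N. y \<in> \<Psi> ` B \<and> \<bar>g y - x i\<bar> < \<epsilon>)"
    if x: "x \<in> B" and "\<epsilon> > 0" for x \<epsilon>
  proof -
    \<comment> \<open>At most half the distance to the wall of the box, so that both ends of the
      interval around \<open>x i\<close> are admissible.\<close>
    define \<eta> where "\<eta> = min \<epsilon> ((e - \<bar>x i - x0 i\<bar>) / 2)"
    have \<eta>: "\<eta> > 0" "\<eta> \<le> \<epsilon>" "\<eta> \<le> (e - \<bar>x i - x0 i\<bar>) / 2" "\<bar>x i - x0 i\<bar> < e"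
      using that BI[OF x] by (auto simp: \<eta>_def min_def)
    have "\<bar>x i - \<eta> - x0 i\<bar> < e" "\<bar>x i + \<eta> - x0 i\<bar> < e" "x i - \<eta> < x i" "x i < x i + \<eta>"
      using \<eta> by (auto simp: abs_if field_simps split: if_splits)
    then obtain N where N: "openin (euc k) N" "\<Psi> x \<in> N" "\<And>y. y\<in>N \<Longrightarrow> y \<in> \<Psi> ` B \<and> x i - \<eta> < g y \<and> g y < x i + \<eta>"
      using key[OF x, of "x i - \<eta>" "x i + \<eta>"] by blast
    have "y \<in> \<Psi> ` B \<and> \<bar>g y - x i\<bar> < \<epsilon>" if "y \<in> N" for y
      using N(3)[OF that] \<eta>(2) by auto
    then show ?thesis using N(1,2) by blast
  qed
  have im: "openin (euc k) (\<Psi> ` B)"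
  proof (subst openin_subopen, safe)
    fix x assume "x \<in> B"
    then show "\<exists>T. openin (euc k) T \<and> \<Psi> x \<in> T \<and> T \<subseteq> \<Psi> ` B"
      using key2[of x 1] by (meson subsetI zero_less_one)
  qed
  have imE: "\<Psi> ` B \<subseteq> espace k" using openin_subset[OF im] by simp
  have gcont: "continuous_map (euc_on k (\<Psi> ` B)) euclideanreal g"
    unfolding continuous_map_def
  proof (intro conjI allI impI)
    fix S :: "real set" assume S: "openin euclideanreal S"
    have "openin (euc k) {y \<in> \<Psi> ` B. g y \<in> S}"
    proof (subst openin_subopen, safe)
      fix x assume x: "x \<in> B" "g (\<Psi> x) \<in> S"
      then have "x i \<in> S" by (simp add: g_def G)
      then obtain \<epsilon> where "\<epsilon> > 0" "\<And>t. \<bar>t - x i\<bar> < \<epsilon> \<Longrightarrow> t \<in> S"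
        using S unfolding open_openin[symmetric] open_dist dist_real_def by blast
      then show "\<exists>T. openin (euc k) T \<and> \<Psi> x \<in> T \<and> T \<subseteq> {y \<in> \<Psi> ` B. g y \<in> S}"
        using key2[OF x(1), of \<epsilon>] by (smt (verit) mem_Collect_eq subsetI)
    qed
    moreover have "{y \<in> topspace (euc_on k (\<Psi> ` B)). g y \<in> S} = {y \<in> \<Psi> ` B. g y \<in> S}"
      using imE by auto
    ultimately show "openin (euc_on k (\<Psi> ` B))
        {y \<in> topspace (euc_on k (\<Psi> ` B)). g y \<in> S}"
      using openin_open_subtopology[OF im] by auto
  qed auto
  \<comment> \<open>The derivatives found by differentiating \<open>F (y(i := g y)) = y i\<close>
    implicitly, as functions of the preimage.\<close>
  define D where "D j x = (if j = i then 1 else - partial j F x) * inverse (partial i F x)" for j x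
  have deriv: "((\<lambda>t. g (y(j := t))) has_real_derivative D j (G y)) (at (y j))"
    if y: "y \<in> \<Psi> ` B" and j: "j < k" for y j
  proof -
    define x where "x = G y"
    have x: "x \<in> B" "\<Psi> x = y" using GB[OF y] by (auto simp: x_def)
    have yx: "y l = (if l = i then F x else x l)" for l using x(2) by (auto simp: \<Psi>_def)
    \<comment> \<open>The preimage of the moved point. Restoring its old \<open>i\<close>-th
      coordinate changes \<open>F\<close> by a value of \<open>partial i F\<close> times the
      increment of \<open>g\<close>, by the mean value theorem; dividing by that value recovers the
      difference quotient of \<open>g\<close>.\<close>
    define X where "X t = G (y(j := t))" for t
    have "\<forall>\<^sub>F t in nhds (y j). y(j := t) \<in> \<Psi> ` B"
      by (rule openin_Euclidean_upd_eventually[OF im y j])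
    then have ev: "\<forall>\<^sub>F t in at (y j). y(j := t) \<in> \<Psi> ` B"
      by (simp add: eventually_at_filter eventually_mono)
    have "((\<lambda>t. g (y(j := t))) \<longlongrightarrow> g y) (at (y j))"
    proof (rule continuous_map_Euclidean_at(1)[OF gcont im y])
      show "\<forall>\<^sub>F t in at (y j). y(j := t) \<in> espace k"
        using ev by eventually_elim (use imE in blast)
      show "((\<lambda>t. (y(j := t)) l) \<longlongrightarrow> y l) (at (y j))" for l
        by (cases "l = j") auto
    qed
    then have glim: "((\<lambda>t. g (y(j := t))) \<longlongrightarrow> x i) (at (y j))" by (simp add: g_def x_def)
    have "\<forall>\<^sub>F t in at (y j). \<exists>s. s \<in> closed_segment (x i) (g (y(j := t))) \<and> (X t)(i := s) \<in> B \<and>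
       F (X t) - F ((X t)(i := x i)) = partial i F ((X t)(i := s)) * (g (y(j := t)) - x i)"
      using ev
    proof eventually_elim
      case (elim t)
      have XB: "X t \<in> B" using GB[OF elim] by (simp add: X_def)
      have seg: "(X t)(i := s) \<in> B" if "s \<in> closed_segment (x i) (g (y(j := t)))" for s
        using that BI[OF XB] BI[OF x(1)]
        by (intro Bs[OF XB]) (auto simp: closed_segment_eq_real_ivl X_def g_def split: if_splits)
      have "(X t)(i := g (y(j := t))) = X t" by (simp add: g_def X_def)
      then show ?case
        using Cr_on_mvt[of "x i" "g (y(j := t))" "X t" i B F] seg dF BV i by (metis subsetD)
    qed
    then obtain s where s: "\<forall>\<^sub>F t in at (y j). s t \<in> closed_segment (x i) (g (y(j := t))) \<and> (X t)(i := s t) \<in> B \<and>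
       F (X t) - F ((X t)(i := x i)) = partial i F ((X t)(i := s t)) * (g (y(j := t)) - x i)"
      unfolding eventually_ex by blast
    have "((\<lambda>t. s t - x i) \<longlongrightarrow> 0) (at (y j))"
    proof (rule Lim_null_comparison)
      show "\<forall>\<^sub>F t in at (y j). norm (s t - x i) \<le> \<bar>g (y(j := t)) - x i\<bar>"
        using s by eventually_elim (auto simp: closed_segment_eq_real_ivl split: if_splits)
      show "((\<lambda>t. \<bar>g (y(j := t)) - x i\<bar>) \<longlongrightarrow> 0) (at (y j))"
        using tendsto_rabs[OF LIM_zero[OF glim]] by simp
    qed
    then have slim: "(s \<longlongrightarrow> x i) (at (y j))" by (rule LIM_zero_cancel)
    have Xl: "\<forall>\<^sub>F t in at (y j). X t = (y(j := t))(i := g (y(j := t)))"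
      using ev by eventually_elim (simp add: X_def yg)
    have plim: "((\<lambda>t. partial i F ((X t)(i := s t))) \<longlongrightarrow> partial i F x) (at (y j))"
    proof (rule continuous_map_Euclidean_at(1)[where f="partial i F" and y=x, OF _ V])
      show "continuous_map (euc_on k V) euclideanreal (partial i F)"
        using cF[OF i, of 0] by simp
      show "x \<in> V" using x BV by blast
      show "\<forall>\<^sub>F t in at (y j). (X t)(i := s t) \<in> espace k"
        using s by eventually_elim (use openin_subset[OF B] in blast)
      show "((\<lambda>t. ((X t)(i := s t)) l) \<longlongrightarrow> x l) (at (y j))" for l
      proof (cases "l = i")
        case False
        have "\<forall>\<^sub>F t in at (y j). (y(j := t)) l = ((X t)(i := s t)) l"
          using Xl by eventually_elim (use False in simp)
        moreover have "((\<lambda>t. (y(j := t)) l) \<longlongrightarrow> x l) (at (y j))"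
          using False yx[of l] by (cases "l = j") auto
        ultimately show ?thesis by (rule Lim_transform_eventually[rotated])
      qed (use slim in simp)
    qed
    have nzx: "partial i F x \<noteq> 0" using pos[OF x(1)] by auto
    \<comment> \<open>For \<open>j = i\<close>, restoring the coordinate gives back
      \<open>x\<close>, and \<open>F (X t)\<close> is \<open>t\<close> itself. For
      \<open>j \<noteq> i\<close>, \<open>F (X t)\<close> stays at \<open>F x\<close>, while
      restoring the coordinate gives \<open>x\<close> moved in direction \<open>j\<close>; hence the
      minus sign.\<close>
    have Rlim: "((\<lambda>t. (F (X t) - F ((X t)(i := x i))) / (t - y j)) \<longlongrightarrow> (if j = i then 1 else - partial j F x)) (at (y j))"
    proof (cases "j = i")
      case True
      have "\<forall>\<^sub>F t in at (y j). 1 = (F (X t) - F ((X t)(i := x i))) / (t - y j)"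
        using ev Xl eventually_neq_at_within[of "y j" "y j" UNIV]
      proof eventually_elim
        case (elim t)
        have "(X t)(i := x i) = x" using elim(2) True x(2) by (auto simp: \<Psi>_def)
        moreover have "F (X t) = t"
          using fun_cong[OF GB(2)[OF elim(1)], of i] True by (simp add: \<Psi>_def X_def)
        ultimately show ?case using elim(3) yx[of i] True by simp
      qed
      then show ?thesis using True tendsto_eventually by (simp add: tendsto_cong Lim_transform_eventually[OF tendsto_const])
    next
      case False
      have xj: "x j = y j" using yx[of j] False by simp
      have "((\<lambda>t. F (x(j := t))) has_real_derivative partial j F x) (at (y j))"
        using differentiable_partial[OF dF[OF subsetD[OF BV x(1)] j]] xj by (simp add: fun_upd_def)
      then have "((\<lambda>t. - ((F (x(j := t)) - F (x(j := y j))) / (t - y j))) \<longlongrightarrow> - partial j F x) (at (y j))"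
        unfolding has_field_derivative_iff by (rule tendsto_minus)
      moreover have "\<forall>\<^sub>F t in at (y j). - ((F (x(j := t)) - F (x(j := y j))) / (t - y j)) = (F (X t) - F ((X t)(i := x i))) / (t - y j)"
        using ev Xl
      proof eventually_elim
        case (elim t)
        have "(X t)(i := x i) = x(j := t)" using elim(2) False x(2) by (auto simp: \<Psi>_def)
        moreover have "F (X t) = F x"
          using fun_cong[OF GB(2)[OF elim(1)], of i] False yx[of i] by (simp add: \<Psi>_def X_def)
        moreover have "x(j := y j) = x" using xj by auto
        ultimately show ?case by (simp add: minus_divide_left)
      qed
      ultimately show ?thesis using False by (simp add: Lim_transform_eventually)
    qed
    have "((\<lambda>t. (F (X t) - F ((X t)(i := x i))) / (t - y j) * inverse (partial i F ((X t)(i := s t)))) \<longlongrightarrow> D j x) (at (y j))"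
      unfolding D_def by (intro tendsto_mult Rlim tendsto_inverse plim nzx)
    moreover have "\<forall>\<^sub>F t in at (y j). (F (X t) - F ((X t)(i := x i))) / (t - y j) * inverse (partial i F ((X t)(i := s t)))
        = (g (y(j := t)) - g (y(j := y j))) / (t - y j)"
      using s
    proof eventually_elim
      case (elim t)
      then have "partial i F ((X t)(i := s t)) \<noteq> 0" using pos by fastforce
      then show ?case using elim by (simp add: g_def[of y] x_def)
    qed
    ultimately show ?thesis
      unfolding has_field_derivative_iff x_def[symmetric] by (rule Lim_transform_eventually)
  qed
  \<comment> \<open>The partial derivatives of \<open>g\<close> are the smooth functions
    \<open>D j\<close> evaluated at \<open>y(i := g y)\<close>, which has the order already known
    for \<open>g\<close>; each round gains one order.\<close>
  have gC: "Cr_on r k (\<Psi> ` B) g" for r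
  proof (induction r)
    case (Suc r)
    have "Cr_on r k (\<Psi> ` B) (partial j g)" if j: "j < k" for j
    proof (rule Cr_on_cong[OF im])
      show "D j (y(i := g y)) = partial j g y" if "y \<in> \<Psi> ` B" for y
        using partial_eqI[OF deriv[OF that j]] yg[OF that] by simp
      have "Cr_on r k B (\<lambda>x. D j x)" unfolding D_def
      proof (intro Cr_on_mult[OF B] Cr_on_inverse[OF B])
        show "Cr_on r k B (\<lambda>x. if j = i then 1 else - partial j F x)"
          using Cr_on_const Cr_on_uminus[OF B Cr_on_mono[OF cF[OF j] BV]] by (cases "j = i") auto
        show "Cr_on r k B (\<lambda>x. partial i F x)" using Cr_on_mono[OF cF[OF i] BV] by simp
      qed (use pos in fastforce)
      then show "Cr_on r k (\<Psi> ` B) (\<lambda>y. D j (y(i := g y)))"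
        by (rule Cr_on_compose[OF im B _ Cr_on_upd[OF im Suc.IH]]) (use yg GB in auto)
    qed
    moreover have "(\<lambda>t. g (y(j := t))) differentiable (at (y j))" if "j < k" "y \<in> \<Psi> ` B" for j y
      using deriv[OF that(2,1)] real_differentiable_def by blast
    ultimately show ?case using gcont by simp
  qed (use gcont in simp)
  have PsiB: "(\<lambda>x. x(i := F x)) = \<Psi>" by (simp add: \<Psi>_def fun_eq_iff)
  show thesis
    by (rule that[OF B x0B BV, of g]) (simp_all only: PsiB im gC, simp add: \<Psi>_def[symmetric] g_def G)
qed

section \<open>Charts\<close>

lemma openin_Cr_on_vimage:
  assumes W: "openin (euc k) W" and F: "\<And>j. j < l \<Longrightarrow> Cr_on r k W (\<lambda>x. F x j)"
    and "F ` W \<subseteq> espace l" and Z: "openin (euc l) Z"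
  shows "openin (euc k) {x \<in> W. F x \<in> Z}"
proof -
  have W': "topspace (euc_on k W) = W"
    using openin_subset[OF W] by auto
  have "continuous_map (euc_on k W) (euc l) F"
    unfolding continuous_map_into_Euclidean_space W'
    using assms(3) F[THEN Cr_on_continuous] by blast
  then have "openin (euc_on k W) {x \<in> topspace (euc_on k W). F x \<in> Z}"
    by (rule openin_continuous_map_preimage[OF _ Z])
  then have "openin (euc_on k W) {x \<in> W. F x \<in> Z}"
    unfolding W' .
  then show ?thesis using openin_trans_full[OF _ W] by blast
qed

lemma inv_into_subset_eq:
  assumes "inj_on f U" "V \<subseteq> U" "z \<in> f ` V"
  shows "inv_into V f z = inv_into U f z"
  using assms by (smt (verit) f_inv_into_f image_mono inj_on_eq_iff inv_into_into subsetD)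

context
  fixes X :: "'a topology" and k :: nat and U :: "'a set" and \<phi> :: "'a \<Rightarrow> nat \<Rightarrow> real"
  assumes chart: "is_chart X (k, U, \<phi>)"
begin

lemma chart_open: "openin X U"
  using chart by (simp add: is_chart_def)

lemma chart_subset: "U \<subseteq> topspace X"
  using chart_open openin_subset by blast

lemma chart_image_open: "openin (euc k) (\<phi> ` U)"
  using chart by (simp add: is_chart_def)

lemma chart_homeo: "homeomorphic_map (subtopology X U) (euc_on k (\<phi> ` U)) \<phi>"
  using chart by (simp add: is_chart_def)

lemma topspace_chart: "topspace (subtopology X U) = U"
  using chart_subset by auto

lemma chart_inj: "inj_on \<phi> U"
  using homeomorphic_imp_injective_map[OF chart_homeo] topspace_chart by simp

lemma chart_inv [simp]: "x \<in> U \<Longrightarrow> inv_into U \<phi> (\<phi> x) = x"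
  using chart_inj by simp

lemma chart_espace: "\<phi> ` U \<subseteq> espace k"
  using openin_subset[OF chart_image_open] .

lemma chart_continuous: "continuous_map (subtopology X U) (euc k) \<phi>"
  using homeomorphic_imp_continuous_map[OF chart_homeo] by (simp add: continuous_map_in_subtopology)

lemma chart_open_image:
  assumes "openin X W" "W \<subseteq> U"
  shows "openin (euc k) (\<phi> ` W)"
proof -
  have "openin (subtopology X U) W" using assms by (simp add: openin_subset_topspace_eq openin_open_subtopology chart_open)
  then have "openin (euc_on k (\<phi> ` U)) (\<phi> ` W)"
    using homeomorphic_imp_open_map[OF chart_homeo] by (simp add: open_map_def)
  then show ?thesis using chart_image_open openin_trans_full by blast
qed

lemma chart_open_preimage:
  assumes "openin (euc k) Z"
  shows "openin X {x \<in> U. \<phi> x \<in> Z}"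
proof -
  have "openin (subtopology X U) {x \<in> U. \<phi> x \<in> Z}"
    using openin_continuous_map_preimage[OF chart_continuous assms] by (simp only: topspace_chart)
  then show ?thesis using chart_open openin_trans_full by blast
qed

lemma chart_inv_continuous:
  "continuous_map (euc_on k (\<phi> ` U)) X (inv_into U \<phi>)"
proof -
  obtain g where g: "homeomorphic_maps (subtopology X U) (euc_on k (\<phi> ` U)) \<phi> g"
    using chart_homeo homeomorphic_map_maps by blast
  then have "continuous_map (euc_on k (\<phi> ` U)) X g"
    by (auto simp: homeomorphic_maps_def continuous_map_in_subtopology)
  moreover have "g z = inv_into U \<phi> z" if "z \<in> topspace (euc_on k (\<phi> ` U))" for z
    using g that chart_subset by (auto simp: homeomorphic_maps_def)
  ultimately show ?thesis by (rule continuous_map_eq)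
qed

end

lemma is_chartI:
  assumes "openin X U" "continuous_map (subtopology X U) (euc k) \<phi>"
    and "openin (euc k) (\<phi> ` U)"
    and "continuous_map (euc_on k (\<phi> ` U)) X g"
    and "\<And>x. x \<in> U \<Longrightarrow> g (\<phi> x) = x"
  shows "is_chart X (k, U, \<phi>)"
proof -
  have 1: "topspace (subtopology X U) = U" "topspace (euc_on k (\<phi> ` U)) = \<phi> ` U"
    using openin_subset[OF assms(1)] openin_subset[OF assms(3)] by auto
  have "homeomorphic_maps (subtopology X U) (euc_on k (\<phi> ` U)) \<phi> g"
    unfolding homeomorphic_maps_def 1 continuous_map_in_subtopology
    using assms by (auto simp: 1)
  then have "homeomorphic_map (subtopology X U) (euc_on k (\<phi> ` U)) \<phi>"
    using homeomorphic_map_maps by blast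
  then show ?thesis
    using assms by (simp add: is_chart_def)
qed

lemma is_chart_subset:
  assumes "is_chart X (k, U, \<phi>)" "openin X V" "V \<subseteq> U"
  shows "is_chart X (k, V, \<phi>)"
proof (rule is_chartI[where g = "inv_into U \<phi>"])
  show "continuous_map (subtopology X V) (euc k) \<phi>"
    using continuous_map_from_subtopology_mono[OF chart_continuous[OF assms(1)] assms(3)] .
  show "continuous_map (euc_on k (\<phi> ` V)) X (inv_into U \<phi>)"
    using continuous_map_from_subtopology_mono[OF chart_inv_continuous[OF assms(1)] image_mono[OF assms(3)]] .
  show "openin (euc k) (\<phi> ` V)" by (rule chart_open_image[OF assms])
  show "inv_into U \<phi> (\<phi> x) = x" if "x \<in> V" for x using chart_inv[OF assms(1)] that assms(3) by blast
qed (rule assms(2))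

lemma Cr_on_change_chart:
  assumes c: "is_chart X (k, U, \<phi>)" and c': "is_chart X (l, V, \<psi>)"
    and sm: "smooth_on l (\<psi> ` (U \<inter> V)) k (\<phi> \<circ> inv_into V \<psi>)"
    and W: "openin X W" "W \<subseteq> U" and u: "Cr_on r k (\<phi> ` W) (u \<circ> inv_into U \<phi>)"
  shows "Cr_on r l (\<psi> ` (W \<inter> V)) (u \<circ> inv_into V \<psi>)"
proof -
  have o: "openin (euc l) (\<psi> ` (W \<inter> V))"
    using W chart_open[OF c'] by (intro chart_open_image[OF c']) auto
  have sm': "Cr_on r l (\<psi> ` (W \<inter> V)) (\<lambda>z. (\<phi> \<circ> inv_into V \<psi>) z j)" if "j < k" for j
    using sm that W(2) unfolding smooth_on_def by (blast intro: Cr_on_mono)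
  have "Cr_on r l (\<psi> ` (W \<inter> V)) (\<lambda>z. (u \<circ> inv_into U \<phi>) ((\<phi> \<circ> inv_into V \<psi>) z))"
    by (rule Cr_on_compose[OF o chart_open_image[OF c W] u sm']) (auto simp: chart_inv[OF c'])
  then show ?thesis
    by (rule Cr_on_cong[OF o, rotated]) (use W(2) in \<open>auto simp: chart_inv[OF c'] chart_inv[OF c] subset_iff\<close>)
qed

lemma atlas_subset_maximal: "smooth_manifold M \<Longrightarrow> atlas M \<subseteq> maximal_atlas M"
  by (auto simp: smooth_manifold_def maximal_atlas_def)

lemma maximal_atlas_chart: "c \<in> maximal_atlas M \<Longrightarrow> is_chart (mtop M) c"
  by (auto simp: maximal_atlas_def)

lemma smooth_manifold_chart: "smooth_manifold M \<Longrightarrow> c \<in> atlas M \<Longrightarrow> is_chart (mtop M) c"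
  by (auto simp: smooth_manifold_def)

lemma smooth_manifold_chart_at:
  assumes "smooth_manifold M" "x \<in> pts M"
  obtains k U \<phi> where "(k, U, \<phi>) \<in> atlas M" "x \<in> U"
  using assms unfolding smooth_manifold_def by blast

section \<open>Germs of smooth functions and maps\<close>

text \<open>A single neighbourhood serves all orders of differentiability. Some chart is enough,
  since \<open>smooth_real_at_chart\<close> passes to any other, including those of the maximal
  atlas.\<close>

definition smooth_real_at :: "'a manifold \<Rightarrow> ('a \<Rightarrow> real) \<Rightarrow> 'a \<Rightarrow> bool" where
  "smooth_real_at M u x \<longleftrightarrow> (\<exists>(k, U, \<phi>)\<in>atlas M. \<exists>W. openin (mtop M) W \<and> x \<in> W \<and> W \<subseteq> U \<and>
     (\<forall>r. Cr_on r k (\<phi> ` W) (u \<circ> inv_into U \<phi>)))"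

lemma smooth_real_at_chart:
  assumes M: "smooth_manifold M" and u: "smooth_real_at M u x"
    and c: "(l, V, \<psi>) \<in> maximal_atlas M" "x \<in> V"
  obtains W where "openin (mtop M) W" "x \<in> W" "W \<subseteq> V" "\<And>r. Cr_on r l (\<psi> ` W) (u \<circ> inv_into V \<psi>)"
proof -
  obtain k U \<phi> W where *: "(k, U, \<phi>) \<in> atlas M" "openin (mtop M) W" "x \<in> W" "W \<subseteq> U"
     "\<And>r. Cr_on r k (\<phi> ` W) (u \<circ> inv_into U \<phi>)"
    using u unfolding smooth_real_at_def by blast
  have "compatible (l, V, \<psi>) (k, U, \<phi>)" using c *(1) by (auto simp: maximal_atlas_def)
  then have sm: "smooth_on l (\<psi> ` (U \<inter> V)) k (\<phi> \<circ> inv_into V \<psi>)"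
    by (simp add: compatible_def Int_commute)
  note ch = smooth_manifold_chart[OF M *(1)] maximal_atlas_chart[OF c(1)]
  show thesis
  proof
    show "Cr_on r l (\<psi> ` (W \<inter> V)) (u \<circ> inv_into V \<psi>)" for r
      by (rule Cr_on_change_chart[OF ch sm *(2,4,5)])
  qed (use * c chart_open[OF ch(2)] in auto)
qed

lemma smooth_real_atI:
  assumes M: "smooth_manifold M" and c: "(l, V, \<psi>) \<in> maximal_atlas M"
    and W: "openin (mtop M) W" "x \<in> W" "W \<subseteq> V" and u: "\<And>r. Cr_on r l (\<psi> ` W) (u \<circ> inv_into V \<psi>)"
  shows "smooth_real_at M u x"
proof -
  have "x \<in> pts M" using W openin_subset by blast
  then obtain k U \<phi> where U: "(k, U, \<phi>) \<in> atlas M" "x \<in> U"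
    using smooth_manifold_chart_at[OF M] by blast
  have "compatible (l, V, \<psi>) (k, U, \<phi>)" using c U(1) by (auto simp: maximal_atlas_def)
  then have sm: "smooth_on k (\<phi> ` (V \<inter> U)) l (\<psi> \<circ> inv_into U \<phi>)"
    by (simp add: compatible_def)
  note ch = maximal_atlas_chart[OF c(1)] smooth_manifold_chart[OF M U(1)]
  have "Cr_on r k (\<phi> ` (W \<inter> U)) (u \<circ> inv_into U \<phi>)" for r
    by (rule Cr_on_change_chart[OF ch sm W(1,3) u])
  then show ?thesis unfolding smooth_real_at_def
    using U W chart_open[OF ch(2)] by (intro bexI[OF _ U(1)]) (auto intro!: exI[of _ "W \<inter> U"])
qed

lemma smooth_real_at_cong:
  assumes M: "smooth_manifold M" and u: "smooth_real_at M u x"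
    and N: "openin (mtop M) N" "x \<in> N" "\<And>y. y \<in> N \<Longrightarrow> u y = v y"
  shows "smooth_real_at M v x"
proof -
  obtain k U \<phi> W where *: "(k, U, \<phi>) \<in> atlas M" "openin (mtop M) W" "x \<in> W" "W \<subseteq> U"
     "\<And>r. Cr_on r k (\<phi> ` W) (u \<circ> inv_into U \<phi>)"
    using u unfolding smooth_real_at_def by blast
  note ch = smooth_manifold_chart[OF M *(1)]
  have c: "(k, U, \<phi>) \<in> maximal_atlas M" using *(1) M atlas_subset_maximal by blast
  have o: "openin (euc k) (\<phi> ` (W \<inter> N))"
    using * N by (intro chart_open_image[OF ch]) auto
  show ?thesis
  proof (rule smooth_real_atI[OF M c])
    show "Cr_on r k (\<phi> ` (W \<inter> N)) (v \<circ> inv_into U \<phi>)" for r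
      by (rule Cr_on_cong[OF o _ Cr_on_mono[OF *(5)]]) (use *(4) N(3) in \<open>auto simp: chart_inv[OF ch] subset_iff\<close>)
  qed (use * N in auto)
qed

lemma smooth_real_at_coord:
  assumes M: "smooth_manifold M" and c: "(l, V, \<psi>) \<in> maximal_atlas M" "x \<in> V"
  shows "smooth_real_at M (\<lambda>y. \<psi> y j) x"
proof (rule smooth_real_atI[OF M c(1)])
  note ch = maximal_atlas_chart[OF c(1)]
  show "openin (mtop M) V" by (rule chart_open[OF ch])
  show "Cr_on r l (\<psi> ` V) ((\<lambda>y. \<psi> y j) \<circ> inv_into V \<psi>)" for r
    by (rule Cr_on_cong[OF chart_image_open[OF ch] _ Cr_on_coord[of r l _ j]]) (auto simp: chart_inv[OF ch])
qed (use c in auto)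

lemma smooth_real_at_diff:
  assumes M: "smooth_manifold M" and u: "smooth_real_at M u x" and v: "smooth_real_at M v x" and x: "x \<in> pts M"
  shows "smooth_real_at M (\<lambda>y. u y - v y) x"
proof -
  obtain k U \<phi> where U: "(k, U, \<phi>) \<in> atlas M" "x \<in> U"
    using smooth_manifold_chart_at[OF M x] by blast
  have c: "(k, U, \<phi>) \<in> maximal_atlas M" using U(1) M atlas_subset_maximal by blast
  note ch = maximal_atlas_chart[OF c]
  obtain W where W: "openin (mtop M) W" "x \<in> W" "W \<subseteq> U" "\<And>r. Cr_on r k (\<phi> ` W) (u \<circ> inv_into U \<phi>)"
    using smooth_real_at_chart[OF M u c U(2)] by blast
  obtain W' where W': "openin (mtop M) W'" "x \<in> W'" "W' \<subseteq> U" "\<And>r. Cr_on r k (\<phi> ` W') (v \<circ> inv_into U \<phi>)"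
    using smooth_real_at_chart[OF M v c U(2)] by blast
  have o: "openin (euc k) (\<phi> ` (W \<inter> W'))"
    using W W' by (intro chart_open_image[OF ch]) auto
  show ?thesis
  proof (rule smooth_real_atI[OF M c, of "W \<inter> W'"])
    have "Cr_on r k (\<phi> ` (W \<inter> W')) (\<lambda>z. (u \<circ> inv_into U \<phi>) z - (v \<circ> inv_into U \<phi>) z)" for r
      by (intro Cr_on_diff[OF o] Cr_on_mono[OF W(4)] Cr_on_mono[OF W'(4)]) auto
    then show "Cr_on r k (\<phi> ` (W \<inter> W')) ((\<lambda>y. u y - v y) \<circ> inv_into U \<phi>)" for r
      by (simp add: o_def)
  qed (use W W' in auto)
qed

lemma smooth_real_at_compose:
  assumes M: "smooth_manifold M" and F: "\<And>j. j < l \<Longrightarrow> smooth_real_at M (\<lambda>y. F y j) x"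
    and N: "openin (mtop M) N" "x \<in> N" "F ` N \<subseteq> espace l"
    and Z: "openin (euc l) Z" "F x \<in> Z" and f: "\<And>r. Cr_on r l Z f"
  shows "smooth_real_at M (\<lambda>y. f (F y)) x"
proof -
  have "x \<in> pts M" using N openin_subset by blast
  then obtain k U \<phi> where U: "(k, U, \<phi>) \<in> atlas M" "x \<in> U"
    using smooth_manifold_chart_at[OF M] by blast
  have c: "(k, U, \<phi>) \<in> maximal_atlas M" using U(1) M atlas_subset_maximal by blast
  note ch = maximal_atlas_chart[OF c]
  have "\<exists>W. openin (mtop M) W \<and> x \<in> W \<and> W \<subseteq> U \<and> (\<forall>r. Cr_on r k (\<phi> ` W) ((\<lambda>y. F y j) \<circ> inv_into U \<phi>))"
    if "j < l" for j
    using smooth_real_at_chart[OF M F[OF that] c U(2)] by metis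
  then obtain W where W: "\<And>j. j < l \<Longrightarrow> openin (mtop M) (W j)" "\<And>j. j < l \<Longrightarrow> x \<in> W j" "\<And>j. j < l \<Longrightarrow> W j \<subseteq> U"
      "\<And>j r. j < l \<Longrightarrow> Cr_on r k (\<phi> ` W j) ((\<lambda>y. F y j) \<circ> inv_into U \<phi>)"
    by metis
  define W0 where "W0 = \<Inter>(insert (U \<inter> N) (W ` {..<l}))"
  have W0: "openin (mtop M) W0" "x \<in> W0" "W0 \<subseteq> U" "W0 \<subseteq> N" "\<And>j. j < l \<Longrightarrow> W0 \<subseteq> W j"
  proof -
    show "openin (mtop M) W0" unfolding W0_def
      by (rule openin_Inter) (use W(1) N(1) chart_open[OF ch] in auto)
  qed (use W U N in \<open>auto simp: W0_def\<close>)
  have o: "openin (euc k) (\<phi> ` W0)" by (rule chart_open_image[OF ch W0(1,3)])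
  define F' where "F' z = F (inv_into U \<phi> z)" for z
  have F': "Cr_on r k (\<phi> ` W0) (\<lambda>z. F' z j)" if "j < l" for j r
    using Cr_on_mono[OF W(4)[OF that] image_mono[OF W0(5)[OF that]]] by (simp add: F'_def o_def)
  have F'x: "F' (\<phi> y) = F y" if "y \<in> W0" for y
    unfolding F'_def using that W0(3) chart_inv[OF ch] by auto
  define Z' where "Z' = {z \<in> \<phi> ` W0. F' z \<in> Z}"
  have Z': "openin (euc k) Z'" unfolding Z'_def
    by (rule openin_Cr_on_vimage[OF o F'[of _ 0] _ Z(1)]) (use W0(4) N(3) F'x in auto)
  define W1 where "W1 = {y \<in> U. \<phi> y \<in> Z'}"
  have W1: "openin (mtop M) W1" unfolding W1_def by (rule chart_open_preimage[OF ch Z'])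
  have "\<phi> ` W1 \<subseteq> Z'" by (auto simp: W1_def)
  moreover have "Cr_on r k Z' (\<lambda>z. f (F' z))" for r
    by (rule Cr_on_compose[OF Z' Z(1) f Cr_on_mono[OF F']]) (auto simp: Z'_def)
  ultimately have "Cr_on r k (\<phi> ` W1) (\<lambda>z. f (F' z))" for r using Cr_on_mono by blast
  then show ?thesis
    using W0 W1 Z(2) F'x[OF W0(2)] by (intro smooth_real_atI[OF M c W1]) (auto simp: W1_def Z'_def F'_def o_def)
qed

text \<open>Germs of maps are needed because local sections have no meaning away from their point.
  Continuity is demanded on a whole neighbourhood, which keeps preimages of open sets open and germs
  composable.\<close>

definition smooth_at :: "'a manifold \<Rightarrow> 'b manifold \<Rightarrow> ('a \<Rightarrow> 'b) \<Rightarrow> 'a \<Rightarrow> bool" where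
  "smooth_at M N f x \<longleftrightarrow>
     (\<exists>W. openin (mtop M) W \<and> x \<in> W \<and> continuous_map (subtopology (mtop M) W) (mtop N) f) \<and>
     (\<forall>(l, V, \<psi>)\<in>atlas N. f x \<in> V \<longrightarrow> (\<forall>j<l. smooth_real_at M (\<lambda>y. \<psi> (f y) j) x))"

lemma smooth_at_unfoldI:
  assumes "openin (mtop M) W" "x \<in> W" "continuous_map (subtopology (mtop M) W) (mtop N) f"
    and "\<And>l V \<psi> j. (l, V, \<psi>) \<in> atlas N \<Longrightarrow> f x \<in> V \<Longrightarrow> j < l \<Longrightarrow> smooth_real_at M (\<lambda>y. \<psi> (f y) j) x"
  shows "smooth_at M N f x"
  unfolding smooth_at_def using assms by blast

lemma smooth_atD:
  "smooth_at M N f x \<Longrightarrow> (l, V, \<psi>) \<in> atlas N \<Longrightarrow> f x \<in> V \<Longrightarrow> j < l \<Longrightarrow> smooth_real_at M (\<lambda>y. \<psi> (f y) j) x"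
  by (auto simp: smooth_at_def)

lemma smooth_at_pts:
  assumes "smooth_at M N f x" shows "x \<in> pts M" "f x \<in> pts N"
proof -
  obtain W where W: "openin (mtop M) W" "x \<in> W" "continuous_map (subtopology (mtop M) W) (mtop N) f"
    using assms by (auto simp: smooth_at_def)
  show x: "x \<in> pts M" using openin_subset[OF W(1)] W(2) by blast
  show "f x \<in> pts N"
    using continuous_map_image_subset_topspace[OF W(3)] W(2) x by auto
qed

lemma smooth_at_preimage:
  assumes "smooth_at M N f x" "openin (mtop N) V" "f x \<in> V"
  obtains W where "openin (mtop M) W" "x \<in> W" "f ` W \<subseteq> V" "continuous_map (subtopology (mtop M) W) (mtop N) f"
proof -
  obtain W where W: "openin (mtop M) W" "x \<in> W" "continuous_map (subtopology (mtop M) W) (mtop N) f"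
    using assms by (auto simp: smooth_at_def)
  let ?W = "{y \<in> topspace (subtopology (mtop M) W). f y \<in> V}"
  have "openin (mtop M) ?W"
    using openin_continuous_map_preimage[OF W(3) assms(2)] W(1) openin_trans_full by blast
  moreover have "x \<in> ?W" using smooth_at_pts[OF assms(1)] assms W by auto
  moreover have "continuous_map (subtopology (mtop M) ?W) (mtop N) f"
    by (rule continuous_map_from_subtopology_mono[OF W(3)]) auto
  ultimately show thesis by (intro that) auto
qed

lemma smooth_real_at_smooth_at:
  assumes M: "smooth_manifold M" and N: "smooth_manifold N"
    and u: "smooth_real_at N u (f x)" and f: "smooth_at M N f x"
  shows "smooth_real_at M (\<lambda>y. u (f y)) x"
proof -
  obtain k U \<phi> W where *: "(k, U, \<phi>) \<in> atlas N" "openin (mtop N) W" "f x \<in> W" "W \<subseteq> U"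
     "\<And>r. Cr_on r k (\<phi> ` W) (u \<circ> inv_into U \<phi>)"
    using u unfolding smooth_real_at_def by blast
  note ch = smooth_manifold_chart[OF N *(1)]
  obtain W' where W': "openin (mtop M) W'" "x \<in> W'" "f ` W' \<subseteq> W"
    by (rule smooth_at_preimage[OF f *(2,3)]) (rule that)
  have "smooth_real_at M (\<lambda>y. (u \<circ> inv_into U \<phi>) (\<phi> (f y))) x"
  proof (rule smooth_real_at_compose[where F="\<lambda>y. \<phi> (f y)" and f="u \<circ> inv_into U \<phi>", OF M _ W'(1,2)])
    show "smooth_real_at M (\<lambda>y. \<phi> (f y) j) x" if "j < k" for j
      using f * that by (auto simp: smooth_at_def)
    show "(\<lambda>y. \<phi> (f y)) ` W' \<subseteq> espace k" using W'(3) *(4) chart_espace[OF ch] by blast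
    show "openin (euc k) (\<phi> ` W)" by (rule chart_open_image[OF ch *(2,4)])
  qed (use * in auto)
  then show ?thesis
    by (rule smooth_real_at_cong[OF M _ W'(1,2)]) (use W'(3) *(4) in \<open>auto simp: chart_inv[OF ch] subset_iff\<close>)
qed

lemma smooth_at_compose:
  assumes M: "smooth_manifold M" and N: "smooth_manifold N"
    and f: "smooth_at M N f x" and g: "smooth_at N P g (f x)"
  shows "smooth_at M P (\<lambda>y. g (f y)) x"
proof -
  obtain V where V: "openin (mtop N) V" "f x \<in> V" "continuous_map (subtopology (mtop N) V) (mtop P) g"
    using g by (auto simp: smooth_at_def)
  obtain W where W: "openin (mtop M) W" "x \<in> W" "f ` W \<subseteq> V" "continuous_map (subtopology (mtop M) W) (mtop N) f"
    by (rule smooth_at_preimage[OF f V(1,2)]) (rule that)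
  show ?thesis
  proof (rule smooth_at_unfoldI[OF W(1,2)])
    have "continuous_map (subtopology (mtop M) W) (subtopology (mtop N) V) f"
      using W(3,4) by (auto simp: continuous_map_in_subtopology)
    then show "continuous_map (subtopology (mtop M) W) (mtop P) (\<lambda>y. g (f y))"
      using continuous_map_compose[OF _ V(3)] by (auto simp: o_def)
    fix l U \<psi> j assume "(l, U, \<psi>) \<in> atlas P" "g (f x) \<in> U" "j < l"
    then have "smooth_real_at N (\<lambda>y. \<psi> (g y) j) (f x)"
      using g by (auto simp: smooth_at_def)
    then show "smooth_real_at M (\<lambda>y. \<psi> (g (f y)) j) x"
      by (rule smooth_real_at_smooth_at[OF M N _ f])
  qed
qed

lemma smooth_at_cong:
  assumes M: "smooth_manifold M" and f: "smooth_at M N f x"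
    and W: "openin (mtop M) W" "x \<in> W" "\<And>y. y \<in> W \<Longrightarrow> f y = g y"
  shows "smooth_at M N g x"
proof -
  obtain V where V: "openin (mtop M) V" "x \<in> V" "continuous_map (subtopology (mtop M) V) (mtop N) f"
    using f by (auto simp: smooth_at_def)
  show ?thesis
  proof (rule smooth_at_unfoldI)
    show "openin (mtop M) (V \<inter> W)" "x \<in> V \<inter> W" using V W by auto
    show "continuous_map (subtopology (mtop M) (V \<inter> W)) (mtop N) g"
      by (rule continuous_map_eq[OF continuous_map_from_subtopology_mono[OF V(3)]]) (use W(3) in auto)
    fix l U \<psi> j assume "(l, U, \<psi>) \<in> atlas N" "g x \<in> U" "j < l"
    then have "smooth_real_at M (\<lambda>y. \<psi> (f y) j) x"
      using f W(2,3) by (auto simp: smooth_at_def)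
    then show "smooth_real_at M (\<lambda>y. \<psi> (g y) j) x"
      by (rule smooth_real_at_cong[OF M _ W(1,2)]) (simp add: W(3))
  qed
qed

lemma smooth_at_id:
  assumes "smooth_manifold M" "x \<in> pts M" shows "smooth_at M M (\<lambda>y. y) x"
  unfolding smooth_at_def using assms
  by (fastforce intro: exI[of _ "pts M"] smooth_real_at_coord dest: atlas_subset_maximal)

text \<open>All smoothness is verified pointwise with germs; this is the exchange with the global
  notion. Backwards, the local pieces of a chart representation are glued by
  \<open>Cr_on_local\<close>.\<close>

lemma smooth_map_iff_smooth_at:
  assumes M: "smooth_manifold M" and N: "smooth_manifold N"
  shows "smooth_map M N f \<longleftrightarrow> (\<forall>x\<in>pts M. smooth_at M N f x)"
proof
  assume f: "smooth_map M N f"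
  show "\<forall>x\<in>pts M. smooth_at M N f x"
  proof
    fix x assume x: "x \<in> pts M"
    have cont: "continuous_map (mtop M) (mtop N) f" using f by (simp add: smooth_map_def)
    show "smooth_at M N f x"
    proof (rule smooth_at_unfoldI[of _ "pts M"])
      show "continuous_map (subtopology (mtop M) (pts M)) (mtop N) f" using cont by simp
      fix l V \<psi> j assume c': "(l, V, \<psi>) \<in> atlas N" and j: "f x \<in> V" "j < l"
      show "smooth_real_at M (\<lambda>y. \<psi> (f y) j) x"
      proof -
        obtain k U \<phi> where U: "(k, U, \<phi>) \<in> atlas M" "x \<in> U"
          using smooth_manifold_chart_at[OF M x] by blast
        have c: "(k, U, \<phi>) \<in> maximal_atlas M" using U(1) M atlas_subset_maximal by blast
        have "openin (mtop M) (U \<inter> {y \<in> pts M. f y \<in> V})"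
          by (intro openin_Int chart_open[OF maximal_atlas_chart[OF c]] openin_continuous_map_preimage[OF cont]
               chart_open[OF smooth_manifold_chart[OF N c']])
        moreover have "U \<inter> {y \<in> pts M. f y \<in> V} = U \<inter> f -` V"
          using chart_subset[OF maximal_atlas_chart[OF c]] by auto
        ultimately have o: "openin (mtop M) (U \<inter> f -` V)" by simp
        show "smooth_real_at M (\<lambda>y. \<psi> (f y) j) x"
        proof (rule smooth_real_atI[OF M c o])
          have "smooth_on k (\<phi> ` (U \<inter> f -` V)) l (\<psi> \<circ> f \<circ> inv_into U \<phi>)"
            using f U(1) c' by (auto simp: smooth_map_def)
          then show "Cr_on r k (\<phi> ` (U \<inter> f -` V)) ((\<lambda>y. \<psi> (f y) j) \<circ> inv_into U \<phi>)" for r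
            using j by (auto simp: smooth_on_def o_def)
        qed (use U j in auto)
      qed
    qed (use x in auto)
  qed
next
  assume f: "\<forall>x\<in>pts M. smooth_at M N f x"
  have cont: "continuous_map (mtop M) (mtop N) f"
    by (rule continuous_map_local) (use f in \<open>auto simp: smooth_at_def\<close>)
  show "smooth_map M N f" unfolding smooth_map_def
  proof (intro conjI cont ballI, clarify)
    fix k U \<phi> l V \<psi> assume c: "(k, U, \<phi>) \<in> atlas M" and c': "(l, V, \<psi>) \<in> atlas N"
    note ch = smooth_manifold_chart[OF M c] and cm = subsetD[OF atlas_subset_maximal[OF M] c]
    have "openin (mtop M) (U \<inter> {y \<in> pts M. f y \<in> V})"
      by (intro openin_Int chart_open[OF ch] openin_continuous_map_preimage[OF cont]
           chart_open[OF smooth_manifold_chart[OF N c']])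
    moreover have "U \<inter> {y \<in> pts M. f y \<in> V} = U \<inter> f -` V"
      using chart_subset[OF ch] by auto
    ultimately have o: "openin (mtop M) (U \<inter> f -` V)" by simp
    show "smooth_on k (\<phi> ` (U \<inter> f -` V)) l (\<psi> \<circ> f \<circ> inv_into U \<phi>)"
      unfolding smooth_on_def
    proof (intro allI impI)
      fix j r assume j: "j < l"
      show "Cr_on r k (\<phi> ` (U \<inter> f -` V)) (\<lambda>x. (\<psi> \<circ> f \<circ> inv_into U \<phi>) x j)"
      proof (rule Cr_on_local)
        show "openin (euc k) (\<phi> ` (U \<inter> f -` V))" by (rule chart_open_image[OF ch o]) auto
        fix z assume "z \<in> \<phi> ` (U \<inter> f -` V)"
        then obtain x where x: "z = \<phi> x" "x \<in> U" "f x \<in> V" by auto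
        then have "smooth_real_at M (\<lambda>y. \<psi> (f y) j) x"
          using smooth_atD[OF bspec[OF f] c' _ j] chart_subset[OF ch] by blast
        then obtain W where W: "openin (mtop M) W" "x \<in> W" "W \<subseteq> U"
          "\<And>r. Cr_on r k (\<phi> ` W) ((\<lambda>y. \<psi> (f y) j) \<circ> inv_into U \<phi>)"
          using smooth_real_at_chart[OF M _ cm x(2)] by blast
        then show "\<exists>V. openin (euc k) V \<and> z \<in> V \<and> Cr_on r k V (\<lambda>x. (\<psi> \<circ> f \<circ> inv_into U \<phi>) x j)"
          using chart_open_image[OF ch W(1,3)] x(1) by (intro exI[of _ "\<phi> ` W"]) (auto simp: o_def)
      qed
    qed
  qed
qed

lemma smooth_map_at: "smooth_manifold M \<Longrightarrow> smooth_manifold N \<Longrightarrow> smooth_map M N f \<Longrightarrow> x \<in> pts M \<Longrightarrow> smooth_at M N f x"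
  using smooth_map_iff_smooth_at by blast

lemma smooth_at_chart_map:
  assumes "smooth_manifold M" "smooth_manifold N" "smooth_at M N f x"
    and "(l, V, \<psi>) \<in> maximal_atlas N" "f x \<in> V"
  shows "smooth_real_at M (\<lambda>y. \<psi> (f y) j) x"
  using smooth_real_at_smooth_at[OF assms(1,2) smooth_real_at_coord[OF assms(2,4,5)] assms(3)] .

text \<open>One chart at \<open>f x\<close> is enough, and it may come from the maximal atlas: the
  coordinates of any other chart are smooth functions of its coordinates.\<close>

lemma smooth_atI:
  assumes M: "smooth_manifold M" and N: "smooth_manifold N"
    and W: "openin (mtop M) W" "x \<in> W" "continuous_map (subtopology (mtop M) W) (mtop N) f"
    and c: "(l, V, \<psi>) \<in> maximal_atlas N" "f x \<in> V"
    and s: "\<And>j. j < l \<Longrightarrow> smooth_real_at M (\<lambda>y. \<psi> (f y) j) x"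
  shows "smooth_at M N f x"
proof (rule smooth_at_unfoldI[OF W])
  fix k U \<phi> j assume c': "(k, U, \<phi>) \<in> atlas N" and x: "f x \<in> U" "j < k"
  note ch = maximal_atlas_chart[OF c(1)] and cm = subsetD[OF atlas_subset_maximal[OF N] c']
  show "smooth_real_at M (\<lambda>y. \<phi> (f y) j) x"
  proof -
    obtain Z where Z: "openin (mtop N) Z" "f x \<in> Z" "Z \<subseteq> V" "\<And>r. Cr_on r l (\<psi> ` Z) ((\<lambda>y. \<phi> y j) \<circ> inv_into V \<psi>)"
      using smooth_real_at_chart[OF N smooth_real_at_coord[OF N cm x(1)] c] by blast
    let ?W = "{y \<in> topspace (subtopology (mtop M) W). f y \<in> Z}"
    have W': "openin (mtop M) ?W"
      using openin_continuous_map_preimage[OF W(3) Z(1)] W(1) openin_trans_full by blast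
    have x': "x \<in> ?W" using W Z openin_subset by fastforce
    have "smooth_real_at M (\<lambda>y. ((\<lambda>y. \<phi> y j) \<circ> inv_into V \<psi>) (\<psi> (f y))) x"
      by (rule smooth_real_at_compose[where F="\<lambda>y. \<psi> (f y)", OF M s W' x' _ chart_open_image[OF ch Z(1,3)] _ Z(4)])
         (use Z chart_espace[OF ch] in auto)
    then show "smooth_real_at M (\<lambda>y. \<phi> (f y) j) x"
      by (rule smooth_real_at_cong[OF M _ W' x']) (use Z(3) in \<open>auto simp: chart_inv[OF ch] subset_iff\<close>)
  qed
qed

section \<open>Topological sums of second countable spaces\<close>

text \<open>For manifolds this is equivalent to paracompactness, but unlike paracompactness it
  passes to subspaces and finite products without further argument. It also supplies the second
  countable pieces of the base over which homotopies are lifted.\<close>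

definition second_countable_sum :: "'a topology \<Rightarrow> bool" where
  "second_countable_sum X \<longleftrightarrow> (\<exists>\<P>. (\<forall>P\<in>\<P>. openin X P \<and> second_countable (subtopology X P)) \<and>
     pairwise disjnt \<P> \<and> \<Union>\<P> = topspace X)"

lemma second_countable_euclidean: "second_countable (euclidean :: 'a::second_countable_topology topology)"
proof -
  obtain B :: "'a set set" where B: "countable B" "topological_basis B"
    using ex_countable_basis by blast
  show ?thesis unfolding second_countable_def
  proof (intro exI[of _ B] conjI allI impI ballI)
    show "openin euclidean V" if "V \<in> B" for V using topological_basis_open[OF B(2) that] by simp
    fix U :: "'a set" and x assume "openin euclidean U \<and> x \<in> U"
    then show "\<exists>V\<in>B. x \<in> V \<and> V \<subseteq> U" using topological_basisE[OF B(2)] open_openin by metis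
  qed (rule B)
qed

lemma second_countable_Euclidean_space: "second_countable (euc k)"
  by (subst Euclidean_space_top_of_set) (rule second_countable_subtopology[OF second_countable_euclidean])

lemma second_countable_prod_topology:
  assumes "second_countable X" "second_countable Y"
  shows "second_countable (prod_topology X Y)"
proof -
  obtain B where B: "countable B" "\<And>V. V \<in> B \<Longrightarrow> openin X V" "\<And>U x. openin X U \<Longrightarrow> x \<in> U \<Longrightarrow> \<exists>V\<in>B. x \<in> V \<and> V \<subseteq> U"
    using assms(1) unfolding second_countable_def by metis
  obtain C where C: "countable C" "\<And>V. V \<in> C \<Longrightarrow> openin Y V" "\<And>U x. openin Y U \<Longrightarrow> x \<in> U \<Longrightarrow> \<exists>V\<in>C. x \<in> V \<and> V \<subseteq> U"
    using assms(2) unfolding second_countable_def by metis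
  show ?thesis unfolding second_countable_def
  proof (intro exI[of _ "(\<lambda>(b, c). b \<times> c) ` (B \<times> C)"] conjI allI impI ballI)
    show "countable ((\<lambda>(b, c). b \<times> c) ` (B \<times> C))" using B(1) C(1) by auto
    show "openin (prod_topology X Y) V" if "V \<in> (\<lambda>(b, c). b \<times> c) ` (B \<times> C)" for V
      using that B(2) C(2) by (auto simp: openin_prod_Times_iff)
    fix W z assume W: "openin (prod_topology X Y) W \<and> z \<in> W"
    obtain x y where z: "z = (x, y)" by force
    obtain U V where UV: "openin X U" "openin Y V" "x \<in> U" "y \<in> V" "U \<times> V \<subseteq> W"
      using W z unfolding openin_prod_topology_alt by blast
    obtain b c where "b \<in> B" "x \<in> b" "b \<subseteq> U" "c \<in> C" "y \<in> c" "c \<subseteq> V"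
      using B(3)[OF UV(1,3)] C(3)[OF UV(2,4)] by blast
    then show "\<exists>V\<in>(\<lambda>(b, c). b \<times> c) ` (B \<times> C). z \<in> V \<and> V \<subseteq> W"
      using UV(5) z by (intro bexI[of _ "b \<times> c"]) auto
  qed
qed

lemma second_countable_product_topology:
  assumes "finite I" "\<And>i. i \<in> I \<Longrightarrow> second_countable (X i)"
  shows "second_countable (product_topology X I)"
proof -
  have "\<exists>B. countable B \<and> (\<forall>V\<in>B. openin (X i) V) \<and> (\<forall>U x. openin (X i) U \<and> x \<in> U \<longrightarrow> (\<exists>V\<in>B. x \<in> V \<and> V \<subseteq> U))"
    if "i \<in> I" for i using assms(2)[OF that] by (simp add: second_countable_def)
  then obtain B where B: "\<And>i. i \<in> I \<Longrightarrow> countable (B i)" "\<And>i V. i \<in> I \<Longrightarrow> V \<in> B i \<Longrightarrow> openin (X i) V"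
     "\<And>i U x. i \<in> I \<Longrightarrow> openin (X i) U \<Longrightarrow> x \<in> U \<Longrightarrow> \<exists>V\<in>B i. x \<in> V \<and> V \<subseteq> U"
    by metis
  show ?thesis unfolding second_countable_def
  proof (intro exI[of _ "(\<lambda>b. Pi\<^sub>E I b) ` (Pi\<^sub>E I B)"] conjI allI impI ballI)
    show "countable ((\<lambda>b. Pi\<^sub>E I b) ` (Pi\<^sub>E I B))" using B(1) assms(1) by (intro countable_image countable_PiE) auto
    show "openin (product_topology X I) V" if "V \<in> (\<lambda>b. Pi\<^sub>E I b) ` (Pi\<^sub>E I B)" for V
      using that B(2) assms(1) by (auto simp: openin_PiE_gen PiE_iff)
    fix W z assume W: "openin (product_topology X I) W \<and> z \<in> W"
    then obtain U where U: "\<And>i. i \<in> I \<Longrightarrow> openin (X i) (U i)" "z \<in> Pi\<^sub>E I U" "Pi\<^sub>E I U \<subseteq> W"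
      unfolding openin_product_topology_alt by metis
    have "\<exists>V\<in>B i. z i \<in> V \<and> V \<subseteq> U i" if "i \<in> I" for i
      using B(3)[OF that U(1)[OF that]] U(2) that by (auto simp: PiE_iff)
    then obtain b where b: "\<And>i. i \<in> I \<Longrightarrow> b i \<in> B i \<and> z i \<in> b i \<and> b i \<subseteq> U i" by metis
    show "\<exists>V\<in>(\<lambda>b. Pi\<^sub>E I b) ` (Pi\<^sub>E I B). z \<in> V \<and> V \<subseteq> W"
    proof (intro bexI conjI)
      have eq: "Pi\<^sub>E I b = Pi\<^sub>E I (restrict b I)" by (intro PiE_cong) auto
      show "Pi\<^sub>E I b \<in> (\<lambda>b. Pi\<^sub>E I b) ` (Pi\<^sub>E I B)"
        unfolding eq by (rule imageI) (use b in auto)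
      show "z \<in> Pi\<^sub>E I b" using b U(2) by (auto simp: PiE_iff)
      have "Pi\<^sub>E I b \<subseteq> Pi\<^sub>E I U" using b by (intro PiE_mono) auto
      then show "Pi\<^sub>E I b \<subseteq> W" using U(3) by blast
    qed
  qed
qed

lemma second_countable_open_Union:
  assumes "countable \<C>" "\<And>C. C \<in> \<C> \<Longrightarrow> openin X C \<and> second_countable (subtopology X C)"
  shows "second_countable (subtopology X (\<Union>\<C>))"
proof -
  have "\<exists>B. countable B \<and> (\<forall>V\<in>B. openin (subtopology X C) V) \<and> (\<forall>U x. openin (subtopology X C) U \<and> x \<in> U \<longrightarrow> (\<exists>V\<in>B. x \<in> V \<and> V \<subseteq> U))"
    if "C \<in> \<C>" for C using assms(2)[OF that] by (simp add: second_countable_def)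
  then obtain B where B: "\<And>C. C \<in> \<C> \<Longrightarrow> countable (B C)" "\<And>C V. C \<in> \<C> \<Longrightarrow> V \<in> B C \<Longrightarrow> openin (subtopology X C) V"
     "\<And>C U x. C \<in> \<C> \<Longrightarrow> openin (subtopology X C) U \<Longrightarrow> x \<in> U \<Longrightarrow> \<exists>V\<in>B C. x \<in> V \<and> V \<subseteq> U"
    by metis
  have o: "openin X (\<Union>\<C>)" using assms(2) by blast
  show ?thesis unfolding second_countable_def
  proof (intro exI[of _ "\<Union>(B ` \<C>)"] conjI allI impI ballI)
    show "countable (\<Union>(B ` \<C>))" using B(1) assms(1) by blast
    show "openin (subtopology X (\<Union>\<C>)) V" if VB: "V \<in> \<Union>(B ` \<C>)" for V
    proof -
      obtain C where C: "C \<in> \<C>" "V \<in> B C" using VB by auto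
      have "openin X V" using openin_trans_full[OF B(2)[OF C]] assms(2)[OF C(1)] by blast
      moreover have "V \<subseteq> C" using openin_imp_subset[OF B(2)[OF C]] .
      ultimately have "openin X V" "V \<subseteq> C" by auto
      then show ?thesis using C(1) openin_open_subtopology[OF o] by blast
    qed
    fix U x assume U: "openin (subtopology X (\<Union>\<C>)) U \<and> x \<in> U"
    then have "openin X U" "U \<subseteq> \<Union>\<C>" using openin_open_subtopology[OF o] by auto
    then obtain C where C: "C \<in> \<C>" "x \<in> C" using U by blast
    have "openin (subtopology X C) (U \<inter> C)"
      using \<open>openin X U\<close> by (auto simp: openin_subtopology)
    then obtain V where "V \<in> B C" "x \<in> V" "V \<subseteq> U \<inter> C" using B(3)[OF C(1)] U C by blast
    then show "\<exists>V\<in>\<Union>(B ` \<C>). x \<in> V \<and> V \<subseteq> U" using C(1) by blast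
  qed
qed

lemma second_countable_sum_subtopology:
  assumes "second_countable_sum X" shows "second_countable_sum (subtopology X S)"
proof -
  obtain \<P> where P: "\<And>P. P \<in> \<P> \<Longrightarrow> openin X P \<and> second_countable (subtopology X P)" "pairwise disjnt \<P>" "\<Union>\<P> = topspace X"
    using assms by (auto simp: second_countable_sum_def)
  show ?thesis unfolding second_countable_sum_def
  proof (intro exI[of _ "(\<lambda>P. P \<inter> S) ` \<P>"] conjI ballI)
    fix Q assume "Q \<in> (\<lambda>P. P \<inter> S) ` \<P>"
    then obtain P' where Q: "P' \<in> \<P>" "Q = P' \<inter> S" by blast
    then show "openin (subtopology X S) Q" using P(1) by (auto simp: openin_subtopology)
    have "subtopology (subtopology X S) Q = subtopology (subtopology X P') S"
      using Q(2) by (simp add: subtopology_subtopology Int_ac)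
    then show "second_countable (subtopology (subtopology X S) Q)"
      using P(1)[OF Q(1)] by (simp add: second_countable_subtopology)
  qed (use P(2,3) in \<open>auto simp: pairwise_def disjnt_def\<close>)
qed

lemma second_countable_sum_prod:
  assumes "second_countable_sum X" "second_countable_sum Y" shows "second_countable_sum (prod_topology X Y)"
proof -
  obtain \<P> where P: "\<And>P. P \<in> \<P> \<Longrightarrow> openin X P \<and> second_countable (subtopology X P)" "pairwise disjnt \<P>" "\<Union>\<P> = topspace X"
    using assms by (auto simp: second_countable_sum_def)
  obtain \<Q> where Q: "\<And>P. P \<in> \<Q> \<Longrightarrow> openin Y P \<and> second_countable (subtopology Y P)" "pairwise disjnt \<Q>" "\<Union>\<Q> = topspace Y"
    using assms by (auto simp: second_countable_sum_def)
  show ?thesis unfolding second_countable_sum_def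
  proof (intro exI[of _ "(\<lambda>(p, q). p \<times> q) ` (\<P> \<times> \<Q>)"] conjI ballI)
    fix R assume "R \<in> (\<lambda>(p, q). p \<times> q) ` (\<P> \<times> \<Q>)"
    then obtain p q where R: "p \<in> \<P>" "q \<in> \<Q>" "R = p \<times> q" by blast
    then show "openin (prod_topology X Y) R" using P(1) Q(1) by (simp add: openin_prod_Times_iff)
    show "second_countable (subtopology (prod_topology X Y) R)"
      unfolding R(3) subtopology_Times using P(1)[OF R(1)] Q(1)[OF R(2)] by (simp add: second_countable_prod_topology)
  next
    show "pairwise disjnt ((\<lambda>(p, q). p \<times> q) ` (\<P> \<times> \<Q>))"
    proof (rule pairwiseI)
      fix R R' assume "R \<in> (\<lambda>(p, q). p \<times> q) ` (\<P> \<times> \<Q>)" "R' \<in> (\<lambda>(p, q). p \<times> q) ` (\<P> \<times> \<Q>)" "R \<noteq> R'"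
      then obtain p q p' q' where *: "p \<in> \<P>" "q \<in> \<Q>" "R = p \<times> q" "p' \<in> \<P>" "q' \<in> \<Q>" "R' = p' \<times> q'" by blast
      then have "p \<noteq> p' \<or> q \<noteq> q'" using \<open>R \<noteq> R'\<close> by blast
      then have "disjnt p p' \<or> disjnt q q'" using P(2) Q(2) * by (metis pairwiseD)
      then show "disjnt R R'" unfolding *(3,6) by (auto simp: disjnt_def)
    qed
    show "\<Union> ((\<lambda>(p, q). p \<times> q) ` (\<P> \<times> \<Q>)) = topspace (prod_topology X Y)"
      unfolding topspace_prod_topology P(3)[symmetric] Q(3)[symmetric] by auto
  qed
qed

lemma second_countable_sum_product:
  assumes "finite I" "\<And>i. i \<in> I \<Longrightarrow> second_countable_sum (X i)" shows "second_countable_sum (product_topology X I)"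
proof -
  obtain \<P> where P: "\<And>i P. i \<in> I \<Longrightarrow> P \<in> \<P> i \<Longrightarrow> openin (X i) P \<and> second_countable (subtopology (X i) P)"
      "\<And>i. i \<in> I \<Longrightarrow> pairwise disjnt (\<P> i)" "\<And>i. i \<in> I \<Longrightarrow> \<Union>(\<P> i) = topspace (X i)"
    using assms(2) unfolding second_countable_sum_def by metis
  show ?thesis unfolding second_countable_sum_def
  proof (intro exI[of _ "Pi\<^sub>E I ` Pi\<^sub>E I \<P>"] conjI ballI)
    fix R assume "R \<in> Pi\<^sub>E I ` Pi\<^sub>E I \<P>"
    then obtain p where p: "\<And>i. i \<in> I \<Longrightarrow> p i \<in> \<P> i" "R = Pi\<^sub>E I p" by (auto simp: PiE_iff)
    then show "openin (product_topology X I) R" using P(1) assms(1) by (auto simp: openin_PiE_gen)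
    show "second_countable (subtopology (product_topology X I) R)"
      unfolding p(2) subtopology_product_topology using P(1) p(1) assms(1) by (intro second_countable_product_topology) auto
  next
    show "pairwise disjnt (Pi\<^sub>E I ` Pi\<^sub>E I \<P>)"
    proof (rule pairwiseI)
      fix R R' assume "R \<in> Pi\<^sub>E I ` Pi\<^sub>E I \<P>" "R' \<in> Pi\<^sub>E I ` Pi\<^sub>E I \<P>" "R \<noteq> R'"
      then obtain p q where *: "p \<in> Pi\<^sub>E I \<P>" "q \<in> Pi\<^sub>E I \<P>" "R = Pi\<^sub>E I p" "R' = Pi\<^sub>E I q" by blast
      then obtain i where i: "i \<in> I" "p i \<noteq> q i" using \<open>R \<noteq> R'\<close> PiE_ext by metis
      then have "disjnt (p i) (q i)" using P(2)[OF i(1)] *(1,2) by (auto simp: pairwise_def PiE_iff)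
      then show "disjnt R R'" unfolding *(3,4) disjnt_def using i(1) by (auto simp: PiE_iff disjoint_iff)
    qed
    show "\<Union> (Pi\<^sub>E I ` Pi\<^sub>E I \<P>) = topspace (product_topology X I)"
    proof (intro equalityI subsetI)
      fix x assume "x \<in> \<Union> (Pi\<^sub>E I ` Pi\<^sub>E I \<P>)"
      then show "x \<in> topspace (product_topology X I)"
        using P(3) by (fastforce simp: PiE_iff)
    next
      fix x assume x: "x \<in> topspace (product_topology X I)"
      then have "\<forall>i\<in>I. \<exists>p\<in>\<P> i. x i \<in> p" using P(3) by (fastforce simp: PiE_iff)
      then obtain p where p: "\<And>i. i \<in> I \<Longrightarrow> p i \<in> \<P> i \<and> x i \<in> p i" by metis
      then have "x \<in> Pi\<^sub>E I (restrict p I)" "restrict p I \<in> Pi\<^sub>E I \<P>" using x by (auto simp: PiE_iff)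
      then show "x \<in> \<Union> (Pi\<^sub>E I ` Pi\<^sub>E I \<P>)" by blast
    qed
  qed
qed

lemma second_countable_sum_homeomorphic:
  assumes "homeomorphic_map X Y f" "second_countable_sum X" shows "second_countable_sum Y"
proof -
  obtain \<P> where P: "\<And>P. P \<in> \<P> \<Longrightarrow> openin X P \<and> second_countable (subtopology X P)" "pairwise disjnt \<P>" "\<Union>\<P> = topspace X"
    using assms(2) by (auto simp: second_countable_sum_def)
  have inj: "inj_on f (topspace X)" and im: "f ` topspace X = topspace Y"
    using homeomorphic_imp_injective_map[OF assms(1)] homeomorphic_imp_surjective_map[OF assms(1)] by auto
  show ?thesis unfolding second_countable_sum_def
  proof (intro exI[of _ "(`) f ` \<P>"] conjI ballI)
    fix Q assume "Q \<in> (`) f ` \<P>"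
    then obtain p where p: "p \<in> \<P>" "Q = f ` p" by blast
    have sub: "p \<subseteq> topspace X" using P(3) p(1) by blast
    show "openin Y Q" using P(1)[OF p(1)] p(2) homeomorphic_imp_open_map[OF assms(1)] by (auto simp: open_map_def)
    have "homeomorphic_map (subtopology X p) (subtopology Y Q) f"
      by (rule homeomorphic_map_subtopologies[OF assms(1)]) (use sub p(2) im in auto)
    then show "second_countable (subtopology Y Q)"
      using P(1)[OF p(1)] homeomorphic_space_second_countability homeomorphic_space by blast
  next
    show "pairwise disjnt ((`) f ` \<P>)"
    proof (rule pairwiseI)
      fix R R' assume "R \<in> (`) f ` \<P>" "R' \<in> (`) f ` \<P>" "R \<noteq> R'"
      then obtain p q where *: "p \<in> \<P>" "q \<in> \<P>" "R = f ` p" "R' = f ` q" "p \<noteq> q" by blast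
      then have "disjnt p q" "p \<subseteq> topspace X" "q \<subseteq> topspace X" using P(2,3) by (auto simp: pairwise_def)
      then have "f ` p \<inter> f ` q = {}" using inj_on_image_Int[OF inj, of p q] by (simp add: disjnt_def)
      then show "disjnt R R'" by (simp add: *(3,4) disjnt_def)
    qed
    show "\<Union> ((`) f ` \<P>) = topspace Y" unfolding im[symmetric] P(3)[symmetric] by auto
  qed
qed

text \<open>In each piece choose countably many open \<open>D\<close> that cover it, each inside a
  closed \<open>K\<close> inside a member of the given cover. Removing the earlier sets
  \<open>K\<close> from the \<open>n\<close>-th member leaves a refinement of which each
  \<open>D\<close> meets only finitely many sets. Regularity provides the closed sets.\<close>

lemma paracompact_second_countable_sum:
  assumes X: "second_countable_sum X" and reg: "regular_space X"
  shows "paracompact_space X"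
  unfolding paracompact_space_def
proof (intro allI impI, elim conjE)
  fix \<U> assume \<U>: "\<forall>U\<in>\<U>. openin X U" "\<Union>\<U> = topspace X"
  obtain \<P> where P: "\<And>P. P \<in> \<P> \<Longrightarrow> openin X P \<and> second_countable (subtopology X P)" "pairwise disjnt \<P>" "\<Union>\<P> = topspace X"
    using X by (auto simp: second_countable_sum_def)
  have "\<exists>D K U. openin X D \<and> closedin X K \<and> U \<in> \<U> \<and> x \<in> D \<and> D \<subseteq> K \<and> K \<subseteq> U \<inter> p" if px: "p \<in> \<P>" "x \<in> p" for p x
  proof -
    obtain U where U: "U \<in> \<U>" "x \<in> U" using \<U>(2) P(3) px by blast
    then have o: "openin X (U \<inter> p)" using \<U>(1) P(1) px by blast
    have "\<exists>D K. openin X D \<and> closedin X K \<and> x \<in> D \<and> D \<subseteq> K \<and> K \<subseteq> U \<inter> p"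
      using reg[folded neighbourhood_base_of_closedin] o U(2) px(2) unfolding neighbourhood_base_of by blast
    then show ?thesis using U(1) by blast
  qed
  then obtain D K U where DK: "\<And>p x. p \<in> \<P> \<Longrightarrow> x \<in> p \<Longrightarrow> openin X (D p x) \<and> closedin X (K p x) \<and> U p x \<in> \<U> \<and> x \<in> D p x \<and> D p x \<subseteq> K p x \<and> K p x \<subseteq> U p x \<inter> p"
    by metis
  have "\<exists>c :: nat \<Rightarrow> 'a. range c \<subseteq> p \<and> (\<Union>n. D p (c n)) = p" if p: "p \<in> \<P>" "p \<noteq> {}" for p
  proof -
    have "Lindelof_space (subtopology X p)" using P(1)[OF p(1)] second_countable_imp_Lindelof_space by blast
    moreover have "openin (subtopology X p) (D p x)" if "x \<in> p" for x
      using DK[OF p(1) that] P(1)[OF p(1)] by (auto simp: openin_open_subtopology)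
    moreover have tp: "topspace (subtopology X p) = p" using P(3) p(1) by auto
    moreover have "\<Union>(D p ` p) = p" using DK[OF p(1)] by blast
    ultimately obtain \<V> where V: "countable \<V>" "\<V> \<subseteq> D p ` p" "\<Union>\<V> = p"
      using Lindelof_spaceD[of "subtopology X p" "D p ` p"] by (auto simp del: topspace_subtopology)
    obtain C where C: "countable C" "C \<subseteq> p" "\<V> = D p ` C" using countable_subset_image[THEN iffD1] V(1,2) by metis
    have "C \<noteq> {}" using V(3) C(3) p(2) by auto
    then have "range (from_nat_into C) = C" using C(1) by (simp add: range_from_nat_into)
    then show ?thesis using C V(3) by (intro exI[of _ "from_nat_into C"]) (metis image_image)
  qed
  then obtain c :: "'a set \<Rightarrow> nat \<Rightarrow> 'a" where c: "\<And>p. p \<in> \<P> \<Longrightarrow> p \<noteq> {} \<Longrightarrow> range (c p) \<subseteq> p \<and> (\<Union>n. D p (c p n)) = p"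
    by metis
  \<comment> \<open>A piece is enumerated by a sequence of its points, which the empty piece does
    not have.\<close>
  define \<P>' where "\<P>' = \<P> - {{}}"
  \<comment> \<open>A point lies in the set belonging to the first \<open>K\<close> that contains
    it, so these sets still cover.\<close>
  define W where "W p n = U p (c p n) \<inter> p - (\<Union>m<n. K p (c p m))" for p n
  have cp: "c p n \<in> p" if "p \<in> \<P>'" for p n using c that by (auto simp: \<P>'_def)
  have DK': "openin X (D p (c p n))" "closedin X (K p (c p n))" "U p (c p n) \<in> \<U>" "D p (c p n) \<subseteq> K p (c p n)" "K p (c p n) \<subseteq> U p (c p n) \<inter> p"
    if "p \<in> \<P>'" for p n
    using DK[of p "c p n"] cp[OF that] that by (auto simp: \<P>'_def)
  have cov: "\<exists>n. y \<in> D p (c p n)" if "p \<in> \<P>'" "y \<in> p" for p y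
    using c[of p] that by (auto simp: \<P>'_def)
  show "\<exists>\<V>. (\<forall>V\<in>\<V>. openin X V \<and> (\<exists>U\<in>\<U>. V \<subseteq> U)) \<and> \<Union>\<V> = topspace X \<and> locally_finite_in X \<V>"
  proof (intro exI[of _ "\<Union>p\<in>\<P>'. range (W p)"] conjI ballI)
    fix V assume "V \<in> (\<Union>p\<in>\<P>'. range (W p))"
    then obtain p n where V: "p \<in> \<P>'" "V = W p n" by blast
    show "openin X V" unfolding V W_def
      using DK'[OF V(1)] \<U>(1) P(1) V(1) by (intro openin_diff openin_Int closedin_Union) (auto simp: \<P>'_def)
    show "\<exists>U\<in>\<U>. V \<subseteq> U" using DK'(3)[OF V(1)] unfolding V W_def by blast
  next
    show *: "\<Union>(\<Union>p\<in>\<P>'. range (W p)) = topspace X"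
    proof (intro equalityI subsetI)
      fix y assume "y \<in> \<Union>(\<Union>p\<in>\<P>'. range (W p))"
      then show "y \<in> topspace X" using P(3) by (auto simp: W_def \<P>'_def)
    next
      fix y assume "y \<in> topspace X"
      then obtain p where p: "p \<in> \<P>'" "y \<in> p" using P(3) by (auto simp: \<P>'_def)
      define n where "n = (LEAST n. y \<in> K p (c p n))"
      have "\<exists>n. y \<in> K p (c p n)" using cov[OF p] DK'(4)[OF p(1)] by blast
      then have "y \<in> K p (c p n)" unfolding n_def by (rule LeastI_ex)
      moreover have "y \<notin> K p (c p m)" if "m < n" for m using that not_less_Least unfolding n_def by blast
      ultimately have "y \<in> W p n" using DK'(5)[OF p(1), of n] by (auto simp: W_def)
      then show "y \<in> \<Union>(\<Union>p\<in>\<P>'. range (W p))" using p(1) by blast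
    qed
    show "locally_finite_in X (\<Union>p\<in>\<P>'. range (W p))"
      unfolding locally_finite_in_def *
    proof (intro conjI ballI subset_refl)
      fix y assume "y \<in> topspace X"
      then obtain p where p: "p \<in> \<P>'" "y \<in> p" using P(3) by (auto simp: \<P>'_def)
      \<comment> \<open>The set \<open>D p (c p m)\<close> lies in a \<open>K\<close> that has been
        removed from all later sets of its piece, and it is disjoint from the other pieces.\<close>
      obtain m where m: "y \<in> D p (c p m)" using cov[OF p] by blast
      have "{V \<in> \<Union>p\<in>\<P>'. range (W p). V \<inter> D p (c p m) \<noteq> {}} \<subseteq> W p ` {..m}"
      proof
        fix V assume V: "V \<in> {V \<in> \<Union>p\<in>\<P>'. range (W p). V \<inter> D p (c p m) \<noteq> {}}"
        then obtain q n z where q: "q \<in> \<P>'" "V = W q n" "z \<in> W q n" "z \<in> D p (c p m)" by blast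
        then have "z \<in> p" "z \<in> q" "z \<in> K p (c p m)" using DK'(4,5)[OF p(1), of m] by (auto simp: W_def)
        then have "p = q" using P(2) p(1) q(1) by (auto simp: pairwise_def disjnt_def \<P>'_def)
        then have "\<not> m < n" using q(3) \<open>z \<in> K p (c p m)\<close> by (auto simp: W_def)
        then show "V \<in> W p ` {..m}" using q(2) \<open>p = q\<close> by auto
      qed
      then have "finite {V \<in> \<Union>p\<in>\<P>'. range (W p). V \<inter> D p (c p m) \<noteq> {}}"
        by (rule finite_subset) simp
      then show "\<exists>V. openin X V \<and> y \<in> V \<and> finite {U \<in> \<Union>p\<in>\<P>'. range (W p). U \<inter> V \<noteq> {}}"
        using m DK'(1)[OF p(1)] by blast
    qed
  qed
qed

text \<open>Take a locally finite refinement by sets with compact hulls. Each of its members meets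
  only finitely many others, so chains of members in which neighbours meet lead from one member to
  countably many. The unions of these chain classes are the pieces.\<close>

lemma second_countable_sum_paracompact:
  assumes X: "paracompact_space X"
    and loc: "\<And>x. x \<in> topspace X \<Longrightarrow> \<exists>V K. openin X V \<and> x \<in> V \<and> V \<subseteq> K \<and> compactin X K \<and> second_countable (subtopology X V)"
  shows "second_countable_sum X"
proof -
  define \<U> where "\<U> = {V. openin X V \<and> second_countable (subtopology X V) \<and> (\<exists>K. V \<subseteq> K \<and> compactin X K)}"
  have o: "\<forall>U\<in>\<U>. openin X U" by (simp add: \<U>_def)
  have "\<exists>U\<in>\<U>. x \<in> U" if "x \<in> topspace X" for x
    using loc[OF that] unfolding \<U>_def by blast
  then have "\<Union>\<U> = topspace X"
    using openin_subset[OF bspec[OF o]] by blast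
  with o have "(\<forall>U\<in>\<U>. openin X U) \<and> \<Union>\<U> = topspace X" ..
  then obtain \<V> where \<V>: "\<And>V. V \<in> \<V> \<Longrightarrow> openin X V" "\<And>V. V \<in> \<V> \<Longrightarrow> \<exists>U\<in>\<U>. V \<subseteq> U" "\<Union>\<V> = topspace X" "locally_finite_in X \<V>"
    using X unfolding paracompact_space_def by metis
  have sc: "second_countable (subtopology X V)" if V: "V \<in> \<V>" for V
  proof -
    obtain U where U: "U \<in> \<U>" "V \<subseteq> U" using \<V>(2)[OF V] by blast
    have "subtopology X V = subtopology (subtopology X U) V"
      using U(2) by (simp add: subtopology_subtopology inf_absorb2)
    then show ?thesis using U(1) by (simp add: \<U>_def second_countable_subtopology)
  qed
  \<comment> \<open>Finitely many neighbourhoods, each meeting finitely many members, cover the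
    compact hull.\<close>
  have fin: "finite {V' \<in> \<V>. V' \<inter> V \<noteq> {}}" if V: "V \<in> \<V>" for V
  proof -
    obtain K where K: "V \<subseteq> K" "compactin X K" using \<V>(2)[OF V] by (auto simp: \<U>_def)
    have "\<forall>x\<in>K. \<exists>N. openin X N \<and> x \<in> N \<and> finite {U \<in> \<V>. U \<inter> N \<noteq> {}}"
      using \<V>(4) compactin_subset_topspace[OF K(2)] unfolding locally_finite_in_def by blast
    from bchoice[OF this] obtain N where N: "\<And>x. x \<in> K \<Longrightarrow> openin X (N x) \<and> x \<in> N x \<and> finite {U \<in> \<V>. U \<inter> N x \<noteq> {}}" by blast
    then obtain \<F> where F: "finite \<F>" "\<F> \<subseteq> N ` K" "K \<subseteq> \<Union>\<F>"
      using compactinD[OF K(2), of "N ` K"] by blast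
    have "{V' \<in> \<V>. V' \<inter> V \<noteq> {}} \<subseteq> (\<Union>N\<in>\<F>. {U \<in> \<V>. U \<inter> N \<noteq> {}})"
      using F(3) K(1) by blast
    moreover have "finite (\<Union>N\<in>\<F>. {U \<in> \<V>. U \<inter> N \<noteq> {}})" using F(1,2) N by blast
    ultimately show ?thesis by (rule finite_subset)
  qed
  \<comment> \<open>Its reflexive transitive closure is an equivalence on the members, and unions of
    different classes are disjoint because two members with a common point are related.\<close>
  define R where "R = {(V, V'). V \<in> \<V> \<and> V' \<in> \<V> \<and> V' \<inter> V \<noteq> {}}"
  have Rsym: "sym (R\<^sup>*)" by (rule sym_rtrancl) (auto simp: R_def sym_def)
  have RV: "V' \<in> \<V>" if "(V, V') \<in> R\<^sup>*" "V \<in> \<V>" for V V'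
    using that by (induction rule: rtrancl_induct) (auto simp: R_def)
  have count: "countable (R\<^sup>* `` {V})" if V: "V \<in> \<V>" for V
  proof -
    have "finite ((R ^^ n) `` {V})" for n
    proof (induction n)
      case (Suc n)
      have "(R ^^ Suc n) `` {V} \<subseteq> (\<Union>V'\<in>(R ^^ n) `` {V} \<inter> \<V>. {U \<in> \<V>. U \<inter> V' \<noteq> {}})"
        by (auto simp: R_def)
      moreover have "finite (\<Union>V'\<in>(R ^^ n) `` {V} \<inter> \<V>. {U \<in> \<V>. U \<inter> V' \<noteq> {}})"
        using Suc fin by auto
      ultimately show ?case by (rule finite_subset)
    qed auto
    moreover have "R\<^sup>* `` {V} = (\<Union>n. (R ^^ n) `` {V})" by (auto simp: rtrancl_is_UN_relpow)
    ultimately show ?thesis by (auto intro: countable_finite)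
  qed
  define P where "P V = \<Union>(R\<^sup>* `` {V})" for V
  show ?thesis unfolding second_countable_sum_def
  proof (intro exI[of _ "P ` \<V>"] conjI ballI)
    fix p assume "p \<in> P ` \<V>"
    then obtain V where V: "V \<in> \<V>" "p = P V" by blast
    show "openin X p" unfolding V P_def using \<V>(1) RV[OF _ V(1)] by (intro openin_Union) auto
    show "second_countable (subtopology X p)" unfolding V P_def
      using count[OF V(1)] \<V>(1) sc RV[OF _ V(1)] by (intro second_countable_open_Union) auto
  next
    show "pairwise disjnt (P ` \<V>)"
    proof (rule pairwiseI)
      fix p q assume "p \<in> P ` \<V>" "q \<in> P ` \<V>" "p \<noteq> q"
      then obtain V W where VW: "V \<in> \<V>" "W \<in> \<V>" "p = P V" "q = P W" "P V \<noteq> P W" by blast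
      show "disjnt p q"
      proof (rule ccontr)
        assume "\<not> disjnt p q"
        then obtain x V' W' where *: "(V, V') \<in> R\<^sup>*" "(W, W') \<in> R\<^sup>*" "x \<in> V'" "x \<in> W'"
          unfolding VW P_def disjnt_def by blast
        then have "(V', W') \<in> R" using RV[OF *(1) VW(1)] RV[OF *(2) VW(2)] by (auto simp: R_def)
        then have "(V, W) \<in> R\<^sup>*" using * symD[OF Rsym] by (meson rtrancl.rtrancl_into_rtrancl rtrancl_trans)
        then have "R\<^sup>* `` {V} = R\<^sup>* `` {W}" using symD[OF Rsym] by (auto intro: rtrancl_trans)
        then show False using VW(5) by (simp add: P_def)
      qed
    qed
    show "\<Union>(P ` \<V>) = topspace X"
    proof (intro equalityI subsetI)
      fix x assume "x \<in> topspace X"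
      then obtain V where "V \<in> \<V>" "x \<in> V" using \<V>(3) by blast
      then show "x \<in> \<Union>(P ` \<V>)" by (auto simp: P_def)
    next
      fix x assume "x \<in> \<Union>(P ` \<V>)"
      then show "x \<in> topspace X" using RV \<V>(3) by (auto simp: P_def)
    qed
  qed
qed

text \<open>The compact set stays inside the chart domain. This is used once for the decomposition
  into pieces and once for the compact core of a push.\<close>

lemma chart_locally_compact:
  assumes c: "is_chart X (k, U, \<phi>)" and x: "x \<in> U"
  shows "\<exists>V K. openin X V \<and> x \<in> V \<and> V \<subseteq> K \<and> K \<subseteq> U \<and> compactin X K \<and> second_countable (subtopology X V)"
proof -
  have "locally_compact_space (euc k)" by (rule locally_compact_Euclidean_space)
  then have "locally_compact_space (euc_on k (\<phi> ` U))"
    using chart_image_open[OF c] locally_compact_space_open_subset Hausdorff_Euclidean_space by blast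
  moreover have hs: "subtopology X U homeomorphic_space euc_on k (\<phi> ` U)"
    using chart_homeo[OF c] homeomorphic_map_imp_homeomorphic_space by blast
  ultimately have "locally_compact_space (subtopology X U)"
    using homeomorphic_locally_compact_space by blast
  then obtain V K where VK: "openin (subtopology X U) V" "compactin (subtopology X U) K" "x \<in> V" "V \<subseteq> K"
    unfolding locally_compact_space_def topspace_chart[OF c] using x by blast
  have V: "openin X V" "V \<subseteq> U" using VK(1) openin_open_subtopology[OF chart_open[OF c]] by auto
  have "second_countable (subtopology X U)"
    using hs homeomorphic_space_second_countability second_countable_subtopology second_countable_Euclidean_space by blast
  then have "second_countable (subtopology (subtopology X U) V)" by (rule second_countable_subtopology)
  then have "second_countable (subtopology X V)" using V(2) by (simp add: subtopology_subtopology inf_absorb2)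
  then show ?thesis using V VK by (auto simp: compactin_subtopology)
qed

lemma regular_space_charts:
  assumes "Hausdorff_space X" "\<And>x. x \<in> topspace X \<Longrightarrow> \<exists>k U \<phi>. is_chart X (k, U, \<phi>) \<and> x \<in> U"
  shows "locally_compact_space X" "regular_space X"
proof -
  show "locally_compact_space X" unfolding locally_compact_space_def
    using assms(2) chart_locally_compact by metis
  then show "regular_space X" using assms(1) locally_compact_Hausdorff_imp_regular_space by blast
qed

lemma smooth_manifold_second_countable_sum:
  assumes M: "smooth_manifold M" shows "second_countable_sum (mtop M)"
proof (rule second_countable_sum_paracompact)
  show "paracompact_space (mtop M)" using M by (simp add: smooth_manifold_def)
  fix x assume "x \<in> pts M"
  then obtain k U \<phi> where "(k, U, \<phi>) \<in> atlas M" "x \<in> U" using smooth_manifold_chart_at[OF M] by blast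
  then show "\<exists>V K. openin (mtop M) V \<and> x \<in> V \<and> V \<subseteq> K \<and> compactin (mtop M) K \<and> second_countable (subtopology (mtop M) V)"
    using chart_locally_compact[OF smooth_manifold_chart[OF M]] by meson
qed

lemma smooth_manifold_topology:
  assumes M: "smooth_manifold M"
  shows "Hausdorff_space (mtop M)" "locally_compact_space (mtop M)" "regular_space (mtop M)"
proof -
  show "Hausdorff_space (mtop M)" using M by (simp add: smooth_manifold_def)
  moreover have "\<exists>k U \<phi>. is_chart (mtop M) (k, U, \<phi>) \<and> x \<in> U" if "x \<in> pts M" for x
    using smooth_manifold_chart_at[OF M that] smooth_manifold_chart[OF M] by metis
  ultimately show "locally_compact_space (mtop M)" "regular_space (mtop M)"
    using regular_space_charts(1)[of "mtop M"] regular_space_charts(2)[of "mtop M"] by auto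
qed

text \<open>Paracompactness is recovered from the sum decomposition; the regularity this needs comes
  from the charts through local compactness. Transitions are required in one direction only, since
  both charts range over the atlas.\<close>

lemma smooth_manifoldI:
  assumes "Hausdorff_space (mtop M)" "second_countable_sum (mtop M)"
    and ch: "\<And>k U \<phi>. (k, U, \<phi>) \<in> atlas M \<Longrightarrow> is_chart (mtop M) (k, U, \<phi>)"
    and cov: "\<And>x. x \<in> pts M \<Longrightarrow> \<exists>k U \<phi>. (k, U, \<phi>) \<in> atlas M \<and> x \<in> U"
    and "\<And>k U \<phi> l V \<psi>. (k, U, \<phi>) \<in> atlas M \<Longrightarrow> (l, V, \<psi>) \<in> atlas M \<Longrightarrow> smooth_on k (\<phi> ` (U \<inter> V)) l (\<psi> \<circ> inv_into U \<phi>)"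
  shows "smooth_manifold M"
  unfolding smooth_manifold_def
proof (intro conjI ballI)
  have "regular_space (mtop M)" by (rule regular_space_charts(2)[OF assms(1)]) (use ch cov in metis)
  then show "paracompact_space (mtop M)" using paracompact_second_countable_sum assms(2) by blast
  show "is_chart (mtop M) c" if "c \<in> atlas M" for c using ch that by (cases c) auto
  have "U \<subseteq> pts M" if "(k, U, \<phi>) \<in> atlas M" for k U \<phi> using chart_subset[OF ch[OF that]] .
  then show "(\<Union>(k, U, \<phi>)\<in>atlas M. U) = pts M" using cov by fast
  show "compatible c c'" if "c \<in> atlas M" "c' \<in> atlas M" for c c'
  proof -
    obtain k U \<phi> l V \<psi> where c: "c = (k, U, \<phi>)" "c' = (l, V, \<psi>)" by (metis prod_cases3)
    have "smooth_on l (\<psi> ` (V \<inter> U)) k (\<phi> \<circ> inv_into V \<psi>)" using assms(5) that c by blast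
    then show ?thesis using assms(5) that c by (simp add: compatible_def Int_commute)
  qed
qed (rule assms(1))

section \<open>Constructions of smooth manifolds\<close>

lemma is_chart_subtopology:
  assumes c: "is_chart X (k, V, \<phi>)" and "V \<subseteq> W"
  shows "is_chart (subtopology X W) (k, V, \<phi>)"
proof -
  have "openin (subtopology X W) V"
    using chart_open[OF c] assms(2) by (auto simp: openin_subtopology)
  moreover have "subtopology (subtopology X W) V = subtopology X V"
    using assms(2) by (simp add: subtopology_subtopology inf_absorb2)
  ultimately show ?thesis using c by (simp add: is_chart_def)
qed

lemma atlas_smooth_on:
  assumes "smooth_manifold M" "(k, U, \<phi>) \<in> atlas M" "(l, V, \<psi>) \<in> atlas M"
  shows "smooth_on k (\<phi> ` (U \<inter> V)) l (\<psi> \<circ> inv_into U \<phi>)"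
  using assms by (fastforce simp: smooth_manifold_def compatible_def)

lemma smooth_on_cong:
  assumes "openin (euc k) W" "smooth_on k W l F" "\<And>x j. x \<in> W \<Longrightarrow> j < l \<Longrightarrow> F x j = G x j"
  shows "smooth_on k W l G"
  unfolding smooth_on_def
proof (intro allI impI)
  fix j r assume j: "j < l"
  have "Cr_on r k W (\<lambda>x. F x j)" using assms(2) j by (simp add: smooth_on_def)
  then show "Cr_on r k W (\<lambda>x. G x j)"
    by (rule Cr_on_cong[OF assms(1), rotated]) (rule assms(3)[OF _ j])
qed

lemma smooth_on_mono: "smooth_on k W l F \<Longrightarrow> V \<subseteq> W \<Longrightarrow> smooth_on k V l F"
  using Cr_on_mono unfolding smooth_on_def by blast

lemma continuous_map_open_union:
  assumes "openin X W" "openin (subtopology X W) V"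
  shows "openin X V" "V \<subseteq> W"
  using assms openin_open_subtopology by auto

lemma mtop_open_submanifold: "mtop (open_submanifold M W) = subtopology (mtop M) W"
  by (simp add: open_submanifold_def)

context
  fixes M :: "'a manifold" and W :: "'a set"
  assumes M: "smooth_manifold M" and W: "openin (mtop M) (pts M \<inter> W)"
begin

lemma openin_open_submanifold:
  "openin (mtop (open_submanifold M W)) V \<longleftrightarrow> openin (mtop M) V \<and> V \<subseteq> W"
proof -
  have "subtopology (mtop M) W = subtopology (mtop M) (pts M \<inter> W)"
    by (simp add: subtopology_restrict)
  then show ?thesis
    using openin_open_subtopology[OF W] openin_subset[of "mtop M" V] by (auto simp: open_submanifold_def)
qed

lemma openin_chart_Int: "(k, U, \<phi>) \<in> atlas M \<Longrightarrow> openin (mtop M) (U \<inter> W)"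
proof -
  assume "(k, U, \<phi>) \<in> atlas M"
  note ch = smooth_manifold_chart[OF M this]
  have "U \<inter> W = U \<inter> (pts M \<inter> W)" using chart_subset[OF ch] by blast
  then show ?thesis using openin_Int[OF chart_open[OF ch] W] by simp
qed

lemma smooth_manifold_open_submanifold: "smooth_manifold (open_submanifold M W)"
proof (rule smooth_manifoldI)
  show "Hausdorff_space (mtop (open_submanifold M W))"
    using smooth_manifold_topology(1)[OF M] by (simp add: open_submanifold_def Hausdorff_space_subtopology)
  show "second_countable_sum (mtop (open_submanifold M W))"
    using smooth_manifold_second_countable_sum[OF M] by (simp add: open_submanifold_def second_countable_sum_subtopology)
next
  fix k U \<phi> assume "(k, U, \<phi>) \<in> atlas (open_submanifold M W)"
  then obtain U' where U: "(k, U', \<phi>) \<in> atlas M" "U = U' \<inter> W" by (auto simp: open_submanifold_def)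
  have "is_chart (mtop M) (k, U, \<phi>)" unfolding U(2)
    by (rule is_chart_subset[OF smooth_manifold_chart[OF M U(1)] openin_chart_Int[OF U(1)]]) auto
  then show "is_chart (mtop (open_submanifold M W)) (k, U, \<phi>)"
    unfolding mtop_open_submanifold by (rule is_chart_subtopology) (simp add: U(2))
next
  fix x assume "x \<in> pts (open_submanifold M W)"
  then have "x \<in> pts M" "x \<in> W" by (auto simp: open_submanifold_def)
  then obtain k U \<phi> where "(k, U, \<phi>) \<in> atlas M" "x \<in> U" using smooth_manifold_chart_at[OF M] by blast
  then show "\<exists>k U \<phi>. (k, U, \<phi>) \<in> atlas (open_submanifold M W) \<and> x \<in> U"
    using \<open>x \<in> W\<close> by (auto simp: open_submanifold_def)
next
  fix k U \<phi> l V \<psi>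
  assume "(k, U, \<phi>) \<in> atlas (open_submanifold M W)" "(l, V, \<psi>) \<in> atlas (open_submanifold M W)"
  then obtain U' V' where U: "(k, U', \<phi>) \<in> atlas M" "U = U' \<inter> W" and V: "(l, V', \<psi>) \<in> atlas M" "V = V' \<inter> W"
    by (auto simp: open_submanifold_def)
  note ch = smooth_manifold_chart[OF M U(1)]
  have o: "openin (euc k) (\<phi> ` (U \<inter> V))"
    unfolding U(2) V(2) by (rule chart_open_image[OF ch openin_Int[OF openin_chart_Int[OF U(1)] openin_chart_Int[OF V(1)]]]) auto
  have "smooth_on k (\<phi> ` (U \<inter> V)) l (\<psi> \<circ> inv_into U' \<phi>)"
    by (rule smooth_on_mono[OF atlas_smooth_on[OF M U(1) V(1)]]) (use U V in auto)
  then show "smooth_on k (\<phi> ` (U \<inter> V)) l (\<psi> \<circ> inv_into U \<phi>)"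
    by (rule smooth_on_cong[OF o]) (use inv_into_subset_eq[OF chart_inj[OF ch], of U] U in \<open>auto simp del: chart_inv\<close>)
qed

lemma smooth_real_at_open_submanifold:
  assumes x: "x \<in> W"
  shows "smooth_real_at (open_submanifold M W) u x \<longleftrightarrow> smooth_real_at M u x"
proof
  assume "smooth_real_at (open_submanifold M W) u x"
  then obtain k U \<phi> Z where U: "(k, U, \<phi>) \<in> atlas M" and Z: "openin (mtop (open_submanifold M W)) Z" "x \<in> Z" "Z \<subseteq> U \<inter> W"
     and u: "\<And>r. Cr_on r k (\<phi> ` Z) (u \<circ> inv_into (U \<inter> W) \<phi>)"
    unfolding smooth_real_at_def by (auto simp: open_submanifold_def)
  note ch = smooth_manifold_chart[OF M U(1)]
  have Z': "openin (mtop M) Z" using Z(1) openin_open_submanifold by blast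
  show "smooth_real_at M u x"
  proof (rule smooth_real_atI[OF M _ Z'])
    have o: "openin (euc k) (\<phi> ` Z)" using Z by (intro chart_open_image[OF ch Z']) auto
    show "Cr_on r k (\<phi> ` Z) (u \<circ> inv_into U \<phi>)" for r
      by (rule Cr_on_cong[OF o _ u]) (use inv_into_subset_eq[OF chart_inj[OF ch], of "U \<inter> W"] Z(3) in \<open>auto simp del: chart_inv simp: subset_iff\<close>)
    show "(k, U, \<phi>) \<in> maximal_atlas M" using U atlas_subset_maximal[OF M] by blast
  qed (use Z in auto)
next
  assume "smooth_real_at M u x"
  then obtain k U \<phi> Z where U: "(k, U, \<phi>) \<in> atlas M" and Z: "openin (mtop M) Z" "x \<in> Z" "Z \<subseteq> U"
     and u: "\<And>r. Cr_on r k (\<phi> ` Z) (u \<circ> inv_into U \<phi>)"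
    unfolding smooth_real_at_def by auto
  note ch = smooth_manifold_chart[OF M U(1)]
  have Z': "openin (mtop M) (Z \<inter> (U \<inter> W))" by (intro openin_Int Z openin_chart_Int[OF U])
  show "smooth_real_at (open_submanifold M W) u x"
    unfolding smooth_real_at_def
  proof (intro bexI[of _ "(k, U \<inter> W, \<phi>)"], clarify, intro exI[of _ "Z \<inter> (U \<inter> W)"] conjI allI)
    have o: "openin (euc k) (\<phi> ` (Z \<inter> (U \<inter> W)))" using Z by (intro chart_open_image[OF ch Z']) auto
    show "Cr_on r k (\<phi> ` (Z \<inter> (U \<inter> W))) (u \<circ> inv_into (U \<inter> W) \<phi>)" for r
      by (rule Cr_on_cong[OF o _ Cr_on_mono[OF u]])
         (use inv_into_subset_eq[OF chart_inj[OF ch], of "U \<inter> W"] in \<open>auto simp del: chart_inv\<close>)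
    show "openin (mtop (open_submanifold M W)) (Z \<inter> (U \<inter> W))" using Z' openin_open_submanifold by blast
    show "(k, U \<inter> W, \<phi>) \<in> atlas (open_submanifold M W)" using U by (auto simp: open_submanifold_def)
  qed (use Z x in auto)
qed

lemma smooth_at_open_source:
  assumes x: "x \<in> W"
  shows "smooth_at (open_submanifold M W) N f x \<longleftrightarrow> smooth_at M N f x"
proof -
  have "(\<exists>V. openin (mtop (open_submanifold M W)) V \<and> x \<in> V \<and> continuous_map (subtopology (mtop (open_submanifold M W)) V) (mtop N) f) \<longleftrightarrow>
        (\<exists>V. openin (mtop M) V \<and> x \<in> V \<and> continuous_map (subtopology (mtop M) V) (mtop N) f)" (is "?L \<longleftrightarrow> ?R")
  proof
    assume ?L
    then obtain V where V: "openin (mtop M) V" "V \<subseteq> W" "x \<in> V" "continuous_map (subtopology (mtop (open_submanifold M W)) V) (mtop N) f"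
      using openin_open_submanifold by blast
    then have "continuous_map (subtopology (mtop M) V) (mtop N) f"
      by (simp add: open_submanifold_def subtopology_subtopology inf_absorb2)
    then show ?R using V by blast
  next
    assume ?R
    then obtain V where V: "openin (mtop M) V" "x \<in> V" "continuous_map (subtopology (mtop M) V) (mtop N) f" by blast
    have V': "openin (mtop M) (V \<inter> (pts M \<inter> W))" "x \<in> V \<inter> (pts M \<inter> W)"
      using openin_Int[OF V(1) W] openin_subset[OF V(1)] V(2) x by auto
    have "continuous_map (subtopology (mtop (open_submanifold M W)) (V \<inter> (pts M \<inter> W))) (mtop N) f"
      unfolding mtop_open_submanifold subtopology_subtopology
      by (rule continuous_map_from_subtopology_mono[OF V(3)]) auto
    then show ?L using V' openin_open_submanifold by blast
  qed
  then show ?thesis by (simp add: smooth_at_def smooth_real_at_open_submanifold[OF x])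
qed

lemma smooth_at_into_open:
  assumes f: "smooth_at N M f x" and x: "f x \<in> W"
  shows "smooth_at N (open_submanifold M W) f x"
proof -
  have "f x \<in> pts M \<inter> W" using smooth_at_pts[OF f] x by blast
  then obtain V where V: "openin (mtop N) V" "x \<in> V" "f ` V \<subseteq> pts M \<inter> W" "continuous_map (subtopology (mtop N) V) (mtop M) f"
    by (rule smooth_at_preimage[OF f W]) (rule that)
  show ?thesis
  proof (rule smooth_at_unfoldI[OF V(1,2)])
    show "continuous_map (subtopology (mtop N) V) (mtop (open_submanifold M W)) f"
      using V(3,4) by (auto simp: open_submanifold_def continuous_map_in_subtopology)
    fix l U \<psi> j assume "(l, U, \<psi>) \<in> atlas (open_submanifold M W)" "f x \<in> U" "j < l"
    then show "smooth_real_at N (\<lambda>y. \<psi> (f y) j) x"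
      using smooth_atD[OF f] by (auto simp: open_submanifold_def)
  qed
qed

end

subsection \<open>Products\<close>

lemma Cr_on_if_coord: "Cr_on r k W (\<lambda>x. if P then x i else 0)"
  by (cases P) (simp_all add: Cr_on_coord Cr_on_const)

definition prod_chart :: "nat \<Rightarrow> ('a \<Rightarrow> nat \<Rightarrow> real) \<Rightarrow> ('b \<Rightarrow> nat \<Rightarrow> real) \<Rightarrow> 'a \<times> 'b \<Rightarrow> nat \<Rightarrow> real" where
  "prod_chart k \<phi> \<psi> = (\<lambda>(x, y) m. if m < k then \<phi> x m else \<psi> y (m - k))"

definition fst_coords :: "nat \<Rightarrow> (nat \<Rightarrow> real) \<Rightarrow> nat \<Rightarrow> real" where
  "fst_coords k z = (\<lambda>j. if j < k then z j else 0)"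

definition snd_coords :: "nat \<Rightarrow> (nat \<Rightarrow> real) \<Rightarrow> nat \<Rightarrow> real" where
  "snd_coords k z = (\<lambda>j. z (j + k))"

lemma atlas_prod_manifold:
  "atlas (prod_manifold M N) = {(k + l, U \<times> V, prod_chart k \<phi> \<psi>) |k U \<phi> l V \<psi>. (k, U, \<phi>) \<in> atlas M \<and> (l, V, \<psi>) \<in> atlas N}"
  by (simp add: prod_manifold_def prod_chart_def)

lemma fst_coords_prod_chart: "\<phi> x \<in> espace k \<Longrightarrow> fst_coords k (prod_chart k \<phi> \<psi> (x, y)) = \<phi> x"
  by (auto simp: fst_coords_def prod_chart_def espace_iff)

lemma snd_coords_prod_chart: "snd_coords k (prod_chart k \<phi> \<psi> (x, y)) = \<psi> y"
  by (auto simp: snd_coords_def prod_chart_def)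

lemma Cr_on_fst_coords: "Cr_on r m W (\<lambda>z. fst_coords k z j)"
  unfolding fst_coords_def by (rule Cr_on_if_coord)

lemma Cr_on_snd_coords: "Cr_on r m W (\<lambda>z. snd_coords k z j)"
  unfolding snd_coords_def by (rule Cr_on_coord)

context
  fixes M :: "'a manifold" and N :: "'b manifold"
  assumes M: "smooth_manifold M" and N: "smooth_manifold N"
begin

lemma prod_chart_image:
  assumes U: "(k, U, \<phi>) \<in> atlas M" and V: "(l, V, \<psi>) \<in> atlas N" and "A \<subseteq> U" "B \<subseteq> V"
  shows "prod_chart k \<phi> \<psi> ` (A \<times> B) = {z \<in> espace (k + l). fst_coords k z \<in> \<phi> ` A \<and> snd_coords k z \<in> \<psi> ` B}"
proof (intro equalityI subsetI)
  note ch = chart_espace[OF smooth_manifold_chart[OF M U]] chart_espace[OF smooth_manifold_chart[OF N V]]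
  fix z assume "z \<in> prod_chart k \<phi> \<psi> ` (A \<times> B)"
  then obtain x y where z: "z = prod_chart k \<phi> \<psi> (x, y)" "x \<in> A" "y \<in> B" by auto
  then have e: "\<phi> x \<in> espace k" "\<psi> y \<in> espace l" using ch assms by blast+
  then have "z \<in> espace (k + l)" unfolding z by (auto simp: espace_iff prod_chart_def)
  then show "z \<in> {z \<in> espace (k + l). fst_coords k z \<in> \<phi> ` A \<and> snd_coords k z \<in> \<psi> ` B}"
    using e z by (auto simp: fst_coords_prod_chart snd_coords_prod_chart)
next
  fix z assume "z \<in> {z \<in> espace (k + l). fst_coords k z \<in> \<phi> ` A \<and> snd_coords k z \<in> \<psi> ` B}"
  then obtain x y where z: "fst_coords k z = \<phi> x" "snd_coords k z = \<psi> y" "x \<in> A" "y \<in> B" by auto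
  have "z m = prod_chart k \<phi> \<psi> (x, y) m" for m
    using fun_cong[OF z(1), of m] fun_cong[OF z(2), of "m - k"] by (auto simp: prod_chart_def fst_coords_def snd_coords_def)
  then show "z \<in> prod_chart k \<phi> \<psi> ` (A \<times> B)" using z(3,4) by (intro image_eqI[of _ _ "(x, y)"]) auto
qed

lemma prod_chart_inv:
  assumes U: "(k, U, \<phi>) \<in> atlas M" and V: "(l, V, \<psi>) \<in> atlas N" and "x \<in> U" "y \<in> V"
  shows "(inv_into U \<phi> (fst_coords k (prod_chart k \<phi> \<psi> (x, y))), inv_into V \<psi> (snd_coords k (prod_chart k \<phi> \<psi> (x, y)))) = (x, y)"
proof -
  note ch = smooth_manifold_chart[OF M U] smooth_manifold_chart[OF N V]
  have "\<phi> x \<in> espace k" using chart_espace[OF ch(1)] assms(3) by blast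
  then show ?thesis
    using assms(3,4) by (simp add: fst_coords_prod_chart snd_coords_prod_chart chart_inv[OF ch(1)] chart_inv[OF ch(2)])
qed

lemma prod_chart_is_chart:
  assumes U: "(k, U, \<phi>) \<in> atlas M" and V: "(l, V, \<psi>) \<in> atlas N"
  shows "is_chart (mtop (prod_manifold M N)) (k + l, U \<times> V, prod_chart k \<phi> \<psi>)"
proof (rule is_chartI)
  note ch = smooth_manifold_chart[OF M U] smooth_manifold_chart[OF N V]
  let ?g = "\<lambda>z. (inv_into U \<phi> (fst_coords k z), inv_into V \<psi> (snd_coords k z))"
  let ?P = "prod_chart k \<phi> \<psi>"
  have mt: "mtop (prod_manifold M N) = prod_topology (mtop M) (mtop N)" by (simp add: prod_manifold_def)
  show "openin (mtop (prod_manifold M N)) (U \<times> V)"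
    using chart_open[OF ch(1)] chart_open[OF ch(2)] by (simp add: mt openin_prod_Times_iff)
  have c1: "continuous_map (subtopology (prod_topology (mtop M) (mtop N)) (U \<times> V)) (euc k) (\<lambda>p. \<phi> (fst p))"
    unfolding subtopology_Times
    using continuous_map_compose[OF continuous_map_fst[of _ "subtopology (mtop N) V"] chart_continuous[OF ch(1)]] by (simp add: o_def)
  have c2: "continuous_map (subtopology (prod_topology (mtop M) (mtop N)) (U \<times> V)) (euc l) (\<lambda>p. \<psi> (snd p))"
    unfolding subtopology_Times
    using continuous_map_compose[OF continuous_map_snd[of "subtopology (mtop M) U"] chart_continuous[OF ch(2)]] by (simp add: o_def)
  show "continuous_map (subtopology (mtop (prod_manifold M N)) (U \<times> V)) (euc (k + l)) ?P"
    unfolding mt continuous_map_into_Euclidean_space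
  proof (intro conjI allI impI)
    fix m assume "m < k + l"
    then show "continuous_map (subtopology (prod_topology (mtop M) (mtop N)) (U \<times> V)) euclideanreal (\<lambda>x. ?P x m)"
      using c1 c2 unfolding continuous_map_into_Euclidean_space by (cases "m < k") (auto simp: prod_chart_def case_prod_beta)
  next
    show "?P ` topspace (subtopology (prod_topology (mtop M) (mtop N)) (U \<times> V)) \<subseteq> espace (k + l)"
      using prod_chart_image[OF U V subset_refl subset_refl] by auto
  qed
  have cf: "continuous_map (euc (k + l)) (euc k) (fst_coords k)"
    using continuous_map_coordinate_Euclidean[of "k + l" UNIV]
    by (auto simp: continuous_map_into_Euclidean_space fst_coords_def espace_iff)
  have cs: "continuous_map (euc (k + l)) (euc l) (snd_coords k)"
    using continuous_map_coordinate_Euclidean[of "k + l" UNIV]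
    by (auto simp: continuous_map_into_Euclidean_space snd_coords_def espace_iff)
  have im: "?P ` (U \<times> V) = {z \<in> espace (k + l). fst_coords k z \<in> \<phi> ` U} \<inter> {z \<in> espace (k + l). snd_coords k z \<in> \<psi> ` V}"
    using prod_chart_image[OF U V subset_refl subset_refl] by auto
  show "openin (euc (k + l)) (?P ` (U \<times> V))" unfolding im
    by (intro openin_Int openin_continuous_map_preimage[OF cf] openin_continuous_map_preimage[OF cs] chart_image_open[OF ch(1)] chart_image_open[OF ch(2)])
  have "continuous_map (subtopology (euc (k + l)) (?P ` (U \<times> V))) (euc_on k (\<phi> ` U)) (fst_coords k)"
    using im by (auto simp: continuous_map_in_subtopology intro: continuous_map_from_subtopology cf)
  moreover have "continuous_map (subtopology (euc (k + l)) (?P ` (U \<times> V))) (euc_on l (\<psi> ` V)) (snd_coords k)"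
    using im by (auto simp: continuous_map_in_subtopology intro: continuous_map_from_subtopology cs)
  ultimately show "continuous_map (subtopology (euc (k + l)) (?P ` (U \<times> V))) (mtop (prod_manifold M N)) ?g"
    unfolding mt
    by (intro continuous_map_pairedI continuous_map_compose[OF _ chart_inv_continuous[OF ch(1)], unfolded o_def]
        continuous_map_compose[OF _ chart_inv_continuous[OF ch(2)], unfolded o_def])
  show "?g (?P p) = p" if "p \<in> U \<times> V" for p
    using prod_chart_inv[OF U V, of "fst p" "snd p"] that by auto
qed

lemma smooth_manifold_prod: "smooth_manifold (prod_manifold M N)"
proof (rule smooth_manifoldI)
  show "Hausdorff_space (mtop (prod_manifold M N))"
    using smooth_manifold_topology(1)[OF M] smooth_manifold_topology(1)[OF N]
    by (simp add: prod_manifold_def Hausdorff_space_prod_topology)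
  show "second_countable_sum (mtop (prod_manifold M N))"
    using smooth_manifold_second_countable_sum[OF M] smooth_manifold_second_countable_sum[OF N]
    by (simp add: prod_manifold_def second_countable_sum_prod)
next
  fix k U \<phi> assume "(k, U, \<phi>) \<in> atlas (prod_manifold M N)"
  then show "is_chart (mtop (prod_manifold M N)) (k, U, \<phi>)"
    using prod_chart_is_chart by (auto simp: atlas_prod_manifold)
next
  fix p assume "p \<in> pts (prod_manifold M N)"
  then have p: "fst p \<in> pts M" "snd p \<in> pts N" by (auto simp: prod_manifold_def)
  obtain k U \<phi> where U: "(k, U, \<phi>) \<in> atlas M" "fst p \<in> U" using smooth_manifold_chart_at[OF M p(1)] by blast
  obtain l V \<psi> where V: "(l, V, \<psi>) \<in> atlas N" "snd p \<in> V" using smooth_manifold_chart_at[OF N p(2)] by blast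
  have "(k + l, U \<times> V, prod_chart k \<phi> \<psi>) \<in> atlas (prod_manifold M N)" unfolding atlas_prod_manifold using U(1) V(1) by blast
  then show "\<exists>k U \<phi>. (k, U, \<phi>) \<in> atlas (prod_manifold M N) \<and> p \<in> U" using U(2) V(2) by (metis mem_Times_iff)
next
  fix K P \<Phi> L Q \<Psi> assume "(K, P, \<Phi>) \<in> atlas (prod_manifold M N)" "(L, Q, \<Psi>) \<in> atlas (prod_manifold M N)"
  then obtain k U \<phi> l V \<psi> k' U' \<phi>' l' V' \<psi>' where
    U: "(k, U, \<phi>) \<in> atlas M" "(k', U', \<phi>') \<in> atlas M" and V: "(l, V, \<psi>) \<in> atlas N" "(l', V', \<psi>') \<in> atlas N"
    and eq: "K = k + l" "P = U \<times> V" "\<Phi> = prod_chart k \<phi> \<psi>" "L = k' + l'" "Q = U' \<times> V'" "\<Psi> = prod_chart k' \<phi>' \<psi>'"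
    unfolding atlas_prod_manifold by blast
  have PQ: "P \<inter> Q = (U \<inter> U') \<times> (V \<inter> V')" unfolding eq by auto
  note ch = smooth_manifold_chart[OF M U(1)] smooth_manifold_chart[OF N V(1)]
  note chP = prod_chart_is_chart[OF U(1) V(1), folded eq] and chQ = prod_chart_is_chart[OF U(2) V(2), folded eq]
  have o: "openin (euc K) (\<Phi> ` (P \<inter> Q))"
    by (rule chart_open_image[OF chP]) (use chart_open[OF chP] chart_open[OF chQ] in auto)
  have oU: "openin (euc k) (\<phi> ` (U \<inter> U'))"
    by (rule chart_open_image[OF ch(1)]) (use chart_open[OF ch(1)] chart_open[OF smooth_manifold_chart[OF M U(2)]] in auto)
  have oV: "openin (euc l) (\<psi> ` (V \<inter> V'))"
    by (rule chart_open_image[OF ch(2)]) (use chart_open[OF ch(2)] chart_open[OF smooth_manifold_chart[OF N V(2)]] in auto)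
  have im: "\<Phi> ` (P \<inter> Q) = {z \<in> espace (k + l). fst_coords k z \<in> \<phi> ` (U \<inter> U') \<and> snd_coords k z \<in> \<psi> ` (V \<inter> V')}"
    unfolding PQ unfolding eq by (rule prod_chart_image[OF U(1) V(1)]) auto
  have inv: "inv_into P \<Phi> z = (inv_into U \<phi> (fst_coords k z), inv_into V \<psi> (snd_coords k z))" if zP: "z \<in> \<Phi> ` (P \<inter> Q)" for z
  proof -
    obtain x y where p: "z = \<Phi> (x, y)" "(x, y) \<in> P" "x \<in> U" "y \<in> V" using zP eq(2) by auto
    then show ?thesis using chart_inv[OF chP p(2)] prod_chart_inv[OF U(1) V(1) p(3,4)] eq(3) by simp
  qed
  show "smooth_on K (\<Phi> ` (P \<inter> Q)) L (\<Psi> \<circ> inv_into P \<Phi>)" unfolding smooth_on_def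
  proof (intro allI impI)
    fix m r assume m: "m < L"
    have a: "Cr_on r K (\<Phi> ` (P \<inter> Q)) (\<lambda>z. (\<phi>' \<circ> inv_into U \<phi>) (fst_coords k z) m)" if "m < k'"
    proof (rule Cr_on_compose[where f="\<lambda>z. (\<phi>' \<circ> inv_into U \<phi>) z m" and F="fst_coords k", OF o oU])
      show "Cr_on r k (\<phi> ` (U \<inter> U')) (\<lambda>z. (\<phi>' \<circ> inv_into U \<phi>) z m)"
        using atlas_smooth_on[OF M U] that by (simp add: smooth_on_def)
    qed (use im in \<open>auto simp: Cr_on_fst_coords\<close>)
    have b: "Cr_on r K (\<Phi> ` (P \<inter> Q)) (\<lambda>z. (\<psi>' \<circ> inv_into V \<psi>) (snd_coords k z) (m - k'))" if "\<not> m < k'"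
    proof (rule Cr_on_compose[where f="\<lambda>z. (\<psi>' \<circ> inv_into V \<psi>) z (m - k')" and F="snd_coords k", OF o oV])
      show "Cr_on r l (\<psi> ` (V \<inter> V')) (\<lambda>z. (\<psi>' \<circ> inv_into V \<psi>) z (m - k'))"
        using atlas_smooth_on[OF N V] that m eq(4) by (simp add: smooth_on_def)
    qed (use im in \<open>auto simp: Cr_on_snd_coords\<close>)
    show "Cr_on r K (\<Phi> ` (P \<inter> Q)) (\<lambda>z. (\<Psi> \<circ> inv_into P \<Phi>) z m)"
    proof (cases "m < k'")
      case True
      show ?thesis by (rule Cr_on_cong[OF o _ a[OF True]]) (use inv True in \<open>simp add: eq(6) prod_chart_def\<close>)
    next
      case False
      show ?thesis by (rule Cr_on_cong[OF o _ b[OF False]]) (use inv False in \<open>simp add: eq(6) prod_chart_def\<close>)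
    qed
  qed
qed

lemma smooth_real_at_prod_coord:
  assumes U: "(k, U, \<phi>) \<in> atlas M" and V: "(l, V, \<psi>) \<in> atlas N" and p: "x \<in> U" "y \<in> V"
  shows "smooth_real_at (prod_manifold M N) (\<lambda>q. \<phi> (fst q) j) (x, y)"
    "smooth_real_at (prod_manifold M N) (\<lambda>q. \<psi> (snd q) j) (x, y)"
proof -
  note ch = smooth_manifold_chart[OF M U] smooth_manifold_chart[OF N V]
  note P = smooth_manifold_prod
  note chP = prod_chart_is_chart[OF U V]
  have "(k + l, U \<times> V, prod_chart k \<phi> \<psi>) \<in> atlas (prod_manifold M N)" unfolding atlas_prod_manifold using U V by blast
  then have c: "(k + l, U \<times> V, prod_chart k \<phi> \<psi>) \<in> maximal_atlas (prod_manifold M N)" using atlas_subset_maximal[OF P] by blast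
  have xy: "(x, y) \<in> U \<times> V" using p by simp
  note co = smooth_real_at_coord[OF P c xy]
  show "smooth_real_at (prod_manifold M N) (\<lambda>q. \<psi> (snd q) j) (x, y)"
    by (rule smooth_real_at_cong[OF P co[of "j + k"] chart_open[OF chP] xy]) (auto simp: prod_chart_def)
  show "smooth_real_at (prod_manifold M N) (\<lambda>q. \<phi> (fst q) j) (x, y)"
  proof (cases "j < k")
    case True
    then show ?thesis
      by (intro smooth_real_at_cong[OF P co[of j] chart_open[OF chP] xy]) (auto simp: prod_chart_def)
  next
    case False
    have "smooth_real_at (prod_manifold M N) (\<lambda>q. 0) (x, y)"
      by (rule smooth_real_atI[OF P c chart_open[OF chP] xy]) (auto simp: o_def Cr_on_const)
    then show ?thesis
      by (rule smooth_real_at_cong[OF P _ chart_open[OF chP] xy]) (use chart_espace[OF ch(1)] False in \<open>auto simp: espace_iff image_subset_iff\<close>)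
  qed
qed

lemma smooth_at_fst_snd:
  assumes "x \<in> pts M" "y \<in> pts N"
  shows "smooth_at (prod_manifold M N) M fst (x, y)" "smooth_at (prod_manifold M N) N snd (x, y)"
proof -
  obtain k U \<phi> where U: "(k, U, \<phi>) \<in> atlas M" "x \<in> U" using smooth_manifold_chart_at[OF M assms(1)] by blast
  obtain l V \<psi> where V: "(l, V, \<psi>) \<in> atlas N" "y \<in> V" using smooth_manifold_chart_at[OF N assms(2)] by blast
  note c = subsetD[OF atlas_subset_maximal[OF M] U(1)] subsetD[OF atlas_subset_maximal[OF N] V(1)]
  have o: "openin (mtop (prod_manifold M N)) (pts (prod_manifold M N))" by simp
  have mt: "mtop (prod_manifold M N) = prod_topology (mtop M) (mtop N)" by (simp add: prod_manifold_def)
  have xy: "(x, y) \<in> pts (prod_manifold M N)" using assms by (simp add: mt)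
  show "smooth_at (prod_manifold M N) M fst (x, y)"
    by (rule smooth_atI[OF smooth_manifold_prod M o xy _ c(1)])
       (use U V smooth_real_at_prod_coord(1)[OF U(1) V(1) U(2) V(2)] in \<open>auto simp: mt continuous_map_from_subtopology continuous_map_fst\<close>)
  show "smooth_at (prod_manifold M N) N snd (x, y)"
    by (rule smooth_atI[OF smooth_manifold_prod N o xy _ c(2)])
       (use U V smooth_real_at_prod_coord(2)[OF U(1) V(1) U(2) V(2)] in \<open>auto simp: mt continuous_map_from_subtopology continuous_map_snd\<close>)
qed

lemma smooth_at_Pair:
  assumes P: "smooth_manifold P" and f: "smooth_at P M f x" and g: "smooth_at P N g x"
  shows "smooth_at P (prod_manifold M N) (\<lambda>z. (f z, g z)) x"
proof -
  obtain W where W: "openin (mtop P) W" "x \<in> W" "continuous_map (subtopology (mtop P) W) (mtop M) f"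
    using f by (auto simp: smooth_at_def)
  obtain W' where W': "openin (mtop P) W'" "x \<in> W'" "continuous_map (subtopology (mtop P) W') (mtop N) g"
    using g by (auto simp: smooth_at_def)
  show ?thesis
  proof (rule smooth_at_unfoldI)
    show "openin (mtop P) (W \<inter> W')" "x \<in> W \<inter> W'" using W W' by auto
    show "continuous_map (subtopology (mtop P) (W \<inter> W')) (mtop (prod_manifold M N)) (\<lambda>z. (f z, g z))"
      using continuous_map_from_subtopology_mono[OF W(3), of "W \<inter> W'"] continuous_map_from_subtopology_mono[OF W'(3), of "W \<inter> W'"]
      by (simp add: prod_manifold_def continuous_map_pairedI)
    fix K Q \<Phi> m assume "(K, Q, \<Phi>) \<in> atlas (prod_manifold M N)" and x: "(f x, g x) \<in> Q" "m < K"
    then obtain k U \<phi> l V \<psi> where U: "(k, U, \<phi>) \<in> atlas M" "(l, V, \<psi>) \<in> atlas N"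
      and eq: "K = k + l" "Q = U \<times> V" "\<Phi> = prod_chart k \<phi> \<psi>"
      unfolding atlas_prod_manifold by blast
    show "smooth_real_at P (\<lambda>z. \<Phi> (f z, g z) m) x"
      using smooth_atD[OF f U(1), of m] smooth_atD[OF g U(2), of "m - k"] x
      by (cases "m < k") (auto simp: eq prod_chart_def)
  qed
qed

end

subsection \<open>Powers\<close>

definition power_chart :: "nat \<Rightarrow> (nat \<Rightarrow> 'a \<Rightarrow> nat \<Rightarrow> real) \<Rightarrow> (nat \<Rightarrow> nat \<times> nat) \<Rightarrow> (nat \<Rightarrow> 'a) \<Rightarrow> nat \<Rightarrow> real" where
  "power_chart K \<phi> \<beta> = (\<lambda>x m. if m < K then (case \<beta> m of (i, j) \<Rightarrow> \<phi> i (x i) j) else 0)"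

text \<open>Recovers the coordinates of the \<open>i\<close>-th factor from a point of the power
  chart, going back through the listing \<open>\<beta>\<close>; the padding by zeros puts the result
  into \<open>k i\<close>-space.\<close>

definition comp_coords :: "nat \<Rightarrow> (nat \<Rightarrow> nat) \<Rightarrow> (nat \<Rightarrow> nat \<times> nat) \<Rightarrow> nat \<Rightarrow> (nat \<Rightarrow> real) \<Rightarrow> nat \<Rightarrow> real" where
  "comp_coords K k \<beta> i z = (\<lambda>j. if j < k i then z (inv_into {..<K} \<beta> (i, j)) else 0)"

definition power_chart_data ::
  "'a manifold \<Rightarrow> nat \<Rightarrow> nat \<Rightarrow> (nat \<Rightarrow> nat) \<Rightarrow> (nat \<Rightarrow> 'a set) \<Rightarrow> (nat \<Rightarrow> 'a \<Rightarrow> nat \<Rightarrow> real) \<Rightarrow> (nat \<Rightarrow> nat \<times> nat) \<Rightarrow> bool" where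
  "power_chart_data M n K k U \<phi> \<beta> \<longleftrightarrow> (\<forall>i\<in>{1..n}. (k i, U i, \<phi> i) \<in> atlas M) \<and>
     bij_betw \<beta> {..<K} (SIGMA i:{1..n}. {..<k i})"

lemma atlas_power_manifold:
  "atlas (power_manifold M n) = {(K, Pi\<^sub>E {1..n} U, power_chart K \<phi> \<beta>) |K k U \<phi> \<beta>. power_chart_data M n K k U \<phi> \<beta>}"
  by (simp add: power_manifold_def power_chart_def power_chart_data_def)

lemma mtop_power_manifold: "mtop (power_manifold M n) = product_topology (\<lambda>_. mtop M) {1..n}"
  by (simp add: power_manifold_def)

lemma Cr_on_comp_coords: "Cr_on r m W (\<lambda>z. comp_coords K k \<beta> i z j)"
  unfolding comp_coords_def by (rule Cr_on_if_coord)

context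
  fixes M :: "'a manifold" and n :: nat
  assumes M: "smooth_manifold M"
begin

context
  fixes K :: nat and k :: "nat \<Rightarrow> nat" and U :: "nat \<Rightarrow> 'a set" and \<phi> \<beta>
  assumes d: "power_chart_data M n K k U \<phi> \<beta>"
begin

lemma power_chart_factor: "i \<in> {1..n} \<Longrightarrow> (k i, U i, \<phi> i) \<in> atlas M"
  using d by (simp add: power_chart_data_def)

lemma power_chart_factor_chart: "i \<in> {1..n} \<Longrightarrow> is_chart (mtop M) (k i, U i, \<phi> i)"
  using power_chart_factor smooth_manifold_chart[OF M] by blast

lemma power_chart_index:
  assumes "m < K" obtains i j where "\<beta> m = (i, j)" "i \<in> {1..n}" "j < k i" "inv_into {..<K} \<beta> (i, j) = m"
proof -
  have b: "bij_betw \<beta> {..<K} (SIGMA i:{1..n}. {..<k i})" using d by (simp add: power_chart_data_def)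
  obtain i j where ij: "\<beta> m = (i, j)" by force
  have "\<beta> m \<in> (SIGMA i:{1..n}. {..<k i})" using bij_betwE[OF b] assms by blast
  moreover have "inv_into {..<K} \<beta> (\<beta> m) = m" using bij_betw_inv_into_left[OF b] assms by simp
  ultimately show thesis using that ij by auto
qed

lemma power_chart_index_inv:
  assumes "i \<in> {1..n}" "j < k i"
  shows "inv_into {..<K} \<beta> (i, j) < K" "\<beta> (inv_into {..<K} \<beta> (i, j)) = (i, j)"
proof -
  have b: "bij_betw \<beta> {..<K} (SIGMA i:{1..n}. {..<k i})" using d by (simp add: power_chart_data_def)
  have "(i, j) \<in> (SIGMA i:{1..n}. {..<k i})" using assms by simp
  then show "\<beta> (inv_into {..<K} \<beta> (i, j)) = (i, j)" by (rule bij_betw_inv_into_right[OF b])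
  have "(i, j) \<in> \<beta> ` {..<K}" using assms b by (simp add: bij_betw_def)
  from inv_into_into[OF this] show "inv_into {..<K} \<beta> (i, j) < K" by simp
qed

lemma comp_coords_power_chart:
  assumes "i \<in> {1..n}" "x i \<in> U i"
  shows "comp_coords K k \<beta> i (power_chart K \<phi> \<beta> x) = \<phi> i (x i)"
proof -
  have "\<phi> i (x i) \<in> espace (k i)" using chart_espace[OF power_chart_factor_chart[OF assms(1)]] assms(2) by blast
  then show ?thesis using power_chart_index_inv[OF assms(1)]
    by (auto simp: comp_coords_def power_chart_def espace_iff)
qed

lemma power_chart_espace: "power_chart K \<phi> \<beta> x \<in> espace K"
  by (simp add: power_chart_def espace_iff)

lemma power_chart_image:
  assumes "\<And>i. i \<in> {1..n} \<Longrightarrow> A i \<subseteq> U i"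
  shows "power_chart K \<phi> \<beta> ` (Pi\<^sub>E {1..n} A) = {z \<in> espace K. \<forall>i\<in>{1..n}. comp_coords K k \<beta> i z \<in> \<phi> i ` A i}"
proof (intro equalityI subsetI)
  fix z assume "z \<in> power_chart K \<phi> \<beta> ` (Pi\<^sub>E {1..n} A)"
  then obtain x where x: "x \<in> Pi\<^sub>E {1..n} A" "z = power_chart K \<phi> \<beta> x" by blast
  have "comp_coords K k \<beta> i z \<in> \<phi> i ` A i" if i: "i \<in> {1..n}" for i
  proof -
    have "x i \<in> A i" using x(1) i by blast
    then show ?thesis using comp_coords_power_chart[of i x, OF i] assms[OF i] x(2) by auto
  qed
  then show "z \<in> {z \<in> espace K. \<forall>i\<in>{1..n}. comp_coords K k \<beta> i z \<in> \<phi> i ` A i}"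
    using power_chart_espace x(2) by simp
next
  fix z assume z: "z \<in> {z \<in> espace K. \<forall>i\<in>{1..n}. comp_coords K k \<beta> i z \<in> \<phi> i ` A i}"
  then have "\<forall>i\<in>{1..n}. \<exists>a. a \<in> A i \<and> comp_coords K k \<beta> i z = \<phi> i a" by blast
  from bchoice[OF this] obtain x where x: "\<And>i. i \<in> {1..n} \<Longrightarrow> x i \<in> A i \<and> comp_coords K k \<beta> i z = \<phi> i (x i)" by blast
  have "z m = power_chart K \<phi> \<beta> (restrict x {1..n}) m" for m
  proof (cases "m < K")
    case True
    obtain i j where ij: "\<beta> m = (i, j)" "i \<in> {1..n}" "j < k i" "inv_into {..<K} \<beta> (i, j) = m"
      by (rule power_chart_index[OF True])
    then show ?thesis using fun_cong[OF conjunct2[OF x[OF ij(2)]], of j] True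
      by (simp add: power_chart_def comp_coords_def)
  qed (use z in \<open>simp add: power_chart_def espace_iff\<close>)
  moreover have "restrict x {1..n} \<in> Pi\<^sub>E {1..n} A" using x by simp
  ultimately show "z \<in> power_chart K \<phi> \<beta> ` (Pi\<^sub>E {1..n} A)" by (intro image_eqI) auto
qed

lemma power_chart_inv:
  assumes "x \<in> Pi\<^sub>E {1..n} U"
  shows "(\<lambda>i\<in>{1..n}. inv_into (U i) (\<phi> i) (comp_coords K k \<beta> i (power_chart K \<phi> \<beta> x))) = x"
proof (rule PiE_ext[OF _ assms])
  have *: "inv_into (U i) (\<phi> i) (comp_coords K k \<beta> i (power_chart K \<phi> \<beta> x)) = x i" if i: "i \<in> {1..n}" for i
  proof -
    have "x i \<in> U i" using assms i by blast
    then show ?thesis using comp_coords_power_chart[of i x, OF i] chart_inv[OF power_chart_factor_chart[OF i]] by simp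
  qed
  then show "(\<lambda>i\<in>{1..n}. inv_into (U i) (\<phi> i) (comp_coords K k \<beta> i (power_chart K \<phi> \<beta> x))) \<in> Pi\<^sub>E {1..n} U"
    using assms by (auto simp: PiE_iff)
  show "(\<lambda>i\<in>{1..n}. inv_into (U i) (\<phi> i) (comp_coords K k \<beta> i (power_chart K \<phi> \<beta> x))) i = x i" if "i \<in> {1..n}" for i
    using *[OF that] that by simp
qed

lemma power_chart_is_chart: "is_chart (mtop (power_manifold M n)) (K, Pi\<^sub>E {1..n} U, power_chart K \<phi> \<beta>)"
  unfolding mtop_power_manifold
proof (rule is_chartI)
  let ?X = "product_topology (\<lambda>_. mtop M) {1..n}"
  let ?P = "power_chart K \<phi> \<beta>"
  let ?W = "Pi\<^sub>E {1..n} U"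
  let ?g = "\<lambda>z. \<lambda>i\<in>{1..n}. inv_into (U i) (\<phi> i) (comp_coords K k \<beta> i z)"
  note ch = power_chart_factor_chart
  show "openin ?X ?W" using chart_open[OF ch] by (auto simp: openin_PiE_gen)
  have coord: "continuous_map (subtopology ?X ?W) euclideanreal (\<lambda>x. \<phi> i (x i) j)" if i: "i \<in> {1..n}" for i j
  proof -
    have "continuous_map (subtopology ?X ?W) (subtopology (mtop M) (U i)) (\<lambda>x. x i)"
      unfolding subtopology_product_topology by (rule continuous_map_product_projection[OF i])
    moreover have "continuous_map (subtopology (mtop M) (U i)) euclideanreal (\<lambda>x. \<phi> i x j)"
      using continuous_map_compose[OF chart_continuous[OF ch[OF i]] continuous_map_coordinate_Euclidean[of "k i" UNIV j, simplified]]
      by (simp add: o_def)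
    ultimately show ?thesis using continuous_map_compose by (fastforce simp: o_def)
  qed
  show "continuous_map (subtopology ?X ?W) (euc K) ?P"
    unfolding continuous_map_into_Euclidean_space
  proof (intro conjI allI impI)
    fix m assume m: "m < K"
    obtain i j where "\<beta> m = (i, j)" "i \<in> {1..n}" by (rule power_chart_index[OF m])
    then show "continuous_map (subtopology ?X ?W) euclideanreal (\<lambda>x. ?P x m)"
      using coord m by (simp add: power_chart_def)
  next
    show "?P ` topspace (subtopology ?X ?W) \<subseteq> espace K" using power_chart_espace by auto
  qed
  have cc: "continuous_map (euc K) (euc (k i)) (comp_coords K k \<beta> i)" for i
    using continuous_map_coordinate_Euclidean[of K UNIV]
    by (auto simp: continuous_map_into_Euclidean_space comp_coords_def espace_iff)
  have im: "?P ` ?W = {z \<in> espace K. \<forall>i\<in>{1..n}. comp_coords K k \<beta> i z \<in> \<phi> i ` U i}"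
    by (rule power_chart_image) simp
  have im': "?P ` ?W = espace K \<inter> (\<Inter>i\<in>{1..n}. {z \<in> espace K. comp_coords K k \<beta> i z \<in> \<phi> i ` U i})"
    unfolding im by auto
  show "openin (euc K) (?P ` ?W)"
  proof (cases "n = 0")
    case True
    then have "?P ` ?W = espace K" unfolding im by auto
    then show ?thesis by simp
  next
    case False
    show ?thesis unfolding im'
      by (intro openin_Int openin_topspace openin_INT2 openin_continuous_map_preimage[OF cc] chart_image_open[OF ch])
         (use False in auto)
  qed
  show "continuous_map (subtopology (euc K) (?P ` ?W)) ?X ?g"
    unfolding continuous_map_componentwise
  proof (intro conjI ballI)
    fix i assume i: "i \<in> {1..n}"
    have "continuous_map (subtopology (euc K) (?P ` ?W)) (subtopology (euc (k i)) (\<phi> i ` U i)) (comp_coords K k \<beta> i)"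
      using im i by (auto simp: continuous_map_in_subtopology intro: continuous_map_from_subtopology cc)
    from continuous_map_compose[OF this chart_inv_continuous[OF ch[OF i]]]
    show "continuous_map (subtopology (euc K) (?P ` ?W)) (mtop M) (\<lambda>x. ?g x i)"
      using i by (simp add: o_def)
  qed auto
  show "?g (?P x) = x" if "x \<in> ?W" for x by (rule power_chart_inv[OF that])
qed

end

lemma power_chart_exists:
  assumes "\<And>i. i \<in> {1..n} \<Longrightarrow> (k i, U i, \<phi> i) \<in> atlas M"
  obtains K \<beta> where "power_chart_data M n K k U \<phi> \<beta>"
proof -
  have "finite (SIGMA i:{1..n}. {..<k i})" by blast
  then obtain \<beta> where "bij_betw \<beta> {0..<card (SIGMA i:{1..n}. {..<k i})} (SIGMA i:{1..n}. {..<k i})"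
    using ex_bij_betw_nat_finite by blast
  then show thesis using that assms unfolding power_chart_data_def atLeast0LessThan by blast
qed

lemma power_chart_at:
  assumes "x \<in> pts (power_manifold M n)"
  obtains K k U \<phi> \<beta> where "power_chart_data M n K k U \<phi> \<beta>" "x \<in> Pi\<^sub>E {1..n} U"
proof -
  have x: "x \<in> Pi\<^sub>E {1..n} (\<lambda>_. pts M)" using assms by (simp add: mtop_power_manifold)
  have "\<exists>k U \<phi>. (k, U, \<phi>) \<in> atlas M \<and> x i \<in> U" if "i \<in> {1..n}" for i
  proof -
    have "x i \<in> pts M" using x that by blast
    then show ?thesis using smooth_manifold_chart_at[OF M] by metis
  qed
  then obtain k U \<phi> where c: "\<And>i. i \<in> {1..n} \<Longrightarrow> (k i, U i, \<phi> i) \<in> atlas M \<and> x i \<in> U i" by metis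
  obtain K \<beta> where "power_chart_data M n K k U \<phi> \<beta>" by (rule power_chart_exists[of k U \<phi>]) (use c in blast)+
  moreover have "x \<in> Pi\<^sub>E {1..n} U" using x c by (simp add: PiE_iff)
  ultimately show thesis by (rule that)
qed

lemma smooth_manifold_power: "smooth_manifold (power_manifold M n)"
proof (rule smooth_manifoldI)
  show "Hausdorff_space (mtop (power_manifold M n))"
    using smooth_manifold_topology(1)[OF M] by (simp add: mtop_power_manifold Hausdorff_space_product_topology)
  show "second_countable_sum (mtop (power_manifold M n))"
    using smooth_manifold_second_countable_sum[OF M] by (simp add: mtop_power_manifold second_countable_sum_product)
next
  fix k U \<phi> assume "(k, U, \<phi>) \<in> atlas (power_manifold M n)"
  then show "is_chart (mtop (power_manifold M n)) (k, U, \<phi>)"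
    using power_chart_is_chart unfolding atlas_power_manifold by blast
next
  fix x assume "x \<in> pts (power_manifold M n)"
  then obtain K k U \<phi> \<beta> where "power_chart_data M n K k U \<phi> \<beta>" "x \<in> Pi\<^sub>E {1..n} U" by (rule power_chart_at)
  then show "\<exists>k U \<phi>. (k, U, \<phi>) \<in> atlas (power_manifold M n) \<and> x \<in> U" unfolding atlas_power_manifold by blast
next
  fix K P \<Phi> L Q \<Psi> assume "(K, P, \<Phi>) \<in> atlas (power_manifold M n)" "(L, Q, \<Psi>) \<in> atlas (power_manifold M n)"
  then obtain k U \<phi> \<beta> l V \<psi> \<gamma> where d: "power_chart_data M n K k U \<phi> \<beta>" "power_chart_data M n L l V \<psi> \<gamma>"
    and eq: "P = Pi\<^sub>E {1..n} U" "\<Phi> = power_chart K \<phi> \<beta>" "Q = Pi\<^sub>E {1..n} V" "\<Psi> = power_chart L \<psi> \<gamma>"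
    unfolding atlas_power_manifold by blast
  have PQ: "P \<inter> Q = Pi\<^sub>E {1..n} (\<lambda>i. U i \<inter> V i)" unfolding eq by auto
  note ch = power_chart_factor_chart[OF d(1)] and ch' = power_chart_factor_chart[OF d(2)]
  note chP = power_chart_is_chart[OF d(1), folded eq] and chQ = power_chart_is_chart[OF d(2), folded eq]
  have o: "openin (euc K) (\<Phi> ` (P \<inter> Q))"
    by (rule chart_open_image[OF chP]) (use chart_open[OF chP] chart_open[OF chQ] in auto)
  have oi: "openin (euc (k i)) (\<phi> i ` (U i \<inter> V i))" if i: "i \<in> {1..n}" for i
    by (rule chart_open_image[OF ch[OF i]]) (use chart_open[OF ch[OF i]] chart_open[OF ch'[OF i]] in auto)
  have im: "\<Phi> ` (P \<inter> Q) = {z \<in> espace K. \<forall>i\<in>{1..n}. comp_coords K k \<beta> i z \<in> \<phi> i ` (U i \<inter> V i)}"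
    unfolding PQ unfolding eq by (rule power_chart_image[OF d(1)]) auto
  have inv: "inv_into P \<Phi> z = (\<lambda>i\<in>{1..n}. inv_into (U i) (\<phi> i) (comp_coords K k \<beta> i z))" if z: "z \<in> \<Phi> ` (P \<inter> Q)" for z
  proof -
    obtain x where p: "z = \<Phi> x" "x \<in> P" using z by auto
    show ?thesis using chart_inv[OF chP p(2)] power_chart_inv[OF d(1), of x] p eq by simp
  qed
  show "smooth_on K (\<Phi> ` (P \<inter> Q)) L (\<Psi> \<circ> inv_into P \<Phi>)" unfolding smooth_on_def
  proof (intro allI impI)
    fix m r assume m: "m < L"
    obtain i j where ij: "\<gamma> m = (i, j)" "i \<in> {1..n}" "j < l i" by (rule power_chart_index[OF d(2) m])
    have "Cr_on r K (\<Phi> ` (P \<inter> Q)) (\<lambda>z. (\<psi> i \<circ> inv_into (U i) (\<phi> i)) (comp_coords K k \<beta> i z) j)"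
    proof (rule Cr_on_compose[where f="\<lambda>z. (\<psi> i \<circ> inv_into (U i) (\<phi> i)) z j" and F="comp_coords K k \<beta> i", OF o oi[OF ij(2)]])
      show "Cr_on r (k i) (\<phi> i ` (U i \<inter> V i)) (\<lambda>z. (\<psi> i \<circ> inv_into (U i) (\<phi> i)) z j)"
        using atlas_smooth_on[OF M power_chart_factor[OF d(1) ij(2)] power_chart_factor[OF d(2) ij(2)]] ij(3)
        by (simp add: smooth_on_def)
    qed (use im ij(2) in \<open>auto simp: Cr_on_comp_coords\<close>)
    then show "Cr_on r K (\<Phi> ` (P \<inter> Q)) (\<lambda>z. (\<Psi> \<circ> inv_into P \<Phi>) z m)"
      by (rule Cr_on_cong[OF o, rotated]) (use inv ij m in \<open>simp add: eq(4) power_chart_def\<close>)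
  qed
qed

lemma smooth_at_component:
  assumes x: "x \<in> pts (power_manifold M n)" and i: "i \<in> {1..n}"
  shows "smooth_at (power_manifold M n) M (\<lambda>x. x i) x"
proof -
  obtain K k U \<phi> \<beta> where d: "power_chart_data M n K k U \<phi> \<beta>" "x \<in> Pi\<^sub>E {1..n} U" by (rule power_chart_at[OF x])
  let ?c = "(K, Pi\<^sub>E {1..n} U, power_chart K \<phi> \<beta>)"
  have "?c \<in> atlas (power_manifold M n)" unfolding atlas_power_manifold using d(1) by blast
  then have c: "?c \<in> maximal_atlas (power_manifold M n)" using atlas_subset_maximal[OF smooth_manifold_power] by blast
  have ci: "(k i, U i, \<phi> i) \<in> maximal_atlas M" using power_chart_factor[OF d(1) i] atlas_subset_maximal[OF M] by blast
  show ?thesis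
  proof (rule smooth_atI[OF smooth_manifold_power M openin_topspace x _ ci])
    show "continuous_map (subtopology (mtop (power_manifold M n)) (pts (power_manifold M n))) (mtop M) (\<lambda>x. x i)"
      unfolding mtop_power_manifold by (intro continuous_map_from_subtopology continuous_map_product_projection i)
    show "x i \<in> U i" using d(2) i by blast
    fix j assume j: "j < k i"
    note I = power_chart_index_inv[OF d(1) i j]
    show "smooth_real_at (power_manifold M n) (\<lambda>y. \<phi> i (y i) j) x"
      by (rule smooth_real_at_cong[OF smooth_manifold_power smooth_real_at_coord[OF smooth_manifold_power c d(2), of "inv_into {..<K} \<beta> (i, j)"] openin_topspace x])
         (use I in \<open>simp add: power_chart_def\<close>)
  qed
qed

lemma smooth_at_tuple:
  assumes P: "smooth_manifold P" and x: "x \<in> pts P" and f: "\<And>i. i \<in> {1..n} \<Longrightarrow> smooth_at P M (f i) x"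
  shows "smooth_at P (power_manifold M n) (\<lambda>y. \<lambda>i\<in>{1..n}. f i y) x"
proof -
  have "\<forall>i\<in>{1..n}. \<exists>W. openin (mtop P) W \<and> x \<in> W \<and> continuous_map (subtopology (mtop P) W) (mtop M) (f i)"
    using f by (simp add: smooth_at_def)
  from bchoice[OF this] obtain W where W: "\<And>i. i \<in> {1..n} \<Longrightarrow> openin (mtop P) (W i) \<and> x \<in> W i \<and> continuous_map (subtopology (mtop P) (W i)) (mtop M) (f i)"
    by blast
  define W0 where "W0 = \<Inter>(insert (pts P) (W ` {1..n}))"
  have o: "openin (mtop P) W0" unfolding W0_def by (rule openin_Inter) (use W in auto)
  show ?thesis
  proof (rule smooth_at_unfoldI[OF o])
    show "x \<in> W0" using x W by (simp add: W0_def)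
    show "continuous_map (subtopology (mtop P) W0) (mtop (power_manifold M n)) (\<lambda>y. \<lambda>i\<in>{1..n}. f i y)"
      unfolding mtop_power_manifold continuous_map_componentwise
    proof (intro conjI ballI)
      fix i assume i: "i \<in> {1..n}"
      have "continuous_map (subtopology (mtop P) W0) (mtop M) (f i)"
        by (rule continuous_map_from_subtopology_mono[of _ "W i"]) (use W i in \<open>auto simp: W0_def\<close>)
      then show "continuous_map (subtopology (mtop P) W0) (mtop M) (\<lambda>y. (\<lambda>i\<in>{1..n}. f i y) i)" using i by simp
    qed auto
    fix L V \<Psi> m assume "(L, V, \<Psi>) \<in> atlas (power_manifold M n)" and xV: "(\<lambda>i\<in>{1..n}. f i x) \<in> V" and m: "m < L"
    then obtain k U \<phi> \<beta> where d: "power_chart_data M n L k U \<phi> \<beta>" and eq: "V = Pi\<^sub>E {1..n} U" "\<Psi> = power_chart L \<phi> \<beta>"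
      unfolding atlas_power_manifold by blast
    obtain i j where ij: "\<beta> m = (i, j)" "i \<in> {1..n}" "j < k i" by (rule power_chart_index[OF d m])
    have "f i x \<in> U i" using xV ij(2) unfolding eq by (auto simp: PiE_iff)
    then have "smooth_real_at P (\<lambda>y. \<phi> i (f i y) j) x" using smooth_atD[OF f[OF ij(2)] power_chart_factor[OF d ij(2)] _ ij(3)] by blast
    then show "smooth_real_at P (\<lambda>y. \<Psi> (\<lambda>i\<in>{1..n}. f i y) m) x" using ij m by (simp add: eq power_chart_def)
  qed
qed

end

subsection \<open>Transport of structure\<close>

context
  fixes M :: "'a manifold" and A :: "'b set" and h :: "'b \<Rightarrow> 'a"
  assumes M: "smooth_manifold M" and inj: "inj_on h A" and sur: "pts M \<subseteq> h ` A"
begin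

lemma pts_transport: "pts (transport A h M) = {a \<in> A. h a \<in> pts M}"
  by (auto simp: transport_def topspace_pullback_topology)

lemma inv_transport: "x \<in> pts M \<Longrightarrow> inv_into A h x \<in> A" "x \<in> pts M \<Longrightarrow> h (inv_into A h x) = x"
  using sur by (auto intro: inv_into_into f_inv_into_f)

lemma continuous_map_transport: "continuous_map (mtop (transport A h M)) (mtop M) h"
proof -
  have "continuous_map (pullback_topology A h (mtop M)) (mtop M) (id \<circ> h)"
    by (rule continuous_map_pullback) simp
  then show ?thesis by (simp add: transport_def)
qed

lemma continuous_map_inv_transport: "continuous_map (mtop M) (mtop (transport A h M)) (inv_into A h)"
proof -
  have "continuous_map (mtop M) (pullback_topology A h (mtop M)) (inv_into A h)"
  proof (rule continuous_map_pullback')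
    show "continuous_map (mtop M) (mtop M) (h \<circ> inv_into A h)"
      by (rule continuous_map_eq[of _ _ "\<lambda>x. x"]) (auto simp: inv_transport)
    show "topspace (mtop M) \<subseteq> inv_into A h -` A" using inv_transport by auto
  qed
  then show ?thesis by (simp add: transport_def)
qed

lemma homeomorphic_map_transport: "homeomorphic_map (mtop M) (mtop (transport A h M)) (inv_into A h)"
  unfolding homeomorphic_map_maps homeomorphic_maps_def
  using continuous_map_transport continuous_map_inv_transport inj
  by (intro exI[of _ h]) (auto simp: inv_transport pts_transport)

lemma transport_chart:
  assumes "is_chart (mtop M) (k, U, \<phi>)"
  shows "is_chart (mtop (transport A h M)) (k, h -` U \<inter> A, \<phi> \<circ> h)"
proof (rule is_chartI[where g = "inv_into A h \<circ> inv_into U \<phi>"])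
  note ch = assms
  have U: "h -` U \<inter> A = {a \<in> pts (transport A h M). h a \<in> U}" using chart_subset[OF ch] by (auto simp: pts_transport)
  show "openin (mtop (transport A h M)) (h -` U \<inter> A)"
    unfolding U by (rule openin_continuous_map_preimage[OF continuous_map_transport chart_open[OF ch]])
  have "continuous_map (subtopology (mtop (transport A h M)) (h -` U \<inter> A)) (subtopology (mtop M) U) h"
    by (auto simp: continuous_map_in_subtopology intro: continuous_map_from_subtopology continuous_map_transport)
  then show "continuous_map (subtopology (mtop (transport A h M)) (h -` U \<inter> A)) (euc k) (\<phi> \<circ> h)"
    using continuous_map_compose chart_continuous[OF ch] by blast
  have im: "h ` (h -` U \<inter> A) = U" using chart_subset[OF ch] sur by auto
  then have im': "(\<phi> \<circ> h) ` (h -` U \<inter> A) = \<phi> ` U" by (metis image_comp)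
  show "openin (euc k) ((\<phi> \<circ> h) ` (h -` U \<inter> A))" unfolding im' by (rule chart_image_open[OF ch])
  show "continuous_map (euc_on k ((\<phi> \<circ> h) ` (h -` U \<inter> A))) (mtop (transport A h M)) (inv_into A h \<circ> inv_into U \<phi>)"
    unfolding im' by (rule continuous_map_compose[OF chart_inv_continuous[OF ch] continuous_map_inv_transport])
  show "(inv_into A h \<circ> inv_into U \<phi>) ((\<phi> \<circ> h) a) = a" if "a \<in> h -` U \<inter> A" for a
    using that inj by (simp add: chart_inv[OF ch])
qed

lemma transport_chart_inv:
  assumes ch: "is_chart (mtop M) (k, U, \<phi>)" and z: "z \<in> \<phi> ` U"
  shows "inv_into (h -` U \<inter> A) (\<phi> \<circ> h) z = inv_into A h (inv_into U \<phi> z)"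
proof -
  obtain x where x: "x \<in> U" "z = \<phi> x" using z by blast
  then have "x \<in> pts M" using chart_subset[OF ch] by blast
  then have a: "inv_into A h x \<in> h -` U \<inter> A" "z = (\<phi> \<circ> h) (inv_into A h x)" using x inv_transport by auto
  show ?thesis unfolding a(2) chart_inv[OF transport_chart[OF ch] a(1)]
    using x inv_transport(2)[OF \<open>x \<in> pts M\<close>] by (simp add: chart_inv[OF ch])
qed

lemma smooth_manifold_transport: "smooth_manifold (transport A h M)"
proof (rule smooth_manifoldI)
  show "second_countable_sum (mtop (transport A h M))"
    using second_countable_sum_homeomorphic[OF homeomorphic_map_transport smooth_manifold_second_countable_sum[OF M]] .
  show "Hausdorff_space (mtop (transport A h M))"
    using homeomorphic_Hausdorff_space[of "mtop M" "mtop (transport A h M)"] homeomorphic_map_transport smooth_manifold_topology(1)[OF M] homeomorphic_space by blast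
next
  fix k U \<phi> assume "(k, U, \<phi>) \<in> atlas (transport A h M)"
  then show "is_chart (mtop (transport A h M)) (k, U, \<phi>)"
    using transport_chart[OF smooth_manifold_chart[OF M]] by (auto simp: transport_def)
next
  fix a assume "a \<in> pts (transport A h M)"
  then have a: "a \<in> A" "h a \<in> pts M" by (auto simp: pts_transport)
  obtain k U \<phi> where "(k, U, \<phi>) \<in> atlas M" "h a \<in> U" using smooth_manifold_chart_at[OF M a(2)] by blast
  then show "\<exists>k U \<phi>. (k, U, \<phi>) \<in> atlas (transport A h M) \<and> a \<in> U"
    using a(1) by (intro exI[of _ k] exI[of _ "h -` U \<inter> A"] exI[of _ "\<phi> \<circ> h"]) (auto simp: transport_def)
next
  fix k U \<phi> l V \<psi> assume "(k, U, \<phi>) \<in> atlas (transport A h M)" "(l, V, \<psi>) \<in> atlas (transport A h M)"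
  then obtain U' \<phi>' V' \<psi>' where U: "(k, U', \<phi>') \<in> atlas M" "U = h -` U' \<inter> A" "\<phi> = \<phi>' \<circ> h"
    and V: "(l, V', \<psi>') \<in> atlas M" "V = h -` V' \<inter> A" "\<psi> = \<psi>' \<circ> h"
    by (auto simp: transport_def)
  note ch = smooth_manifold_chart[OF M U(1)] and ch' = smooth_manifold_chart[OF M V(1)]
  have "h ` (U \<inter> V) = U' \<inter> V'" unfolding U(2) V(2) using chart_subset[OF ch] sur by auto
  then have im: "\<phi> ` (U \<inter> V) = \<phi>' ` (U' \<inter> V')" unfolding U(3) by (metis image_comp)
  have o: "openin (euc k) (\<phi>' ` (U' \<inter> V'))"
    by (rule chart_open_image[OF ch]) (use chart_open[OF ch] chart_open[OF ch'] in auto)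
  show "smooth_on k (\<phi> ` (U \<inter> V)) l (\<psi> \<circ> inv_into U \<phi>)" unfolding im
  proof (rule smooth_on_cong[OF o atlas_smooth_on[OF M U(1) V(1)]])
    fix z j assume z: "z \<in> \<phi>' ` (U' \<inter> V')"
    then have "inv_into U' \<phi>' z \<in> pts M" using chart_subset[OF ch] chart_inv[OF ch] by auto
    moreover have "z \<in> \<phi>' ` U'" using z by blast
    ultimately show "(\<psi>' \<circ> inv_into U' \<phi>') z j = (\<psi> \<circ> inv_into U \<phi>) z j"
      unfolding U(2,3) V(3) using transport_chart_inv[OF ch] inv_transport(2) by simp
  qed
qed

lemma smooth_at_transport:
  assumes a: "a \<in> pts (transport A h M)"
  shows "smooth_at (transport A h M) M h a"
proof -
  have a': "a \<in> A" "h a \<in> pts M" using a by (auto simp: pts_transport)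
  obtain k U \<phi> where U: "(k, U, \<phi>) \<in> atlas M" "h a \<in> U" using smooth_manifold_chart_at[OF M a'(2)] by blast
  have "(k, h -` U \<inter> A, \<phi> \<circ> h) \<in> atlas (transport A h M)" using U by (auto simp: transport_def)
  then have c: "(k, h -` U \<inter> A, \<phi> \<circ> h) \<in> maximal_atlas (transport A h M)" using atlas_subset_maximal[OF smooth_manifold_transport] by blast
  show ?thesis
  proof (rule smooth_atI[where f=h, OF smooth_manifold_transport M openin_topspace a _ subsetD[OF atlas_subset_maximal[OF M] U(1)] U(2)])
    show "smooth_real_at (transport A h M) (\<lambda>y. \<phi> (h y) j) a" for j
      using smooth_real_at_coord[OF smooth_manifold_transport c, of a j] a' U by simp
  qed (use continuous_map_transport in auto)
qed

lemma smooth_at_inv_transport: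
  assumes x: "x \<in> pts M"
  shows "smooth_at M (transport A h M) (inv_into A h) x"
proof (rule smooth_at_unfoldI[OF openin_topspace x])
  show "continuous_map (subtopology (mtop M) (pts M)) (mtop (transport A h M)) (inv_into A h)"
    using continuous_map_inv_transport by simp
  fix l V \<psi> j assume "(l, V, \<psi>) \<in> atlas (transport A h M)" "inv_into A h x \<in> V" "j < l"
  then obtain U \<phi> where U: "(l, U, \<phi>) \<in> atlas M" "\<psi> = \<phi> \<circ> h" "h (inv_into A h x) \<in> U" by (auto simp: transport_def)
  have xU: "x \<in> U" using U(3) inv_transport(2)[OF x] by simp
  show "smooth_real_at M (\<lambda>y. \<psi> (inv_into A h y) j) x"
    by (rule smooth_real_at_cong[OF M smooth_real_at_coord[OF M subsetD[OF atlas_subset_maximal[OF M] U(1)] xU, of j] openin_topspace x])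
       (simp add: U(2) inv_transport)
qed

end

subsection \<open>Embedded submanifolds\<close>

text \<open>A slice chart uses the same function as chart into \<open>r\<close>-space and into
  \<open>k\<close>-space. With points encoded as sequences the smaller space is a subspace of the
  larger, and no inclusion map intervenes.\<close>

lemma Euclidean_space_lower_dimension:
  assumes "r \<le> k"
  shows "A \<subseteq> espace r \<Longrightarrow> euc_on r A = euc_on k A"
    and "openin (euc k) Z \<Longrightarrow> openin (euc r) (Z \<inter> espace r)"
    and "continuous_map X (euc k) f \<Longrightarrow> f ` topspace X \<subseteq> espace r \<Longrightarrow> continuous_map X (euc r) f"
proof -
  have eq: "euc r = euc_on k {x. \<forall>i\<ge>r. x i = 0}"
    unfolding Euclidean_space_def subtopology_subtopology
    by (rule arg_cong[where f="subtopology (powertop_real UNIV)"]) (use assms in auto)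
  show "euc_on r A = euc_on k A" if "A \<subseteq> espace r"
    unfolding eq subtopology_subtopology
    by (rule arg_cong[where f="subtopology (euc k)"]) (use that in \<open>auto simp: espace_iff\<close>)
  show "openin (euc r) (Z \<inter> espace r)" if "openin (euc k) Z"
    unfolding topspace_Euclidean_space unfolding eq using that by (auto simp: openin_subtopology)
  show "continuous_map X (euc r) f" if "continuous_map X (euc k) f" "f ` topspace X \<subseteq> espace r"
    using that unfolding eq continuous_map_in_subtopology by (auto simp: espace_iff image_subset_iff)
qed

text \<open>The partial derivatives in the first \<open>r\<close> directions are literally the same
  functions, so only the continuity statements have to be restricted.\<close>

lemma Cr_on_lower_dimension:
  assumes "Cr_on s k W f" "r \<le> k"
  shows "Cr_on s r (W \<inter> espace r) f"
proof -
  have eq: "euc_on r (W \<inter> espace r) = euc_on k (W \<inter> espace r)"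
    by (rule Euclidean_space_lower_dimension(1)[OF assms(2)]) simp
  have c: "continuous_map (euc_on k W) euclideanreal f \<Longrightarrow>
       continuous_map (euc_on r (W \<inter> espace r)) euclideanreal f" for f
    unfolding eq by (erule continuous_map_from_subtopology_mono) auto
  show ?thesis using assms(1)
  proof (induction s arbitrary: f)
    case 0
    then show ?case using c by simp
  next
    case (Suc s)
    then show ?case using c assms(2) by simp
  qed
qed

lemma maximal_atlas_smooth_on:
  assumes M: "smooth_manifold M" and c: "(k, U, \<phi>) \<in> maximal_atlas M" "(l, V, \<psi>) \<in> maximal_atlas M"
  shows "smooth_on k (\<phi> ` (U \<inter> V)) l (\<psi> \<circ> inv_into U \<phi>)"
  unfolding smooth_on_def
proof (intro allI impI)
  note ch = maximal_atlas_chart[OF c(1)] and ch' = maximal_atlas_chart[OF c(2)]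
  fix j r assume "j < l"
  show "Cr_on r k (\<phi> ` (U \<inter> V)) (\<lambda>z. (\<psi> \<circ> inv_into U \<phi>) z j)"
  proof (rule Cr_on_local)
    show "openin (euc k) (\<phi> ` (U \<inter> V))"
      by (rule chart_open_image[OF ch]) (use chart_open[OF ch] chart_open[OF ch'] in auto)
    fix z assume "z \<in> \<phi> ` (U \<inter> V)"
    then obtain x where x: "x \<in> U" "x \<in> V" "z = \<phi> x" by blast
    obtain W where W: "openin (mtop M) W" "x \<in> W" "W \<subseteq> U" "\<And>r. Cr_on r k (\<phi> ` W) ((\<lambda>y. \<psi> y j) \<circ> inv_into U \<phi>)"
      using smooth_real_at_chart[OF M smooth_real_at_coord[OF M c(2) x(2)] c(1) x(1)] by metis
    show "\<exists>V. openin (euc k) V \<and> z \<in> V \<and> Cr_on r k V (\<lambda>z. (\<psi> \<circ> inv_into U \<phi>) z j)"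
      using chart_open_image[OF ch W(1,3)] W(2,4) x(3) by (intro exI[of _ "\<phi> ` W"]) (auto simp: o_def)
  qed
qed

lemma mtop_embedded_submanifold: "mtop (embedded_submanifold M S) = subtopology (mtop M) S"
  by (simp add: embedded_submanifold_def)

context
  fixes M :: "'a manifold" and S :: "'a set"
  assumes M: "smooth_manifold M"
    and slice: "\<And>x. x \<in> pts M \<Longrightarrow> x \<in> S \<Longrightarrow> \<exists>r k U \<phi>. (k, U, \<phi>) \<in> maximal_atlas M \<and> r \<le> k \<and> x \<in> U \<and>
                 \<phi> ` (U \<inter> S) = \<phi> ` U \<inter> espace r"
begin

lemma slice_chart:
  assumes c: "(k, U, \<phi>) \<in> maximal_atlas M" and r: "r \<le> k" "\<phi> ` (U \<inter> S) = \<phi> ` U \<inter> espace r"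
  shows "is_chart (mtop (embedded_submanifold M S)) (r, U \<inter> S, \<phi>)"
  unfolding mtop_embedded_submanifold
proof (rule is_chartI[where g = "inv_into U \<phi>"])
  note ch = maximal_atlas_chart[OF c]
  show "openin (subtopology (mtop M) S) (U \<inter> S)" using chart_open[OF ch] by (auto simp: openin_subtopology)
  have "continuous_map (subtopology (mtop M) (U \<inter> S)) (euc k) \<phi>"
    by (rule continuous_map_from_subtopology_mono[OF chart_continuous[OF ch]]) simp
  then show "continuous_map (subtopology (subtopology (mtop M) S) (U \<inter> S)) (euc r) \<phi>"
    using r(2) by (intro Euclidean_space_lower_dimension(3)[OF r(1)]) (auto simp: subtopology_subtopology Int_ac)
  show "openin (euc r) (\<phi> ` (U \<inter> S))"
    unfolding r(2) by (rule Euclidean_space_lower_dimension(2)[OF r(1) chart_image_open[OF ch]])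
  have eq: "euc_on r (\<phi> ` (U \<inter> S)) = euc_on k (\<phi> ` (U \<inter> S))"
    by (rule Euclidean_space_lower_dimension(1)[OF r(1)]) (use r(2) in auto)
  have "continuous_map (euc_on k (\<phi> ` (U \<inter> S))) (mtop M) (inv_into U \<phi>)"
    by (rule continuous_map_from_subtopology_mono[OF chart_inv_continuous[OF ch]]) auto
  then show "continuous_map (euc_on r (\<phi> ` (U \<inter> S))) (subtopology (mtop M) S) (inv_into U \<phi>)"
    unfolding eq continuous_map_in_subtopology by (auto simp: chart_inv[OF ch])
  show "inv_into U \<phi> (\<phi> x) = x" if "x \<in> U \<inter> S" for x using that by (simp add: chart_inv[OF ch])
qed

lemma smooth_manifold_embedded: "smooth_manifold (embedded_submanifold M S)"
proof (rule smooth_manifoldI)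
  show "Hausdorff_space (mtop (embedded_submanifold M S))"
    using smooth_manifold_topology(1)[OF M] by (simp add: mtop_embedded_submanifold Hausdorff_space_subtopology)
  show "second_countable_sum (mtop (embedded_submanifold M S))"
    using smooth_manifold_second_countable_sum[OF M] by (simp add: mtop_embedded_submanifold second_countable_sum_subtopology)
next
  fix k U \<phi> assume "(k, U, \<phi>) \<in> atlas (embedded_submanifold M S)"
  then show "is_chart (mtop (embedded_submanifold M S)) (k, U, \<phi>)"
    using slice_chart by (auto simp: embedded_submanifold_def)
next
  fix x assume "x \<in> pts (embedded_submanifold M S)"
  then have "x \<in> pts M" "x \<in> S" by (auto simp: mtop_embedded_submanifold)
  then obtain r k U \<phi> where "(k, U, \<phi>) \<in> maximal_atlas M" "r \<le> k" "x \<in> U" "\<phi> ` (U \<inter> S) = \<phi> ` U \<inter> espace r"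
    using slice by blast
  then show "\<exists>k U \<phi>. (k, U, \<phi>) \<in> atlas (embedded_submanifold M S) \<and> x \<in> U"
    using \<open>x \<in> S\<close> by (intro exI[of _ r] exI[of _ "U \<inter> S"] exI[of _ \<phi>]) (auto simp: embedded_submanifold_def)
next
  fix r U \<phi> s V \<psi> assume "(r, U, \<phi>) \<in> atlas (embedded_submanifold M S)" "(s, V, \<psi>) \<in> atlas (embedded_submanifold M S)"
  then obtain k U' l V' where U: "(k, U', \<phi>) \<in> maximal_atlas M" "r \<le> k" "\<phi> ` (U' \<inter> S) = \<phi> ` U' \<inter> espace r" "U = U' \<inter> S"
     and V: "(l, V', \<psi>) \<in> maximal_atlas M" "s \<le> l" "\<psi> ` (V' \<inter> S) = \<psi> ` V' \<inter> espace s" "V = V' \<inter> S"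
    by (auto simp: embedded_submanifold_def)
  note ch = slice_chart[OF U(1-3), folded U(4)] and ch' = slice_chart[OF V(1-3), folded V(4)]
  have o: "openin (euc r) (\<phi> ` (U \<inter> V))"
    by (rule chart_open_image[OF ch]) (use chart_open[OF ch] chart_open[OF ch'] in auto)
  have sub: "\<phi> ` (U \<inter> V) \<subseteq> \<phi> ` (U' \<inter> V') \<inter> espace r" unfolding U(4) V(4) using U(3) by blast
  have "smooth_on r (\<phi> ` (U \<inter> V)) s (\<psi> \<circ> inv_into U' \<phi>)"
    using maximal_atlas_smooth_on[OF M U(1) V(1)] Cr_on_mono[OF Cr_on_lower_dimension[OF _ U(2)] sub] V(2)
    unfolding smooth_on_def by (meson less_le_trans)
  then show "smooth_on r (\<phi> ` (U \<inter> V)) s (\<psi> \<circ> inv_into U \<phi>)"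
    by (rule smooth_on_cong[OF o]) (auto simp: chart_inv[OF ch[unfolded U(4)]] chart_inv[OF maximal_atlas_chart[OF U(1)]] U(4))
qed

lemma smooth_at_embedded:
  assumes x: "x \<in> pts M" "x \<in> S"
  shows "smooth_at (embedded_submanifold M S) M (\<lambda>y. y) x"
proof -
  obtain r k U \<phi> where U: "(k, U, \<phi>) \<in> maximal_atlas M" "r \<le> k" "x \<in> U" "\<phi> ` (U \<inter> S) = \<phi> ` U \<inter> espace r"
    using slice[OF x] by blast
  then have "(r, U \<inter> S, \<phi>) \<in> atlas (embedded_submanifold M S)" by (auto simp: embedded_submanifold_def)
  then have c: "(r, U \<inter> S, \<phi>) \<in> maximal_atlas (embedded_submanifold M S)"
    using atlas_subset_maximal[OF smooth_manifold_embedded] by blast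
  have x': "x \<in> pts (embedded_submanifold M S)" using x by (simp add: mtop_embedded_submanifold)
  show ?thesis
  proof (rule smooth_atI[where f="\<lambda>y. y", OF smooth_manifold_embedded M openin_topspace x' _ U(1,3)])
    show "continuous_map (subtopology (mtop (embedded_submanifold M S)) (pts (embedded_submanifold M S))) (mtop M) (\<lambda>y. y)"
      unfolding mtop_embedded_submanifold by (intro continuous_map_from_subtopology continuous_map_id[unfolded id_def])
    show "smooth_real_at (embedded_submanifold M S) (\<lambda>y. \<phi> y j) x" for j
      by (rule smooth_real_at_coord[OF smooth_manifold_embedded c]) (use x U in auto)
  qed
qed

text \<open>The charts of the submanifold are restrictions of charts of the ambient manifold, so its
  coordinates of \<open>f\<close> are smooth already and only the topology has to be
  restricted.\<close>

lemma smooth_at_into_embedded: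
  assumes P: "smooth_manifold P" and f: "smooth_at P M f x"
    and N: "openin (mtop P) N" "x \<in> N" "f ` N \<subseteq> S"
  shows "smooth_at P (embedded_submanifold M S) f x"
proof -
  obtain W where W: "openin (mtop P) W" "x \<in> W" "continuous_map (subtopology (mtop P) W) (mtop M) f"
    using f by (auto simp: smooth_at_def)
  show ?thesis
  proof (rule smooth_at_unfoldI)
    show "openin (mtop P) (W \<inter> N)" "x \<in> W \<inter> N" using W N by auto
    show "continuous_map (subtopology (mtop P) (W \<inter> N)) (mtop (embedded_submanifold M S)) f"
      unfolding mtop_embedded_submanifold continuous_map_in_subtopology
      using continuous_map_from_subtopology_mono[OF W(3), of "W \<inter> N"] N(3) by auto
    fix r V \<psi> j assume "(r, V, \<psi>) \<in> atlas (embedded_submanifold M S)" "f x \<in> V" "j < r"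
    then obtain l V' where V: "(l, V', \<psi>) \<in> maximal_atlas M" "f x \<in> V'" by (auto simp: embedded_submanifold_def)
    show "smooth_real_at P (\<lambda>y. \<psi> (f y) j) x" by (rule smooth_at_chart_map[OF P M f V])
  qed
qed

end

section \<open>Submersions and local sections\<close>

text \<open>Comparison with one known chart around is enough: transitions from the new chart factor
  through it, and transitions into the new chart are smooth because its coordinate functions
  are.\<close>

lemma maximal_atlasI:
  assumes M: "smooth_manifold M" and ch: "is_chart (mtop M) (k, U, \<phi>)"
    and sm: "\<And>x j. x \<in> U \<Longrightarrow> j < k \<Longrightarrow> smooth_real_at M (\<lambda>y. \<phi> y j) x"
    and c0: "(k0, U0, \<phi>0) \<in> maximal_atlas M" "U \<subseteq> U0"
    and inv: "smooth_on k (\<phi> ` U) k0 (\<phi>0 \<circ> inv_into U \<phi>)"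
  shows "(k, U, \<phi>) \<in> maximal_atlas M"
  unfolding maximal_atlas_def
proof (intro CollectI conjI ch ballI)
  fix c assume "c \<in> atlas M"
  then obtain l V \<psi> where c: "c = (l, V, \<psi>)" "(l, V, \<psi>) \<in> atlas M" by (cases c) auto
  note ch' = smooth_manifold_chart[OF M c(2)] and cm = subsetD[OF atlas_subset_maximal[OF M] c(2)]
  note ch0 = maximal_atlas_chart[OF c0(1)]
  have oUV: "openin (mtop M) (U \<inter> V)" using chart_open[OF ch] chart_open[OF ch'] by auto
  have o: "openin (euc k) (\<phi> ` (U \<inter> V))" by (rule chart_open_image[OF ch oUV]) auto
  have o0: "openin (euc k0) (\<phi>0 ` (U \<inter> V))" by (rule chart_open_image[OF ch0 oUV]) (use c0(2) in auto)
  have o': "openin (euc l) (\<psi> ` (U \<inter> V))" by (rule chart_open_image[OF ch' oUV]) auto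
  have "smooth_on k (\<phi> ` (U \<inter> V)) l (\<psi> \<circ> inv_into U \<phi>)" unfolding smooth_on_def
  proof (intro allI impI)
    fix j r assume j: "j < l"
    have "Cr_on r k (\<phi> ` (U \<inter> V)) (\<lambda>z. (\<psi> \<circ> inv_into U0 \<phi>0) ((\<phi>0 \<circ> inv_into U \<phi>) z) j)"
    proof (rule Cr_on_compose[where f="\<lambda>z. (\<psi> \<circ> inv_into U0 \<phi>0) z j", OF o o0])
      show "Cr_on r k0 (\<phi>0 ` (U \<inter> V)) (\<lambda>z. (\<psi> \<circ> inv_into U0 \<phi>0) z j)"
        by (rule Cr_on_mono[of _ _ "\<phi>0 ` (U0 \<inter> V)"])
           (use maximal_atlas_smooth_on[OF M c0(1) cm] j c0(2) in \<open>auto simp: smooth_on_def\<close>)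
      show "Cr_on r k (\<phi> ` (U \<inter> V)) (\<lambda>z. (\<phi>0 \<circ> inv_into U \<phi>) z i)" if "i < k0" for i
        by (rule Cr_on_mono[of _ _ "\<phi> ` U"]) (use inv that in \<open>auto simp: smooth_on_def\<close>)
      show "(\<phi>0 \<circ> inv_into U \<phi>) ` \<phi> ` (U \<inter> V) \<subseteq> \<phi>0 ` (U \<inter> V)" by (auto simp: chart_inv[OF ch])
    qed
    then show "Cr_on r k (\<phi> ` (U \<inter> V)) (\<lambda>z. (\<psi> \<circ> inv_into U \<phi>) z j)"
      by (rule Cr_on_cong[OF o, rotated]) (use c0(2) in \<open>auto simp: chart_inv[OF ch] chart_inv[OF ch0] subset_iff\<close>)
  qed
  moreover have "smooth_on l (\<psi> ` (U \<inter> V)) k (\<phi> \<circ> inv_into V \<psi>)" unfolding smooth_on_def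
  proof (intro allI impI)
    fix j r assume j: "j < k"
    show "Cr_on r l (\<psi> ` (U \<inter> V)) (\<lambda>z. (\<phi> \<circ> inv_into V \<psi>) z j)"
    proof (rule Cr_on_local[OF o'])
      fix z assume "z \<in> \<psi> ` (U \<inter> V)"
      then obtain x where x: "x \<in> U" "x \<in> V" "z = \<psi> x" by blast
      obtain W where W: "openin (mtop M) W" "x \<in> W" "W \<subseteq> V" "\<And>r. Cr_on r l (\<psi> ` W) ((\<lambda>y. \<phi> y j) \<circ> inv_into V \<psi>)"
        using smooth_real_at_chart[OF M sm[OF x(1) j] cm x(2)] by metis
      show "\<exists>V'. openin (euc l) V' \<and> z \<in> V' \<and> Cr_on r l V' (\<lambda>z. (\<phi> \<circ> inv_into V \<psi>) z j)"
        using chart_open_image[OF ch' W(1,3)] W(2,4) x(3) by (intro exI[of _ "\<psi> ` W"]) (auto simp: o_def)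
    qed
  qed
  ultimately show "compatible (k, U, \<phi>) c" by (simp add: c(1) compatible_def)
qed

lemma maximal_atlas_restrict:
  assumes M: "smooth_manifold M" and c: "(k, U, \<phi>) \<in> maximal_atlas M" and V: "openin (mtop M) V" "V \<subseteq> U"
  shows "(k, V, \<phi>) \<in> maximal_atlas M"
proof (rule maximal_atlasI[OF M _ _ c V(2)])
  show ch: "is_chart (mtop M) (k, V, \<phi>)" by (rule is_chart_subset[OF maximal_atlas_chart[OF c] V])
  show "smooth_real_at M (\<lambda>y. \<phi> y j) x" if "x \<in> V" for x j
    by (rule smooth_real_at_coord[OF M c]) (use V that in blast)
  show "smooth_on k (\<phi> ` V) k (\<phi> \<circ> inv_into V \<phi>)" unfolding smooth_on_def
  proof (intro allI impI)
    fix j r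
    show "Cr_on r k (\<phi> ` V) (\<lambda>x. (\<phi> \<circ> inv_into V \<phi>) x j)"
      by (rule Cr_on_cong[OF chart_image_open[OF ch] _ Cr_on_coord[of _ _ _ j]]) (auto simp: chart_inv[OF ch])
  qed
qed

subsection \<open>Curves\<close>

lemma has_real_derivative_cong_ev:
  assumes "(f has_real_derivative D) (at x)" "\<forall>\<^sub>F t in nhds x. f t = g t"
  shows "(g has_real_derivative D) (at x)"
  using DERIV_cong_ev[OF refl assms(2) refl, THEN iffD1, OF assms(1)] .

text \<open>Curves serve as tangent vectors: they do not depend on a choice of charts.\<close>

definition curve_at :: "'a manifold \<Rightarrow> (real \<Rightarrow> 'a) \<Rightarrow> 'a \<Rightarrow> bool" where
  "curve_at M c x \<longleftrightarrow> c 0 = x \<and> (\<forall>W. openin (mtop M) W \<and> x \<in> W \<longrightarrow> (\<forall>\<^sub>F t in nhds 0. c t \<in> W)) \<and>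
     (\<forall>u. smooth_real_at M u x \<longrightarrow> (\<lambda>t. u (c t)) differentiable (at 0))"

lemma curve_chain_rule:
  assumes M: "smooth_manifold M" and c: "curve_at M c x" and u: "smooth_real_at M u x"
    and ch: "(k, U, \<phi>) \<in> maximal_atlas M" "x \<in> U"
    and d: "\<And>i. i < k \<Longrightarrow> ((\<lambda>t. \<phi> (c t) i) has_real_derivative v i) (at 0)"
  shows "((\<lambda>t. u (c t)) has_real_derivative (\<Sum>i<k. partial i (u \<circ> inv_into U \<phi>) (\<phi> x) * v i)) (at 0)"
proof -
  note C = maximal_atlas_chart[OF ch(1)]
  obtain W where W: "openin (mtop M) W" "x \<in> W" "W \<subseteq> U" "\<And>r. Cr_on r k (\<phi> ` W) (u \<circ> inv_into U \<phi>)"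
    using smooth_real_at_chart[OF M u ch] by metis
  have c0: "c 0 = x" and ev: "\<forall>\<^sub>F t in nhds 0. c t \<in> W"
    using c W(1,2) by (auto simp: curve_at_def)
  have "((\<lambda>t. (u \<circ> inv_into U \<phi>) (\<phi> (c t))) has_real_derivative
     (\<Sum>i<k. partial i (u \<circ> inv_into U \<phi>) (\<phi> (c 0)) * v i)) (at 0)"
  proof (rule Cr_on_chain_derivative[OF chart_open_image[OF C W(1,3)] W(4) _ _ d])
    show "\<forall>\<^sub>F t in nhds 0. \<phi> (c t) \<in> espace k"
      using ev by eventually_elim (use W(3) chart_espace[OF C] in blast)
  qed (use c0 W(2) in auto)
  moreover have "\<forall>\<^sub>F t in nhds 0. (u \<circ> inv_into U \<phi>) (\<phi> (c t)) = u (c t)"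
    using ev by eventually_elim (use W(3) chart_inv[OF C] in auto)
  ultimately show ?thesis unfolding c0 by (rule has_real_derivative_cong_ev)
qed

text \<open>The curve is a straight line in the chart. For larger \<open>t\<close> the line may
  leave the image, where \<open>inv_into\<close> is arbitrary; this is why \<open>curve_at\<close>
  only looks at small \<open>t\<close>.\<close>

lemma curve_at_line:
  assumes M: "smooth_manifold M" and ch: "(k, U, \<phi>) \<in> maximal_atlas M" "x \<in> U" and v: "v \<in> espace k"
  obtains c where "curve_at M c x" "\<And>i. ((\<lambda>t. \<phi> (c t) i) has_real_derivative v i) (at 0)"
proof -
  note C = maximal_atlas_chart[OF ch(1)]
  define l where "l t = (\<lambda>i. \<phi> x i + t * v i)" for t
  define c where "c t = inv_into U \<phi> (l t)" for t
  have l0: "l 0 = \<phi> x" by (simp add: l_def)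
  have xe: "\<phi> x \<in> espace k" using chart_espace[OF C] ch(2) by blast
  then have le: "l t \<in> espace k" for t using v by (auto simp: l_def espace_iff)
  have ld: "((\<lambda>t. l t i) has_real_derivative v i) (at 0)" for i
    unfolding l_def by (auto intro!: derivative_eq_intros)
  have lev: "\<forall>\<^sub>F t in nhds 0. l t \<in> Z" if Z: "openin (euc k) Z" "\<phi> x \<in> Z" for Z
  proof -
    have "\<forall>\<^sub>F t in at 0. l t \<in> Z"
    proof (rule continuous_map_Euclidean_at(2)[where y="\<phi> x" and f="\<lambda>_. 0" and V=Z])
      show "((\<lambda>t. l t j) \<longlongrightarrow> \<phi> x j) (at 0)" for j
        using DERIV_isCont[OF ld, of j] by (simp add: isCont_def l0)
    qed (use Z le in auto)
    then show ?thesis using Z(2) l0 by (simp add: eventually_at_filter eventually_nhds_metric) (metis)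
  qed
  have cev: "\<forall>\<^sub>F t in nhds 0. c t \<in> W \<and> \<phi> (c t) = l t" if W: "openin (mtop M) W" "x \<in> W" for W
  proof -
    have "openin (euc k) (\<phi> ` (U \<inter> W))"
      by (rule chart_open_image[OF C]) (use chart_open[OF C] W in auto)
    then have "\<forall>\<^sub>F t in nhds 0. l t \<in> \<phi> ` (U \<inter> W)" using ch(2) W(2) by (intro lev) auto
    then show ?thesis by eventually_elim (auto simp: c_def chart_inv[OF C])
  qed
  have xM: "openin (mtop M) U" by (rule chart_open[OF C])
  have cd: "((\<lambda>t. \<phi> (c t) i) has_real_derivative v i) (at 0)" for i
  proof -
    have "\<forall>\<^sub>F t in nhds 0. l t i = \<phi> (c t) i" using cev[OF xM ch(2)] by eventually_elim simp
    then show ?thesis by (rule has_real_derivative_cong_ev[OF ld])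
  qed
  have c0: "c 0 = x" using ch(2) by (simp add: c_def l0 chart_inv[OF C])
  have "(\<lambda>t. u (c t)) differentiable (at 0)" if u: "smooth_real_at M u x" for u
  proof -
    obtain W where W: "openin (mtop M) W" "x \<in> W" "W \<subseteq> U" "\<And>r. Cr_on r k (\<phi> ` W) (u \<circ> inv_into U \<phi>)"
      using smooth_real_at_chart[OF M u ch] by metis
    have "((\<lambda>t. (u \<circ> inv_into U \<phi>) (l t)) has_real_derivative
       (\<Sum>i<k. partial i (u \<circ> inv_into U \<phi>) (l 0) * v i)) (at 0)"
      by (rule Cr_on_chain_derivative[OF chart_open_image[OF C W(1,3)] W(4) _ _ ld]) (use W(2) l0 le in auto)
    moreover have "(u \<circ> inv_into U \<phi>) (l t) = u (c t)" for t by (simp add: c_def)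
    ultimately show ?thesis using real_differentiable_def by auto
  qed
  moreover have "\<forall>\<^sub>F t in nhds 0. c t \<in> W" if "openin (mtop M) W \<and> x \<in> W" for W
    using cev[of W] that by (auto elim: eventually_mono)
  ultimately have "curve_at M c x" unfolding curve_at_def using c0 by blast
  then show thesis using cd that by blast
qed

lemma curve_at_map:
  assumes M: "smooth_manifold M" and N: "smooth_manifold N" and c: "curve_at M c x" and f: "smooth_at M N f x"
  shows "curve_at N (\<lambda>t. f (c t)) (f x)"
  unfolding curve_at_def
proof (intro conjI allI impI)
  show "f (c 0) = f x" using c by (simp add: curve_at_def)
  fix W assume "openin (mtop N) W \<and> f x \<in> W"
  then obtain V where "openin (mtop M) V" "x \<in> V" "f ` V \<subseteq> W" using smooth_at_preimage[OF f] by metis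
  then have "\<forall>\<^sub>F t in nhds 0. c t \<in> V" using c by (auto simp: curve_at_def)
  then show "\<forall>\<^sub>F t in nhds 0. f (c t) \<in> W" by eventually_elim (use \<open>f ` V \<subseteq> W\<close> in blast)
next
  fix u assume "smooth_real_at N u (f x)"
  from smooth_real_at_smooth_at[OF M N this f] show "(\<lambda>t. u (f (c t))) differentiable at 0"
    using c by (auto simp: curve_at_def)
qed

subsection \<open>Charts extending independent functions\<close>

text \<open>Transfers \<open>coordinate_change\<close> to a manifold: a function with non-zero
  derivative in a coordinate direction can take the place of that coordinate.\<close>

lemma chart_coordinate_change:
  assumes M: "smooth_manifold M" and c: "(k, U, \<phi>) \<in> maximal_atlas M" "x \<in> U"
    and h: "smooth_real_at M h x" and i: "i < k" and nz: "partial i (h \<circ> inv_into U \<phi>) (\<phi> x) \<noteq> 0"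
  obtains W where "(k, W, \<lambda>y. (\<phi> y)(i := h y)) \<in> maximal_atlas M" "x \<in> W" "W \<subseteq> U"
proof -
  note C = maximal_atlas_chart[OF c(1)]
  obtain W0 where W0: "openin (mtop M) W0" "x \<in> W0" "W0 \<subseteq> U" "\<And>r. Cr_on r k (\<phi> ` W0) (h \<circ> inv_into U \<phi>)"
    using smooth_real_at_chart[OF M h c] by metis
  define F where "F = h \<circ> inv_into U \<phi>"
  have "\<phi> x \<in> \<phi> ` W0" using W0(2) by blast
  from coordinate_change[OF chart_open_image[OF C W0(1,3)] W0(4) i this nz]
  obtain Z g where Z: "openin (euc k) Z" "\<phi> x \<in> Z" "Z \<subseteq> \<phi> ` W0"
    "openin (euc k) ((\<lambda>z. z(i := F z)) ` Z)"
    "\<And>z. z \<in> Z \<Longrightarrow> g (z(i := F z)) = z i"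
    "\<And>r. Cr_on r k ((\<lambda>z. z(i := F z)) ` Z) g" unfolding F_def by blast
  define W where "W = {y \<in> U. \<phi> y \<in> Z}"
  define \<phi>' where "\<phi>' y = (\<phi> y)(i := h y)" for y
  have W: "openin (mtop M) W" "x \<in> W" "W \<subseteq> U" unfolding W_def using chart_open_preimage[OF C Z(1)] Z(2) c(2) by auto
  have FW: "F (\<phi> y) = h y" if "y \<in> U" for y using that by (simp add: F_def chart_inv[OF C])
  have WZ: "\<phi> ` W = Z" using Z(3) W0(3) by (auto simp: W_def)
  have im: "\<phi>' ` W = (\<lambda>z. z(i := F z)) ` Z"
    unfolding WZ[symmetric] image_image using FW W(3) by (intro image_cong) (auto simp: \<phi>'_def)
  have gW: "(\<phi>' y)(i := g (\<phi>' y)) = \<phi> y" if "y \<in> W" for y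
  proof -
    have "\<phi> y \<in> Z" "y \<in> U" using that by (auto simp: W_def)
    then show ?thesis using Z(5)[of "\<phi> y"] FW[of y] by (simp add: \<phi>'_def)
  qed
  have W0W: "W \<subseteq> W0"
  proof
    fix y assume y: "y \<in> W"
    then obtain y' where y': "y' \<in> W0" "\<phi> y = \<phi> y'" using Z(3) by (auto simp: W_def)
    have "y = y'" using chart_inj[OF C] y' W0(3) W(3) y by (auto dest: inj_onD)
    then show "y \<in> W0" using y' by simp
  qed
  have hW: "smooth_real_at M h y" if "y \<in> W" for y
    by (rule smooth_real_atI[OF M c(1) W0(1) _ W0(3,4)]) (use that W0W in blast)
  have \<phi>'sm: "smooth_real_at M (\<lambda>y. \<phi>' y j) y" if y: "y \<in> W" for j y
    using hW[OF y] smooth_real_at_coord[OF M c(1), of y j] y W(3) by (cases "j = i") (auto simp: \<phi>'_def)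
  have h0: "continuous_map (subtopology (mtop M) W) euclideanreal h"
  proof -
    have "continuous_map (subtopology (mtop M) W) (euc_on k (\<phi> ` W0)) \<phi>"
      using continuous_map_from_subtopology_mono[OF chart_continuous[OF C] W(3)] W0W by (auto simp: continuous_map_in_subtopology)
    from continuous_map_compose[OF this Cr_on_continuous[OF W0(4)]]
    show ?thesis by (rule continuous_map_eq) (use W(3) in \<open>auto simp: chart_inv[OF C] subset_iff\<close>)
  qed
  have ch': "is_chart (mtop M) (k, W, \<phi>')"
  proof (rule is_chartI[where g="\<lambda>z. inv_into U \<phi> (z(i := g z))"])
    have "\<phi>' y \<in> espace k" if "y \<in> W" for y
      using openin_subset[OF Z(4)] that unfolding im[symmetric] by blast
    then show "continuous_map (subtopology (mtop M) W) (euc k) \<phi>'"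
      using continuous_map_from_subtopology_mono[OF chart_continuous[OF C] W(3)] h0
      unfolding continuous_map_into_Euclidean_space by (auto simp: \<phi>'_def)
    show "openin (euc k) (\<phi>' ` W)" unfolding im by (rule Z(4))
    show "inv_into U \<phi> ((\<phi>' y)(i := g (\<phi>' y))) = y" if "y \<in> W" for y
      using gW[OF that] that W(3) chart_inv[OF C] by auto
    have "continuous_map (euc_on k (\<phi>' ` W)) (euc k) (\<lambda>z. z(i := g z))"
      unfolding continuous_map_into_Euclidean_space
    proof (intro conjI allI impI)
      fix j
      show "continuous_map (euc_on k (\<phi>' ` W)) euclideanreal (\<lambda>z. (z(i := g z)) j)"
        using Cr_on_continuous[OF Cr_on_upd[OF Z(4) Z(6)[of 0]]] unfolding im .
    next
      show "(\<lambda>z. z(i := g z)) ` topspace (euc_on k (\<phi>' ` W)) \<subseteq> espace k"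
        using gW W(3) chart_espace[OF C] by auto
    qed
    then have "continuous_map (euc_on k (\<phi>' ` W)) (euc_on k (\<phi> ` U)) (\<lambda>z. z(i := g z))"
      unfolding continuous_map_in_subtopology using gW W(3) by auto
    from continuous_map_compose[OF this chart_inv_continuous[OF C]]
    show "continuous_map (euc_on k (\<phi>' ` W)) (mtop M) (\<lambda>z. inv_into U \<phi> (z(i := g z)))"
      by (simp add: o_def)
  qed (rule W)
  have "(k, W, \<phi>') \<in> maximal_atlas M"
  proof (rule maximal_atlasI[OF M ch' \<phi>'sm c(1) W(3)])
    show "smooth_on k (\<phi>' ` W) k (\<phi> \<circ> inv_into W \<phi>')" unfolding smooth_on_def
    proof (intro allI impI)
      fix j r
      show "Cr_on r k (\<phi>' ` W) (\<lambda>x. (\<phi> \<circ> inv_into W \<phi>') x j)"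
      proof (rule Cr_on_cong[OF chart_image_open[OF ch']])
        show "Cr_on r k (\<phi>' ` W) (\<lambda>z. (z(i := g z)) j)" unfolding im by (rule Cr_on_upd[OF Z(4) Z(6)])
        fix z assume "z \<in> \<phi>' ` W"
        then obtain y where "y \<in> W" "z = \<phi>' y" by blast
        then show "(z(i := g z)) j = (\<phi> \<circ> inv_into W \<phi>') z j" by (simp only: gW chart_inv[OF ch'] o_apply)
      qed
    qed
  qed
  moreover have "\<phi>' = (\<lambda>y. (\<phi> y)(i := h y))" by (simp add: \<phi>'_def fun_eq_iff)
  ultimately show thesis using that W by simp
qed

text \<open>Needed to move chosen coordinates to the end, the place where slice charts have the
  coordinates that vanish on the submanifold.\<close>

lemma chart_permute:
  assumes M: "smooth_manifold M" and c: "(k, U, \<phi>) \<in> maximal_atlas M" and p: "bij_betw p {..<k} {..<k}"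
  shows "(k, U, \<lambda>y m. if m < k then \<phi> y (p m) else 0) \<in> maximal_atlas M"
proof -
  note C = maximal_atlas_chart[OF c]
  let ?q = "inv_into {..<k} p"
  define \<phi>' where "\<phi>' y = (\<lambda>m. if m < k then \<phi> y (p m) else 0)" for y
  define Q where "Q z = (\<lambda>m. if m < k then z (?q m) else 0)" for z :: "nat \<Rightarrow> real"
  have pq: "p (?q m) = m" "?q m < k" "?q (p m) = m" "p m < k" if "m < k" for m
    using that bij_betw_inv_into_right[OF p] bij_betw_inv_into_left[OF p] bij_betwE[OF p] bij_betwE[OF bij_betw_inv_into[OF p]] by auto
  have Q: "Q (\<phi>' y) = \<phi> y" if "y \<in> U" for y
  proof -
    have "\<phi> y \<in> espace k" using chart_espace[OF C] that by blast
    then show ?thesis using pq by (auto simp: Q_def \<phi>'_def espace_iff fun_eq_iff)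
  qed
  have cQ: "continuous_map (euc k) (euc k) Q"
    using continuous_map_coordinate_Euclidean[of k UNIV]
    by (auto simp: continuous_map_into_Euclidean_space Q_def espace_iff)
  have im: "\<phi>' ` U = {z \<in> espace k. Q z \<in> \<phi> ` U}"
  proof (intro equalityI subsetI)
    fix z assume "z \<in> \<phi>' ` U" then show "z \<in> {z \<in> espace k. Q z \<in> \<phi> ` U}" using Q by (auto simp: \<phi>'_def espace_iff)
  next
    fix z assume z: "z \<in> {z \<in> espace k. Q z \<in> \<phi> ` U}"
    then obtain y where y: "y \<in> U" "Q z = \<phi> y" by blast
    have "z m = \<phi>' y m" for m
      using z fun_cong[OF y(2), of "p m"] pq by (cases "m < k") (auto simp: \<phi>'_def Q_def espace_iff)
    then show "z \<in> \<phi>' ` U" using y(1) by blast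
  qed
  have ch': "is_chart (mtop M) (k, U, \<phi>')"
  proof (rule is_chartI[where g="inv_into U \<phi> \<circ> Q"])
    show "continuous_map (subtopology (mtop M) U) (euc k) \<phi>'"
      using chart_continuous[OF C] pq(4) unfolding continuous_map_into_Euclidean_space by (auto simp: \<phi>'_def espace_iff)
    show "openin (euc k) (\<phi>' ` U)"
      unfolding im by (rule openin_continuous_map_preimage[OF cQ chart_image_open[OF C]])
    have "continuous_map (euc_on k (\<phi>' ` U)) (euc_on k (\<phi> ` U)) Q"
      unfolding continuous_map_in_subtopology using Q by (auto intro: continuous_map_from_subtopology cQ)
    then show "continuous_map (euc_on k (\<phi>' ` U)) (mtop M) (inv_into U \<phi> \<circ> Q)"
      by (rule continuous_map_compose[OF _ chart_inv_continuous[OF C]])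
    show "(inv_into U \<phi> \<circ> Q) (\<phi>' y) = y" if "y \<in> U" for y using that Q chart_inv[OF C] by simp
  qed (rule chart_open[OF C])
  have "(k, U, \<phi>') \<in> maximal_atlas M"
  proof (rule maximal_atlasI[OF M ch' _ c subset_refl])
    show "smooth_real_at M (\<lambda>y. \<phi>' y j) x" if "x \<in> U" "j < k" for x j
      using smooth_real_at_coord[OF M c that(1), of "p j"] that(2) by (simp add: \<phi>'_def)
    show "smooth_on k (\<phi>' ` U) k (\<phi> \<circ> inv_into U \<phi>')" unfolding smooth_on_def
    proof (intro allI impI)
      fix j r
      show "Cr_on r k (\<phi>' ` U) (\<lambda>x. (\<phi> \<circ> inv_into U \<phi>') x j)"
      proof (rule Cr_on_cong[OF chart_image_open[OF ch']])
        show "Cr_on r k (\<phi>' ` U) (\<lambda>z. Q z j)" unfolding Q_def by (rule Cr_on_if_coord)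
      qed (use Q in \<open>auto simp: chart_inv[OF ch']\<close>)
    qed
  qed
  moreover have "\<phi>' = (\<lambda>y m. if m < k then \<phi> y (p m) else 0)" by (simp add: \<phi>'_def fun_eq_iff)
  ultimately show ?thesis by simp
qed

text \<open>An exchange argument: the functions replace coordinates one after the other.
  Independence is given in triangular form, by a curve along which \<open>h m\<close> has speed one
  and the earlier functions are stationary; this guarantees that the coordinate given up for
  \<open>h m\<close> is not one of those already exchanged.\<close>

lemma chart_with_coordinates:
  assumes M: "smooth_manifold M" and x: "x \<in> pts M"
    and h: "\<And>j. j < l \<Longrightarrow> smooth_real_at M (h j) x"
    and ind: "\<And>m. m < l \<Longrightarrow> \<exists>c. curve_at M c x \<and> (\<forall>j\<le>m. ((\<lambda>t. h j (c t)) has_real_derivative (if j = m then 1 else 0)) (at 0))"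
    and W: "openin (mtop M) W" "x \<in> W"
  obtains k U \<phi> where "(k, U, \<phi>) \<in> maximal_atlas M" "x \<in> U" "U \<subseteq> W" "l \<le> k"
    "\<And>y j. y \<in> U \<Longrightarrow> j < l \<Longrightarrow> \<phi> y (k - l + j) = h j y"
proof -
  have "\<exists>k U \<phi> \<sigma>. (k, U, \<phi>) \<in> maximal_atlas M \<and> x \<in> U \<and> U \<subseteq> W \<and> inj_on \<sigma> {..<m} \<and> \<sigma> ` {..<m} \<subseteq> {..<k} \<and>
     (\<forall>y\<in>U. \<forall>j<m. \<phi> y (\<sigma> j) = h j y)" if "m \<le> l" for m
    using that
  proof (induction m)
    case 0
    obtain k U \<phi> where U: "(k, U, \<phi>) \<in> atlas M" "x \<in> U" using smooth_manifold_chart_at[OF M x] by blast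
    have c: "(k, U, \<phi>) \<in> maximal_atlas M" using U(1) atlas_subset_maximal[OF M] by blast
    have "(k, U \<inter> W, \<phi>) \<in> maximal_atlas M"
      by (rule maximal_atlas_restrict[OF M c]) (use chart_open[OF maximal_atlas_chart[OF c]] W in auto)
    then show ?case using U(2) W(2) by fastforce
  next
    case (Suc m)
    then obtain k U \<phi> \<sigma> where c: "(k, U, \<phi>) \<in> maximal_atlas M" "x \<in> U" and UW: "U \<subseteq> W"
      and \<sigma>: "inj_on \<sigma> {..<m}" "\<sigma> ` {..<m} \<subseteq> {..<k}" and eq: "\<And>y j. y \<in> U \<Longrightarrow> j < m \<Longrightarrow> \<phi> y (\<sigma> j) = h j y" by auto
    obtain b where b: "curve_at M b x" "\<And>j. j \<le> m \<Longrightarrow> ((\<lambda>t. h j (b t)) has_real_derivative (if j = m then 1 else 0)) (at 0)"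
      using ind[of m] Suc.prems by auto
    have "(\<lambda>t. \<phi> (b t) i) differentiable (at 0)" for i
      using b(1) smooth_real_at_coord[OF M c] by (auto simp: curve_at_def)
    then obtain v where v: "\<And>i. ((\<lambda>t. \<phi> (b t) i) has_real_derivative v i) (at 0)"
      unfolding real_differentiable_def by metis
    \<comment> \<open>The earlier functions are coordinates by now, and the curve is stationary in
      them.\<close>
    have v0: "v (\<sigma> j) = 0" if j: "j < m" for j
    proof -
      have "\<forall>\<^sub>F t in nhds 0. b t \<in> U" using b(1) chart_open[OF maximal_atlas_chart[OF c(1)]] c(2) by (auto simp: curve_at_def)
      then have "\<forall>\<^sub>F t in nhds 0. \<phi> (b t) (\<sigma> j) = h j (b t)" by eventually_elim (use eq j in auto)
      then have "((\<lambda>t. h j (b t)) has_real_derivative v (\<sigma> j)) (at 0)"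
        by (rule has_real_derivative_cong_ev[OF v])
      then show ?thesis using DERIV_unique b(2)[of j] j by force
    qed
    have hm: "smooth_real_at M (h m) x" using h Suc.prems by simp
    have "((\<lambda>t. h m (b t)) has_real_derivative (\<Sum>i<k. partial i (h m \<circ> inv_into U \<phi>) (\<phi> x) * v i)) (at 0)"
      by (rule curve_chain_rule[OF M b(1) hm c v])
    moreover have "((\<lambda>t. h m (b t)) has_real_derivative 1) (at 0)" using b(2)[of m] by simp
    ultimately have "(\<Sum>i<k. partial i (h m \<circ> inv_into U \<phi>) (\<phi> x) * v i) = 1" using DERIV_unique by blast
    \<comment> \<open>A sum equal to 1 has a non-zero term. It cannot belong to an exchanged
      coordinate, where the velocity vanishes.\<close>
    then obtain i where i: "i < k" "partial i (h m \<circ> inv_into U \<phi>) (\<phi> x) * v i \<noteq> 0"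
      by (metis (no_types, lifting) lessThan_iff sum.neutral zero_neq_one)
    then have i': "partial i (h m \<circ> inv_into U \<phi>) (\<phi> x) \<noteq> 0" "i \<notin> \<sigma> ` {..<m}" using v0 by auto
    obtain W' where W': "(k, W', \<lambda>y. (\<phi> y)(i := h m y)) \<in> maximal_atlas M" "x \<in> W'" "W' \<subseteq> U"
      by (rule chart_coordinate_change[OF M c hm i(1) i'(1)])
    show ?case
    proof (intro exI conjI)
      show "(k, W', \<lambda>y. (\<phi> y)(i := h m y)) \<in> maximal_atlas M" "x \<in> W'" by (fact W')+
      show "W' \<subseteq> W" using W' UW by blast
      show "inj_on (\<sigma>(m := i)) {..<Suc m}" "(\<sigma>(m := i)) ` {..<Suc m} \<subseteq> {..<k}"
        using \<sigma> i(1) i'(2) by (auto simp: inj_on_def less_Suc_eq image_subset_iff)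
      show "\<forall>y\<in>W'. \<forall>j<Suc m. ((\<phi> y)(i := h m y)) ((\<sigma>(m := i)) j) = h j y"
        using W'(3) eq i'(2) by (auto simp: less_Suc_eq)
    qed
  qed
  from this[of l] obtain k U \<phi> \<sigma> where c: "(k, U, \<phi>) \<in> maximal_atlas M" "x \<in> U" and UW: "U \<subseteq> W"
      and \<sigma>: "inj_on \<sigma> {..<l}" "\<sigma> ` {..<l} \<subseteq> {..<k}" and eq: "\<And>y j. y \<in> U \<Longrightarrow> j < l \<Longrightarrow> \<phi> y (\<sigma> j) = h j y" by auto
  have lk: "l \<le> k" using card_inj_on_le[OF \<sigma>] by simp
  have "card ({..<k} - \<sigma> ` {..<l}) = k - l" using \<sigma> by (simp add: card_Diff_subset card_image)
  then obtain p0 where p0: "bij_betw p0 {0..<k - l} ({..<k} - \<sigma> ` {..<l})"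
    using ex_bij_betw_nat_finite[of "{..<k} - \<sigma> ` {..<l}"] by auto
  \<comment> \<open>The first \<open>k - l\<close> places list the untouched coordinates, the last
    \<open>l\<close> places the given functions in order.\<close>
  define p where "p m = (if m < k - l then p0 m else \<sigma> (m - (k - l)))" for m
  have "bij_betw p {0..<k - l} ({..<k} - \<sigma> ` {..<l})"
    using p0 by (rule bij_betw_cong[THEN iffD1, rotated]) (auto simp: p_def)
  moreover have "bij_betw p {k - l..<k} (\<sigma> ` {..<l})"
    unfolding bij_betw_def
  proof
    show "inj_on p {k - l..<k}"
    proof (rule inj_onI)
      fix a b assume "a \<in> {k - l..<k}" "b \<in> {k - l..<k}" "p a = p b"
      then have "\<sigma> (a - (k - l)) = \<sigma> (b - (k - l))" "a - (k - l) \<in> {..<l}" "b - (k - l) \<in> {..<l}" using lk by (auto simp: p_def)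
      then have "a - (k - l) = b - (k - l)" by (rule inj_onD[OF \<sigma>(1)])
      then show "a = b" using \<open>a \<in> _\<close> \<open>b \<in> _\<close> by auto
    qed
    show "p ` {k - l..<k} = \<sigma> ` {..<l}"
    proof (intro equalityI subsetI)
      fix y assume "y \<in> \<sigma> ` {..<l}"
      then obtain j where "j < l" "y = \<sigma> j" by blast
      then show "y \<in> p ` {k - l..<k}" using lk by (intro image_eqI[of _ _ "k - l + j"]) (auto simp: p_def)
    qed (auto simp: p_def)
  qed
  ultimately have "bij_betw p ({0..<k - l} \<union> {k - l..<k}) (({..<k} - \<sigma> ` {..<l}) \<union> \<sigma> ` {..<l})"
    by (rule bij_betw_combine) auto
  moreover have "{0..<k - l} \<union> {k - l..<k} = {..<k}" "({..<k} - \<sigma> ` {..<l}) \<union> \<sigma> ` {..<l} = {..<k}"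
    using lk \<sigma>(2) by auto
  ultimately have p: "bij_betw p {..<k} {..<k}" by simp
  show thesis
  proof (rule that[OF chart_permute[OF M c(1) p] c(2) UW lk])
    fix y j assume "y \<in> U" "j < l"
    moreover from this have "k - l + j < k" "\<not> k - l + j < k - l" "k - l + j - (k - l) = j" using lk by auto
    ultimately show "(if k - l + j < k then \<phi> y (p (k - l + j)) else 0) = h j y"
      using eq[of y j] by (simp add: p_def del: diff_add_assoc2 Nat.add_diff_assoc2)
  qed
qed

subsection \<open>Submersions\<close>

lemma smooth_at_const:
  assumes M: "smooth_manifold M" and N: "smooth_manifold N" and x: "x \<in> pts M" and y: "y \<in> pts N"
  shows "smooth_at M N (\<lambda>_. y) x"
proof (rule smooth_at_unfoldI[OF openin_topspace x])
  show "continuous_map (subtopology (mtop M) (pts M)) (mtop N) (\<lambda>_. y)" using y by simp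
  obtain k U \<phi> where U: "(k, U, \<phi>) \<in> atlas M" "x \<in> U" using smooth_manifold_chart_at[OF M x] by blast
  note c = subsetD[OF atlas_subset_maximal[OF M] U(1)]
  show "smooth_real_at M (\<lambda>z. \<psi> y j) x" for \<psi> :: "'b \<Rightarrow> nat \<Rightarrow> real" and j
    by (rule smooth_real_atI[OF M c chart_open[OF maximal_atlas_chart[OF c]] U(2) subset_refl])
       (simp add: o_def Cr_on_const)
qed

text \<open>The Jacobian condition in terms of curves: every velocity in a chart of the target is
  realised by a curve in the source. In this form it no longer refers to a chart of the
  source.\<close>

lemma submersion_curve:
  assumes M: "smooth_manifold M" and N: "smooth_manifold N" and f: "submersion M N f"
    and x: "x \<in> pts M" and V: "(l, V, \<psi>) \<in> atlas N" "f x \<in> V" and w: "w \<in> espace l"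
  obtains c where "curve_at M c x" "\<And>j. j < l \<Longrightarrow> ((\<lambda>t. \<psi> (f (c t)) j) has_real_derivative w j) (at 0)"
proof -
  obtain k U \<phi> where U: "(k, U, \<phi>) \<in> atlas M" "x \<in> U" using smooth_manifold_chart_at[OF M x] by blast
  note c = subsetD[OF atlas_subset_maximal[OF M] U(1)]
  have "\<exists>v\<in>espace k. \<forall>j<l. (\<Sum>i<k. partial i (\<lambda>y. (\<psi> \<circ> f \<circ> inv_into U \<phi>) y j) (\<phi> x) * v i) = w j"
    using f U V w unfolding submersion_def by blast
  then obtain v where v: "v \<in> espace k" "\<And>j. j < l \<Longrightarrow> (\<Sum>i<k. partial i (\<lambda>y. (\<psi> \<circ> f \<circ> inv_into U \<phi>) y j) (\<phi> x) * v i) = w j"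
    by blast
  obtain b where b: "curve_at M b x" "\<And>i. ((\<lambda>t. \<phi> (b t) i) has_real_derivative v i) (at 0)"
    using curve_at_line[OF M c U(2) v(1)] by blast
  have sf: "smooth_at M N f x" using f smooth_map_at[OF M N _ x] by (simp add: submersion_def)
  have "((\<lambda>t. \<psi> (f (b t)) j) has_real_derivative w j) (at 0)" if j: "j < l" for j
    using curve_chain_rule[OF M b(1) smooth_atD[OF sf V j] c U(2) b(2)] v(2)[OF j] by (simp add: o_def)
  then show thesis using that b(1) by blast
qed

lemma unit_vector_espace: "m < l \<Longrightarrow> (\<lambda>j. if j = m then 1 else 0) \<in> espace l"
  by (simp add: espace_iff)

definition local_section :: "'a manifold \<Rightarrow> 'b manifold \<Rightarrow> ('a \<Rightarrow> 'b) \<Rightarrow> 'a \<Rightarrow> ('b \<Rightarrow> 'a) \<Rightarrow> bool" where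
  "local_section M N f x s \<longleftrightarrow> smooth_at N M s (f x) \<and> s (f x) = x \<and>
     (\<exists>W. openin (mtop N) W \<and> f x \<in> W \<and> (\<forall>y\<in>W. f (s y) = y))"

text \<open>The components of \<open>f\<close> in a chart of the target are independent, so they can
  be completed to a chart of the source. In that chart \<open>f\<close> is a projection, and
  freezing the complementary coordinates at their values at \<open>x\<close> gives the
  section.\<close>

lemma submersion_local_section:
  assumes M: "smooth_manifold M" and N: "smooth_manifold N" and f: "submersion M N f" and x: "x \<in> pts M"
  obtains s where "local_section M N f x s"
proof -
  have sf: "smooth_at M N f x" using f smooth_map_at[OF M N _ x] by (simp add: submersion_def)
  obtain l V \<psi> where V: "(l, V, \<psi>) \<in> atlas N" "f x \<in> V"
    using smooth_manifold_chart_at[OF N smooth_at_pts(2)[OF sf]] by blast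
  note cV = subsetD[OF atlas_subset_maximal[OF N] V(1)] and chV = smooth_manifold_chart[OF N V(1)]
  obtain W where W: "openin (mtop M) W" "x \<in> W" "f ` W \<subseteq> V"
    using smooth_at_preimage[OF sf chart_open[OF chV] V(2)] by metis
  have ind: "\<exists>c. curve_at M c x \<and> (\<forall>j\<le>m. ((\<lambda>t. \<psi> (f (c t)) j) has_real_derivative (if j = m then 1 else 0)) (at 0))"
    if m: "m < l" for m
  proof -
    obtain c where "curve_at M c x" "\<And>j. j < l \<Longrightarrow> ((\<lambda>t. \<psi> (f (c t)) j) has_real_derivative (if j = m then 1 else 0)) (at 0)"
      by (rule submersion_curve[OF M N f x V unit_vector_espace[OF m]]) (rule that)
    then show ?thesis using m by (meson le_less_trans)
  qed
  obtain k U \<phi> where c: "(k, U, \<phi>) \<in> maximal_atlas M" "x \<in> U" "U \<subseteq> W" "l \<le> k"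
    "\<And>y j. y \<in> U \<Longrightarrow> j < l \<Longrightarrow> \<phi> y (k - l + j) = \<psi> (f y) j"
    using chart_with_coordinates[where h="\<lambda>j y. \<psi> (f y) j", OF M x smooth_atD[OF sf V] ind W(1,2)] by metis
  note ch = maximal_atlas_chart[OF c(1)]
  \<comment> \<open>The first \<open>k - l\<close> coordinates are frozen at \<open>x\<close>; the
    last \<open>l\<close>, which represent \<open>f\<close>, are read off from
    \<open>y\<close>.\<close>
  define L where "L y = (\<lambda>i. if i < k - l then \<phi> x i else if i < k then \<psi> y (i - (k - l)) else 0)" for y
  define s where "s y = inv_into U \<phi> (L y)" for y
  have xe: "\<phi> x \<in> espace k" using chart_espace[OF ch] c(2) by blast
  have Lx: "L (f x) = \<phi> x"
  proof
    fix i
    show "L (f x) i = \<phi> x i"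
      using c(4) c(5)[OF c(2), of "i - (k - l)"] xe by (auto simp: L_def espace_iff)
  qed
  have Lc: "continuous_map (subtopology (mtop N) V) (euc k) L"
    unfolding continuous_map_into_Euclidean_space
  proof (intro conjI allI impI)
    fix i assume "i < k"
    then show "continuous_map (subtopology (mtop N) V) euclideanreal (\<lambda>x. L x i)"
      using chart_continuous[OF chV] c(4) unfolding continuous_map_into_Euclidean_space L_def by auto
  qed (auto simp: L_def espace_iff)
  define Z where "Z = {y \<in> topspace (subtopology (mtop N) V). L y \<in> \<phi> ` U}"
  have Z: "openin (mtop N) Z" "Z \<subseteq> V"
    using continuous_map_open_union[OF chart_open[OF chV] openin_continuous_map_preimage[OF Lc chart_image_open[OF ch]]]
    unfolding Z_def by auto
  have xZ: "f x \<in> Z" using V chart_subset[OF chV] Lx c(2) by (auto simp: Z_def)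
  have sZ: "s y \<in> U" "\<phi> (s y) = L y" if "y \<in> Z" for y
    using that by (auto simp: Z_def s_def chart_inv[OF ch])
  have fs: "f (s y) = y" if y: "y \<in> Z" for y
  proof -
    have fV: "f (s y) \<in> V" "y \<in> V" using sZ(1)[OF y] c(3) W(3) y Z(2) by auto
    then have e: "\<psi> (f (s y)) \<in> espace l" "\<psi> y \<in> espace l" using chart_espace[OF chV] by blast+
    have "\<psi> (f (s y)) j = \<psi> y j" for j
    proof (cases "j < l")
      case True
      then have "\<psi> (f (s y)) j = L y (k - l + j)" using c(5)[OF sZ(1)[OF y] True] sZ(2)[OF y] by simp
      moreover have "k - l + j < k" "\<not> k - l + j < k - l" "k - l + j - (k - l) = j" using c(4) True by auto
      ultimately show ?thesis unfolding L_def by presburger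
    qed (use e in \<open>simp add: espace_iff\<close>)
    then have "\<psi> (f (s y)) = \<psi> y" by blast
    then show ?thesis using chart_inj[OF chV] fV by (auto dest: inj_onD)
  qed
  have "smooth_at N M s (f x)"
  proof (rule smooth_atI[OF N M Z(1) xZ _ c(1)])
    have "continuous_map (subtopology (mtop N) Z) (euc_on k (\<phi> ` U)) L"
      unfolding continuous_map_in_subtopology
      using continuous_map_from_subtopology_mono[OF Lc Z(2)] by (auto simp: Z_def)
    from continuous_map_compose[OF this chart_inv_continuous[OF ch]]
    show "continuous_map (subtopology (mtop N) Z) (mtop M) s" by (simp add: s_def[abs_def] o_def)
    show "s (f x) \<in> U" by (rule sZ(1)[OF xZ])
    fix i assume i: "i < k"
    have "smooth_real_at N (\<lambda>y. L y i) (f x)"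
    proof (cases "i < k - l")
      case True
      have "smooth_real_at N (\<lambda>y. \<phi> x i) (f x)"
        by (rule smooth_real_atI[OF N cV chart_open[OF chV] V(2) subset_refl]) (simp add: o_def Cr_on_const)
      then show ?thesis using True by (simp add: L_def)
    next
      case False
      then show ?thesis using smooth_real_at_coord[OF N cV V(2), of "i - (k - l)"] i by (simp add: L_def)
    qed
    then show "smooth_real_at N (\<lambda>y. \<phi> (s y) i) (f x)"
      by (rule smooth_real_at_cong[OF N _ Z(1) xZ]) (simp add: sZ)
  qed
  moreover have "s (f x) = x" using c(2) by (simp add: s_def Lx chart_inv[OF ch])
  ultimately show thesis using that Z(1) xZ fs unfolding local_section_def by blast
qed

text \<open>To solve the Jacobian equation for \<open>w\<close>, take a curve through
  \<open>f x\<close> with velocity \<open>w\<close> and lift it by the section. The velocity of the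
  lifted curve is a solution by the chain rule.\<close>

lemma submersionI:
  assumes M: "smooth_manifold M" and N: "smooth_manifold N" and f: "\<And>x. x \<in> pts M \<Longrightarrow> smooth_at M N f x"
    and s: "\<And>x. x \<in> pts M \<Longrightarrow> \<exists>s. local_section M N f x s"
  shows "submersion M N f"
  unfolding submersion_def
proof (intro conjI ballI, goal_cases)
  case 1
  show ?case using smooth_map_iff_smooth_at[OF M N] f by blast
next
  case (2 c)
  obtain k U \<phi> where c: "c = (k, U, \<phi>)" by (cases c) auto
  have "\<exists>v\<in>espace k. \<forall>j<l. (\<Sum>i<k. partial i (\<lambda>y. (\<psi> \<circ> f \<circ> inv_into U \<phi>) y j) (\<phi> x) * v i) = w j"
    if V: "(l, V, \<psi>) \<in> atlas N" and x: "x \<in> U" "f x \<in> V" and w: "w \<in> espace l" for l V \<psi> x w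
  proof -
    have U: "(k, U, \<phi>) \<in> atlas M" using 2 c by simp
    note cU = subsetD[OF atlas_subset_maximal[OF M] U] and cV = subsetD[OF atlas_subset_maximal[OF N] V]
    have xM: "x \<in> pts M" using chart_subset[OF maximal_atlas_chart[OF cU]] x by blast
    obtain s W where s: "smooth_at N M s (f x)" "s (f x) = x" and W: "openin (mtop N) W" "f x \<in> W" "\<And>y. y \<in> W \<Longrightarrow> f (s y) = y"
      using s[OF xM] unfolding local_section_def by blast
    obtain b where b: "curve_at N b (f x)" "\<And>i. ((\<lambda>t. \<psi> (b t) i) has_real_derivative w i) (at 0)"
      using curve_at_line[OF N cV x(2) w] by blast
    have sb: "curve_at M (\<lambda>t. s (b t)) x" using curve_at_map[OF N M b(1) s(1)] s(2) by simp
    have "(\<lambda>t. \<phi> (s (b t)) i) differentiable (at 0)" for i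
      using sb smooth_real_at_coord[OF M cU x(1)] by (auto simp: curve_at_def)
    then obtain v where v: "\<And>i. ((\<lambda>t. \<phi> (s (b t)) i) has_real_derivative v i) (at 0)"
      unfolding real_differentiable_def by metis
    have "(\<Sum>i<k. partial i (\<lambda>y. (\<psi> \<circ> f \<circ> inv_into U \<phi>) y j) (\<phi> x) * v i) = w j" if j: "j < l" for j
    proof -
      have "((\<lambda>t. \<psi> (f (s (b t))) j) has_real_derivative (\<Sum>i<k. partial i ((\<lambda>y. \<psi> (f y) j) \<circ> inv_into U \<phi>) (\<phi> x) * v i)) (at 0)"
        by (rule curve_chain_rule[where u="\<lambda>y. \<psi> (f y) j", OF M sb smooth_atD[OF f[OF xM] V x(2) j] cU x(1) v])
      moreover have "\<forall>\<^sub>F t in nhds 0. b t \<in> W" using b(1) W by (auto simp: curve_at_def)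
      then have "\<forall>\<^sub>F t in nhds 0. \<psi> (b t) j = \<psi> (f (s (b t))) j" by eventually_elim (simp add: W(3))
      then have "((\<lambda>t. \<psi> (f (s (b t))) j) has_real_derivative w j) (at 0)"
        by (rule has_real_derivative_cong_ev[OF b(2)])
      ultimately show ?thesis using DERIV_unique by (fastforce simp: o_def)
    qed
    \<comment> \<open>Cutting the velocity off at \<open>k\<close> puts it into
      \<open>k\<close>-space and leaves the sum unchanged.\<close>
    moreover have "(\<Sum>i<k. a i * (if i < k then v i else 0)) = (\<Sum>i<k. a i * v i)" for a :: "nat \<Rightarrow> real"
      by (intro sum.cong) auto
    ultimately show ?thesis
      by (intro bexI[of _ "\<lambda>i. if i < k then v i else 0"]) (auto simp: espace_iff)
  qed
  then show ?case by (auto simp: c)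
qed

subsection \<open>Fibre products\<close>

lemma mtop_fibre_product:
  "mtop (fibre_product M f N g) = subtopology (prod_topology (mtop M) (mtop N)) {(x, y). x \<in> pts M \<and> y \<in> pts N \<and> f x = g y}"
  by (simp add: fibre_product_def mtop_embedded_submanifold prod_manifold_def)

lemma pts_fibre_product: "pts (fibre_product M f N g) = {(x, y). x \<in> pts M \<and> y \<in> pts N \<and> f x = g y}"
  by (auto simp: mtop_fibre_product)

context
  fixes M :: "'a manifold" and N :: "'b manifold" and B :: "'c manifold" and f :: "'a \<Rightarrow> 'c" and g :: "'b \<Rightarrow> 'c"
  assumes M: "smooth_manifold M" and N: "smooth_manifold N" and B: "smooth_manifold B"
    and f: "submersion M B f" and g: "smooth_map N B g"
begin

text \<open>The fibre product is locally the zero set of the differences of the components of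
  \<open>f\<close> and \<open>g\<close>. These are independent because \<open>f\<close> alone is a
  submersion, so they can serve as the last coordinates of a chart of the product, which is then a
  slice chart.\<close>

lemma fibre_product_slice:
  assumes p: "p \<in> pts (prod_manifold M N)" "p \<in> {(x, y). x \<in> pts M \<and> y \<in> pts N \<and> f x = g y}"
  shows "\<exists>r k U \<phi>. (k, U, \<phi>) \<in> maximal_atlas (prod_manifold M N) \<and> r \<le> k \<and> p \<in> U \<and>
     \<phi> ` (U \<inter> {(x, y). x \<in> pts M \<and> y \<in> pts N \<and> f x = g y}) = \<phi> ` U \<inter> espace r"
proof -
  let ?P = "prod_manifold M N"
  let ?S = "{(x, y). x \<in> pts M \<and> y \<in> pts N \<and> f x = g y}"
  obtain x y where xy: "p = (x, y)" "x \<in> pts M" "y \<in> pts N" "f x = g y" using p(2) by auto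
  note P = smooth_manifold_prod[OF M N]
  have sf: "smooth_at ?P B (\<lambda>q. f (fst q)) (x, y)"
    by (rule smooth_at_compose[OF P M smooth_at_fst_snd(1)[OF M N xy(2,3)]])
       (use smooth_map_at[OF M B _ xy(2)] f in \<open>simp add: submersion_def\<close>)
  have sg: "smooth_at ?P B (\<lambda>q. g (snd q)) (x, y)"
    by (rule smooth_at_compose[OF P N smooth_at_fst_snd(2)[OF M N xy(2,3)]])
       (use smooth_map_at[OF N B g xy(3)] in simp)
  obtain l V \<psi> where V: "(l, V, \<psi>) \<in> atlas B" "f x \<in> V"
    using smooth_manifold_chart_at[OF B smooth_at_pts(2)[OF sf]] by auto
  note chV = smooth_manifold_chart[OF B V(1)]
  define h where "h j q = \<psi> (f (fst q)) j - \<psi> (g (snd q)) j" for j q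
  have pP: "(x, y) \<in> pts ?P" using p(1) xy(1) by simp
  have h: "smooth_real_at ?P (h j) (x, y)" if j: "j < l" for j
    unfolding h_def
    by (rule smooth_real_at_diff[OF P _ _ pP])
       (use smooth_atD[OF sf V(1) _ j] smooth_atD[OF sg V(1) _ j] V(2) xy(4) in auto)
  have ind: "\<exists>c. curve_at ?P c (x, y) \<and> (\<forall>j\<le>m. ((\<lambda>t. h j (c t)) has_real_derivative (if j = m then 1 else 0)) (at 0))"
    if m: "m < l" for m
  proof -
    obtain c where c: "curve_at M c x" "\<And>j. j < l \<Longrightarrow> ((\<lambda>t. \<psi> (f (c t)) j) has_real_derivative (if j = m then 1 else 0)) (at 0)"
      by (rule submersion_curve[OF M B f xy(2) V unit_vector_espace[OF m]]) (rule that)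
    \<comment> \<open>Only the first factor moves, so the contribution of \<open>g\<close> is
      constant along the curve.\<close>
    have "smooth_at M ?P (\<lambda>z. (z, y)) x"
      by (rule smooth_at_Pair[OF M N M smooth_at_id[OF M xy(2)] smooth_at_const[OF M N xy(2,3)]])
    from curve_at_map[OF M P c(1) this] have "curve_at ?P (\<lambda>t. (c t, y)) (x, y)" .
    moreover have "((\<lambda>t. h j (c t, y)) has_real_derivative (if j = m then 1 else 0)) (at 0)" if "j \<le> m" for j
      unfolding h_def using DERIV_diff[OF c(2)[of j] DERIV_const] that m by simp
    ultimately show ?thesis by blast
  qed
  obtain W1 where W1: "openin (mtop ?P) W1" "(x, y) \<in> W1" "(\<lambda>q. f (fst q)) ` W1 \<subseteq> V"
  proof (rule smooth_at_preimage[OF sf chart_open[OF chV]])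
    show "f (fst (x, y)) \<in> V" using V(2) by simp
  qed (rule that)
  obtain W2 where W2: "openin (mtop ?P) W2" "(x, y) \<in> W2" "(\<lambda>q. g (snd q)) ` W2 \<subseteq> V"
  proof (rule smooth_at_preimage[OF sg chart_open[OF chV]])
    show "g (snd (x, y)) \<in> V" using V(2) xy(4) by simp
  qed (rule that)
  obtain k U \<phi> where c: "(k, U, \<phi>) \<in> maximal_atlas ?P" "(x, y) \<in> U" "U \<subseteq> W1 \<inter> W2" "l \<le> k"
    "\<And>q j. q \<in> U \<Longrightarrow> j < l \<Longrightarrow> \<phi> q (k - l + j) = h j q"
    using chart_with_coordinates[where W="W1 \<inter> W2", OF P pP h ind] W1(1,2) W2(1,2) by (metis IntI openin_Int)
  note ch = maximal_atlas_chart[OF c(1)]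
  have "q \<in> ?S \<longleftrightarrow> \<phi> q \<in> espace (k - l)" if q: "q \<in> U" for q
  proof -
    have V: "f (fst q) \<in> V" "g (snd q) \<in> V" using q c(3) W1(3) W2(3) by (auto simp: image_subset_iff)
    have qe: "\<phi> q \<in> espace k" "\<psi> (f (fst q)) \<in> espace l" "\<psi> (g (snd q)) \<in> espace l"
      using chart_espace[OF ch] chart_espace[OF chV] q V by blast+
    have "q \<in> ?S \<longleftrightarrow> f (fst q) = g (snd q)"
      using q chart_subset[OF ch] by (auto simp: prod_manifold_def)
    also have "\<dots> \<longleftrightarrow> \<psi> (f (fst q)) = \<psi> (g (snd q))" using chart_inj[OF chV] V by (auto dest: inj_onD)
    also have "\<dots> \<longleftrightarrow> (\<forall>j<l. h j q = 0)"
    proof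
      assume z: "\<forall>j<l. h j q = 0"
      show "\<psi> (f (fst q)) = \<psi> (g (snd q))"
      proof
        fix j show "\<psi> (f (fst q)) j = \<psi> (g (snd q)) j"
          using z qe by (cases "j < l") (auto simp: h_def espace_iff)
      qed
    qed (simp add: h_def)
    also have "\<dots> \<longleftrightarrow> (\<forall>j<l. \<phi> q (k - l + j) = 0)" using c(5)[OF q] by simp
    also have "\<dots> \<longleftrightarrow> \<phi> q \<in> espace (k - l)"
    proof
      assume z: "\<forall>j<l. \<phi> q (k - l + j) = 0"
      have "\<phi> q i = 0" if i: "i \<ge> k - l" for i
        using z[rule_format, of "i - (k - l)"] qe(1) i c(4) by (cases "i < k") (auto simp: espace_iff)
      then show "\<phi> q \<in> espace (k - l)" by (simp add: espace_iff)
    qed (simp add: espace_iff)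
    finally show ?thesis .
  qed
  then have "\<phi> ` (U \<inter> ?S) = \<phi> ` U \<inter> espace (k - l)" by blast
  then show ?thesis using c(1,2) xy(1) by (intro exI[of _ "k - l"] exI[of _ k] exI[of _ U] exI[of _ \<phi>]) simp
qed

lemma smooth_manifold_fibre_product: "smooth_manifold (fibre_product M f N g)"
  unfolding fibre_product_def
  by (rule smooth_manifold_embedded[OF smooth_manifold_prod[OF M N] fibre_product_slice])

lemma smooth_at_fibre_product_inclusion:
  assumes "p \<in> pts (fibre_product M f N g)"
  shows "smooth_at (fibre_product M f N g) (prod_manifold M N) (\<lambda>q. q) p"
proof -
  have p: "p \<in> pts (prod_manifold M N)" "p \<in> {(x, y). x \<in> pts M \<and> y \<in> pts N \<and> f x = g y}"
    using assms unfolding pts_fibre_product by (auto simp: prod_manifold_def)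
  show ?thesis unfolding fibre_product_def
    by (rule smooth_at_embedded[OF smooth_manifold_prod[OF M N] fibre_product_slice p])
qed

lemma smooth_at_fibre_product_fst_snd:
  assumes p: "p \<in> pts (fibre_product M f N g)"
  shows "smooth_at (fibre_product M f N g) M fst p" "smooth_at (fibre_product M f N g) N snd p"
proof -
  obtain x y where xy: "p = (x, y)" "x \<in> pts M" "y \<in> pts N" using p by (auto simp: pts_fibre_product)
  note i = smooth_at_fibre_product_inclusion[OF p]
  show "smooth_at (fibre_product M f N g) M fst p"
    using smooth_at_compose[OF smooth_manifold_fibre_product smooth_manifold_prod[OF M N] i] smooth_at_fst_snd(1)[OF M N xy(2,3)] xy(1) by blast
  show "smooth_at (fibre_product M f N g) N snd p"
    using smooth_at_compose[OF smooth_manifold_fibre_product smooth_manifold_prod[OF M N] i] smooth_at_fst_snd(2)[OF M N xy(2,3)] xy(1) by blast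
qed

lemma smooth_at_into_fibre_product:
  assumes P: "smooth_manifold P" and a: "smooth_at P M a x" and b: "smooth_at P N b x"
    and W: "openin (mtop P) W" "x \<in> W" "\<And>z. z \<in> W \<Longrightarrow> a z \<in> pts M \<and> b z \<in> pts N \<and> f (a z) = g (b z)"
  shows "smooth_at P (fibre_product M f N g) (\<lambda>z. (a z, b z)) x"
  unfolding fibre_product_def
  by (rule smooth_at_into_embedded[OF smooth_manifold_prod[OF M N] fibre_product_slice P smooth_at_Pair[OF M N P a b] W(1,2)])
     (use W(3) in auto)

end

section \<open>Locally trivial maps are Hurewicz fibrations\<close>

lemma continuous_map_locally_finite_sum:
  fixes f :: "nat \<Rightarrow> 'a \<Rightarrow> real"
  assumes f: "\<And>n. continuous_map X euclideanreal (f n)"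
    and fin: "\<And>x. x \<in> topspace X \<Longrightarrow> \<exists>V N. openin X V \<and> x \<in> V \<and> (\<forall>y\<in>V. \<forall>n\<ge>N. f n y = 0)"
  shows "continuous_map X euclideanreal (\<lambda>x. \<Sum>n. f n x)"
proof (rule continuous_map_local)
  fix x assume x: "x \<in> topspace X"
  obtain V N where V: "openin X V" "x \<in> V" "\<forall>y\<in>V. \<forall>n\<ge>N. f n y = 0" using fin[OF x] by blast
  have "continuous_map (subtopology X V) euclideanreal (\<lambda>x. \<Sum>n<N. f n x)"
    by (intro continuous_map_sum continuous_map_from_subtopology f) auto
  moreover have "(\<Sum>n<N. f n y) = (\<Sum>n. f n y)" if "y \<in> topspace (subtopology X V)" for y
    by (rule suminf_finite[symmetric]) (use V(3) that in auto)
  ultimately have "continuous_map (subtopology X V) euclideanreal (\<lambda>x. \<Sum>n. f n x)" by (rule continuous_map_eq)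
  then show "\<exists>V. openin X V \<and> x \<in> V \<and> continuous_map (subtopology X V) euclideanreal (\<lambda>x. \<Sum>n. f n x)"
    using V(1,2) by blast
qed

text \<open>Compactness of \<open>K\<close> makes the infimum a minimum. It stays above a bound near
  a parameter by the tube lemma, and being below a bound is open because projections are open
  maps.\<close>

lemma compact_INF:
  fixes F :: "'k \<times> 'y \<Rightarrow> real"
  assumes K: "compact_space K" "topspace K \<noteq> {}" and F: "continuous_map (prod_topology K Y) euclideanreal F"
  shows "continuous_map Y euclideanreal (\<lambda>y. INF k\<in>topspace K. F (k, y))"
    and "y \<in> topspace Y \<Longrightarrow> \<exists>k\<in>topspace K. (INF k\<in>topspace K. F (k, y)) = F (k, y)"
    and "y \<in> topspace Y \<Longrightarrow> k \<in> topspace K \<Longrightarrow> (INF k\<in>topspace K. F (k, y)) \<le> F (k, y)"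
proof -
  let ?m = "\<lambda>y. INF k\<in>topspace K. F (k, y)"
  have att: "\<exists>k\<in>topspace K. \<forall>k'\<in>topspace K. F (k, y) \<le> F (k', y)" if y: "y \<in> topspace Y" for y
  proof -
    have "continuous_map K (prod_topology K Y) (\<lambda>k. (k, y))"
      using y by (intro continuous_map_pairedI) auto
    from continuous_map_compose[OF this F] have "continuous_map K euclideanreal (\<lambda>k. F (k, y))" by (simp add: o_def)
    then have "compactin euclideanreal ((\<lambda>k. F (k, y)) ` topspace K)"
      using K(1) image_compactin unfolding compact_space_def by blast
    then have "compact ((\<lambda>k. F (k, y)) ` topspace K)" by simp
    then show ?thesis using compact_attains_inf[of "(\<lambda>k. F (k, y)) ` topspace K"] K(2) by auto
  qed
  have bdd: "bdd_below ((\<lambda>k. F (k, y)) ` topspace K)" if y: "y \<in> topspace Y" for y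
    using att[OF y] by (auto intro: bdd_belowI)
  show le: "?m y \<le> F (k, y)" if "y \<in> topspace Y" "k \<in> topspace K" for k y
    using that bdd by (intro cINF_lower) auto
  show eq: "\<exists>k\<in>topspace K. ?m y = F (k, y)" if y: "y \<in> topspace Y" for y
  proof -
    obtain k where k: "k \<in> topspace K" "\<And>k'. k' \<in> topspace K \<Longrightarrow> F (k, y) \<le> F (k', y)" using att[OF y] by blast
    have "F (k, y) \<le> ?m y" using K(2) k(2) by (intro cINF_greatest) auto
    then show ?thesis using le[OF y k(1)] k(1) by force
  qed
  show "continuous_map Y euclideanreal (\<lambda>y. INF k\<in>topspace K. F (k, y))"
    unfolding continuous_map_upper_lower_semicontinuous_lt
  proof (intro conjI allI)
    fix a
    have W: "openin (prod_topology K Y) {z \<in> topspace (prod_topology K Y). F z > a}"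
      "openin (prod_topology K Y) {z \<in> topspace (prod_topology K Y). F z < a}"
      using F unfolding continuous_map_upper_lower_semicontinuous_lt by auto
    show "openin Y {y \<in> topspace Y. a < ?m y}"
    proof (subst openin_subopen, clarify)
      fix y assume y: "y \<in> topspace Y" "a < ?m y"
      have "topspace K \<times> {y} \<subseteq> {z \<in> topspace (prod_topology K Y). F z > a}"
        using y le by (force intro: less_le_trans)
      from tube_lemma_left[OF W(1) K(1)[unfolded compact_space_def] y(1) this]
      obtain U V where V: "openin Y V" "y \<in> V" "topspace K \<subseteq> U" "U \<times> V \<subseteq> {z \<in> topspace (prod_topology K Y). F z > a}"
        by blast
      then have V: "openin Y V" "y \<in> V" "topspace K \<times> V \<subseteq> {z \<in> topspace (prod_topology K Y). F z > a}" by auto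
      have "V \<subseteq> {y \<in> topspace Y. a < ?m y}"
      proof
        fix y' assume "y' \<in> V"
        then have "y' \<in> topspace Y" using V(1) openin_subset by blast
        then show "y' \<in> {y \<in> topspace Y. a < ?m y}"
          using eq[of y'] V(3) \<open>y' \<in> V\<close> by fastforce
      qed
      then show "\<exists>T. openin Y T \<and> y \<in> T \<and> T \<subseteq> {y \<in> topspace Y. a < ?m y}"
        using V(1,2) by blast
    qed
    have "{y \<in> topspace Y. ?m y < a} = snd ` {z \<in> topspace (prod_topology K Y). F z < a}"
    proof (intro equalityI subsetI)
      fix y assume "y \<in> {y \<in> topspace Y. ?m y < a}"
      then obtain k where "y \<in> topspace Y" "k \<in> topspace K" "F (k, y) < a" using eq by force
      then show "y \<in> snd ` {z \<in> topspace (prod_topology K Y). F z < a}" by force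
    next
      fix y assume "y \<in> snd ` {z \<in> topspace (prod_topology K Y). F z < a}"
      then obtain k where "y \<in> topspace Y" "k \<in> topspace K" "F (k, y) < a" by auto
      then show "y \<in> {y \<in> topspace Y. ?m y < a}" using le by (force intro: le_less_trans)
    qed
    then show "openin Y {y \<in> topspace Y. ?m y < a}"
      using open_map_snd[of K Y] W(2) by (simp add: open_map_def)
  qed
qed

text \<open>The sets \<open>{G n > 1}\<close> form a locally finite shrinking of the cover; passing from
  \<open>G n > 1\<close> to \<open>G n > 0\<close> leaves the margin which makes a uniform step size possible.\<close>

lemma locally_finite_weights:
  assumes sc: "second_countable B" and lc: "locally_compact_space B" and H: "Hausdorff_space B"
    and cov: "\<And>b. b \<in> topspace B \<Longrightarrow> \<exists>U\<in>\<U>. openin B U \<and> b \<in> U" and ne: "topspace B \<noteq> {}"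
  obtains G :: "nat \<Rightarrow> 'b \<Rightarrow> real" and U :: "nat \<Rightarrow> 'b set" where
    "\<And>n. U n \<in> \<U>" "\<And>n. continuous_map B euclideanreal (G n)"
    "\<And>n b. b \<in> topspace B \<Longrightarrow> G n b > 0 \<Longrightarrow> b \<in> U n" "\<And>b. b \<in> topspace B \<Longrightarrow> \<exists>n. G n b > 1"
    "\<And>b. b \<in> topspace B \<Longrightarrow> \<exists>V N. openin B V \<and> b \<in> V \<and> (\<forall>y\<in>V. \<forall>n\<ge>N. G n y = 0)"
proof -
  have cr: "completely_regular_space B"
    using locally_compact_regular_imp_completely_regular_space locally_compact_Hausdorff_imp_regular_space lc H by blast
  have "\<exists>f U. continuous_map B euclideanreal f \<and> U \<in> \<U> \<and> f b = 1 \<and> (\<forall>x\<in>topspace B. 0 \<le> f x \<and> f x \<le> 1 \<and> (f x > 0 \<longrightarrow> x \<in> U))"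
    if b: "b \<in> topspace B" for b
  proof -
    obtain U where U: "U \<in> \<U>" "openin B U" "b \<in> U" using cov[OF b] by blast
    have "closedin B (topspace B - U)" "b \<in> topspace B - (topspace B - U)" using U b by auto
    then obtain f :: "'b \<Rightarrow> real" where f: "continuous_map B (top_of_set {0..1}) f" "f b = 0" "f ` (topspace B - U) \<subseteq> {1}"
      using cr unfolding completely_regular_space_def by blast
    have fc: "continuous_map B euclideanreal f" "f ` topspace B \<subseteq> {0..1}"
      using f(1) by (auto simp: continuous_map_in_subtopology)
    have "continuous_map B euclideanreal (\<lambda>x. 1 - f x)" using fc(1) by (intro continuous_intros) auto
    then show ?thesis using f(2,3) fc(2) U(1)
      by (intro exI[of _ "\<lambda>x. 1 - f x"] exI[of _ U]) (fastforce simp: image_subset_iff)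
  qed
  then obtain f U where f: "\<And>b. b \<in> topspace B \<Longrightarrow> continuous_map B euclideanreal (f b) \<and> U b \<in> \<U> \<and> f b b = 1 \<and>
      (\<forall>x\<in>topspace B. 0 \<le> f b x \<and> f b x \<le> (1::real) \<and> (f b x > 0 \<longrightarrow> x \<in> U b))"
    by metis
  define D where "D b = {x \<in> topspace B. f b x \<in> {1/2<..}}" for b
  have Do: "openin B (D b)" if "b \<in> topspace B" for b
    unfolding D_def by (rule openin_continuous_map_preimage) (use f[OF that] in auto)
  have "\<Union>(D ` topspace B) = topspace B"
  proof (intro equalityI subsetI)
    fix b assume b: "b \<in> topspace B"
    then have "b \<in> D b" using f[OF b] by (auto simp: D_def)
    then show "b \<in> \<Union>(D ` topspace B)" using b by blast
  qed (auto simp: D_def)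
  then have "\<exists>\<V>. countable \<V> \<and> \<V> \<subseteq> D ` topspace B \<and> \<Union>\<V> = topspace B"
    by (rule Lindelof_spaceD[OF second_countable_imp_Lindelof_space[OF sc], rotated]) (use Do in blast)
  then obtain \<V> where V: "countable \<V>" "\<V> \<subseteq> D ` topspace B" "\<Union>\<V> = topspace B" by metis
  obtain C where C: "countable C" "C \<subseteq> topspace B" "\<V> = D ` C" using countable_subset_image[THEN iffD1] V(1,2) by metis
  have "C \<noteq> {}"
  proof
    assume "C = {}"
    then have "\<Union>\<V> = {}" using C(3) by simp
    then show False using V(3) ne by simp
  qed
  define c where "c = from_nat_into C"
  have c: "range c = C" unfolding c_def using C(1) \<open>C \<noteq> {}\<close> by (simp add: range_from_nat_into)
  have cB: "c n \<in> topspace B" for n using c C(2) by blast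
  define h where "h n = f (c n)" for n
  have hc: "continuous_map B euclideanreal (h n)" for n using f[OF cB] by (simp add: h_def)
  have h01: "0 \<le> h n x" "h n x \<le> 1" "h n x > 0 \<Longrightarrow> x \<in> U (c n)" if "x \<in> topspace B" for n x
    using f[OF cB[of n]] that by (auto simp: h_def)
  have hcov: "\<exists>n. h n x > 1/2" if xB: "x \<in> topspace B" for x
  proof -
    obtain b where "b \<in> C" "x \<in> D b" using V(3) C(3) xB by auto
    then show ?thesis using c by (force simp: h_def D_def)
  qed
  \<comment> \<open>Positive exactly where \<open>h n\<close> exceeds 1/2, the threshold at which
    the functions \<open>h n\<close> cover.\<close>
  define F where "F n x = max 0 (2 * h n x - 1)" for n x
  \<comment> \<open>Subtracting \<open>n\<close> times the earlier bumps makes the family locally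
    finite: where some \<open>F m\<close> is positive, the subtrahend eventually exceeds
    \<open>2 * h n\<close>. At the first index with \<open>h n > 1/2\<close> all earlier
    \<open>F\<close> vanish, so there the weight is \<open>2 * h n > 1\<close>.\<close>
  define G where "G n x = max 0 (2 * h n x - real n * (\<Sum>j<n. F j x))" for n x
  have Fc: "continuous_map B euclideanreal (F n)" for n
    unfolding F_def by (intro continuous_map_real_max continuous_map_diff continuous_map_real_mult_left hc) auto
  have F0: "F n x \<ge> 0" for n x by (simp add: F_def)
  show thesis
  proof (rule that[of "\<lambda>n. U (c n)" G])
    show "U (c n) \<in> \<U>" for n using f[OF cB] by blast
    show "continuous_map B euclideanreal (G n)" for n
      unfolding G_def
      by (intro continuous_map_real_max continuous_map_diff continuous_map_real_mult_left continuous_map_sum hc Fc) auto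
    show "b \<in> U (c n)" if "b \<in> topspace B" "G n b > 0" for n b
    proof -
      have "real n * (\<Sum>j<n. F j b) \<ge> 0" by (intro mult_nonneg_nonneg sum_nonneg F0) auto
      then have "h n b > 0" using that(2) by (auto simp: G_def max_def split: if_splits)
      then show ?thesis by (rule h01(3)[OF that(1)])
    qed
    show "\<exists>n. G n b > 1" if b: "b \<in> topspace B" for b
    proof -
      define n where "n = (LEAST n. h n b > 1/2)"
      have n: "h n b > 1/2" unfolding n_def using hcov[OF b] by (rule LeastI_ex)
      have "F j b = 0" if "j < n" for j using not_less_Least[OF that[unfolded n_def]] by (simp add: F_def)
      then have "G n b = 2 * h n b" using n by (simp add: G_def)
      then show ?thesis using n by (intro exI[of _ n]) simp
    qed
    show "\<exists>V N. openin B V \<and> b \<in> V \<and> (\<forall>y\<in>V. \<forall>n\<ge>N. G n y = 0)" if b: "b \<in> topspace B" for b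
    proof -
      obtain m where m: "h m b > 1/2" using hcov[OF b] by blast
      define r where "r = F m b / 2"
      have r: "r > 0" "F m b > r" using m by (auto simp: r_def F_def)
      \<comment> \<open>The bound 2 is the largest possible value of \<open>2 * h n\<close>.\<close>
      obtain N0 :: nat where N0: "real N0 * r > 2" using reals_Archimedean3[OF r(1)] by blast
      let ?V = "{x \<in> topspace B. F m x \<in> {r<..}}"
      have "G n y = 0" if "y \<in> ?V" "n \<ge> max N0 (Suc m)" for y n
      proof -
        have "F m y \<le> (\<Sum>j<n. F j y)" using that(2) F0 by (intro member_le_sum) auto
        then have "r < (\<Sum>j<n. F j y)" using that(1) by simp
        then have "real N0 * r \<le> real n * (\<Sum>j<n. F j y)" using that(2) r(1) by (intro mult_mono) auto
        then show ?thesis using N0 h01(2)[of y n] that(1) by (simp add: G_def)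
      qed
      moreover have "openin B ?V" by (rule openin_continuous_map_preimage[OF Fc]) simp
      ultimately show ?thesis using b r(2) by (intro exI[of _ ?V] exI[of _ "max N0 (Suc m)"]) auto
    qed
  qed
qed

text \<open>A slicing function in the sense of Hurewicz: \<open>\<phi> b e\<close> transports
  \<open>e\<close> to the fibre over \<open>b\<close>. The last clause makes the transport trivial
  over the own base point, which is needed to glue it with doing nothing.\<close>

definition local_slicing :: "'a topology \<Rightarrow> 'b topology \<Rightarrow> ('a \<Rightarrow> 'b) \<Rightarrow> 'b set \<Rightarrow> ('b \<Rightarrow> 'a \<Rightarrow> 'a) \<Rightarrow> bool" where
  "local_slicing E B p U \<phi> \<longleftrightarrow> openin B U \<and>
     continuous_map (subtopology (prod_topology B E) {(b, e). b \<in> U \<and> p e \<in> U}) E (\<lambda>(b, e). \<phi> b e) \<and>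
     (\<forall>b\<in>U. \<forall>e\<in>topspace E. p e \<in> U \<longrightarrow> p (\<phi> b e) = b \<and> \<phi> (p e) e = e)"

abbreviation unit_interval :: "real topology" where
  "unit_interval \<equiv> top_of_set {0..1}"

lemma continuous_map_unit_interval:
  "continuous_map Z unit_interval s \<longleftrightarrow> continuous_map Z euclideanreal s \<and> (\<forall>z\<in>topspace Z. 0 \<le> s z \<and> s z \<le> 1)"
  by (auto simp: continuous_map_in_subtopology)

lemma continuous_map_along:
  assumes H: "continuous_map (prod_topology unit_interval Z) B H" and s: "continuous_map Z unit_interval s"
  shows "continuous_map Z B (\<lambda>z. H (s z, z))"
proof -
  have "continuous_map Z (prod_topology unit_interval Z) (\<lambda>z. (s z, z))"
    using s by (intro continuous_map_pairedI) auto
  from continuous_map_compose[OF this H] show ?thesis by (simp add: o_def)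
qed

text \<open>Moves a lift from time \<open>s\<close> to time \<open>s'\<close>. Where
  \<open>g \<ge> 1\<close> the slicing does it; where \<open>g \<le> 1\<close> the two times agree
  and nothing has to be done. On the common boundary the slicing is trivial, so the two continuous
  maps on closed sets fit together.\<close>

lemma lift_along_slicing:
  assumes sl: "local_slicing E B p U \<phi>" and H: "continuous_map (prod_topology unit_interval Z) B H"
    and s: "continuous_map Z unit_interval s" "continuous_map Z unit_interval s'"
    and e: "continuous_map Z E e" "\<And>z. z \<in> topspace Z \<Longrightarrow> p (e z) = H (s z, z)"
    and g: "continuous_map Z euclideanreal g"
    and g1: "\<And>z. z \<in> topspace Z \<Longrightarrow> g z \<ge> 1 \<Longrightarrow> H (s z, z) \<in> U \<and> H (s' z, z) \<in> U"
    and g2: "\<And>z. z \<in> topspace Z \<Longrightarrow> g z \<le> 1 \<Longrightarrow> s' z = s z"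
  shows "\<exists>e'. continuous_map Z E e' \<and> (\<forall>z\<in>topspace Z. p (e' z) = H (s' z, z)) \<and>
     (\<forall>z\<in>topspace Z. s' z = s z \<longrightarrow> e' z = e z)"
proof -
  have eE: "e z \<in> topspace E" if "z \<in> topspace Z" for z
    using continuous_map_image_subset_topspace[OF e(1)] that by blast
  let ?Z = "subtopology Z {z \<in> topspace Z. 1 \<le> g z}"
  have "continuous_map ?Z (subtopology (prod_topology B E) {(b, e). b \<in> U \<and> p e \<in> U}) (\<lambda>z. (H (s' z, z), e z))"
    unfolding continuous_map_in_subtopology
  proof
    show "continuous_map ?Z (prod_topology B E) (\<lambda>z. (H (s' z, z), e z))"
      by (intro continuous_map_pairedI continuous_map_from_subtopology continuous_map_along[OF H s(2)] e(1))
  qed (use g1 e(2) in auto)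
  moreover have "continuous_map (subtopology (prod_topology B E) {(b, e). b \<in> U \<and> p e \<in> U}) E (\<lambda>(b, e). \<phi> b e)"
    using sl by (simp add: local_slicing_def)
  ultimately have 1: "continuous_map ?Z E (\<lambda>z. \<phi> (H (s' z, z)) (e z))"
    by (drule_tac continuous_map_compose) (auto simp: o_def)
  have triv: "\<phi> (H (s z, z)) (e z) = e z" if "z \<in> topspace Z" "g z \<ge> 1" for z
    using sl g1[OF that] eE[OF that(1)] unfolding local_slicing_def e(2)[OF that(1), symmetric] by blast
  let ?e = "\<lambda>z. if 1 \<le> g z then \<phi> (H (s' z, z)) (e z) else e z"
  have "continuous_map Z E ?e"
  proof (rule continuous_map_cases_le[OF _ g 1 continuous_map_from_subtopology[OF e(1)]])
    fix z assume "z \<in> topspace Z" "1 = g z"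
    then show "\<phi> (H (s' z, z)) (e z) = e z" using triv[of z] g2[of z] by simp
  qed auto
  moreover have "p (?e z) = H (s' z, z)" if "z \<in> topspace Z" for z
    using sl g1[OF that] g2[OF that] eE[OF that] e(2)[OF that] by (auto simp: local_slicing_def)
  moreover have "?e z = e z" if "z \<in> topspace Z" "s' z = s z" for z
    using triv[OF that(1)] that(2) by auto
  ultimately show ?thesis by blast
qed

text \<open>The interval from \<open>a z\<close> to \<open>b z\<close> is divided in proportion to
  the weights of its starting point, and on the \<open>k\<close>-th part the \<open>k\<close>-th
  slicing is used. If that part is not trivial then \<open>G k > 1\<close> at the start; as
  \<open>G k\<close> changes by less than 1 it stays positive, so the path does not leave
  \<open>U k\<close>. All but finitely many parts are trivial near each point, and trivial parts do
  not change the lift.\<close>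

lemma lift_small_step:
  fixes G :: "nat \<Rightarrow> 'b \<Rightarrow> real"
  assumes sl: "\<And>n. local_slicing E B p (U n) (\<phi> n)"
    and G: "\<And>n. continuous_map (subtopology B P) euclideanreal (G n)"
    and GU: "\<And>n b. b \<in> topspace B \<Longrightarrow> b \<in> P \<Longrightarrow> G n b > 0 \<Longrightarrow> b \<in> U n"
    and G1: "\<And>b. b \<in> topspace B \<Longrightarrow> b \<in> P \<Longrightarrow> \<exists>n. G n b > 1"
    and fin: "\<And>b. b \<in> topspace B \<Longrightarrow> b \<in> P \<Longrightarrow> \<exists>V N. openin (subtopology B P) V \<and> b \<in> V \<and> (\<forall>y\<in>V. \<forall>n\<ge>N. G n y = 0)"
    and H: "continuous_map (prod_topology unit_interval Z) (subtopology B P) H"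
    and a: "continuous_map Z unit_interval a" and b: "continuous_map Z unit_interval b" "\<And>z. z \<in> topspace Z \<Longrightarrow> a z \<le> b z"
    and e: "continuous_map Z E e" "\<And>z. z \<in> topspace Z \<Longrightarrow> p (e z) = H (a z, z)"
    and small: "\<And>z s n. z \<in> topspace Z \<Longrightarrow> a z \<le> s \<Longrightarrow> s \<le> b z \<Longrightarrow> \<bar>G n (H (a z, z)) - G n (H (s, z))\<bar> < 1"
  shows "\<exists>e'. continuous_map Z E e' \<and> (\<forall>z\<in>topspace Z. p (e' z) = H (b z, z)) \<and> (\<forall>z\<in>topspace Z. a z = b z \<longrightarrow> e' z = e z)"
proof -
  have HB: "continuous_map (prod_topology unit_interval Z) B H" using H by (simp add: continuous_map_in_subtopology)
  have HP: "H (s, z) \<in> topspace B \<and> H (s, z) \<in> P" if "z \<in> topspace Z" "0 \<le> s" "s \<le> 1" for s z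
    using continuous_map_image_subset_topspace[OF H] that by (auto simp: image_subset_iff)
  have a01: "0 \<le> a z" "a z \<le> 1" "0 \<le> b z" "b z \<le> 1" if "z \<in> topspace Z" for z
    using a b(1) that by (auto simp: continuous_map_unit_interval)
  have Ha: "continuous_map Z (subtopology B P) (\<lambda>z. H (a z, z))" by (rule continuous_map_along[OF H a])
  \<comment> \<open>Supported where \<open>G n > 1\<close>; the margin from there to
    \<open>G n > 0\<close> is what the path may use up.\<close>
  define \<rho> where "\<rho> n b = max 0 (G n b - 1)" for n b
  define S where "S b = (\<Sum>n. \<rho> n b)" for b
  have \<rho>c: "continuous_map (subtopology B P) euclideanreal (\<rho> n)" for n
    unfolding \<rho>_def by (intro continuous_map_real_max continuous_map_diff G) auto
  have \<rho>0: "\<rho> n b \<ge> 0" for n b by (simp add: \<rho>_def)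
  have fin': "\<exists>V N. openin (subtopology B P) V \<and> b \<in> V \<and> (\<forall>y\<in>V. \<forall>n\<ge>N. \<rho> n y = 0)" if bB: "b \<in> topspace (subtopology B P)" for b
  proof -
    obtain V N where "openin (subtopology B P) V" "b \<in> V" "\<forall>y\<in>V. \<forall>n\<ge>N. G n y = 0" using fin[of b] bB by auto
    then show ?thesis by (intro exI[of _ V] exI[of _ N]) (auto simp: \<rho>_def)
  qed
  have Sc: "continuous_map (subtopology B P) euclideanreal S"
    unfolding S_def by (rule continuous_map_locally_finite_sum[OF \<rho>c fin'])
  have Ssum: "\<exists>N. \<forall>n\<ge>N. \<rho> n b = 0" if "b \<in> topspace (subtopology B P)" for b
    using fin'[OF that] by blast
  have Seq: "S b = (\<Sum>n<N. \<rho> n b)" if "\<forall>n\<ge>N. \<rho> n b = 0" for b N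
    unfolding S_def by (rule suminf_finite) (use that in auto)
  have Sle: "(\<Sum>n<k. \<rho> n b) \<le> S b" if bB: "b \<in> topspace (subtopology B P)" for b k
  proof -
    obtain N where N: "\<forall>n\<ge>N. \<rho> n b = 0" using Ssum[OF bB] by blast
    then have "\<forall>n\<ge>max N k. \<rho> n b = 0" by simp
    then have "S b = (\<Sum>n<max N k. \<rho> n b)" by (rule Seq)
    also have "\<dots> \<ge> (\<Sum>n<k. \<rho> n b)" using \<rho>0 by (intro sum_mono2) auto
    finally show ?thesis .
  qed
  have Spos: "S b > 0" if bB: "b \<in> topspace (subtopology B P)" for b
  proof -
    obtain n where n: "G n b > 1" using G1 bB by auto
    then have "0 < \<rho> n b" by (simp add: \<rho>_def)
    also have "\<dots> \<le> (\<Sum>j<Suc n. \<rho> j b)" using \<rho>0 by (intro member_le_sum) auto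
    also have "\<dots> \<le> S b" by (rule Sle[OF bB])
    finally show ?thesis .
  qed
  \<comment> \<open>Fraction of the interval that has been covered after \<open>k\<close> parts. It
    reaches 1 after finitely many, locally uniformly.\<close>
  define \<theta> where "\<theta> k b = (\<Sum>n<k. \<rho> n b) / S b" for k b
  have \<theta>c: "continuous_map (subtopology B P) euclideanreal (\<theta> k)" for k
    unfolding \<theta>_def using Spos by (intro continuous_map_real_divide continuous_map_sum \<rho>c Sc) (auto simp: less_imp_neq[symmetric])
  have \<theta>01: "0 \<le> \<theta> k b" "\<theta> k b \<le> 1" if "b \<in> topspace (subtopology B P)" for k b
    using Spos[OF that] Sle[OF that, of k] \<rho>0 by (auto simp: \<theta>_def sum_nonneg)
  define s where "s k z = a z + \<theta> k (H (a z, z)) * (b z - a z)" for k z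
  have sab: "a z \<le> s k z" "s k z \<le> b z" if z: "z \<in> topspace Z" for k z
  proof -
    have t: "H (a z, z) \<in> topspace (subtopology B P)" using HP a01[OF z] z by simp
    have "0 \<le> \<theta> k (H (a z, z)) * (b z - a z)" using \<theta>01[OF t] b(2)[OF z] by simp
    then show "a z \<le> s k z" by (simp add: s_def)
    have "\<theta> k (H (a z, z)) * (b z - a z) \<le> 1 * (b z - a z)" using \<theta>01[OF t] b(2)[OF z] by (intro mult_right_mono) auto
    then show "s k z \<le> b z" by (simp add: s_def)
  qed
  have sc: "continuous_map Z unit_interval (s k)" for k
  proof -
    have "continuous_map Z euclideanreal (\<lambda>z. \<theta> k (H (a z, z)))"
      using continuous_map_compose[OF Ha \<theta>c] by (simp add: o_def)
    then have "continuous_map Z euclideanreal (s k)"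
      unfolding s_def using a b(1) by (intro continuous_map_add continuous_map_real_mult continuous_map_diff) (auto simp: continuous_map_unit_interval)
    moreover have "0 \<le> s k z \<and> s k z \<le> 1" if "z \<in> topspace Z" for z
      using sab[OF that] a01[OF that] by (meson order_trans)
    ultimately show ?thesis by (auto simp: continuous_map_unit_interval)
  qed
  have s0: "s 0 z = a z" for z by (simp add: s_def \<theta>_def)
  \<comment> \<open>The conjunct about \<open>k = 0\<close> carries the prescribed initial lift
    through the choice of a sequence.\<close>
  have "\<exists>E'. \<forall>k. (continuous_map Z E (E' k) \<and> (\<forall>z\<in>topspace Z. p (E' k z) = H (s k z, z))
        \<and> (k = 0 \<longrightarrow> E' k = e)) \<and>
      (\<forall>z\<in>topspace Z. s (Suc k) z = s k z \<longrightarrow> E' (Suc k) z = E' k z)"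
  proof (rule dependent_nat_choice)
    show "\<exists>x. continuous_map Z E x \<and> (\<forall>z\<in>topspace Z. p (x z) = H (s 0 z, z)) \<and> (0 = (0::nat) \<longrightarrow> x = e)"
      using e by (intro exI[of _ e]) (simp add: s0)
    fix f k assume f: "continuous_map Z E f \<and> (\<forall>z\<in>topspace Z. p (f z) = H (s k z, z)) \<and> (k = 0 \<longrightarrow> f = e)"
    have "\<exists>f'. continuous_map Z E f' \<and> (\<forall>z\<in>topspace Z. p (f' z) = H (s (Suc k) z, z)) \<and>
       (\<forall>z\<in>topspace Z. s (Suc k) z = s k z \<longrightarrow> f' z = f z)"
    proof (rule lift_along_slicing[where g="\<lambda>z. G k (H (a z, z))", OF sl HB sc sc])
      show "continuous_map Z euclideanreal (\<lambda>z. G k (H (a z, z)))"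
        using continuous_map_compose[OF Ha G] by (simp add: o_def)
      fix z assume z: "z \<in> topspace Z"
      \<comment> \<open>Holds for all times between \<open>a z\<close> and \<open>b z\<close>, not
        only on the \<open>k\<close>-th part, since smallness is measured from the time
        \<open>a z\<close>.\<close>
      have *: "H (t, z) \<in> U k" if "G k (H (a z, z)) \<ge> 1" "a z \<le> t" "t \<le> b z" for t
      proof (rule GU)
        show "H (t, z) \<in> topspace B" "H (t, z) \<in> P" using HP[OF z, of t] a01[OF z] that(2,3) by auto
        show "0 < G k (H (t, z))" using small[OF z that(2,3), of k] that(1) by linarith
      qed
      show "H (s k z, z) \<in> U k \<and> H (s (Suc k) z, z) \<in> U k" if "G k (H (a z, z)) \<ge> 1"
        using * that sab[OF z] by blast
      show "s (Suc k) z = s k z" if "G k (H (a z, z)) \<le> 1"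
        using that by (simp add: s_def \<theta>_def \<rho>_def)
    qed (use f in auto)
    then show "\<exists>y. (continuous_map Z E y \<and> (\<forall>z\<in>topspace Z. p (y z) = H (s (Suc k) z, z)) \<and> (Suc k = 0 \<longrightarrow> y = e)) \<and>
       (\<forall>z\<in>topspace Z. s (Suc k) z = s k z \<longrightarrow> y z = f z)" by simp
  qed
  then obtain E' where E': "\<And>k. continuous_map Z E (E' k)" "\<And>k z. z \<in> topspace Z \<Longrightarrow> p (E' k z) = H (s k z, z)"
     "E' 0 = e" "\<And>k z. z \<in> topspace Z \<Longrightarrow> s (Suc k) z = s k z \<Longrightarrow> E' (Suc k) z = E' k z" by metis
  have fin2: "\<exists>V N. openin Z V \<and> z \<in> V \<and> (\<forall>w\<in>V. \<forall>k\<ge>N. s k w = b w)" if z: "z \<in> topspace Z" for z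
  proof -
    have "H (a z, z) \<in> topspace (subtopology B P)" using HP a01[OF z] z by simp
    from fin'[OF this] obtain V N where V: "openin (subtopology B P) V" "H (a z, z) \<in> V" "\<forall>y\<in>V. \<forall>n\<ge>N. \<rho> n y = 0" by metis
    let ?V = "{w \<in> topspace Z. H (a w, w) \<in> V}"
    have "s k w = b w" if "w \<in> ?V" "k \<ge> N" for w k
    proof -
      have "H (a w, w) \<in> topspace (subtopology B P)" using HP a01[of w] that(1) by simp
      then have "S (H (a w, w)) > 0" by (rule Spos)
      moreover have "S (H (a w, w)) = (\<Sum>n<k. \<rho> n (H (a w, w)))" using V(3) that by (intro Seq) auto
      ultimately show ?thesis by (simp add: s_def \<theta>_def)
    qed
    moreover have "openin Z ?V" by (rule openin_continuous_map_preimage[OF Ha V(1)])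
    ultimately show ?thesis using z V(2) by (intro exI[of _ ?V] exI[of _ N]) auto
  qed
  have stable: "E' k z = E' N z" if "z \<in> topspace Z" "\<forall>k\<ge>N. s k z = b z" "k \<ge> N" for k N z
    using that(3) by (induction rule: dec_induct) (use E'(4)[OF that(1)] that(2) in auto)
  \<comment> \<open>Any index after which the times no longer change gives the same value, so near a
    point one fixed index represents the lift; this makes the limit continuous.\<close>
  define K where "K z = (SOME N. \<forall>k\<ge>N. s k z = b z)" for z
  have K: "\<forall>k\<ge>K z. s k z = b z" if "z \<in> topspace Z" for z
    unfolding K_def by (rule someI_ex) (use fin2[OF that] in blast)
  have KN: "E' (K z) z = E' N z" if "z \<in> topspace Z" "\<forall>k\<ge>N. s k z = b z" for z N
    using stable[OF that(1) K[OF that(1)], of "max N (K z)"] stable[OF that, of "max N (K z)"] by simp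
  show ?thesis
  proof (intro exI[of _ "\<lambda>z. E' (K z) z"] conjI ballI impI)
    show "continuous_map Z E (\<lambda>z. E' (K z) z)"
    proof (rule continuous_map_local)
      fix z assume "z \<in> topspace Z"
      from fin2[OF this] obtain V N where V: "openin Z V" "z \<in> V" "\<forall>w\<in>V. \<forall>k\<ge>N. s k w = b w" by metis
      have "continuous_map (subtopology Z V) E (\<lambda>z. E' (K z) z)"
        by (rule continuous_map_eq[OF continuous_map_from_subtopology[OF E'(1)[of N]]]) (use KN V(3) in auto)
      then show "\<exists>V. openin Z V \<and> z \<in> V \<and> continuous_map (subtopology Z V) E (\<lambda>z. E' (K z) z)" using V(1,2) by blast
    qed
    show "p (E' (K z) z) = H (b z, z)" if "z \<in> topspace Z" for z using E'(2)[OF that] K[OF that] by simp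
    show "E' (K z) z = e z" if z: "z \<in> topspace Z" and "a z = b z" for z
    proof -
      have "\<forall>k\<ge>0. s k z = b z" using that(2) by (simp add: s_def)
      from KN[OF z this] show ?thesis using E'(3) by simp
    qed
  qed
qed

text \<open>A step size depending only on \<open>y\<close> is found for which no weight changes by 1
  or more along the path of \<open>y\<close>. The path up to time \<open>t\<close> is then lifted in
  steps of this size, with the pair of \<open>t\<close> and \<open>y\<close> as parameter, so that
  the endpoints form the lifted homotopy. Near each parameter finitely many steps are
  enough.\<close>

lemma lift_over_second_countable:
  fixes E :: "'a topology" and B :: "'b topology" and Y :: "'c topology"
  assumes sl: "\<And>b. b \<in> topspace B \<Longrightarrow> \<exists>U \<phi>. b \<in> U \<and> local_slicing E B p U \<phi>"
    and P: "second_countable (subtopology B P)" "locally_compact_space (subtopology B P)" "Hausdorff_space (subtopology B P)"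
    and h: "continuous_map (prod_topology unit_interval Y) (subtopology B P) h"
    and g: "continuous_map Y E g" "\<And>y. y \<in> topspace Y \<Longrightarrow> p (g y) = h (0, y)"
  shows "\<exists>k. continuous_map (prod_topology unit_interval Y) E k \<and> (\<forall>y\<in>topspace Y. k (0, y) = g y) \<and>
     (\<forall>t\<in>{0..1}. \<forall>y\<in>topspace Y. p (k (t, y)) = h (t, y))"
proof (cases "topspace Y = {}")
  case True
  then show ?thesis by (intro exI[of _ undefined]) (auto simp: continuous_map_def)
next
  case False
  let ?B = "subtopology B P" and ?IY = "prod_topology unit_interval Y"
  have hP: "h (t, y) \<in> topspace ?B" if "y \<in> topspace Y" "0 \<le> t" "t \<le> 1" for t y
    using continuous_map_image_subset_topspace[OF h] that by (auto simp: image_subset_iff)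
  have ne: "topspace ?B \<noteq> {}" using False hP[of _ 0] by fastforce
  let ?\<U> = "{U \<inter> P |U. \<exists>\<phi>. local_slicing E B p U \<phi>}"
  have cov: "\<exists>U\<in>?\<U>. openin ?B U \<and> b \<in> U" if "b \<in> topspace ?B" for b
  proof -
    have "b \<in> topspace B" "b \<in> P" using that by auto
    then obtain U \<phi> where U: "b \<in> U" "local_slicing E B p U \<phi>" using sl by blast
    then have "openin ?B (U \<inter> P)" by (auto simp: local_slicing_def openin_subtopology)
    then show ?thesis using U \<open>b \<in> P\<close> by blast
  qed
  obtain G :: "nat \<Rightarrow> 'b \<Rightarrow> real" and U' where G: "\<And>n. U' n \<in> ?\<U>" "\<And>n. continuous_map ?B euclideanreal (G n)"
    "\<And>n b. b \<in> topspace ?B \<Longrightarrow> G n b > 0 \<Longrightarrow> b \<in> U' n" "\<And>b. b \<in> topspace ?B \<Longrightarrow> \<exists>n. G n b > 1"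
    "\<And>b. b \<in> topspace ?B \<Longrightarrow> \<exists>V N. openin ?B V \<and> b \<in> V \<and> (\<forall>y\<in>V. \<forall>n\<ge>N. G n y = 0)"
  proof (rule locally_finite_weights[OF P cov ne], assumption, goal_cases)
    case (1 G U)
    show thesis by (rule that[of U G]) (fact 1)+
  qed
  have "\<exists>U \<phi>. U' n \<subseteq> U \<and> local_slicing E B p U \<phi>" for n using G(1)[of n] by blast
  then obtain U \<phi> where U: "\<And>n. U' n \<subseteq> U n \<and> local_slicing E B p (U n) (\<phi> n)" by metis
  \<comment> \<open>Bounds the change of all weights simultaneously; local finiteness makes the sum
    continuous.\<close>
  define c where "c a b = (\<Sum>n. \<bar>G n a - G n b\<bar>)" for a b
  have c_fin: "\<exists>V N. openin (prod_topology ?B ?B) V \<and> z \<in> V \<and> (\<forall>w\<in>V. \<forall>n\<ge>N. \<bar>G n (fst w) - G n (snd w)\<bar> = 0)"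
    if z: "z \<in> topspace (prod_topology ?B ?B)" for z
  proof -
    obtain x y where xy: "z = (x, y)" "x \<in> topspace ?B" "y \<in> topspace ?B" using z by auto
    obtain V N where V: "openin ?B V" "x \<in> V" "\<forall>y\<in>V. \<forall>n\<ge>N. G n y = 0" using G(5)[OF xy(2)] by blast
    obtain V' N' where V': "openin ?B V'" "y \<in> V'" "\<forall>y\<in>V'. \<forall>n\<ge>N'. G n y = 0" using G(5)[OF xy(3)] by blast
    have "openin (prod_topology ?B ?B) (V \<times> V')" using V V' by (simp add: openin_prod_Times_iff)
    then show ?thesis using V V' xy(1) by (intro exI[of _ "V \<times> V'"] exI[of _ "max N N'"]) auto
  qed
  have cc: "continuous_map (prod_topology ?B ?B) euclideanreal (\<lambda>w. c (fst w) (snd w))"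
    unfolding c_def
  proof (rule continuous_map_locally_finite_sum[OF _ c_fin])
    fix n
    have "continuous_map (prod_topology ?B ?B) euclideanreal (\<lambda>w. G n (fst w))" "continuous_map (prod_topology ?B ?B) euclideanreal (\<lambda>w. G n (snd w))"
      using continuous_map_compose[OF continuous_map_fst G(2)] continuous_map_compose[OF continuous_map_snd G(2)] by (auto simp: o_def)
    then show "continuous_map (prod_topology ?B ?B) euclideanreal (\<lambda>w. \<bar>G n (fst w) - G n (snd w)\<bar>)"
      by (intro continuous_map_real_abs continuous_map_diff)
  qed
  have cle: "\<bar>G n a - G n b\<bar> \<le> c a b" if ab: "a \<in> topspace ?B" "b \<in> topspace ?B" for n a b
  proof -
    have "(a, b) \<in> topspace (prod_topology ?B ?B)" using ab by simp
    from c_fin[OF this] obtain N where N: "\<forall>n\<ge>N. \<bar>G n a - G n b\<bar> = 0" by fastforce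
    have "c a b = (\<Sum>n<max N (Suc n). \<bar>G n a - G n b\<bar>)" unfolding c_def by (rule suminf_finite) (use N in auto)
    also have "\<dots> \<ge> \<bar>G n a - G n b\<bar>" by (intro member_le_sum) auto
    finally show ?thesis .
  qed
  let ?K = "prod_topology unit_interval unit_interval"
  have K: "compact_space ?K" "topspace ?K \<noteq> {}"
  proof -
    have "compact_space unit_interval" by (simp add: compact_space_subtopology)
    then show "compact_space ?K" unfolding compact_space_prod_topology by blast
  qed auto
  \<comment> \<open>Positive everywhere: for distinct times because of the first summand, for equal
    times because \<open>c\<close> vanishes on the diagonal.\<close>
  define F where "F w = \<bar>fst (fst w) - snd (fst w)\<bar> + max 0 (1 - c (h (fst (fst w), snd w)) (h (snd (fst w), snd w)))" for w
  have Fc: "continuous_map (prod_topology ?K Y) euclideanreal F"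
  proof -
    let ?KY = "prod_topology ?K Y"
    have f1: "continuous_map ?KY unit_interval (\<lambda>w. fst (fst w))" "continuous_map ?KY unit_interval (\<lambda>w. snd (fst w))"
      by (rule continuous_map_compose[OF continuous_map_fst continuous_map_fst, unfolded o_def],
          rule continuous_map_compose[OF continuous_map_fst continuous_map_snd, unfolded o_def])
    have "continuous_map ?KY ?B (\<lambda>w. h (fst (fst w), snd w))" "continuous_map ?KY ?B (\<lambda>w. h (snd (fst w), snd w))"
      using continuous_map_compose[OF continuous_map_pairedI[OF f1(1) continuous_map_snd] h]
        continuous_map_compose[OF continuous_map_pairedI[OF f1(2) continuous_map_snd] h] by (auto simp: o_def)
    from continuous_map_compose[OF continuous_map_pairedI[OF this] cc]
    have "continuous_map ?KY euclideanreal (\<lambda>w. c (h (fst (fst w), snd w)) (h (snd (fst w), snd w)))" by (simp add: o_def)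
    then show ?thesis unfolding F_def using f1
      by (intro continuous_map_add continuous_map_real_abs continuous_map_real_max continuous_map_diff) (auto simp: continuous_map_unit_interval)
  qed
  define m where "m y = (INF k\<in>topspace ?K. F (k, y))" for y
  note mI = compact_INF[OF K Fc, folded m_def]
  have mpos: "m y > 0" if y: "y \<in> topspace Y" for y
  proof -
    obtain k where k: "k \<in> topspace ?K" "m y = F (k, y)" using mI(2)[OF y] by blast
    have "F (k, y) > 0"
    proof (cases "fst k = snd k")
      case True
      then show ?thesis by (simp add: F_def c_def)
    next
      case False
      then have "\<bar>fst k - snd k\<bar> > 0" by simp
      then show ?thesis by (simp add: F_def add_pos_nonneg)
    qed
    then show ?thesis using k by simp
  qed
  \<comment> \<open>Half of the minimum: if two times are this close, the first summand of
    \<open>F\<close> cannot account for all of \<open>m y\<close>, so the second is positive and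
    \<open>c\<close> is below 1.\<close>
  define \<delta> where "\<delta> y = m y / 2" for y
  have \<delta>c: "continuous_map Y euclideanreal \<delta>" and \<delta>pos: "\<And>y. y \<in> topspace Y \<Longrightarrow> \<delta> y > 0"
    using mI(1) mpos unfolding \<delta>_def by (auto intro!: continuous_map_real_divide)
  have csmall: "c (h (s, y)) (h (t, y)) < 1" if y: "y \<in> topspace Y" and st: "s \<in> {0..1}" "t \<in> {0..1}" "\<bar>s - t\<bar> \<le> \<delta> y" for s t y
  proof -
    have "m y \<le> F ((s, t), y)" by (rule mI(3)[OF y]) (use st in auto)
    then show ?thesis using st(3) mpos[OF y] by (auto simp: F_def \<delta>_def max_def split: if_splits)
  qed
  \<comment> \<open>Time reached after \<open>n\<close> steps, stopped at the final time
    \<open>fst z\<close>. Afterwards the steps are trivial.\<close>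
  define T where "T n z = min (fst z) (real n * \<delta> (snd z))" for n and z :: "real \<times> 'c"
  have T0: "T 0 z = 0" if "z \<in> topspace ?IY" for z using that by (auto simp: T_def)
  have T01: "0 \<le> T n z" "T n z \<le> 1" "T n z \<le> T (Suc n) z" "T (Suc n) z \<le> T n z + \<delta> (snd z)" if "z \<in> topspace ?IY" for n z
    using that \<delta>pos[of "snd z"] by (auto simp: T_def min_def algebra_simps)
  have Tc: "continuous_map ?IY unit_interval (T n)" for n
  proof -
    have "continuous_map ?IY euclideanreal (\<lambda>z. fst z)" using continuous_map_fst[of unit_interval Y] by (simp add: continuous_map_in_subtopology)
    moreover have "continuous_map ?IY euclideanreal (\<lambda>z. \<delta> (snd z))"
      using continuous_map_compose[OF continuous_map_snd \<delta>c] by (simp add: o_def)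
    ultimately have "continuous_map ?IY euclideanreal (T n)"
      unfolding T_def by (intro continuous_map_real_min continuous_map_real_mult_left)
    then show ?thesis using T01 by (simp add: continuous_map_unit_interval)
  qed
  \<comment> \<open>The final time becomes part of the parameter and the running time is the first
    argument, so \<open>h\<close> does not see the final time.\<close>
  define H where "H w = h (fst w, snd (snd w))" for w :: "real \<times> real \<times> 'c"
  have Hc: "continuous_map (prod_topology unit_interval ?IY) ?B H"
  proof -
    have "continuous_map (prod_topology unit_interval ?IY) Y (\<lambda>w. snd (snd w))"
      using continuous_map_compose[OF continuous_map_snd continuous_map_snd] by (simp add: o_def)
    from continuous_map_compose[OF continuous_map_pairedI[OF continuous_map_fst this] h]
    show ?thesis by (simp add: o_def H_def[abs_def])
  qed
  have "\<exists>R. \<forall>n. (continuous_map ?IY E (R n) \<and> (\<forall>z\<in>topspace ?IY. p (R n z) = H (T n z, z)) \<and> (n = 0 \<longrightarrow> R n = (\<lambda>z. g (snd z)))) \<and>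
     (\<forall>z\<in>topspace ?IY. T n z = T (Suc n) z \<longrightarrow> R (Suc n) z = R n z)"
  proof (rule dependent_nat_choice)
    have "continuous_map ?IY E (\<lambda>z. g (snd z))" using continuous_map_compose[OF continuous_map_snd g(1)] by (simp add: o_def)
    then show "\<exists>x. continuous_map ?IY E x \<and> (\<forall>z\<in>topspace ?IY. p (x z) = H (T 0 z, z)) \<and> (0 = (0::nat) \<longrightarrow> x = (\<lambda>z. g (snd z)))"
      using g(2) T0 by (intro exI[of _ "\<lambda>z. g (snd z)"]) (auto simp: H_def)
    fix f n assume f: "continuous_map ?IY E f \<and> (\<forall>z\<in>topspace ?IY. p (f z) = H (T n z, z)) \<and> (n = 0 \<longrightarrow> f = (\<lambda>z. g (snd z)))"
    have "\<exists>f'. continuous_map ?IY E f' \<and> (\<forall>z\<in>topspace ?IY. p (f' z) = H (T (Suc n) z, z)) \<and>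
       (\<forall>z\<in>topspace ?IY. T n z = T (Suc n) z \<longrightarrow> f' z = f z)"
    proof (rule lift_small_step[where U=U and \<phi>=\<phi> and G=G, OF _ G(2) _ _ _ Hc Tc Tc])
      show "local_slicing E B p (U n) (\<phi> n)" for n using U by blast
      show "b \<in> U n" if "b \<in> topspace B" "b \<in> P" "0 < G n b" for n b using G(3)[of b n] U[of n] that by auto
      show "\<exists>n. 1 < G n b" if "b \<in> topspace B" "b \<in> P" for b using G(4)[of b] that by auto
      show "\<exists>V N. openin ?B V \<and> b \<in> V \<and> (\<forall>y\<in>V. \<forall>n\<ge>N. G n y = 0)" if "b \<in> topspace B" "b \<in> P" for b using G(5)[of b] that by auto
      fix z assume z: "z \<in> topspace ?IY"
      show "T n z \<le> T (Suc n) z" by (rule T01(3)[OF z])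
      fix s j assume s: "T n z \<le> s" "s \<le> T (Suc n) z"
      have y: "snd z \<in> topspace Y" using z by auto
      have s01: "s \<in> {0..1}" "T n z \<in> {0..1}" using T01(1,2)[OF z, of n] T01(2)[OF z, of "Suc n"] s by auto
      have "\<bar>T n z - s\<bar> \<le> \<delta> (snd z)" using s T01(4)[OF z, of n] by auto
      from csmall[OF y s01(2,1) this] show "\<bar>G j (H (T n z, z)) - G j (H (s, z))\<bar> < 1"
        using cle[of "H (T n z, z)" "H (s, z)" j] hP[OF y] s01 by (simp add: H_def)
    qed (use f in auto)
    then show "\<exists>y. (continuous_map ?IY E y \<and> (\<forall>z\<in>topspace ?IY. p (y z) = H (T (Suc n) z, z)) \<and> (Suc n = 0 \<longrightarrow> y = (\<lambda>z. g (snd z)))) \<and>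
       (\<forall>z\<in>topspace ?IY. T n z = T (Suc n) z \<longrightarrow> y z = f z)" by simp
  qed
  then obtain R where R: "\<And>n. continuous_map ?IY E (R n)" "\<And>n z. z \<in> topspace ?IY \<Longrightarrow> p (R n z) = H (T n z, z)"
     "R 0 = (\<lambda>z. g (snd z))" "\<And>n z. z \<in> topspace ?IY \<Longrightarrow> T n z = T (Suc n) z \<Longrightarrow> R (Suc n) z = R n z" by metis
  have Tend: "T n z = fst z" if "z \<in> topspace ?IY" "real N * \<delta> (snd z) \<ge> 1" "n \<ge> N" for n N z
  proof -
    have "real N * \<delta> (snd z) \<le> real n * \<delta> (snd z)" using that \<delta>pos[of "snd z"] by (intro mult_right_mono) auto
    then show ?thesis using that by (auto simp: T_def)
  qed
  have stable: "R n z = R N z" if "z \<in> topspace ?IY" "\<forall>n\<ge>N. T n z = fst z" "n \<ge> N" for n N z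
    using that(3) by (induction rule: dec_induct) (use R(4)[OF that(1)] that(2) in auto)
  have ex: "\<exists>N. \<forall>n\<ge>N. T n z = fst z" if z: "z \<in> topspace ?IY" for z
  proof -
    have "\<delta> (snd z) > 0" using \<delta>pos z by auto
    then obtain N :: nat where "1 < real N * \<delta> (snd z)" using reals_Archimedean3 by blast
    then show ?thesis using Tend[OF z, of N] by auto
  qed
  define K where "K z = (SOME N. \<forall>n\<ge>N. T n z = fst z)" for z
  have K: "\<forall>n\<ge>K z. T n z = fst z" if "z \<in> topspace ?IY" for z
    unfolding K_def by (rule someI_ex) (rule ex[OF that])
  have KN: "R (K z) z = R N z" if "z \<in> topspace ?IY" "\<forall>n\<ge>N. T n z = fst z" for z N
    using stable[OF that(1) K[OF that(1)], of "max N (K z)"] stable[OF that, of "max N (K z)"] by simp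
  show ?thesis
  proof (intro exI[of _ "\<lambda>z. R (K z) z"] conjI ballI)
    show "continuous_map ?IY E (\<lambda>z. R (K z) z)"
    proof (rule continuous_map_local)
      fix z assume z: "z \<in> topspace ?IY"
      then have d: "\<delta> (snd z) > 0" using \<delta>pos by auto
      then obtain N :: nat where N: "1 < real N * \<delta> (snd z)" using reals_Archimedean3 by blast
      let ?V = "{w \<in> topspace ?IY. real N * \<delta> (snd w) \<in> {1<..}}"
      have "continuous_map ?IY euclideanreal (\<lambda>w. real N * \<delta> (snd w))"
        using continuous_map_compose[OF continuous_map_snd \<delta>c] by (intro continuous_map_real_mult_left) (simp add: o_def)
      then have o: "openin ?IY ?V" by (rule openin_continuous_map_preimage) simp
      have "continuous_map (subtopology ?IY ?V) E (\<lambda>z. R (K z) z)"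
      proof (rule continuous_map_eq[OF continuous_map_from_subtopology[OF R(1)[of N]]])
        fix w assume "w \<in> topspace (subtopology ?IY ?V)"
        then have w: "w \<in> topspace ?IY" "real N * \<delta> (snd w) \<ge> 1" by auto
        show "R N w = R (K w) w" using KN[OF w(1), of N] Tend[OF w] by auto
      qed
      then show "\<exists>V. openin ?IY V \<and> z \<in> V \<and> continuous_map (subtopology ?IY V) E (\<lambda>z. R (K z) z)"
        using o z N by (intro exI[of _ ?V]) auto
    qed
    show "R (K (0, y)) (0, y) = g y" if y: "y \<in> topspace Y" for y
    proof -
      have z: "(0, y) \<in> topspace ?IY" using y by auto
      have "\<forall>n\<ge>0. T n (0, y) = fst (0::real, y)" using \<delta>pos[OF y] by (auto simp: T_def min_def)
      from KN[OF z this] show ?thesis by (simp add: R(3))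
    qed
    show "p (R (K (t, y)) (t, y)) = h (t, y)" if "t \<in> {0..1}" "y \<in> topspace Y" for t y
    proof -
      have z: "(t, y) \<in> topspace ?IY" using that by auto
      show ?thesis using R(2)[OF z] K[OF z] by (simp add: H_def)
    qed
  qed
qed

text \<open>Each path of the homotopy stays in the piece of the base in which it starts. Hence the
  test space splits into disjoint open parts, over each of which the homotopy runs in a second
  countable piece, and the lifts over the parts need no gluing.\<close>

theorem hurewicz_fibration_local_slicing:
  assumes p: "continuous_map E B p" and sl: "\<And>b. b \<in> topspace B \<Longrightarrow> \<exists>U \<phi>. b \<in> U \<and> local_slicing E B p U \<phi>"
    and B: "second_countable_sum B" "locally_compact_space B" "Hausdorff_space B"
  shows "hurewicz_fibration TYPE('y) E B p"
  unfolding hurewicz_fibration_def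
proof (intro conjI p allI impI, elim conjE)
  fix Y :: "'y topology" and h g
  assume h: "continuous_map (prod_topology unit_interval Y) B h" and g: "continuous_map Y E g" "\<forall>y\<in>topspace Y. p (g y) = h (0, y)"
  let ?IY = "prod_topology unit_interval Y"
  obtain \<P> where P: "\<And>P. P \<in> \<P> \<Longrightarrow> openin B P \<and> second_countable (subtopology B P)" "pairwise disjnt \<P>" "\<Union>\<P> = topspace B"
    using B(1) by (auto simp: second_countable_sum_def)
  define Q where "Q P = {y \<in> topspace Y. h (0, y) \<in> P}" for P
  have h0: "continuous_map Y B (\<lambda>y. h (0, y))"
  proof -
    have "continuous_map Y ?IY (\<lambda>y. (0, y))" by (intro continuous_map_pairedI) auto
    from continuous_map_compose[OF this h] show ?thesis by (simp add: o_def)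
  qed
  have Qo: "openin Y (Q P)" if "P \<in> \<P>" for P unfolding Q_def using openin_continuous_map_preimage[OF h0] P(1)[OF that] by blast
  \<comment> \<open>The complement of a piece is the union of the other pieces, hence open, and a
    path is connected.\<close>
  have path: "h (t, y) \<in> P" if PP: "P \<in> \<P>" and y: "y \<in> Q P" and t: "t \<in> {0..1}" for P y t
  proof -
    have yY: "y \<in> topspace Y" using y by (simp add: Q_def)
    have "continuous_map unit_interval ?IY (\<lambda>t. (t, y))" using yY by (intro continuous_map_pairedI) auto
    from continuous_map_compose[OF this h] have c: "continuous_map unit_interval B (\<lambda>t. h (t, y))" by (simp add: o_def)
    have "connectedin unit_interval {0..1}" by (simp add: connectedin_subtopology)
    then have con: "connectedin B ((\<lambda>t. h (t, y)) ` {0..1})" by (rule connectedin_continuous_map_image[OF c])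
    have sub: "(\<lambda>t. h (t, y)) ` {0..1} \<subseteq> topspace B" by (rule connectedin_subset_topspace[OF con])
    have o: "openin B (topspace B - P)"
    proof -
      have "topspace B - P = \<Union>(\<P> - {P})" using P(2,3) PP by (auto simp: pairwise_def disjnt_def)
      then show ?thesis using P(1) by auto
    qed
    have "openin B P" using P(1) PP by blast
    moreover have "(\<lambda>t. h (t, y)) ` {0..1} \<subseteq> P \<union> (topspace B - P)" using sub by blast
    moreover have "P \<inter> (topspace B - P) \<inter> (\<lambda>t. h (t, y)) ` {0..1} = {}" by blast
    moreover have "P \<inter> (\<lambda>t. h (t, y)) ` {0..1} \<noteq> {}" using y by (force simp: Q_def)
    ultimately have "(topspace B - P) \<inter> (\<lambda>t. h (t, y)) ` {0..1} = {}"
      using con o unfolding connectedin by blast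
    then show ?thesis using sub t by blast
  qed
  let ?I = "\<lambda>P. prod_topology unit_interval (subtopology Y (Q P))"
  have IYQ: "?I P = subtopology ?IY ({0..1} \<times> Q P)" for P
    by (simp add: prod_topology_subtopology(2))
  have "\<exists>k. continuous_map (?I P) E k \<and> (\<forall>y\<in>topspace (subtopology Y (Q P)). k (0, y) = g y) \<and>
     (\<forall>t\<in>{0..1}. \<forall>y\<in>topspace (subtopology Y (Q P)). p (k (t, y)) = h (t, y))" if PP: "P \<in> \<P>" for P
  proof (rule lift_over_second_countable[OF sl])
    show "second_countable (subtopology B P)" using P(1)[OF PP] by blast
    show "locally_compact_space (subtopology B P)" using locally_compact_space_open_subset B(2,3) P(1)[OF PP] by blast
    show "Hausdorff_space (subtopology B P)" using B(3) Hausdorff_space_subtopology by blast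
    show "continuous_map (?I P) (subtopology B P) h"
      unfolding IYQ using h path[OF PP] by (auto simp: continuous_map_in_subtopology intro: continuous_map_from_subtopology)
    show "continuous_map (subtopology Y (Q P)) E g" using g(1) by (rule continuous_map_from_subtopology)
  qed (use g(2) in auto)
  then obtain k where k: "\<And>P. P \<in> \<P> \<Longrightarrow> continuous_map (?I P) E (k P)"
    "\<And>P y. P \<in> \<P> \<Longrightarrow> y \<in> Q P \<Longrightarrow> k P (0, y) = g y"
    "\<And>P t y. P \<in> \<P> \<Longrightarrow> t \<in> {0..1} \<Longrightarrow> y \<in> Q P \<Longrightarrow> p (k P (t, y)) = h (t, y)"
  proof -
    assume *: thesis if "\<And>P. P \<in> \<P> \<Longrightarrow> continuous_map (?I P) E (k P)"
      "\<And>P y. P \<in> \<P> \<Longrightarrow> y \<in> Q P \<Longrightarrow> k P (0, y) = g y"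
      "\<And>P t y. P \<in> \<P> \<Longrightarrow> t \<in> {0..1} \<Longrightarrow> y \<in> Q P \<Longrightarrow> p (k P (t, y)) = h (t, y)" for k
    assume "\<And>P. P \<in> \<P> \<Longrightarrow> \<exists>k. continuous_map (?I P) E k \<and> (\<forall>y\<in>topspace (subtopology Y (Q P)). k (0, y) = g y) \<and>
     (\<forall>t\<in>{0..1}. \<forall>y\<in>topspace (subtopology Y (Q P)). p (k (t, y)) = h (t, y))"
    then obtain k where "\<And>P. P \<in> \<P> \<Longrightarrow> continuous_map (?I P) E (k P) \<and> (\<forall>y\<in>topspace (subtopology Y (Q P)). k P (0, y) = g y) \<and>
     (\<forall>t\<in>{0..1}. \<forall>y\<in>topspace (subtopology Y (Q P)). p (k P (t, y)) = h (t, y))" by metis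
    then show thesis by (intro *[of k]) (auto simp: Q_def)
  qed
  define c where "c y = (SOME P. P \<in> \<P> \<and> y \<in> Q P)" for y
  have cex: "\<exists>P. P \<in> \<P> \<and> y \<in> Q P" if "y \<in> topspace Y" for y
    using continuous_map_image_subset_topspace[OF h0] P(3) that unfolding Q_def by blast
  have c: "c y = P" if "P \<in> \<P>" "y \<in> Q P" for y P
  proof -
    have "c y \<in> \<P> \<and> y \<in> Q (c y)" unfolding c_def by (rule someI_ex) (use that in blast)
    then show ?thesis using that P(2) by (auto simp: Q_def pairwise_def disjnt_def)
  qed
  show "\<exists>k. continuous_map ?IY E k \<and> (\<forall>y\<in>topspace Y. k (0, y) = g y) \<and> (\<forall>t\<in>{0..1}. \<forall>y\<in>topspace Y. p (k (t, y)) = h (t, y))"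
  proof (intro exI[of _ "\<lambda>z. k (c (snd z)) z"] conjI ballI)
    show "continuous_map ?IY E (\<lambda>z. k (c (snd z)) z)"
    proof (rule continuous_map_local)
      fix z assume z: "z \<in> topspace ?IY"
      then have "snd z \<in> topspace Y" by auto
      from cex[OF this] obtain P where P': "P \<in> \<P>" "snd z \<in> Q P" by blast
      have "continuous_map (subtopology ?IY ({0..1} \<times> Q P)) E (\<lambda>z. k (c (snd z)) z)"
        by (rule continuous_map_eq[OF k(1)[OF P'(1), unfolded IYQ]]) (use c[OF P'(1)] in auto)
      moreover have "openin ?IY ({0..1} \<times> Q P)"
        using Qo[OF P'(1)] by (simp add: openin_prod_Times_iff)
      ultimately show "\<exists>V. openin ?IY V \<and> z \<in> V \<and> continuous_map (subtopology ?IY V) E (\<lambda>z. k (c (snd z)) z)"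
        using z P'(2) by (intro exI[of _ "{0..1} \<times> Q P"]) auto
    qed
    show "k (c (snd (0, y))) (0, y) = g y" if "y \<in> topspace Y" for y using cex[OF that] c k(2) by fastforce
    show "p (k (c (snd (t, y))) (t, y)) = h (t, y)" if "t \<in> {0..1}" "y \<in> topspace Y" for t y
      using cex[OF that(2)] c k(3)[OF _ that(1)] by fastforce
  qed
qed

section \<open>Forgetting a point of a configuration\<close>

definition l1norm :: "nat \<Rightarrow> (nat \<Rightarrow> real) \<Rightarrow> real" where
  "l1norm k x = (\<Sum>i<k. \<bar>x i\<bar>)"

lemma l1norm_nonneg: "l1norm k x \<ge> 0"
  by (simp add: l1norm_def sum_nonneg)

lemma l1norm_add: "l1norm k (\<lambda>i. x i + y i) \<le> l1norm k x + l1norm k y"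
  unfolding l1norm_def sum.distrib[symmetric] by (intro sum_mono) auto

lemma l1norm_diff: "l1norm k (\<lambda>i. x i - y i) \<le> l1norm k x + l1norm k y"
  unfolding l1norm_def sum.distrib[symmetric] by (intro sum_mono) auto

lemma l1norm_scale: "l1norm k (\<lambda>i. c * x i) = \<bar>c\<bar> * l1norm k x"
  by (simp add: l1norm_def abs_mult sum_distrib_left)

lemma l1norm_triangle: "\<bar>l1norm k x - l1norm k y\<bar> \<le> l1norm k (\<lambda>i. x i - y i)"
  using l1norm_add[of k y "\<lambda>i. x i - y i"] l1norm_add[of k x "\<lambda>i. y i - x i"]
  by (simp add: l1norm_def abs_minus_commute)

lemma l1norm_eq_0: "x \<in> espace k \<Longrightarrow> l1norm k x = 0 \<Longrightarrow> x = (\<lambda>_. 0)"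
  unfolding fun_eq_iff
proof
  fix i assume x: "x \<in> espace k" "l1norm k x = 0"
  then have "\<forall>j\<in>{..<k}. \<bar>x j\<bar> = 0"
    unfolding l1norm_def by (subst (asm) sum_nonneg_eq_0_iff) auto
  then show "x i = 0" using x(1) by (cases "i < k") (simp_all add: espace_iff)
qed

lemma abs_le_l1norm: "i < k \<Longrightarrow> \<bar>x i\<bar> \<le> l1norm k x"
  unfolding l1norm_def by (intro member_le_sum) auto

text \<open>Pushes \<open>a\<close> to \<open>a'\<close> and leaves everything outside the unit ball fixed.\<close>

definition push :: "nat \<Rightarrow> (nat \<Rightarrow> real) \<Rightarrow> (nat \<Rightarrow> real) \<Rightarrow> (nat \<Rightarrow> real) \<Rightarrow> nat \<Rightarrow> real" where
  "push k a a' w = (\<lambda>i. w i + max 0 (1 - l1norm k w) / (1 - l1norm k a) * (a' i - a i))"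

lemma push_espace: "a \<in> espace k \<Longrightarrow> a' \<in> espace k \<Longrightarrow> w \<in> espace k \<Longrightarrow> push k a a' w \<in> espace k"
  by (simp add: push_def espace_iff)

lemma push_same: "push k a a w = w"
  by (simp add: push_def)

lemma push_outside: "l1norm k w \<ge> 1 \<Longrightarrow> push k a a' w = w"
  by (simp add: push_def)

text \<open>The radius 1/3 is chosen so that the displacement from \<open>a\<close> to
  \<open>a'\<close> has norm below 2/3, and \<open>1 - l1norm k a\<close> is above 2/3. A point
  \<open>w\<close> of the unit ball is then moved by at most \<open>1 - l1norm k w\<close> and stays
  in the unit ball; points outside are fixed.\<close>

lemma push_bound:
  assumes "l1norm k a < 1/3" "l1norm k a' < 1/3" "l1norm k w < 2"
  shows "l1norm k (push k a a' w) < 2"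
proof (cases "l1norm k w \<ge> 1")
  case True
  then show ?thesis using assms by (simp add: push_outside)
next
  case False
  define c where "c = (1 - l1norm k w) / (1 - l1norm k a)"
  have c: "c \<ge> 0" "c * (1 - l1norm k a) = 1 - l1norm k w" using False assms(1) by (auto simp: c_def)
  have "push k a a' w = (\<lambda>i. w i + c * (a' i - a i))" using False by (simp add: push_def c_def max_def)
  then have "l1norm k (push k a a' w) \<le> l1norm k w + c * l1norm k (\<lambda>i. a' i - a i)"
    using l1norm_add[of k w "\<lambda>i. c * (a' i - a i)"] c(1) by (simp add: l1norm_scale)
  also have "\<dots> \<le> l1norm k w + c * (1 - l1norm k a)"
    using l1norm_diff[of k a' a] assms c(1) by (intro add_left_mono mult_left_mono) auto
  also have "\<dots> < 2" using c(2) by simp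
  finally show ?thesis .
qed

text \<open>The only form of injectivity that is needed. If \<open>w\<close> is pushed to
  \<open>a'\<close>, then \<open>w - a\<close> is a multiple of the displacement, with a factor
  bounded by \<open>l1norm k (w - a) / (1 - l1norm k a)\<close>. As the displacement is shorter than
  \<open>1 - l1norm k a\<close>, this forces \<open>w = a\<close>.\<close>

lemma push_eq_target:
  assumes a: "l1norm k a < 1/3" "l1norm k a' < 1/3" and e: "a \<in> espace k" "w \<in> espace k" and eq: "push k a a' w = a'"
  shows "w = a"
proof (cases "l1norm k w \<ge> 1")
  case True
  then show ?thesis using assms by (simp add: push_outside)
next
  case False
  define c where "c = (1 - l1norm k w) / (1 - l1norm k a)"
  let ?d = "\<lambda>i. a' i - a i"
  have pos: "1 - l1norm k a > 2/3" using a by simp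
  have "push k a a' w = (\<lambda>i. w i + c * ?d i)" using False by (simp add: push_def c_def max_def)
  then have "w i - a i = (1 - c) * ?d i" for i using fun_cong[OF eq, of i] by (simp add: algebra_simps)
  then have "l1norm k (\<lambda>i. w i - a i) = \<bar>1 - c\<bar> * l1norm k ?d" by (simp add: l1norm_scale)
  moreover have "1 - c = (l1norm k w - l1norm k a) / (1 - l1norm k a)" using pos by (simp add: c_def field_simps)
  ultimately have n: "l1norm k (\<lambda>i. w i - a i) * (1 - l1norm k a) = \<bar>l1norm k w - l1norm k a\<bar> * l1norm k ?d"
    using pos by (simp add: abs_divide)
  \<comment> \<open>The triangle inequality turns the identity \<open>n\<close> into an estimate of
    the norm of \<open>w - a\<close> by a proper fraction of itself.\<close>
  have "\<bar>l1norm k w - l1norm k a\<bar> * l1norm k ?d \<le> l1norm k (\<lambda>i. w i - a i) * l1norm k ?d"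
    by (intro mult_right_mono l1norm_triangle l1norm_nonneg)
  then have "l1norm k (\<lambda>i. w i - a i) * (1 - l1norm k a - l1norm k ?d) \<le> 0" using n by (simp add: algebra_simps)
  moreover have "1 - l1norm k a - l1norm k ?d > 0" using l1norm_diff[of k a' a] a by simp
  ultimately have "l1norm k (\<lambda>i. w i - a i) \<le> 0" by (simp add: mult_le_0_iff)
  then have "l1norm k (\<lambda>i. w i - a i) = 0" using l1norm_nonneg[of k "\<lambda>i. w i - a i"] by simp
  moreover have "(\<lambda>i. w i - a i) \<in> espace k" using e by (simp add: espace_iff)
  ultimately have "(\<lambda>i. w i - a i) = (\<lambda>_. 0)" using l1norm_eq_0 by blast
  then show ?thesis by (metis eq_iff_diff_eq_0 ext)
qed

lemma continuous_map_push:
  assumes "\<And>i. i < k \<Longrightarrow> continuous_map Z euclideanreal (\<lambda>z. a z i)" "\<And>i. i < k \<Longrightarrow> continuous_map Z euclideanreal (\<lambda>z. a' z i)"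
    "\<And>i. i < k \<Longrightarrow> continuous_map Z euclideanreal (\<lambda>z. w z i)" and "\<And>z. z \<in> topspace Z \<Longrightarrow> l1norm k (a z) \<noteq> 1" and i: "i < k"
  shows "continuous_map Z euclideanreal (\<lambda>z. push k (a z) (a' z) (w z) i)"
proof -
  have "continuous_map Z euclideanreal (\<lambda>z. l1norm k (w z))" "continuous_map Z euclideanreal (\<lambda>z. l1norm k (a z))"
    unfolding l1norm_def using assms(1,3) by (auto intro!: continuous_map_sum continuous_map_real_abs)
  then show ?thesis unfolding push_def
    using assms i by (intro continuous_map_add continuous_map_real_mult continuous_map_diff continuous_map_real_divide continuous_map_real_max) auto
qed

text \<open>\<open>\<tau> a a' z\<close> first replaces \<open>z\<close> by the point over the same
  \<open>q z\<close> in the sheet of \<open>x0\<close>, pushes that point in a chart by the push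
  from \<open>a\<close> to \<open>a'\<close>, and returns to the sheet of \<open>z\<close>. So it
  covers one motion below, whatever the sheet. The implication from
  \<open>q (\<tau> a a' z) = q a'\<close> to \<open>q z = q a\<close> is meant contrapositively:
  what was not over the old point is not over the new one. The set \<open>W\<close> confines the
  motion, so that pushes around different points do not interfere.\<close>

lemma covering_push:
  fixes X :: "'a topology" and N :: "'b topology"
  assumes cov: "covering_map X N q" and X: "Hausdorff_space X" and N: "Hausdorff_space N"
    and ch: "\<And>x. x \<in> topspace X \<Longrightarrow> \<exists>k U \<phi>. is_chart X (k, U, \<phi>) \<and> x \<in> U"
    and x0: "x0 \<in> topspace X" and W: "openin N W" "q x0 \<in> W"
  obtains D \<tau> where "openin X D" "x0 \<in> D" "q ` D \<subseteq> W"
    "continuous_map (subtopology (prod_topology X (prod_topology X X)) (D \<times> D \<times> UNIV)) X (\<lambda>(a, a', z). \<tau> a a' z)"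
    "\<And>a a' z. a \<in> D \<Longrightarrow> a' \<in> D \<Longrightarrow> z \<in> topspace X \<Longrightarrow> q (\<tau> a a' z) = q a' \<Longrightarrow> q z = q a"
    "\<And>a z. a \<in> D \<Longrightarrow> z \<in> topspace X \<Longrightarrow> \<tau> a a z = z"
    "\<And>a a' z. a \<in> D \<Longrightarrow> a' \<in> D \<Longrightarrow> z \<in> topspace X \<Longrightarrow> q z \<notin> W \<Longrightarrow> \<tau> a a' z = z"
    "\<And>a a' z. a \<in> D \<Longrightarrow> a' \<in> D \<Longrightarrow> z \<in> topspace X \<Longrightarrow> q z \<in> W \<Longrightarrow> q (\<tau> a a' z) \<in> W"
proof -
  have qc: "continuous_map X N q" using cov by (simp add: covering_map_def)
  have "q x0 \<in> topspace N" using W openin_subset by blast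
  then obtain T \<V> where T: "q x0 \<in> T" "openin N T" and V: "\<Union>\<V> = topspace X \<inter> q -` T" "\<And>V. V \<in> \<V> \<Longrightarrow> openin X V" "pairwise disjnt \<V>"
    "\<And>V. V \<in> \<V> \<Longrightarrow> homeomorphic_map (subtopology X V) (subtopology N T) q"
    using cov unfolding covering_map_def by metis
  have TN: "T \<subseteq> topspace N" using T(2) openin_subset by blast
  have VX: "topspace (subtopology X V) = V" if "V \<in> \<V>" for V using V(2)[OF that] openin_subset by auto
  have qV: "inj_on q V" "q ` V = T" if "V \<in> \<V>" for V
    using homeomorphic_imp_injective_map[OF V(4)[OF that]] homeomorphic_imp_surjective_map[OF V(4)[OF that]] VX[OF that] TN by auto
  have inv_c: "continuous_map (subtopology N T) X (inv_into V q)" if VV: "V \<in> \<V>" for V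
  proof -
    obtain g where g: "homeomorphic_maps (subtopology X V) (subtopology N T) q g"
      using V(4)[OF VV] homeomorphic_map_maps by blast
    then have "continuous_map (subtopology N T) X g" by (auto simp: homeomorphic_maps_def continuous_map_in_subtopology)
    moreover have "g y = inv_into V q y" if y: "y \<in> topspace (subtopology N T)" for y
    proof -
      have "g y \<in> V" "q (g y) = y" using g y VX[OF VV] by (auto simp: homeomorphic_maps_def continuous_map_def)
      then show ?thesis using qV(1)[OF VV] by (metis inv_into_f_f)
    qed
    ultimately show ?thesis by (rule continuous_map_eq)
  qed
  \<comment> \<open>The sheet through \<open>z\<close>.\<close>
  define sh where "sh z = (SOME V. V \<in> \<V> \<and> z \<in> V)" for z
  have sh: "sh z \<in> \<V>" "z \<in> sh z" if "z \<in> topspace X" "q z \<in> T" for z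
  proof -
    have "\<exists>V. V \<in> \<V> \<and> z \<in> V" using V(1) that by blast
    from someI_ex[OF this] show "sh z \<in> \<V>" "z \<in> sh z" by (auto simp: sh_def)
  qed
  have sh_eq: "sh z = V" if "V \<in> \<V>" "z \<in> V" for z V
  proof -
    have "z \<in> topspace X" "q z \<in> T" using V(1) that by blast+
    then show ?thesis using sh[of z] that V(3) by (auto simp: pairwise_def disjnt_def)
  qed
  \<comment> \<open>The point over \<open>y\<close> in the sheet through \<open>z\<close>.\<close>
  define r where "r z y = inv_into (sh z) q y" for z y
  have r: "r z y \<in> topspace X" "q (r z y) = y" if z: "z \<in> topspace X" "q z \<in> T" and y: "y \<in> T" for z y
  proof -
    have "y \<in> q ` sh z" using qV(2)[OF sh(1)[OF z]] y by simp
    then have "r z y \<in> sh z" "q (r z y) = y" by (auto simp: r_def inv_into_into f_inv_into_f)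
    then show "r z y \<in> topspace X" "q (r z y) = y" using V(1) sh(1)[OF z] by auto
  qed
  have rself: "r z (q z) = z" if "z \<in> topspace X" "q z \<in> T" for z
    unfolding r_def using qV(1)[OF sh(1)[OF that]] sh(2)[OF that] by simp
  let ?A = "{z \<in> topspace X. q z \<in> T}"
  let ?AT = "prod_topology (subtopology X ?A) (subtopology N T)"
  have Ao: "openin X ?A" by (rule openin_continuous_map_preimage[OF qc T(2)])
  \<comment> \<open>Joint continuity in \<open>z\<close> and \<open>y\<close> holds because the
    sheet is locally constant in \<open>z\<close>.\<close>
  have rc: "continuous_map ?AT X (\<lambda>(z, y). r z y)"
  proof (rule continuous_map_local)
    fix w assume w: "w \<in> topspace ?AT"
    obtain z y where zy: "w = (z, y)" "z \<in> topspace X" "q z \<in> T" "y \<in> T" using w by (cases w) auto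
    let ?V = "sh z"
    note s = sh[OF zy(2,3)]
    have VA: "?V \<subseteq> ?A" using V(1) s(1) by blast
    have eq: "subtopology ?AT (?V \<times> T) = prod_topology (subtopology X ?V) (subtopology N T)"
      using VA by (simp add: subtopology_Times subtopology_subtopology inf_absorb2)
    have "continuous_map (prod_topology (subtopology X ?V) (subtopology N T)) X (\<lambda>w. inv_into ?V q (snd w))"
      using continuous_map_compose[OF continuous_map_snd inv_c[OF s(1)]] by (simp add: o_def)
    then have "continuous_map (prod_topology (subtopology X ?V) (subtopology N T)) X (\<lambda>(z, y). r z y)"
      by (rule continuous_map_eq) (use sh_eq[OF s(1)] in \<open>auto simp: r_def\<close>)
    moreover have "openin ?AT (?V \<times> T)"
      using V(2)[OF s(1)] VA T(2) by (simp add: openin_prod_Times_iff openin_open_subtopology[OF Ao] openin_open_subtopology[OF T(2)])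
    ultimately show "\<exists>V. openin ?AT V \<and> w \<in> V \<and>
       continuous_map (subtopology ?AT V) X (\<lambda>(z, y). r z y)"
      using zy s(2) eq by (intro exI[of _ "?V \<times> T"]) auto
  qed
  define V0 where "V0 = sh x0"
  have V0: "V0 \<in> \<V>" "x0 \<in> V0" using sh[OF x0 T(1)] by (auto simp: V0_def)
  \<comment> \<open>Everything that moves is kept in one sheet and over \<open>W\<close>.\<close>
  define D0 where "D0 = V0 \<inter> {z \<in> topspace X. q z \<in> W}"
  have D0: "openin X D0" "x0 \<in> D0"
    unfolding D0_def using V(2)[OF V0(1)] openin_continuous_map_preimage[OF qc W(1)] V0(2) x0 W(2) by auto
  obtain k U \<phi> where c: "is_chart X (k, U, \<phi>)" "x0 \<in> U" using ch[OF x0] by blast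
  have c': "is_chart X (k, U \<inter> D0, \<phi>)" by (rule is_chart_subset[OF c(1)]) (use chart_open[OF c(1)] D0 in auto)
  obtain Vc Kc where Kc: "openin X Vc" "x0 \<in> Vc" "Vc \<subseteq> Kc" "Kc \<subseteq> U \<inter> D0" "compactin X Kc"
    using chart_locally_compact[OF c', of x0] c(2) D0(2) by auto
  have "openin (euc k) (\<phi> ` Vc)" by (rule chart_open_image[OF c(1) Kc(1)]) (use Kc in auto)
  then obtain e where e: "e > 0" "\<And>y. y \<in> espace k \<Longrightarrow> (\<And>i. i < k \<Longrightarrow> \<bar>y i - \<phi> x0 i\<bar> < e) \<Longrightarrow> y \<in> \<phi> ` Vc"
    using openin_Euclidean_contains_box[of k "\<phi> ` Vc" "\<phi> x0"] Kc(2) by (metis imageI)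
  \<comment> \<open>Coordinates centred at \<open>x0\<close> and scaled so that the ball of radius 2
    fits into the box of half-width \<open>e\<close>. Three radii are used: 1/3 for the positions
    \<open>a\<close> and \<open>a'\<close>, 1 for the support of the push, 2 for the domain on which
    it is defined.\<close>
  define u where "u x = (\<lambda>i. (\<phi> x i - \<phi> x0 i) * (2 / e))" for x
  let ?sc = "\<lambda>y i. \<phi> x0 i + e / 2 * y i"
  define v where "v y = inv_into U \<phi> (?sc y)" for y
  have fe: "\<phi> x \<in> espace k" if "x \<in> U" for x using chart_espace[OF c(1)] that by blast
  have ue: "u x \<in> espace k" if "x \<in> U" for x using fe[OF that] fe[OF c(2)] by (simp add: u_def espace_iff)
  have vy: "v y \<in> Vc" "\<phi> (v y) = (?sc y)" if y: "y \<in> espace k" "l1norm k y < 2" for y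
  proof -
    have "(?sc y) \<in> \<phi> ` Vc"
    proof (rule e(2))
      show "(?sc y) \<in> espace k" using fe[OF c(2)] y(1) by (simp add: espace_iff)
      fix i assume "i < k"
      then have "\<bar>y i\<bar> < 2" using abs_le_l1norm[of i k y] y(2) by simp
      then show "\<bar>\<phi> x0 i + e / 2 * y i - \<phi> x0 i\<bar> < e" using e(1) by (simp add: abs_mult)
    qed
    then obtain x where x: "x \<in> Vc" "(?sc y) = \<phi> x" by blast
    then have "v y = x" using Kc(3,4) chart_inv[OF c(1)] by (auto simp: v_def)
    then show "v y \<in> Vc" "\<phi> (v y) = (?sc y)" using x by auto
  qed
  have uv: "u (v y) = y" if y: "y \<in> espace k" "l1norm k y < 2" for y
    using vy(2)[OF y] e(1) by (simp add: u_def fun_eq_iff)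
  have vu: "v (u x) = x" if "x \<in> U" for x
  proof -
    have "(\<lambda>i. \<phi> x0 i + e / 2 * u x i) = \<phi> x" using e(1) by (simp add: u_def fun_eq_iff field_simps)
    then show ?thesis using chart_inv[OF c(1) that] by (simp add: v_def)
  qed
  have uc: "continuous_map (subtopology X U) euclideanreal (\<lambda>x. u x i)" if "i < k" for i
    using chart_continuous[OF c(1)] that unfolding continuous_map_into_Euclidean_space u_def
    by (intro continuous_map_real_mult_right continuous_map_diff) auto
  have nc: "continuous_map (subtopology X U) euclideanreal (\<lambda>x. l1norm k (u x))"
    unfolding l1norm_def using uc by (intro continuous_map_sum continuous_map_real_abs) auto
  define Ob where "Ob R = {x \<in> topspace (subtopology X U). l1norm k (u x) \<in> {..<R}}" for R
  have Ob_iff: "x \<in> Ob R \<longleftrightarrow> x \<in> U \<and> l1norm k (u x) < R" for x R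
    using topspace_chart[OF c(1)] by (auto simp: Ob_def)
  have Obo: "openin X (Ob R)" for R
    using openin_trans_full[OF _ chart_open[OF c(1)]] openin_continuous_map_preimage[OF nc, of "{..<R}"] by (simp add: Ob_def)
  have ObVc: "x \<in> Vc" if "x \<in> Ob 2" for x
    using vy(1)[OF ue, of x] vu[of x] that by (auto simp: Ob_iff)
  then have ObD0: "x \<in> D0" if "x \<in> Ob 2" for x using Kc(3,4) that by blast
  have Ob_mono: "x \<in> Ob R" if "x \<in> Ob S" "S \<le> R" for x R S using that by (auto simp: Ob_iff)
  have ObV0: "x \<in> V0" "q x \<in> W" "q x \<in> T" "x \<in> topspace X" if "x \<in> Ob 2" for x
    using ObD0[OF that] V(1) V0(1) by (auto simp: D0_def)
  define D where "D = Ob (1/3)"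
  have D2: "a \<in> Ob 2" if "a \<in> D" for a using Ob_mono[OF that[unfolded D_def]] by simp
  have ux0: "u x0 = (\<lambda>_. 0)" by (simp add: u_def fun_eq_iff)
  have x0D: "x0 \<in> D" using c(2) by (simp add: D_def Ob_iff ux0 l1norm_def)
  \<comment> \<open>The closed ball of radius 1 in these coordinates, compact as a closed part of
    \<open>Kc\<close>. Its image below is compact, hence closed since \<open>N\<close> is Hausdorff;
    so not lying over it is an open condition.\<close>
  define K where "K = {x \<in> Kc. l1norm k (u x) \<in> {..1}}"
  have KX: "Kc \<subseteq> topspace X" using compactin_subset_topspace[OF Kc(5)] .
  have "continuous_map (subtopology X Kc) euclideanreal (\<lambda>x. l1norm k (u x))"
    by (rule continuous_map_from_subtopology_mono[OF nc]) (use Kc in auto)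
  then have "closedin (subtopology X Kc) {x \<in> topspace (subtopology X Kc). l1norm k (u x) \<in> {..1}}"
    by (rule closedin_continuous_map_preimage) simp
  then have "closedin (subtopology X Kc) K" using KX by (simp add: K_def inf_absorb2)
  moreover have "compact_space (subtopology X Kc)" using Kc(5) by (simp add: compact_space_subtopology)
  ultimately have "compactin (subtopology X Kc) K" using closedin_compact_space by blast
  then have "compactin X K" by (simp add: compactin_subtopology)
  then have "closedin N (q ` K)" using image_compactin[OF _ qc] compactin_imp_closedin[OF N] by blast
  then have "openin N (topspace N - q ` K)" by blast
  from openin_continuous_map_preimage[OF qc this]
  have A1o: "openin X {z \<in> topspace X. q z \<in> topspace N - q ` K}" .
  \<comment> \<open>The points not over the support of the push, where \<open>\<tau>\<close> is the
    identity. Together with \<open>A2\<close>, the points over the ball of radius 2, they form an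
    open cover, and continuity of \<open>\<tau>\<close> is checked on each set.\<close>
  define A1 where "A1 = {z \<in> topspace X. q z \<in> topspace N - q ` K}"
  \<comment> \<open>The representative of \<open>z\<close> in the sheet of
    \<open>x0\<close>.\<close>
  define w where "w z = inv_into V0 q (q z)" for z
  have wV: "w z \<in> V0" "q (w z) = q z" if "q z \<in> T" for z
    using qV(2)[OF V0(1)] that by (auto simp: w_def inv_into_into f_inv_into_f)
  have wc: "continuous_map (subtopology X ?A) X w"
  proof -
    have "continuous_map (subtopology X ?A) (subtopology N T) q"
      using qc by (auto simp: continuous_map_in_subtopology continuous_map_from_subtopology)
    from continuous_map_compose[OF this inv_c[OF V0(1)]] show ?thesis by (simp add: o_def w_def[abs_def])
  qed
  define A2 where "A2 = {z \<in> topspace (subtopology X ?A). w z \<in> Ob 2}"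
  have A2: "openin X A2" unfolding A2_def
    using openin_trans_full[OF openin_continuous_map_preimage[OF wc Obo] Ao] .
  have A2_iff: "z \<in> A2 \<longleftrightarrow> z \<in> topspace X \<and> q z \<in> q ` Ob 2" for z
  proof
    assume "z \<in> A2"
    then have "z \<in> topspace X" "w z \<in> Ob 2" "q (w z) = q z" using wV by (auto simp: A2_def)
    then show "z \<in> topspace X \<and> q z \<in> q ` Ob 2" by (metis imageI)
  next
    assume z: "z \<in> topspace X \<and> q z \<in> q ` Ob 2"
    then obtain x where x: "x \<in> Ob 2" "q z = q x" by blast
    have "w z = x" unfolding w_def x(2) using qV(1)[OF V0(1)] ObV0(1)[OF x(1)] by simp
    then show "z \<in> A2" using z x ObV0(3)[OF x(1)] by (simp add: A2_def)
  qed
  define mv where "mv a a' x = v (push k (u a) (u a') (u x))" for a a' x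
  have mv: "mv a a' x \<in> Ob 2" "u (mv a a' x) = push k (u a) (u a') (u x)" if "a \<in> D" "a' \<in> D" "x \<in> Ob 2" for a a' x
  proof -
    have p: "push k (u a) (u a') (u x) \<in> espace k" "l1norm k (push k (u a) (u a') (u x)) < 2"
      using that by (auto simp: D_def Ob_iff intro!: push_espace push_bound ue)
    show "u (mv a a' x) = push k (u a) (u a') (u x)" unfolding mv_def by (rule uv[OF p])
    then show "mv a a' x \<in> Ob 2" using vy(1)[OF p] Kc(3,4) p(2) by (auto simp: Ob_iff mv_def)
  qed
  define \<tau> where "\<tau> a a' z = (if z \<in> A2 then r z (q (mv a a' (w z))) else z)" for a a' z
  have A2D: "z \<in> topspace X" "q z \<in> T" "w z \<in> Ob 2" "q (w z) = q z" if "z \<in> A2" for z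
    using that wV by (auto simp: A2_def)
  have \<tau>A2: "q (\<tau> a a' z) = q (mv a a' (w z))" if "a \<in> D" "a' \<in> D" "z \<in> A2" for a a' z
    using r(2)[OF A2D(1,2)[OF that(3)] ObV0(3)[OF mv(1)[OF that(1,2) A2D(3)[OF that(3)]]]] that(3) by (simp add: \<tau>_def)
  have \<tau>A1: "\<tau> a a' z = z" if "z \<in> A1" for a a' z
  proof (cases "z \<in> A2")
    case True
    note z = A2D[OF True]
    have "\<not> l1norm k (u (w z)) \<le> 1"
    proof
      assume "l1norm k (u (w z)) \<le> 1"
      then have "w z \<in> K" using ObVc[OF z(3)] Kc(3) by (auto simp: K_def)
      then have "q z \<in> q ` K" using imageI[of "w z" K q] z(4) by simp
      then show False using that by (simp add: A1_def)
    qed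
    then have "mv a a' (w z) = w z" using z(3) vu[of "w z"] by (simp add: mv_def push_outside Ob_iff)
    then show ?thesis using True z rself by (simp add: \<tau>_def)
  qed (simp add: \<tau>_def)
  \<comment> \<open>The support lies over the ball of radius 1, well inside the ball of radius
    2.\<close>
  have cover: "z \<in> A1 \<or> z \<in> A2" if z: "z \<in> topspace X" for z
  proof (cases "q z \<in> q ` K")
    case True
    then obtain x where x: "x \<in> Kc" "l1norm k (u x) \<le> 1" "q z = q x" by (auto simp: K_def)
    then have "x \<in> Ob 2" using Kc(4) by (auto simp: Ob_iff)
    then show ?thesis using A2_iff z x(3) by blast
  next
    case False
    then show ?thesis using z continuous_map_image_subset_topspace[OF qc] by (auto simp: A1_def)
  qed
  let ?P = "subtopology (prod_topology X (prod_topology X X)) (D \<times> D \<times> UNIV)"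
  have DX: "D \<subseteq> topspace X" using ObV0(4) D2 by blast
  have PT: "topspace ?P = D \<times> D \<times> topspace X" using DX by auto
  have \<tau>c: "continuous_map ?P X (\<lambda>(a, a', z). \<tau> a a' z)"
  proof (rule continuous_map_local)
    fix p assume p: "p \<in> topspace ?P"
    have po: "openin ?P (D \<times> D \<times> A)" if "openin X A" for A
    proof -
      have "D \<times> D \<times> A = (topspace X \<times> topspace X \<times> A) \<inter> (D \<times> D \<times> UNIV)" using DX by auto
      moreover have "openin (prod_topology X (prod_topology X X)) (topspace X \<times> topspace X \<times> A)"
        using that by (simp add: openin_prod_Times_iff)
      ultimately show ?thesis by (auto simp: openin_subtopology)
    qed
    have proj: "continuous_map (subtopology ?P S) X (\<lambda>p. fst p)" "continuous_map (subtopology ?P S) X (\<lambda>p. fst (snd p))"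
      "continuous_map (subtopology ?P S) X (\<lambda>p. snd (snd p))" for S
      by (intro continuous_map_from_subtopology continuous_map_fst
        continuous_map_compose[OF continuous_map_snd continuous_map_fst, unfolded o_def]
        continuous_map_compose[OF continuous_map_snd continuous_map_snd, unfolded o_def])+
    show "\<exists>S. openin ?P S \<and> p \<in> S \<and> continuous_map (subtopology ?P S) X (\<lambda>(a, a', z). \<tau> a a' z)"
    proof (cases "snd (snd p) \<in> A1")
      case True
      have "continuous_map (subtopology ?P (D \<times> D \<times> A1)) X (\<lambda>(a, a', z). \<tau> a a' z)"
        by (rule continuous_map_eq[OF proj(3)]) (use \<tau>A1 in auto)
      then show ?thesis using po[OF A1o] True p PT by (intro exI[of _ "D \<times> D \<times> A1"]) (auto simp: A1_def)
    next
      case False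
      have "p \<in> D \<times> D \<times> topspace X" using p unfolding PT .
      then have pA2: "snd (snd p) \<in> A2" using cover[of "snd (snd p)"] False by (simp add: mem_Times_iff)
      let ?S = "D \<times> D \<times> A2"
      let ?Q = "subtopology ?P ?S"
      have Q: "fst s \<in> D" "fst (snd s) \<in> D" "snd (snd s) \<in> A2" if "s \<in> topspace ?Q" for s using that by auto
      have uD: "continuous_map ?Q euclideanreal (\<lambda>s. u (fst s) i)" "continuous_map ?Q euclideanreal (\<lambda>s. u (fst (snd s)) i)"
        "continuous_map ?Q euclideanreal (\<lambda>s. u (w (snd (snd s))) i)" if i: "i < k" for i
      proof -
        have "continuous_map ?Q (subtopology X U) (\<lambda>s. fst s)" "continuous_map ?Q (subtopology X U) (\<lambda>s. fst (snd s))"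
          unfolding continuous_map_in_subtopology using proj Q D2 by (auto simp: Ob_iff)
        then show "continuous_map ?Q euclideanreal (\<lambda>s. u (fst s) i)" "continuous_map ?Q euclideanreal (\<lambda>s. u (fst (snd s)) i)"
          using continuous_map_compose[OF _ uc[OF i]] by (auto simp: o_def)
        have "continuous_map ?Q (subtopology X ?A) (\<lambda>s. snd (snd s))"
          unfolding continuous_map_in_subtopology using proj Q A2D by auto
        from continuous_map_compose[OF this wc] have "continuous_map ?Q (subtopology X U) (\<lambda>s. w (snd (snd s)))"
          unfolding continuous_map_in_subtopology using Q A2D(3) by (auto simp: o_def Ob_iff)
        then show "continuous_map ?Q euclideanreal (\<lambda>s. u (w (snd (snd s))) i)"
          using continuous_map_compose[OF _ uc[OF i]] by (auto simp: o_def)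
      qed
      let ?push = "\<lambda>s. push k (u (fst s)) (u (fst (snd s))) (u (w (snd (snd s))))"
      have pc: "continuous_map ?Q euclideanreal (\<lambda>s. ?push s i)" if "i < k" for i
      proof (rule continuous_map_push[OF uD(1) uD(2) uD(3) _ that])
        show "l1norm k (u (fst s)) \<noteq> 1" if "s \<in> topspace ?Q" for s using Q(1)[OF that] by (auto simp: D_def Ob_iff)
      qed
      have pe: "?push s \<in> espace k" "l1norm k (?push s) < 2" if "s \<in> topspace ?Q" for s
        using Q[OF that] A2D(3)[OF Q(3)[OF that]] by (auto simp: D_def Ob_iff intro!: push_espace push_bound ue)
      have "continuous_map ?Q (euc_on k (\<phi> ` U)) (\<lambda>s i. \<phi> x0 i + e / 2 * ?push s i)"
        unfolding continuous_map_in_subtopology continuous_map_into_Euclidean_space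
      proof (intro conjI allI impI)
        fix i assume "i < k"
        then show "continuous_map ?Q euclideanreal (\<lambda>s. \<phi> x0 i + e / 2 * ?push s i)"
          by (intro continuous_map_add continuous_map_real_mult_left pc) auto
      next
        show "(\<lambda>s i. \<phi> x0 i + e / 2 * ?push s i) ` topspace ?Q \<subseteq> espace k"
          using pe(1) fe[OF c(2)] by (auto simp: espace_iff simp del: topspace_subtopology)
        show "(\<lambda>s i. \<phi> x0 i + e / 2 * ?push s i) \<in> topspace ?Q \<rightarrow> \<phi> ` U"
        proof
          fix s assume s: "s \<in> topspace ?Q"
          have "(\<lambda>i. \<phi> x0 i + e / 2 * ?push s i) = \<phi> (v (?push s))" by (rule vy(2)[OF pe[OF s], symmetric])
          moreover have "v (?push s) \<in> U" using vy(1)[OF pe[OF s]] Kc(3,4) by blast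
          ultimately show "(\<lambda>i. \<phi> x0 i + e / 2 * ?push s i) \<in> \<phi> ` U" by blast
        qed
      qed
      from continuous_map_compose[OF this chart_inv_continuous[OF c(1)]]
      have mvc: "continuous_map ?Q X (\<lambda>s. mv (fst s) (fst (snd s)) (w (snd (snd s))))"
        by (simp add: o_def mv_def v_def)
      have mvO: "mv (fst s) (fst (snd s)) (w (snd (snd s))) \<in> Ob 2" if "s \<in> topspace ?Q" for s
        by (rule mv(1)[OF Q(1,2)[OF that] A2D(3)[OF Q(3)[OF that]]])
      have "continuous_map ?Q ?AT (\<lambda>s. (snd (snd s), q (mv (fst s) (fst (snd s)) (w (snd (snd s))))))"
      proof (rule continuous_map_pairedI)
        show "continuous_map ?Q (subtopology X ?A) (\<lambda>s. snd (snd s))"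
          unfolding continuous_map_in_subtopology using proj Q A2D by auto
        show "continuous_map ?Q (subtopology N T) (\<lambda>s. q (mv (fst s) (fst (snd s)) (w (snd (snd s)))))"
          unfolding continuous_map_in_subtopology
          using continuous_map_compose[OF mvc qc] mvO ObV0(3) by (auto simp: o_def simp del: topspace_subtopology)
      qed
      from continuous_map_compose[OF this rc]
      have "continuous_map ?Q X (\<lambda>s. r (snd (snd s)) (q (mv (fst s) (fst (snd s)) (w (snd (snd s))))))" by (simp add: o_def)
      then have "continuous_map ?Q X (\<lambda>(a, a', z). \<tau> a a' z)"
        by (rule continuous_map_eq) (use Q(3) in \<open>auto simp: \<tau>_def simp del: topspace_subtopology\<close>)
      then show ?thesis using po[OF A2] pA2 p PT by (intro exI[of _ ?S]) auto
    qed
  qed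
  show thesis
  proof (rule that[OF _ x0D _ \<tau>c])
    show "openin X D" unfolding D_def by (rule Obo)
    show "q ` D \<subseteq> W" using ObV0(2) D2 by blast
    fix a a' z assume a: "a \<in> D" and z: "z \<in> topspace X"
    show "\<tau> a a z = z"
    proof (cases "z \<in> A2")
      case True
      then have "mv a a (w z) = w z" using vu[of "w z"] A2D(3)[OF True] by (simp add: mv_def push_same Ob_iff)
      then show ?thesis using True A2D rself by (simp add: \<tau>_def)
    qed (simp add: \<tau>_def)
    assume a': "a' \<in> D"
    show "q z = q a" if eq: "q (\<tau> a a' z) = q a'"
    proof (cases "z \<in> A2")
      case True
      note m = mv[OF a a' A2D(3)[OF True]]
      have "q (mv a a' (w z)) = q a'" using \<tau>A2[OF a a' True] eq by simp
      then have "mv a a' (w z) = a'" using qV(1)[OF V0(1)] ObV0(1)[OF m(1)] ObV0(1)[OF D2[OF a']] by (auto dest: inj_onD)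
      then have "push k (u a) (u a') (u (w z)) = u a'" using m(2) by simp
      then have "u (w z) = u a"
        using a a' A2D(3)[OF True] by (intro push_eq_target[of k "u a" "u a'"]) (auto simp: D_def Ob_iff intro: ue)
      moreover have "v (u (w z)) = w z" "v (u a) = a"
        using vu[of "w z"] vu[of a] a A2D(3)[OF True] unfolding D_def Ob_iff by blast+
      ultimately have "w z = a" by metis
      then show ?thesis using A2D(4)[OF True] by simp
    next
      case False
      \<comment> \<open>Outside \<open>A2\<close> nothing moves, so \<open>z\<close> itself would
        lie over \<open>a'\<close>; but all points over \<open>a'\<close> belong to
        \<open>A2\<close>.\<close>
      then have "q z = q a'" using eq by (simp add: \<tau>_def)
      then have "z \<in> A2" using A2_iff z D2[OF a'] by blast
      then show ?thesis using False by blast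
    qed
    show "\<tau> a a' z = z" if "q z \<notin> W"
      using that A2_iff ObV0(2) by (auto simp: \<tau>_def)
    show "q (\<tau> a a' z) \<in> W" if "q z \<in> W"
    proof (cases "z \<in> A2")
      case True
      then show ?thesis using \<tau>A2[OF a a' True] ObV0(2)[OF mv(1)[OF a a' A2D(3)[OF True]]] by simp
    qed (use that in \<open>simp add: \<tau>_def\<close>)
  qed
qed

section \<open>Slicing the map that forgets the last point\<close>

lemma Hausdorff_separate_finite:
  assumes N: "Hausdorff_space N" and I: "finite I" and y: "\<And>i. i \<in> I \<Longrightarrow> y i \<in> topspace N" "inj_on y I"
  obtains W where "\<And>i. i \<in> I \<Longrightarrow> openin N (W i)" "\<And>i. i \<in> I \<Longrightarrow> y i \<in> W i"
    "\<And>i j. i \<in> I \<Longrightarrow> j \<in> I \<Longrightarrow> i \<noteq> j \<Longrightarrow> W i \<inter> W j = {}"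
proof -
  have "\<exists>P Q. openin N P \<and> openin N Q \<and> y i \<in> P \<and> y j \<in> Q \<and> disjnt P Q" if "i \<in> I" "j \<in> I" "i \<noteq> j" for i j
    using N y that unfolding Hausdorff_space_def by (metis inj_onD)
  then obtain P Q where PQ: "\<And>i j. i \<in> I \<Longrightarrow> j \<in> I \<Longrightarrow> i \<noteq> j \<Longrightarrow> openin N (P i j) \<and> openin N (Q i j) \<and> y i \<in> P i j \<and> y j \<in> Q i j \<and> disjnt (P i j) (Q i j)"
    by metis
  \<comment> \<open>Both roles of \<open>y i\<close> are used, as first and as second member of a
    separated pair, so that for each pair \<open>i\<close>, \<open>j\<close> the two sets lie in the
    disjoint sets \<open>P i j\<close> and \<open>Q i j\<close>.\<close>
  define W where "W i = \<Inter>(insert (topspace N) ((\<lambda>j. P i j \<inter> Q j i) ` (I - {i})))" for i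
  show thesis
  proof
    show "openin N (W i)" if "i \<in> I" for i
      unfolding W_def by (rule openin_Inter) (use PQ that I in auto)
    show "y i \<in> W i" if "i \<in> I" for i using PQ that y(1) by (auto simp: W_def)
    show "W i \<inter> W j = {}" if "i \<in> I" "j \<in> I" "i \<noteq> j" for i j
    proof -
      have "W i \<subseteq> P i j" "W j \<subseteq> Q i j" using that by (auto simp: W_def)
      then show ?thesis using PQ[OF that] by (auto simp: disjnt_def)
    qed
  qed
qed

text \<open>For \<open>q\<close> the orbit map this is the topology of the object space of the
  configuration groupoids. A general map \<open>q\<close> keeps the slicing independent of
  groupoids.\<close>

definition configurations :: "'a topology \<Rightarrow> ('a \<Rightarrow> 'b) \<Rightarrow> nat \<Rightarrow> (nat \<Rightarrow> 'a) topology" where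
  "configurations X q n = subtopology (product_topology (\<lambda>_. X) {1..n})
     {x. \<forall>i\<in>{1..n}. \<forall>j\<in>{1..n}. i \<noteq> j \<longrightarrow> q (x i) \<noteq> q (x j)}"

lemma topspace_configurations:
  "topspace (configurations X q n) = {x \<in> {1..n} \<rightarrow>\<^sub>E topspace X. \<forall>i\<in>{1..n}. \<forall>j\<in>{1..n}. i \<noteq> j \<longrightarrow> q (x i) \<noteq> q (x j)}"
  by (auto simp: configurations_def)

lemma continuous_map_configuration_component:
  "i \<in> {1..n} \<Longrightarrow> continuous_map (configurations X q n) X (\<lambda>x. x i)"
  unfolding configurations_def by (intro continuous_map_from_subtopology continuous_map_product_projection)

lemma continuous_map_forget:
  "continuous_map (configurations X q (Suc m)) (configurations X q m) (\<lambda>x. restrict x {1..m})"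
proof -
  have "continuous_map (configurations X q (Suc m)) (product_topology (\<lambda>_. X) {1..m}) (\<lambda>x. restrict x {1..m})"
    unfolding continuous_map_componentwise
    by (auto intro!: continuous_map_eq[OF continuous_map_configuration_component])
  then show ?thesis
    unfolding configurations_def[of X q m] continuous_map_in_subtopology by (auto simp: topspace_configurations)
qed

lemma configuration_extend:
  assumes b: "b \<in> topspace (configurations X q m)" and z: "z \<in> topspace X" "\<And>i. i \<in> {1..m} \<Longrightarrow> q z \<noteq> q (b i)"
  shows "b(Suc m := z) \<in> topspace (configurations X q (Suc m))" "restrict (b(Suc m := z)) {1..m} = b"
proof -
  show "b(Suc m := z) \<in> topspace (configurations X q (Suc m))"
    unfolding topspace_configurations
  proof (intro CollectI conjI ballI impI)
    have b': "b \<in> {1..m} \<rightarrow>\<^sub>E topspace X" using b unfolding topspace_configurations by blast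
    have "b(Suc m := z) \<in> insert (Suc m) {1..m} \<rightarrow>\<^sub>E topspace X" by (rule PiE_fun_upd[OF z(1) b'])
    moreover have "insert (Suc m) {1..m} = {1..Suc m}" by auto
    ultimately show "b(Suc m := z) \<in> {1..Suc m} \<rightarrow>\<^sub>E topspace X" by simp
    have d: "q (b i) \<noteq> q (b j)" if "i \<in> {1..m}" "j \<in> {1..m}" "i \<noteq> j" for i j
      using b that unfolding topspace_configurations by blast
    fix i j assume i: "i \<in> {1..Suc m}" and j: "j \<in> {1..Suc m}" and ij: "i \<noteq> j"
    have "i = Suc m \<or> i \<in> {1..m}" "j = Suc m \<or> j \<in> {1..m}" using i j by auto
    then show "q ((b(Suc m := z)) i) \<noteq> q ((b(Suc m := z)) j)"
      using ij z(2)[of i] z(2)[of j] d[of i j] by (metis fun_upd_apply)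
  qed
  show "restrict (b(Suc m := z)) {1..m} = b"
    using b by (auto simp: topspace_configurations PiE_iff extensional_def restrict_def fun_eq_iff)
qed

text \<open>Over base configurations close to \<open>b0\<close>, the last point of \<open>e\<close>
  is carried along by the pushes from \<open>e i\<close> to \<open>b i\<close>, one after the other.
  The orbits of the points of \<open>b0\<close> have disjoint neighbourhoods, so at most one push
  really moves the last point, and that push keeps it off the orbit of the corresponding new point.
  The first \<open>m\<close> points are simply replaced by \<open>b\<close>.\<close>

lemma configuration_local_slicing:
  fixes X :: "'a topology" and N :: "'b topology"
  assumes cov: "covering_map X N q" and X: "Hausdorff_space X" and N: "Hausdorff_space N"
    and ch: "\<And>x. x \<in> topspace X \<Longrightarrow> \<exists>k U \<phi>. is_chart X (k, U, \<phi>) \<and> x \<in> U"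
    and b0: "b0 \<in> topspace (configurations X q m)"
  shows "\<exists>U \<phi>. b0 \<in> U \<and> local_slicing (configurations X q (Suc m)) (configurations X q m) (\<lambda>x. restrict x {1..m}) U \<phi>"
proof -
  let ?E = "configurations X q (Suc m)" and ?B = "configurations X q m"
  define p where "p = (\<lambda>x :: nat \<Rightarrow> 'a. restrict x {1..m})"
  have p: "p x i = x i" if "i \<in> {1..m}" for x i using that by (simp add: p_def)
  have qN: "q x \<in> topspace N" if "x \<in> topspace X" for x
    using cov continuous_map_image_subset_topspace that unfolding covering_map_def by blast
  have b0X: "b0 i \<in> topspace X" if "i \<in> {1..m}" for i using b0 that by (auto simp: topspace_configurations)
  have "inj_on (\<lambda>i. q (b0 i)) {1..m}" using b0 by (force simp: topspace_configurations inj_on_def)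
  then obtain W where W: "\<And>i. i \<in> {1..m} \<Longrightarrow> openin N (W i)" "\<And>i. i \<in> {1..m} \<Longrightarrow> q (b0 i) \<in> W i"
    "\<And>i j. i \<in> {1..m} \<Longrightarrow> j \<in> {1..m} \<Longrightarrow> i \<noteq> j \<Longrightarrow> W i \<inter> W j = {}"
    using Hausdorff_separate_finite[OF N, of "{1..m}" "\<lambda>i. q (b0 i)"] b0X qN by (metis finite_atLeastAtMost)
  \<comment> \<open>Bundles the properties of one push so that the domains and pushes for all
    indices can be chosen together.\<close>
  define good where "good i D \<tau> \<longleftrightarrow> openin X D \<and> b0 i \<in> D \<and> q ` D \<subseteq> W i \<and>
    continuous_map (subtopology (prod_topology X (prod_topology X X)) (D \<times> D \<times> UNIV)) X (\<lambda>(a, a', z). \<tau> a a' z) \<and>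
    (\<forall>a\<in>D. \<forall>a'\<in>D. \<forall>z\<in>topspace X. (q (\<tau> a a' z) = q a' \<longrightarrow> q z = q a) \<and> \<tau> a a z = z \<and>
      (q z \<notin> W i \<longrightarrow> \<tau> a a' z = z) \<and> (q z \<in> W i \<longrightarrow> q (\<tau> a a' z) \<in> W i))" for i D \<tau>
  have "\<exists>D \<tau>. good i D \<tau>" if i: "i \<in> {1..m}" for i
  proof (rule covering_push[OF cov X N ch b0X[OF i] W(1,2)[OF i]], assumption, goal_cases)
    case (1 D \<tau>)
    have "\<forall>a\<in>D. \<forall>a'\<in>D. \<forall>z\<in>topspace X. (q (\<tau> a a' z) = q a' \<longrightarrow> q z = q a) \<and> \<tau> a a z = z \<and>
      (q z \<notin> W i \<longrightarrow> \<tau> a a' z = z) \<and> (q z \<in> W i \<longrightarrow> q (\<tau> a a' z) \<in> W i)"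
      using 1(5-8) by blast
    then have "good i D \<tau>" unfolding good_def using 1(1-4) by blast
    then show ?case by blast
  qed
  then obtain D \<tau> where g: "\<And>i. i \<in> {1..m} \<Longrightarrow> good i (D i) (\<tau> i)" by metis
  have D: "openin X (D i)" "b0 i \<in> D i" "q ` D i \<subseteq> W i"
    "continuous_map (subtopology (prod_topology X (prod_topology X X)) (D i \<times> D i \<times> UNIV)) X (\<lambda>(a, a', z). \<tau> i a a' z)"
    if "i \<in> {1..m}" for i using g[OF that] by (auto simp: good_def)
  have \<tau>: "q (\<tau> i a a' z) = q a' \<Longrightarrow> q z = q a" "\<tau> i a a z = z" "q z \<notin> W i \<Longrightarrow> \<tau> i a a' z = z" "q z \<in> W i \<Longrightarrow> q (\<tau> i a a' z) \<in> W i"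
    if "i \<in> {1..m}" "a \<in> D i" "a' \<in> D i" "z \<in> topspace X" for i a a' z
  proof -
    note h = g[OF that(1), unfolded good_def, THEN conjunct2, THEN conjunct2, THEN conjunct2, THEN conjunct2, rule_format, OF that(2-4)]
    from h show "q (\<tau> i a a' z) = q a' \<Longrightarrow> q z = q a" "\<tau> i a a z = z" "q z \<notin> W i \<Longrightarrow> \<tau> i a a' z = z" "q z \<in> W i \<Longrightarrow> q (\<tau> i a a' z) \<in> W i"
      by blast+
  qed
  have \<tau>X: "\<tau> i a a' z \<in> topspace X" if "i \<in> {1..m}" "a \<in> D i" "a' \<in> D i" "z \<in> topspace X" for i a a' z
  proof -
    have "(a, a', z) \<in> topspace (subtopology (prod_topology X (prod_topology X X)) (D i \<times> D i \<times> UNIV))"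
      using that openin_subset[OF D(1)[OF that(1)]] by auto
    then show ?thesis using continuous_map_image_subset_topspace[OF D(4)[OF that(1)]] by force
  qed
  define U where "U = {b \<in> topspace ?B. \<forall>i\<in>{1..m}. b i \<in> D i}"
  have Uo: "openin ?B U"
  proof -
    have "U = topspace ?B \<inter> (\<Inter>i\<in>{1..m}. {b \<in> topspace ?B. b i \<in> D i})" by (auto simp: U_def)
    moreover have "openin ?B \<dots>"
    proof (cases "m = 0")
      case False
      then have "openin ?B (\<Inter>i\<in>{1..m}. {b \<in> topspace ?B. b i \<in> D i})"
        by (intro openin_INT2 openin_continuous_map_preimage[OF continuous_map_configuration_component D(1)]) auto
      then show ?thesis by (simp add: openin_Int)
    qed auto
    ultimately show ?thesis by simp
  qed
  \<comment> \<open>The last point after the first \<open>i\<close> pushes. Step \<open>i\<close> of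
    the recursion uses the push with index \<open>Suc i\<close>, since tuples start at index
    1.\<close>
  define it where "it = rec_nat (\<lambda>b e. e (Suc m)) (\<lambda>i f b e. \<tau> (Suc i) (e (Suc i)) (b (Suc i)) (f b e))"
  have it0: "it 0 b e = e (Suc m)" and itS: "it (Suc i) b e = \<tau> (Suc i) (e (Suc i)) (b (Suc i)) (it i b e)" for i b e
    by (simp_all add: it_def)
  define S where "S = {(b, e). b \<in> U \<and> p e \<in> U}"
  let ?Z = "subtopology (prod_topology ?B ?E) S"
  have dom: "b i \<in> D i" "e i \<in> D i" "i \<in> {1..m}" if "b \<in> U" "p e \<in> U" "i \<in> {1..m}" for b e i
  proof -
    show "b i \<in> D i" using that(1,3) unfolding U_def by blast
    have "p e i \<in> D i" using that(2,3) unfolding U_def by blast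
    then show "e i \<in> D i" by (simp only: p[OF that(3)])
  qed (rule that(3))
  have ZS: "fst z \<in> U" "p (snd z) \<in> U" "snd z \<in> topspace ?E" if "z \<in> topspace ?Z" for z
    using that by (auto simp: S_def)
  have itX: "it i b e \<in> topspace X" if be: "b \<in> U" "p e \<in> U" "e \<in> topspace ?E" and i: "i \<le> m" for b e i
    using i
  proof (induction i)
    case 0
    then show ?case using be(3) by (auto simp: it0 topspace_configurations)
  next
    case (Suc i)
    then show ?case unfolding itS using dom[OF be(1,2), of "Suc i"] by (intro \<tau>X) auto
  qed
  have itc: "i \<le> m \<Longrightarrow> continuous_map ?Z X (\<lambda>z. it i (fst z) (snd z))" for i
  proof (induction i)
    case 0
    have "continuous_map ?Z X (\<lambda>z. snd z (Suc m))"
      by (rule continuous_map_from_subtopology[OF continuous_map_compose[OF continuous_map_snd continuous_map_configuration_component, unfolded o_def]]) simp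
    then show ?case by (simp add: it0)
  next
    case (Suc i)
    then have i: "Suc i \<in> {1..m}" "Suc i \<in> {1..Suc m}" by auto
    have 1: "continuous_map ?Z X (\<lambda>z. snd z (Suc i))"
      by (rule continuous_map_from_subtopology[OF continuous_map_compose[OF continuous_map_snd continuous_map_configuration_component[OF i(2)], unfolded o_def]])
    have 2: "continuous_map ?Z X (\<lambda>z. fst z (Suc i))"
      by (rule continuous_map_from_subtopology[OF continuous_map_compose[OF continuous_map_fst continuous_map_configuration_component[OF i(1)], unfolded o_def]])
    have "continuous_map ?Z (prod_topology X (prod_topology X X)) (\<lambda>z. (snd z (Suc i), fst z (Suc i), it i (fst z) (snd z)))"
      using Suc 1 2 by (intro continuous_map_pairedI) auto
    then have "continuous_map ?Z (subtopology (prod_topology X (prod_topology X X)) (D (Suc i) \<times> D (Suc i) \<times> UNIV))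
       (\<lambda>z. (snd z (Suc i), fst z (Suc i), it i (fst z) (snd z)))"
      unfolding continuous_map_in_subtopology using dom[OF ZS(1,2) i(1)] by (intro conjI) (assumption, blast)
    from continuous_map_compose[OF this D(4)[OF i(1)]] show ?case by (simp add: o_def itS)
  qed
  have qe: "e (Suc m) \<in> topspace X" "\<And>i. i \<in> {1..m} \<Longrightarrow> q (e (Suc m)) \<noteq> q (e i)" if "e \<in> topspace ?E" for e
    using that by (auto simp: topspace_configurations)
  \<comment> \<open>If the last point is over none of the \<open>W l\<close>, no push moves it, and
    it stays away from the new points, which are over the \<open>W j\<close>.\<close>
  have avoid: "q (it m b e) \<noteq> q (b j)" if be: "b \<in> U" "p e \<in> U" "e \<in> topspace ?E" and j: "j \<in> {1..m}" for b e j
  proof (cases "\<exists>l\<in>{1..m}. q (e (Suc m)) \<in> W l")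
    case False
    have "i \<le> m \<Longrightarrow> it i b e = e (Suc m)" for i
    proof (induction i)
      case (Suc i)
      then have "Suc i \<in> {1..m}" by auto
      then show ?case using \<tau>(3)[of "Suc i" "e (Suc i)" "b (Suc i)" "e (Suc m)"] dom[OF be(1,2), of "Suc i"] qe(1)[OF be(3)] False Suc
        by (auto simp: itS)
    qed (simp add: it0)
    then have "q (it m b e) = q (e (Suc m))" by simp
    moreover have "q (b j) \<in> W j" using D(3)[OF j] dom[OF be(1,2) j] by blast
    ultimately show ?thesis using False j by metis
  next
    case True
    then obtain l where l: "l \<in> {1..m}" "q (e (Suc m)) \<in> W l" by blast
    \<comment> \<open>Up to push \<open>l\<close> the point has not moved, push \<open>l\<close>
      makes it avoid the orbit of \<open>b l\<close> without leaving the preimage of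
      \<open>W l\<close>, and all later pushes fix it there.\<close>
    have "i \<le> m \<Longrightarrow> q (it i b e) \<in> W l \<and> (i < l \<longrightarrow> it i b e = e (Suc m)) \<and> (l \<le> i \<longrightarrow> q (it i b e) \<noteq> q (b l))" for i
    proof (induction i)
      case 0
      then show ?case using l by (auto simp: it0)
    next
      case (Suc i)
      then have i: "Suc i \<in> {1..m}" and IH: "q (it i b e) \<in> W l" "i < l \<Longrightarrow> it i b e = e (Suc m)" "l \<le> i \<Longrightarrow> q (it i b e) \<noteq> q (b l)" by auto
      note d = dom[OF be(1,2) i]
      have iX: "it i b e \<in> topspace X" using itX[OF be] Suc by simp
      note t = \<tau>[OF i d(2,1) iX]
      show ?case
      proof (cases "Suc i = l")
        case True
        have "q (e (Suc m)) \<noteq> q (e (Suc i))" using qe(2)[OF be(3) i] .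
        moreover have "it i b e = e (Suc m)" using IH(2) True by simp
        ultimately have "q (\<tau> (Suc i) (e (Suc i)) (b (Suc i)) (it i b e)) \<noteq> q (b (Suc i))" using t(1) by metis
        moreover have "q (\<tau> (Suc i) (e (Suc i)) (b (Suc i)) (it i b e)) \<in> W (Suc i)" using t(4) IH(1) True by simp
        ultimately show ?thesis unfolding itS[symmetric] using True by simp
      next
        case False
        then have "q (it i b e) \<notin> W (Suc i)" using W(3)[OF i l(1)] IH(1) by blast
        then have "it (Suc i) b e = it i b e" using t(3) by (simp add: itS)
        then show ?thesis using IH False by auto
      qed
    qed
    from this[of m] have m: "q (it m b e) \<in> W l" "q (it m b e) \<noteq> q (b l)" using l(1) by auto
    show ?thesis
    proof (cases "j = l")
      case False
      have "q (b j) \<in> W j" using D(3)[OF j] dom[OF be(1,2) j] by blast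
      then show ?thesis using W(3)[OF j l(1) False] m(1) by (metis IntI empty_iff)
    qed (use m in simp)
  qed
  define \<phi> where "\<phi> b e = b(Suc m := it m b e)" for b e
  have \<phi>: "\<phi> b e \<in> topspace ?E" "p (\<phi> b e) = b" if be: "b \<in> U" "p e \<in> U" "e \<in> topspace ?E" for b e
  proof -
    have bB: "b \<in> topspace ?B" using be(1) by (simp add: U_def)
    have "it m b e \<in> topspace X" by (rule itX[OF be]) simp
    from configuration_extend[OF bB this avoid[OF be]]
    show "\<phi> b e \<in> topspace ?E" "p (\<phi> b e) = b" unfolding \<phi>_def p_def by blast+
  qed
  have \<phi>E: "(case z of (b, e) \<Rightarrow> \<phi> b e) \<in> topspace ?E" if "z \<in> topspace ?Z" for z
    using \<phi>(1)[OF ZS[OF that]] by (simp add: case_prod_beta)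
  have "local_slicing ?E ?B p U \<phi>" unfolding local_slicing_def S_def[symmetric]
  proof (intro conjI Uo ballI impI)
    have "continuous_map ?Z (product_topology (\<lambda>_. X) {1..Suc m}) (\<lambda>(b, e). \<phi> b e)"
      unfolding continuous_map_componentwise
    proof (intro conjI ballI)
      show "(\<lambda>(b, e). \<phi> b e) ` topspace ?Z \<subseteq> extensional {1..Suc m}"
        using \<phi>E unfolding topspace_configurations PiE_def by blast
      fix i assume i: "i \<in> {1..Suc m}"
      show "continuous_map ?Z X (\<lambda>x. (case x of (b, e) \<Rightarrow> \<phi> b e) i)"
      proof (cases "i = Suc m")
        case True
        then show ?thesis using itc[of m] by (simp add: \<phi>_def case_prod_beta)
      next
        case False
        then have "i \<in> {1..m}" using i by auto
        from continuous_map_from_subtopology[OF continuous_map_compose[OF continuous_map_fst continuous_map_configuration_component[OF this], unfolded o_def]]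
        have "continuous_map ?Z X (\<lambda>z. fst z i)" .
        then show ?thesis using False by (simp add: \<phi>_def case_prod_beta)
      qed
    qed
    moreover have "(\<lambda>(b, e). \<phi> b e) \<in> topspace ?Z \<rightarrow> {x. \<forall>i\<in>{1..Suc m}. \<forall>j\<in>{1..Suc m}. i \<noteq> j \<longrightarrow> q (x i) \<noteq> q (x j)}"
      using \<phi>E unfolding topspace_configurations by blast
    ultimately have "continuous_map ?Z (subtopology (product_topology (\<lambda>_. X) {1..Suc m})
       {x. \<forall>i\<in>{1..Suc m}. \<forall>j\<in>{1..Suc m}. i \<noteq> j \<longrightarrow> q (x i) \<noteq> q (x j)}) (\<lambda>(b, e). \<phi> b e)"
      unfolding continuous_map_in_subtopology by blast
    then show "continuous_map ?Z ?E (\<lambda>(b, e). \<phi> b e)" by (simp only: configurations_def[of X q "Suc m", symmetric])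
    fix b e assume be: "b \<in> U" "e \<in> topspace ?E" "p e \<in> U"
    show "p (\<phi> b e) = b" by (rule \<phi>(2)[OF be(1,3,2)])
    have "i \<le> m \<Longrightarrow> it i (p e) e = e (Suc m)" for i
    proof (induction i)
      case (Suc i)
      then have i: "Suc i \<in> {1..m}" by auto
      show ?case using Suc i dom[OF be(3,3) i] \<tau>(2)[OF i, of "e (Suc i)" "e (Suc i)" "e (Suc m)"] qe(1)[OF be(2)] by (simp add: itS p[OF i])
    qed (simp add: it0)
    then have "\<phi> (p e) e = (p e)(Suc m := e (Suc m))" by (simp add: \<phi>_def)
    also have "\<dots> = e" using be(2) by (auto simp: p_def topspace_configurations PiE_iff extensional_def restrict_def fun_eq_iff)
    finally show "\<phi> (p e) e = e" .
  qed
  moreover have "b0 \<in> U" using b0 D(2) by (simp add: U_def)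
  ultimately show ?thesis unfolding p_def by blast
qed

section \<open>Lie groupoids and action groupoids\<close>

lemma smooth_at_nhd:
  assumes f: "smooth_at M N f x" and V: "openin (mtop N) V" "f x \<in> V"
  obtains W where "openin (mtop M) W" "x \<in> W" "\<And>y. y \<in> W \<Longrightarrow> f y \<in> V" "\<And>y. y \<in> W \<Longrightarrow> y \<in> pts M"
proof -
  obtain W where W: "openin (mtop M) W" "x \<in> W" "f ` W \<subseteq> V" by (rule smooth_at_preimage[OF f V])
  show thesis by (rule that[OF W(1,2)]) (use W(3) openin_subset[OF W(1)] in auto)
qed

lemma local_section_nhd:
  assumes "local_section M N f x s"
  obtains W where "openin (mtop N) W" "f x \<in> W" "\<And>y. y \<in> W \<Longrightarrow> f (s y) = y" "\<And>y. y \<in> W \<Longrightarrow> s y \<in> pts M" "\<And>y. y \<in> W \<Longrightarrow> y \<in> pts N"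
proof -
  obtain W where W: "openin (mtop N) W" "f x \<in> W" "\<And>y. y \<in> W \<Longrightarrow> f (s y) = y"
    using assms by (auto simp: local_section_def)
  have s: "smooth_at N M s (f x)" using assms by (simp add: local_section_def)
  obtain W' where W': "openin (mtop N) W'" "f x \<in> W'" "\<And>y. y \<in> W' \<Longrightarrow> s y \<in> pts M" "\<And>y. y \<in> W' \<Longrightarrow> y \<in> pts N"
    using smooth_at_nhd[OF s openin_topspace smooth_at_pts(2)[OF s]] by metis
  show thesis by (rule that[of "W \<inter> W'"]) (use W W' in auto)
qed

lemma local_sectionI:
  assumes "smooth_at N M s (f x)" "s (f x) = x" "openin (mtop N) W" "f x \<in> W" "\<And>y. y \<in> W \<Longrightarrow> f (s y) = y"
  shows "local_section M N f x s"
  using assms by (auto simp: local_section_def)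

lemma groupoid_laws:
  assumes "groupoid G"
  shows groupoid_src: "\<alpha> \<in> pts (Mor G) \<Longrightarrow> src G \<alpha> \<in> pts (Ob G)"
    and groupoid_tgt: "\<alpha> \<in> pts (Mor G) \<Longrightarrow> tgt G \<alpha> \<in> pts (Ob G)"
    and groupoid_ident: "x \<in> pts (Ob G) \<Longrightarrow> ident G x \<in> pts (Mor G)"
    and groupoid_src_ident: "x \<in> pts (Ob G) \<Longrightarrow> src G (ident G x) = x"
    and groupoid_tgt_ident: "x \<in> pts (Ob G) \<Longrightarrow> tgt G (ident G x) = x"
    and groupoid_ginv: "\<alpha> \<in> pts (Mor G) \<Longrightarrow> ginv G \<alpha> \<in> pts (Mor G)"
    and groupoid_src_ginv: "\<alpha> \<in> pts (Mor G) \<Longrightarrow> src G (ginv G \<alpha>) = tgt G \<alpha>"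
    and groupoid_tgt_ginv: "\<alpha> \<in> pts (Mor G) \<Longrightarrow> tgt G (ginv G \<alpha>) = src G \<alpha>"
    and groupoid_ginv_left: "\<alpha> \<in> pts (Mor G) \<Longrightarrow> gcomp G (ginv G \<alpha>) \<alpha> = ident G (src G \<alpha>)"
    and groupoid_ginv_right: "\<alpha> \<in> pts (Mor G) \<Longrightarrow> gcomp G \<alpha> (ginv G \<alpha>) = ident G (tgt G \<alpha>)"
    and groupoid_unit_right: "\<alpha> \<in> pts (Mor G) \<Longrightarrow> gcomp G \<alpha> (ident G (src G \<alpha>)) = \<alpha>"
    and groupoid_unit_left: "\<alpha> \<in> pts (Mor G) \<Longrightarrow> gcomp G (ident G (tgt G \<alpha>)) \<alpha> = \<alpha>"
    and groupoid_comp: "\<alpha> \<in> pts (Mor G) \<Longrightarrow> \<beta> \<in> pts (Mor G) \<Longrightarrow> src G \<alpha> = tgt G \<beta> \<Longrightarrow> gcomp G \<alpha> \<beta> \<in> pts (Mor G)"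
    and groupoid_src_comp: "\<alpha> \<in> pts (Mor G) \<Longrightarrow> \<beta> \<in> pts (Mor G) \<Longrightarrow> src G \<alpha> = tgt G \<beta> \<Longrightarrow> src G (gcomp G \<alpha> \<beta>) = src G \<beta>"
    and groupoid_tgt_comp: "\<alpha> \<in> pts (Mor G) \<Longrightarrow> \<beta> \<in> pts (Mor G) \<Longrightarrow> src G \<alpha> = tgt G \<beta> \<Longrightarrow> tgt G (gcomp G \<alpha> \<beta>) = tgt G \<alpha>"
    and groupoid_assoc: "\<alpha> \<in> pts (Mor G) \<Longrightarrow> \<beta> \<in> pts (Mor G) \<Longrightarrow> \<gamma> \<in> pts (Mor G) \<Longrightarrow> src G \<alpha> = tgt G \<beta> \<Longrightarrow>
      src G \<beta> = tgt G \<gamma> \<Longrightarrow> gcomp G (gcomp G \<alpha> \<beta>) \<gamma> = gcomp G \<alpha> (gcomp G \<beta> \<gamma>)"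
  using assms unfolding groupoid_def by blast+

lemma groupoidI:
  assumes "\<And>\<alpha>. \<alpha> \<in> pts (Mor G) \<Longrightarrow> src G \<alpha> \<in> pts (Ob G) \<and> tgt G \<alpha> \<in> pts (Ob G)"
    and "\<And>x. x \<in> pts (Ob G) \<Longrightarrow> ident G x \<in> pts (Mor G) \<and> src G (ident G x) = x \<and> tgt G (ident G x) = x"
    and "\<And>\<alpha> \<beta>. \<alpha> \<in> pts (Mor G) \<Longrightarrow> \<beta> \<in> pts (Mor G) \<Longrightarrow> src G \<alpha> = tgt G \<beta> \<Longrightarrow>
      gcomp G \<alpha> \<beta> \<in> pts (Mor G) \<and> src G (gcomp G \<alpha> \<beta>) = src G \<beta> \<and> tgt G (gcomp G \<alpha> \<beta>) = tgt G \<alpha>"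
    and "\<And>\<alpha> \<beta> \<gamma>. \<alpha> \<in> pts (Mor G) \<Longrightarrow> \<beta> \<in> pts (Mor G) \<Longrightarrow> \<gamma> \<in> pts (Mor G) \<Longrightarrow> src G \<alpha> = tgt G \<beta> \<Longrightarrow>
      src G \<beta> = tgt G \<gamma> \<Longrightarrow> gcomp G (gcomp G \<alpha> \<beta>) \<gamma> = gcomp G \<alpha> (gcomp G \<beta> \<gamma>)"
    and "\<And>\<alpha>. \<alpha> \<in> pts (Mor G) \<Longrightarrow> gcomp G \<alpha> (ident G (src G \<alpha>)) = \<alpha> \<and> gcomp G (ident G (tgt G \<alpha>)) \<alpha> = \<alpha>"
    and "\<And>\<alpha>. \<alpha> \<in> pts (Mor G) \<Longrightarrow> ginv G \<alpha> \<in> pts (Mor G) \<and> src G (ginv G \<alpha>) = tgt G \<alpha> \<and> tgt G (ginv G \<alpha>) = src G \<alpha> \<and>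
      gcomp G (ginv G \<alpha>) \<alpha> = ident G (src G \<alpha>) \<and> gcomp G \<alpha> (ginv G \<alpha>) = ident G (tgt G \<alpha>)"
  shows "groupoid G"
  unfolding groupoid_def by (simp add: assms)

lemma groupoid_ginv_ginv:
  assumes G: "groupoid G" and a: "\<alpha> \<in> pts (Mor G)"
  shows "ginv G (ginv G \<alpha>) = \<alpha>"
proof -
  let ?b = "ginv G \<alpha>" and ?c = "ginv G (ginv G \<alpha>)"
  note L = groupoid_laws[OF G]
  have b: "?b \<in> pts (Mor G)" and c: "?c \<in> pts (Mor G)" using a L by auto
  have "?c = gcomp G ?c (ident G (src G ?c))" using L(11)[OF c] by simp
  also have "src G ?c = src G \<alpha>" using a b L by simp
  also have "ident G (src G \<alpha>) = gcomp G ?b \<alpha>" using L(9)[OF a] by simp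
  also have "gcomp G ?c (gcomp G ?b \<alpha>) = gcomp G (gcomp G ?c ?b) \<alpha>"
    by (rule L(16)[OF c b a, symmetric]) (use a b L in auto)
  also have "gcomp G ?c ?b = ident G (tgt G \<alpha>)" using L(9)[OF b] a L(7) by simp
  also have "gcomp G (ident G (tgt G \<alpha>)) \<alpha> = \<alpha>" by (rule L(12)[OF a])
  finally show ?thesis .
qed

text \<open>Composition with \<open>\<alpha>\<close> gives one inclusion for every morphism; applied
  to the inverse it gives the other.\<close>

lemma orbit_src_tgt:
  assumes G: "groupoid G" and a: "\<alpha> \<in> pts (Mor G)"
  shows "orbit G (tgt G \<alpha>) = orbit G (src G \<alpha>)"
proof -
  note L = groupoid_laws[OF G]
  have le: "orbit G (tgt G \<alpha>) \<subseteq> orbit G (src G \<alpha>)" if a: "\<alpha> \<in> pts (Mor G)" for \<alpha>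
  proof
    fix y assume "y \<in> orbit G (tgt G \<alpha>)"
    then obtain \<beta> where b: "\<beta> \<in> pts (Mor G)" "src G \<beta> = tgt G \<alpha>" "y = tgt G \<beta>" by (auto simp: orbit_def)
    show "y \<in> orbit G (src G \<alpha>)" unfolding orbit_def
      by (rule image_eqI[of _ _ "gcomp G \<beta> \<alpha>"]) (use b a L(13,14,15)[OF b(1) a b(2)] in auto)
  qed
  from le[OF a] le[OF L(6)[OF a]] show ?thesis using L(7,8)[OF a] by auto
qed

locale lie_gpd =
  fixes G :: "('o, 'm) groupoid_data"
  assumes lie: "lie_groupoid G"
begin

lemma grp: "groupoid G" and ob: "smooth_manifold (Ob G)" and mor: "smooth_manifold (Mor G)"
  and src_submersion: "submersion (Mor G) (Ob G) (src G)"
  and tgt_submersion: "submersion (Mor G) (Ob G) (tgt G)"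
  using lie by (auto simp: lie_groupoid_def)

lemmas L = groupoid_laws[OF grp]

lemma src_smooth: "smooth_map (Mor G) (Ob G) (src G)" and tgt_smooth: "smooth_map (Mor G) (Ob G) (tgt G)"
  using src_submersion tgt_submersion by (auto simp: submersion_def)

lemma src_at: "\<alpha> \<in> pts (Mor G) \<Longrightarrow> smooth_at (Mor G) (Ob G) (src G) \<alpha>"
  and tgt_at: "\<alpha> \<in> pts (Mor G) \<Longrightarrow> smooth_at (Mor G) (Ob G) (tgt G) \<alpha>"
  and ident_at: "x \<in> pts (Ob G) \<Longrightarrow> smooth_at (Ob G) (Mor G) (ident G) x"
  and ginv_at: "\<alpha> \<in> pts (Mor G) \<Longrightarrow> smooth_at (Mor G) (Mor G) (ginv G) \<alpha>"
  using smooth_map_at[OF mor ob src_smooth] smooth_map_at[OF mor ob tgt_smooth] smooth_map_at[OF ob mor] smooth_map_at[OF mor mor] lie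
  by (auto simp: lie_groupoid_def)

text \<open>Composition is smooth on the manifold of composable pairs; this brings it into the form
  in which it is used, for two germs that are composable near a point.\<close>

lemma comp_at:
  assumes P: "smooth_manifold P" and a: "smooth_at P (Mor G) a x" and b: "smooth_at P (Mor G) b x"
    and W: "openin (mtop P) W" "x \<in> W" "\<And>z. z \<in> W \<Longrightarrow> a z \<in> pts (Mor G) \<and> b z \<in> pts (Mor G) \<and> src G (a z) = tgt G (b z)"
  shows "smooth_at P (Mor G) (\<lambda>z. gcomp G (a z) (b z)) x"
proof -
  let ?F = "fibre_product (Mor G) (src G) (Mor G) (tgt G)"
  have F: "smooth_manifold ?F" by (rule smooth_manifold_fibre_product[OF mor mor ob src_submersion tgt_smooth])
  have i: "smooth_at P ?F (\<lambda>z. (a z, b z)) x"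
    by (rule smooth_at_into_fibre_product[OF mor mor ob src_submersion tgt_smooth P a b W(1,2)]) (use W(3) in auto)
  have "smooth_map ?F (Mor G) (\<lambda>(\<alpha>, \<beta>). gcomp G \<alpha> \<beta>)" using lie by (simp add: lie_groupoid_def)
  from smooth_map_at[OF F mor this smooth_at_pts(2)[OF i]]
  have c: "smooth_at ?F (Mor G) (\<lambda>(\<alpha>, \<beta>). gcomp G \<alpha> \<beta>) (a x, b x)" .
  from smooth_at_compose[OF P F i c] show ?thesis by simp
qed

lemma src_section:
  assumes "\<alpha> \<in> pts (Mor G)" obtains s where "local_section (Mor G) (Ob G) (src G) \<alpha> s"
  using submersion_local_section[OF mor ob src_submersion assms] by blast

end

text \<open>The target map is the source map precomposed with inversion, a diffeomorphism, so only the
  source map has to be shown to be a submersion.\<close>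

lemma lie_groupoidI:
  fixes H :: "('o, 'm) groupoid_data"
  assumes H: "groupoid H" and ob: "smooth_manifold (Ob H)" and mor: "smooth_manifold (Mor H)"
    and src_at: "\<And>\<alpha>. \<alpha> \<in> pts (Mor H) \<Longrightarrow> smooth_at (Mor H) (Ob H) (src H) \<alpha>"
    and sec: "\<And>\<alpha>. \<alpha> \<in> pts (Mor H) \<Longrightarrow> \<exists>s. local_section (Mor H) (Ob H) (src H) \<alpha> s"
    and ident_at: "\<And>x. x \<in> pts (Ob H) \<Longrightarrow> smooth_at (Ob H) (Mor H) (ident H) x"
    and ginv_at: "\<And>\<alpha>. \<alpha> \<in> pts (Mor H) \<Longrightarrow> smooth_at (Mor H) (Mor H) (ginv H) \<alpha>"
    and comp_at: "\<And>(P :: ('m \<times> 'm) manifold) a b x W. smooth_manifold P \<Longrightarrow> smooth_at P (Mor H) a x \<Longrightarrow> smooth_at P (Mor H) b x \<Longrightarrow>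
      openin (mtop P) W \<Longrightarrow> x \<in> W \<Longrightarrow> (\<And>z. z \<in> W \<Longrightarrow> a z \<in> pts (Mor H) \<and> b z \<in> pts (Mor H) \<and> src H (a z) = tgt H (b z)) \<Longrightarrow>
      smooth_at P (Mor H) (\<lambda>z. gcomp H (a z) (b z)) x"
  shows "lie_groupoid H"
proof -
  note L = groupoid_laws[OF H]
  have s: "submersion (Mor H) (Ob H) (src H)" by (rule submersionI[OF mor ob src_at sec])
  have t_at: "smooth_at (Mor H) (Ob H) (tgt H) \<alpha>" if a: "\<alpha> \<in> pts (Mor H)" for \<alpha>
  proof (rule smooth_at_cong[OF mor smooth_at_compose[OF mor mor ginv_at[OF a] src_at[OF L(6)[OF a]]] openin_topspace a])
    show "src H (ginv H y) = tgt H y" if "y \<in> pts (Mor H)" for y by (rule L(7)[OF that])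
  qed
  have t: "submersion (Mor H) (Ob H) (tgt H)"
  proof (rule submersionI[OF mor ob t_at])
    fix \<alpha> assume a: "\<alpha> \<in> pts (Mor H)"
    obtain s where s: "local_section (Mor H) (Ob H) (src H) (ginv H \<alpha>) s" using sec[OF L(6)[OF a]] by blast
    have sa: "smooth_at (Ob H) (Mor H) s (tgt H \<alpha>)" "s (tgt H \<alpha>) = ginv H \<alpha>"
      using s L(7)[OF a] by (auto simp: local_section_def)
    have "ginv H \<alpha> \<in> pts (Mor H)" by (rule L(6)[OF a])
    then have g: "smooth_at (Mor H) (Mor H) (ginv H) (s (tgt H \<alpha>))" unfolding sa(2) by (rule ginv_at)
    obtain W where W: "openin (mtop (Ob H)) W" "src H (ginv H \<alpha>) \<in> W" "\<And>y. y \<in> W \<Longrightarrow> src H (s y) = y" "\<And>y. y \<in> W \<Longrightarrow> s y \<in> pts (Mor H)"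
      using local_section_nhd[OF s] by metis
    have "local_section (Mor H) (Ob H) (tgt H) \<alpha> (\<lambda>y. ginv H (s y))"
    proof (rule local_sectionI[where W = W])
      show "smooth_at (Ob H) (Mor H) (\<lambda>y. ginv H (s y)) (tgt H \<alpha>)" by (rule smooth_at_compose[OF ob mor sa(1) g])
      show "openin (mtop (Ob H)) W" by (rule W(1))
      show "ginv H (s (tgt H \<alpha>)) = \<alpha>" unfolding sa(2) by (rule groupoid_ginv_ginv[OF H a])
      show "tgt H \<alpha> \<in> W" using W(2) unfolding L(7)[OF a] .
      show "tgt H (ginv H (s y)) = y" if "y \<in> W" for y using L(8)[OF W(4)[OF that]] W(3)[OF that] by simp
    qed
    then show "\<exists>s. local_section (Mor H) (Ob H) (tgt H) \<alpha> s" by blast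
  qed
  then have ts: "smooth_map (Mor H) (Ob H) (tgt H)" by (simp add: submersion_def)
  let ?F = "fibre_product (Mor H) (src H) (Mor H) (tgt H)"
  have F: "smooth_manifold ?F" by (rule smooth_manifold_fibre_product[OF mor mor ob s ts])
  have "smooth_at ?F (Mor H) (\<lambda>z. gcomp H (fst z) (snd z)) p" if p: "p \<in> pts ?F" for p
  proof (rule comp_at[OF F smooth_at_fibre_product_fst_snd[OF mor mor ob s ts p] openin_topspace p])
    show "fst z \<in> pts (Mor H) \<and> snd z \<in> pts (Mor H) \<and> src H (fst z) = tgt H (snd z)" if "z \<in> pts ?F" for z
      using that unfolding pts_fibre_product by auto
  qed
  then have "smooth_map ?F (Mor H) (\<lambda>(\<alpha>, \<beta>). gcomp H \<alpha> \<beta>)"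
    unfolding smooth_map_iff_smooth_at[OF F mor] by (simp add: case_prod_beta')
  then show ?thesis
    unfolding lie_groupoid_def using H ob mor s t ident_at ginv_at
    by (simp add: smooth_map_iff_smooth_at[OF ob mor] smooth_map_iff_smooth_at[OF mor mor])
qed

text \<open>The groupoid of an action: a morphism is a morphism of \<open>P\<close> together with
  the point it acts on. Its morphisms are coded in the datatype of type a groupoids so that each
  stage of \<open>PBa\<close> becomes an instance.\<close>

definition action_groupoid ::
  "('p, ('o, 'm) pba_mor) groupoid_data \<Rightarrow> (nat \<Rightarrow> 'o) manifold \<Rightarrow> ((nat \<Rightarrow> 'o) \<Rightarrow> 'p) \<Rightarrow>
   (('o, 'm) pba_mor \<times> (nat \<Rightarrow> 'o) \<Rightarrow> (nat \<Rightarrow> 'o)) \<Rightarrow> (nat \<Rightarrow> 'o, ('o, 'm) pba_mor) groupoid_data" where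
  "action_groupoid P M F \<mu> =
     \<lparr>Ob = M,
      Mor = transport (range (\<lambda>(\<beta>, x). Ext \<beta> x)) (\<lambda>z. (prev z, point z)) (fibre_product (Mor P) (src P) M F),
      src = point,
      tgt = (\<lambda>z. \<mu> (prev z, point z)),
      ident = (\<lambda>x. Ext (ident P (F x)) x),
      ginv = (\<lambda>z. Ext (ginv P (prev z)) (\<mu> (prev z, point z))),
      gcomp = (\<lambda>z' z. Ext (gcomp P (prev z') (prev z)) (point z))\<rparr>"

locale groupoid_action = lie_gpd P for P :: "('p, ('o, 'm) pba_mor) groupoid_data" +
  fixes M :: "(nat \<Rightarrow> 'o) manifold" and F :: "(nat \<Rightarrow> 'o) \<Rightarrow> 'p" and \<mu>
  assumes act: "left_space P M F \<mu>"
begin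

abbreviation "FP \<equiv> fibre_product (Mor P) (src P) M F"
abbreviation "H \<equiv> action_groupoid P M F \<mu>"

lemma man: "smooth_manifold M" and F_smooth: "smooth_map M (Ob P) F" and \<mu>_smooth: "smooth_map FP M \<mu>"
  and F_\<mu>: "\<alpha> \<in> pts (Mor P) \<Longrightarrow> x \<in> pts M \<Longrightarrow> src P \<alpha> = F x \<Longrightarrow> F (\<mu> (\<alpha>, x)) = tgt P \<alpha>"
  and \<mu>_ident: "x \<in> pts M \<Longrightarrow> \<mu> (ident P (F x), x) = x"
  and \<mu>_comp: "\<alpha> \<in> pts (Mor P) \<Longrightarrow> \<beta> \<in> pts (Mor P) \<Longrightarrow> x \<in> pts M \<Longrightarrow> src P \<alpha> = tgt P \<beta> \<Longrightarrow> src P \<beta> = F x \<Longrightarrow>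
    \<mu> (\<alpha>, \<mu> (\<beta>, x)) = \<mu> (gcomp P \<alpha> \<beta>, x)"
  using act unfolding left_space_def by blast+

lemma F_at: "x \<in> pts M \<Longrightarrow> smooth_at M (Ob P) F x"
  by (rule smooth_map_at[OF man ob F_smooth])

lemma F_pts: "x \<in> pts M \<Longrightarrow> F x \<in> pts (Ob P)"
  using smooth_at_pts(2)[OF F_at] .

lemmas FP_facts = mor man ob src_submersion F_smooth

lemma FP: "smooth_manifold FP"
  by (rule smooth_manifold_fibre_product[OF FP_facts])

lemma pts_FP: "(\<beta>, x) \<in> pts FP \<longleftrightarrow> \<beta> \<in> pts (Mor P) \<and> x \<in> pts M \<and> src P \<beta> = F x"
  unfolding pts_fibre_product by simp

lemma \<mu>_pts: "\<alpha> \<in> pts (Mor P) \<Longrightarrow> x \<in> pts M \<Longrightarrow> src P \<alpha> = F x \<Longrightarrow> \<mu> (\<alpha>, x) \<in> pts M"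
  by (rule smooth_at_pts(2)[OF smooth_map_at[OF FP man \<mu>_smooth]]) (simp add: pts_FP)

lemma \<mu>_at:
  assumes Q: "smooth_manifold Q" and a: "smooth_at Q (Mor P) a x" and b: "smooth_at Q M b x"
    and W: "openin (mtop Q) W" "x \<in> W" "\<And>z. z \<in> W \<Longrightarrow> a z \<in> pts (Mor P) \<and> b z \<in> pts M \<and> src P (a z) = F (b z)"
  shows "smooth_at Q M (\<lambda>z. \<mu> (a z, b z)) x"
proof -
  have i: "smooth_at Q FP (\<lambda>z. (a z, b z)) x"
    by (rule smooth_at_into_fibre_product[OF FP_facts Q a b W])
  from smooth_map_at[OF FP man \<mu>_smooth smooth_at_pts(2)[OF i]]
  show ?thesis by (rule smooth_at_compose[OF Q FP i])
qed

abbreviation "pairs \<equiv> range (\<lambda>(\<beta> :: ('o, 'm) pba_mor, x :: nat \<Rightarrow> 'o). Ext \<beta> x)"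
abbreviation "unpair \<equiv> (\<lambda>z :: ('o, 'm) pba_mor. (prev z, point z))"

lemma transport_hyps: "inj_on unpair pairs" "pts FP \<subseteq> unpair ` pairs"
  by (auto simp: inj_on_def image_iff)

lemma inv_unpair: "inv_into pairs unpair (\<beta>, x) = Ext \<beta> x"
proof -
  have "Ext \<beta> x \<in> pairs" by (rule image_eqI[of _ _ "(\<beta>, x)"]) auto
  from inv_into_f_f[OF transport_hyps(1) this] show ?thesis by simp
qed

lemma H_sel [simp]: "Ob H = M" "src H = point" "tgt H z = \<mu> (prev z, point z)" "ident H x = Ext (ident P (F x)) x"
  "ginv H z = Ext (ginv P (prev z)) (\<mu> (prev z, point z))" "gcomp H z' z = Ext (gcomp P (prev z') (prev z)) (point z)"
  by (simp_all add: action_groupoid_def)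

lemma Mor_H: "Mor H = transport pairs unpair FP"
  by (simp add: action_groupoid_def)

lemma pts_H: "z \<in> pts (Mor H) \<longleftrightarrow> (\<exists>\<beta> x. z = Ext \<beta> x \<and> \<beta> \<in> pts (Mor P) \<and> x \<in> pts M \<and> src P \<beta> = F x)"
  unfolding Mor_H pts_transport[OF FP transport_hyps] by (force simp: pts_FP image_iff)

lemma HE:
  assumes "z \<in> pts (Mor H)"
  obtains \<beta> x where "z = Ext \<beta> x" "\<beta> \<in> pts (Mor P)" "x \<in> pts M" "src P \<beta> = F x"
  using assms unfolding pts_H by blast

lemma HI: "\<beta> \<in> pts (Mor P) \<Longrightarrow> x \<in> pts M \<Longrightarrow> src P \<beta> = F x \<Longrightarrow> Ext \<beta> x \<in> pts (Mor H)"
  unfolding pts_H by blast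

lemma morH: "smooth_manifold (Mor H)"
  unfolding Mor_H by (rule smooth_manifold_transport[OF FP transport_hyps])

lemma unpair_at:
  assumes "z \<in> pts (Mor H)" shows "smooth_at (Mor H) FP unpair z"
  using smooth_at_transport[OF FP transport_hyps] assms unfolding Mor_H by blast

lemma unpair_pts: "z \<in> pts (Mor H) \<Longrightarrow> unpair z \<in> pts FP"
  by (auto elim!: HE simp: pts_FP)

lemma prev_at: "z \<in> pts (Mor H) \<Longrightarrow> smooth_at (Mor H) (Mor P) prev z"
  and point_at: "z \<in> pts (Mor H) \<Longrightarrow> smooth_at (Mor H) M point z"
  using smooth_at_compose[OF morH FP unpair_at smooth_at_fibre_product_fst_snd(1)[OF FP_facts unpair_pts]]
    smooth_at_compose[OF morH FP unpair_at smooth_at_fibre_product_fst_snd(2)[OF FP_facts unpair_pts]] by simp_all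

lemma Ext_at:
  assumes Q: "smooth_manifold Q" and a: "smooth_at Q (Mor P) a x" and b: "smooth_at Q M b x"
    and W: "openin (mtop Q) W" "x \<in> W" "\<And>z. z \<in> W \<Longrightarrow> a z \<in> pts (Mor P) \<and> b z \<in> pts M \<and> src P (a z) = F (b z)"
  shows "smooth_at Q (Mor H) (\<lambda>z. Ext (a z) (b z)) x"
proof -
  have i: "smooth_at Q FP (\<lambda>z. (a z, b z)) x"
    by (rule smooth_at_into_fibre_product[OF FP_facts Q a b W])
  from smooth_at_compose[OF Q FP i smooth_at_inv_transport[OF FP transport_hyps smooth_at_pts(2)[OF i]]]
  show ?thesis unfolding Mor_H inv_unpair .
qed

lemma groupoid_H: "groupoid H"
proof -
  have e: "src P (prev z') = tgt P (prev z)" if "z' \<in> pts (Mor H)" "z \<in> pts (Mor H)" "src H z' = tgt H z" for z' z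
    using that F_\<mu> by (auto elim!: HE)
  have m: "prev z \<in> pts (Mor P)" "point z \<in> pts M" "src P (prev z) = F (point z)" if "z \<in> pts (Mor H)" for z
    using that by (auto elim: HE)
  have ext: "Ext (prev z) (point z) = z" if "z \<in> pts (Mor H)" for z using that by (auto elim: HE)
  show ?thesis
  proof (rule groupoidI, goal_cases)
    case (1 z)
    then show ?case by (auto elim!: HE simp: \<mu>_pts)
  next
    case (2 x)
    then show ?case using F_pts[of x] L(3,4)[of "F x"] \<mu>_ident[of x] by (auto intro: HI)
  next
    case (3 z' z)
    note e = e[OF 3]
    show ?case using 3(3) m[OF 3(2)] L(13,14)[OF m(1)[OF 3(1)] m(1)[OF 3(2)] e] \<mu>_comp[OF m(1)[OF 3(1)] m(1,2)[OF 3(2)] e m(3)[OF 3(2)]]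
      by (auto intro: HI)
  next
    case (4 z'' z' z)
    show ?case using L(16)[OF m(1)[OF 4(1)] m(1)[OF 4(2)] m(1)[OF 4(3)] e[OF 4(1,2,4)] e[OF 4(2,3,5)]] by simp
  next
    case (5 z)
    show ?case using m[OF 5] ext[OF 5] L(11,12)[OF m(1)[OF 5]] F_\<mu>[OF m[OF 5]] by simp
  next
    case (6 z)
    note m = m[OF 6]
    note g = L(6-10)[OF m(1)] and Fm = F_\<mu>[OF m]
    have "\<mu> (ginv P (prev z), \<mu> (prev z, point z)) = \<mu> (gcomp P (ginv P (prev z)) (prev z), point z)"
      by (rule \<mu>_comp[OF g(1) m(1,2) g(2) m(3)])
    also have "\<dots> = point z" using g(4) m(3) \<mu>_ident[OF m(2)] by simp
    finally have "\<mu> (ginv P (prev z), \<mu> (prev z, point z)) = point z" .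
    moreover have "Ext (ginv P (prev z)) (\<mu> (prev z, point z)) \<in> pts (Mor H)"
      by (rule HI[OF g(1) \<mu>_pts[OF m]]) (simp add: g(2) Fm)
    ultimately show ?case using m g Fm by simp
  qed
qed

lemma lie_groupoid_H: "lie_groupoid H"
proof (rule lie_groupoidI[OF groupoid_H])
  have mo: "prev z \<in> pts (Mor P)" "point z \<in> pts M" "src P (prev z) = F (point z)" if "z \<in> pts (Mor H)" for z
    using that by (auto elim: HE)
  have t_at: "smooth_at (Mor H) M (\<lambda>z. \<mu> (prev z, point z)) z" if "z \<in> pts (Mor H)" for z
    by (rule \<mu>_at[OF morH prev_at[OF that] point_at[OF that] openin_topspace that]) (use mo in auto)
  show "smooth_manifold (Ob H)" "smooth_manifold (Mor H)" using man morH by simp_all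
  show "smooth_at (Mor H) (Ob H) (src H) z" if "z \<in> pts (Mor H)" for z using point_at[OF that] by simp
  show "\<exists>s. local_section (Mor H) (Ob H) (src H) z s" if z: "z \<in> pts (Mor H)" for z
  proof -
    note m = mo[OF z]
    obtain s where s: "local_section (Mor P) (Ob P) (src P) (prev z) s" by (rule src_section[OF m(1)])
    have sa: "smooth_at (Ob P) (Mor P) s (F (point z))" "s (F (point z)) = prev z"
      using s m(3) by (auto simp: local_section_def)
    obtain W where W: "openin (mtop (Ob P)) W" "src P (prev z) \<in> W" "\<And>y. y \<in> W \<Longrightarrow> src P (s y) = y" "\<And>y. y \<in> W \<Longrightarrow> s y \<in> pts (Mor P)"
      using local_section_nhd[OF s] by metis
    obtain V where V: "openin (mtop M) V" "point z \<in> V" "\<And>y. y \<in> V \<Longrightarrow> F y \<in> W" "\<And>y. y \<in> V \<Longrightarrow> y \<in> pts M"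
      using smooth_at_nhd[OF F_at[OF m(2)] W(1)] W(2) m(3) by metis
    \<comment> \<open>A section of the source map through \<open>z\<close>: take a section of the
      source map of \<open>P\<close> through the first component and evaluate it at
      \<open>F x\<close>.\<close>
    have "smooth_at M (Mor H) (\<lambda>x. Ext (s (F x)) x) (point z)"
      by (rule Ext_at[OF man smooth_at_compose[where f = F and g = s, OF man ob F_at[OF m(2)] sa(1)] smooth_at_id[OF man m(2)] V(1,2)])
        (use V W in auto)
    then have "local_section (Mor H) (Ob H) (src H) z (\<lambda>x. Ext (s (F x)) x)"
      by (intro local_sectionI[where W = V]) (use V sa(2) z in \<open>auto elim: HE\<close>)
    then show ?thesis by blast
  qed
  show "smooth_at (Ob H) (Mor H) (ident H) x" if x: "x \<in> pts (Ob H)" for x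
  proof -
    have x': "x \<in> pts M" using x by simp
    have "smooth_at M (Mor H) (\<lambda>x. Ext (ident P (F x)) x) x"
      by (rule Ext_at[OF man smooth_at_compose[where f = F and g = "ident P", OF man ob F_at[OF x'] ident_at[OF F_pts[OF x']]] smooth_at_id[OF man x'] openin_topspace x'])
        (use F_pts L(3,4) in auto)
    then show ?thesis by (simp add: action_groupoid_def)
  qed
  show "smooth_at (Mor H) (Mor H) (ginv H) z" if z: "z \<in> pts (Mor H)" for z
  proof -
    have "smooth_at (Mor H) (Mor H) (\<lambda>z. Ext (ginv P (prev z)) (\<mu> (prev z, point z))) z"
      by (rule Ext_at[OF morH smooth_at_compose[where f = prev and g = "ginv P", OF morH mor prev_at[OF z] ginv_at[OF mo(1)[OF z]]] t_at[OF z] openin_topspace z])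
        (use mo L(6,7) \<mu>_pts F_\<mu> in auto)
    then show ?thesis by (simp add: action_groupoid_def)
  qed
  fix Q :: "(('o, 'm) pba_mor \<times> ('o, 'm) pba_mor) manifold" and a b x W
  assume Q: "smooth_manifold Q" and a: "smooth_at Q (Mor H) a x" and b: "smooth_at Q (Mor H) b x"
    and W: "openin (mtop Q) W" "x \<in> W" "\<And>z. z \<in> W \<Longrightarrow> a z \<in> pts (Mor H) \<and> b z \<in> pts (Mor H) \<and> src H (a z) = tgt H (b z)"
  have ab: "a z \<in> pts (Mor H)" "b z \<in> pts (Mor H)" "src P (prev (a z)) = tgt P (prev (b z))" if "z \<in> W" for z
    using W(3)[OF that] mo[of "a z"] mo[of "b z"] F_\<mu>[of "prev (b z)" "point (b z)"] by auto
  have "smooth_at Q (Mor P) (\<lambda>z. gcomp P (prev (a z)) (prev (b z))) x"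
    by (rule comp_at[OF Q smooth_at_compose[where f = a and g = prev, OF Q morH a prev_at[OF ab(1)[OF W(2)]]] smooth_at_compose[where f = b and g = prev, OF Q morH b prev_at[OF ab(2)[OF W(2)]]] W(1,2)])
      (use ab mo in auto)
  then have "smooth_at Q (Mor H) (\<lambda>z. Ext (gcomp P (prev (a z)) (prev (b z))) (point (b z))) x"
    by (rule Ext_at[OF Q _ smooth_at_compose[where f = b and g = point, OF Q morH b point_at[OF ab(2)[OF W(2)]]] W(1,2)])
      (use ab mo L(13,14) in auto)
  then show "smooth_at Q (Mor H) (\<lambda>z. gcomp H (a z) (b z)) x" by simp
qed

text \<open>By construction the identification with the fibre product is unpairing, and the action
  required is the given one; only the conditions on the object map have to be supplied.\<close>

lemma a_fibration_H:
  assumes F: "submersion M (Ob P) F" and fib: "hurewicz_fibration Y (mtop M) (mtop (Ob P)) F"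
  shows "a_fibration Y H P F prev"
proof -
  have mo: "prev z \<in> pts (Mor P)" "point z \<in> pts M" "src P (prev z) = F (point z)" if "z \<in> pts (Mor H)" for z
    using that by (auto elim: HE)
  have hom: "lie_homomorphism H P F prev"
    unfolding lie_homomorphism_def
  proof (intro conjI ballI impI lie lie_groupoid_H)
    show "smooth_map (Ob H) (Ob P) F" using F_smooth by simp
    show "smooth_map (Mor H) (Mor P) prev" using prev_at by (simp add: smooth_map_iff_smooth_at[OF morH mor])
    show "src P (prev \<alpha>) = F (src H \<alpha>)" "tgt P (prev \<alpha>) = F (tgt H \<alpha>)" if "\<alpha> \<in> pts (Mor H)" for \<alpha>
      using mo[OF that] F_\<mu>[OF mo[OF that]] by simp_all
  qed simp_all
  have "diffeomorphism (Mor H) FP unpair"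
    unfolding diffeomorphism_def
  proof (intro conjI exI[of _ "\<lambda>p. Ext (fst p) (snd p)"] ballI)
    show "smooth_map (Mor H) FP unpair" using unpair_at by (simp add: smooth_map_iff_smooth_at[OF morH FP])
    have "smooth_at FP (Mor H) (\<lambda>p. Ext (fst p) (snd p)) p" if p: "p \<in> pts FP" for p
      by (rule Ext_at[OF FP smooth_at_fibre_product_fst_snd[OF FP_facts p] openin_topspace p])
        (metis pts_FP prod.collapse)
    then show "smooth_map FP (Mor H) (\<lambda>p. Ext (fst p) (snd p))" by (simp add: smooth_map_iff_smooth_at[OF FP morH])
  qed (auto elim: HE)
  then show ?thesis
    unfolding a_fibration_def using hom F fib act by (intro conjI exI[of _ \<mu>] exI[of _ unpair]) auto
qed

end

section \<open>Configuration groupoids\<close>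

declare One_nat_def [simp del]

lemma open_power_component:
  assumes M: "smooth_manifold M" and W: "openin (mtop (power_manifold M n)) (pts (power_manifold M n) \<inter> W)"
    and x: "x \<in> pts (open_submanifold (power_manifold M n) W)" and i: "i \<in> {1..n}"
  shows "smooth_at (open_submanifold (power_manifold M n) W) M (\<lambda>x. x i) x"
proof -
  have xp: "x \<in> pts (power_manifold M n)" "x \<in> W" using x unfolding mtop_open_submanifold topspace_subtopology by blast+
  show ?thesis unfolding smooth_at_open_source[OF smooth_manifold_power[OF M] W xp(2)] by (rule smooth_at_component[OF M xp(1) i])
qed

lemma open_power_tuple:
  assumes M: "smooth_manifold M" and W: "openin (mtop (power_manifold M n)) (pts (power_manifold M n) \<inter> W)"
    and P: "smooth_manifold P" and x: "x \<in> pts P" and f: "\<And>i. i \<in> {1..n} \<Longrightarrow> smooth_at P M (f i) x"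
    and m: "(\<lambda>i\<in>{1..n}. f i x) \<in> pts (open_submanifold (power_manifold M n) W)"
  shows "smooth_at P (open_submanifold (power_manifold M n) W) (\<lambda>y. \<lambda>i\<in>{1..n}. f i y) x"
proof (rule smooth_at_into_open[OF smooth_manifold_power[OF M] W])
  show "smooth_at P (power_manifold M n) (\<lambda>y. \<lambda>i\<in>{1..n}. f i y) x" by (rule smooth_at_tuple[OF M P x f])
  show "(\<lambda>i\<in>{1..n}. f i x) \<in> W" using m unfolding mtop_open_submanifold topspace_subtopology by blast
qed

text \<open>Writes an extended tuple in the form \<open>\<lambda>i\<in>{1..Suc m}\<close> for which
  smoothness is checked componentwise.\<close>

lemma fun_upd_tuple: "b \<in> extensional {1..m} \<Longrightarrow> (\<lambda>i\<in>{1..Suc m}. if i = Suc m then y else b i) = b(Suc m := y)"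
  by (auto simp: extensional_def fun_eq_iff)

section \<open>Configurations as manifolds\<close>

locale c_gpd = lie_gpd +
  assumes c: "c_groupoid G"
begin

abbreviation "q \<equiv> orbit G"
abbreviation "X \<equiv> mtop (Ob G)"
abbreviation "PB \<equiv> PB_ob G"

lemma cov: "covering_map X (orbit_space G) q" and Haus: "Hausdorff_space (orbit_space G)"
  using c by (auto simp: c_groupoid_def hausdorff_groupoid_def)

lemma q_cont: "continuous_map X (orbit_space G) q"
  using cov by (simp add: covering_map_def)

lemma q_tgt: "\<alpha> \<in> pts (Mor G) \<Longrightarrow> q (tgt G \<alpha>) = q (src G \<alpha>)"
  by (rule orbit_src_tgt[OF grp])

lemma mtop_PB: "mtop (PB n) = configurations X q n"
  by (simp add: PB_ob_def mtop_open_submanifold mtop_power_manifold configurations_def)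

lemma pts_PB: "x \<in> pts (PB n) \<longleftrightarrow>
    x \<in> {1..n} \<rightarrow>\<^sub>E pts (Ob G) \<and> (\<forall>i\<in>{1..n}. \<forall>j\<in>{1..n}. i \<noteq> j \<longrightarrow> q (x i) \<noteq> q (x j))"
  unfolding mtop_PB topspace_configurations by blast

lemma PB_pts: "x \<in> pts (PB n) \<Longrightarrow> i \<in> {1..n} \<Longrightarrow> x i \<in> pts (Ob G)"
  and PB_distinct: "x \<in> pts (PB n) \<Longrightarrow> i \<in> {1..n} \<Longrightarrow> j \<in> {1..n} \<Longrightarrow> i \<noteq> j \<Longrightarrow> q (x i) \<noteq> q (x j)"
  and PB_ext: "x \<in> pts (PB n) \<Longrightarrow> x \<in> extensional {1..n}"
  unfolding pts_PB by (auto simp: PiE_iff)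

lemma PB_tupleI:
  "(\<And>i. i \<in> {1..n} \<Longrightarrow> g i \<in> pts (Ob G)) \<Longrightarrow> (\<And>i j. i \<in> {1..n} \<Longrightarrow> j \<in> {1..n} \<Longrightarrow> i \<noteq> j \<Longrightarrow> q (g i) \<noteq> q (g j)) \<Longrightarrow>
    (\<lambda>i\<in>{1..n}. g i) \<in> pts (PB n)"
  unfolding pts_PB by (auto simp del: atLeastAtMost_iff)

text \<open>Two continuous maps into the Hausdorff orbit space agree on a closed set, and only
  finitely many pairs of indices are involved.\<close>

lemma PB_open:
  "openin (mtop (power_manifold (Ob G) n)) (pts (power_manifold (Ob G) n) \<inter>
     {x. \<forall>i\<in>{1..n}. \<forall>j\<in>{1..n}. i \<noteq> j \<longrightarrow> q (x i) \<noteq> q (x j)})"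
proof -
  let ?P = "power_manifold (Ob G) n"
  have pr: "continuous_map (mtop ?P) (orbit_space G) (\<lambda>x. q (x i))" if "i \<in> {1..n}" for i
    using continuous_map_compose[OF continuous_map_product_projection[OF that] q_cont] by (simp add: mtop_power_manifold o_def)
  have o: "openin (mtop ?P) {x \<in> pts ?P. i \<noteq> j \<longrightarrow> q (x i) \<noteq> q (x j)}" if i: "i \<in> {1..n}" "j \<in> {1..n}" for i j
  proof (cases "i = j")
    case False
    have "closedin (mtop ?P) {x \<in> pts ?P. q (x i) = q (x j)}"
      by (rule closedin_continuous_maps_eq[OF Haus pr[OF i(1)] pr[OF i(2)]])
    then have "openin (mtop ?P) (pts ?P - {x \<in> pts ?P. q (x i) = q (x j)})" by blast
    moreover have "pts ?P - {x \<in> pts ?P. q (x i) = q (x j)} = {x \<in> pts ?P. i \<noteq> j \<longrightarrow> q (x i) \<noteq> q (x j)}" using False by blast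
    ultimately show ?thesis by simp
  qed simp
  have "pts ?P \<inter> {x. \<forall>i\<in>{1..n}. \<forall>j\<in>{1..n}. i \<noteq> j \<longrightarrow> q (x i) \<noteq> q (x j)} =
    \<Inter>(insert (pts ?P) ((\<lambda>(i, j). {x \<in> pts ?P. i \<noteq> j \<longrightarrow> q (x i) \<noteq> q (x j)}) ` ({1..n} \<times> {1..n})))"
    by (auto simp del: atLeastAtMost_iff)
  moreover have "openin (mtop ?P) \<dots>" by (rule openin_Inter) (use o in auto)
  ultimately show ?thesis by simp
qed

lemma PB_man: "smooth_manifold (PB n)"
  unfolding PB_ob_def by (rule smooth_manifold_open_submanifold[OF smooth_manifold_power[OF ob] PB_open])

lemma PB_component: "x \<in> pts (PB n) \<Longrightarrow> i \<in> {1..n} \<Longrightarrow> smooth_at (PB n) (Ob G) (\<lambda>x. x i) x"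
  unfolding PB_ob_def by (rule open_power_component[OF ob PB_open])

lemma PB_tuple:
  "smooth_manifold P \<Longrightarrow> x \<in> pts P \<Longrightarrow> (\<And>i. i \<in> {1..n} \<Longrightarrow> smooth_at P (Ob G) (f i) x) \<Longrightarrow>
    (\<lambda>i\<in>{1..n}. f i x) \<in> pts (PB n) \<Longrightarrow> smooth_at P (PB n) (\<lambda>y. \<lambda>i\<in>{1..n}. f i y) x"
  unfolding PB_ob_def by (rule open_power_tuple[OF ob PB_open])

lemma PB_upd:
  "b \<in> pts (PB m) \<Longrightarrow> y \<in> pts (Ob G) \<Longrightarrow> (\<And>i. i \<in> {1..m} \<Longrightarrow> q y \<noteq> q (b i)) \<Longrightarrow> b(Suc m := y) \<in> pts (PB (Suc m))"
  unfolding mtop_PB by (rule configuration_extend(1))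

lemma forget_upd: "b \<in> pts (PB m) \<Longrightarrow> restrict (b(Suc m := y)) {1..m} = b"
  using PB_ext[of b m] by (auto simp: extensional_def fun_eq_iff)

lemma upd_forget: "x \<in> pts (PB (Suc m)) \<Longrightarrow> (restrict x {1..m})(Suc m := x (Suc m)) = x"
  using PB_ext[of x "Suc m"] by (auto simp: extensional_def fun_eq_iff le_Suc_eq)

text \<open>Distinctness is required at \<open>x\<close> only; it persists nearby since
  configurations form an open subset of the power.\<close>

lemma PB_upd_at:
  assumes P: "smooth_manifold P" and a: "smooth_at P (PB m) a x" and y: "smooth_at P (Ob G) y x"
    and d: "\<And>i. i \<in> {1..m} \<Longrightarrow> q (y x) \<noteq> q (a x i)"
  shows "smooth_at P (PB (Suc m)) (\<lambda>z. (a z)(Suc m := y z)) x"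
proof -
  obtain W where W: "openin (mtop P) W" "x \<in> W" "\<And>z. z \<in> W \<Longrightarrow> a z \<in> pts (PB m)"
    using smooth_at_nhd[OF a openin_topspace smooth_at_pts(2)[OF a]] by metis
  let ?f = "\<lambda>i z. if i = Suc m then y z else a z i"
  have eq: "(\<lambda>i\<in>{1..Suc m}. ?f i z) = (a z)(Suc m := y z)" if "z \<in> W" for z
    by (rule fun_upd_tuple[OF PB_ext[OF W(3)[OF that]]])
  have "smooth_at P (PB (Suc m)) (\<lambda>z. \<lambda>i\<in>{1..Suc m}. ?f i z) x"
  proof (rule PB_tuple[OF P smooth_at_pts(1)[OF a]])
    fix i assume i: "i \<in> {1..Suc m}"
    show "smooth_at P (Ob G) (?f i) x"
    proof (cases "i = Suc m")
      case False
      then have "i \<in> {1..m}" using i by auto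
      from smooth_at_compose[OF P PB_man a PB_component[OF smooth_at_pts(2)[OF a] this]]
      show ?thesis using False by simp
    qed (use y in simp)
  next
    show "(\<lambda>i\<in>{1..Suc m}. ?f i x) \<in> pts (PB (Suc m))"
      unfolding eq[OF W(2)] by (rule PB_upd[OF smooth_at_pts(2)[OF a] smooth_at_pts(2)[OF y] d])
  qed
  then show ?thesis by (rule smooth_at_cong[OF P _ W(1,2) eq])
qed

lemma forget_at:
  assumes x: "x \<in> pts (PB (Suc m))"
  shows "smooth_at (PB (Suc m)) (PB m) (\<lambda>x. restrict x {1..m}) x"
  by (rule PB_tuple[OF PB_man x PB_component[OF x]]) (use PB_pts[OF x] PB_distinct[OF x] in \<open>auto intro!: PB_tupleI\<close>)

lemma forget_smooth: "smooth_map (PB (Suc m)) (PB m) (\<lambda>x. restrict x {1..m})"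
  unfolding smooth_map_iff_smooth_at[OF PB_man PB_man] using forget_at by blast

lemma forget_submersion: "submersion (PB (Suc m)) (PB m) (\<lambda>x. restrict x {1..m})"
proof (rule submersionI[OF PB_man PB_man forget_at])
  fix x assume x: "x \<in> pts (PB (Suc m))"
  let ?F = "\<lambda>x :: nat \<Rightarrow> 'a. restrict x {1..m}"
  have Fx: "?F x \<in> pts (PB m)" by (rule smooth_at_pts(2)[OF forget_at[OF x]])
  have xm: "x (Suc m) \<in> pts (Ob G)" by (rule PB_pts[OF x]) simp
  have "local_section (PB (Suc m)) (PB m) ?F x (\<lambda>b. b(Suc m := x (Suc m)))"
  proof (rule local_sectionI[where W = "pts (PB m)"])
    show "(?F x)(Suc m := x (Suc m)) = x" by (rule upd_forget[OF x])
    show "?F (b(Suc m := x (Suc m))) = b" if "b \<in> pts (PB m)" for b by (rule forget_upd[OF that])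
    show "smooth_at (PB m) (PB (Suc m)) (\<lambda>b. b(Suc m := x (Suc m))) (?F x)"
      by (rule PB_upd_at[OF PB_man smooth_at_id[OF PB_man Fx] smooth_at_const[OF PB_man ob Fx xm]])
        (use PB_distinct[OF x, of "Suc m"] in auto)
  qed (use Fx in auto)
  then show "\<exists>s. local_section (PB (Suc m)) (PB m) ?F x s" by blast
qed

lemma forget_fibration: "hurewicz_fibration TYPE('y) (mtop (PB (Suc m))) (mtop (PB m)) (\<lambda>x. restrict x {1..m})"
proof (rule hurewicz_fibration_local_slicing)
  show "continuous_map (mtop (PB (Suc m))) (mtop (PB m)) (\<lambda>x. restrict x {1..m})"
    unfolding mtop_PB by (rule continuous_map_forget)
  have ch: "\<exists>k U \<phi>. is_chart X (k, U, \<phi>) \<and> x \<in> U" if "x \<in> topspace X" for x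
    using smooth_manifold_chart_at[OF ob that] smooth_manifold_chart[OF ob] by metis
  show "\<exists>U \<phi>. b \<in> U \<and> local_slicing (mtop (PB (Suc m))) (mtop (PB m)) (\<lambda>x. restrict x {1..m}) U \<phi>"
    if "b \<in> pts (PB m)" for b
    using configuration_local_slicing[OF cov smooth_manifold_topology(1)[OF ob] Haus ch] that unfolding mtop_PB by blast
qed (rule smooth_manifold_second_countable_sum[OF PB_man] smooth_manifold_topology[OF PB_man])+

subsection \<open>The groupoids of type b\<close>

abbreviation "MB n \<equiv> Mor (PBb G n)"

lemma PBb_sel [simp]:
  "Ob (PBb G n) = PB n" "src (PBb G n) = (\<lambda>\<alpha>. \<lambda>i\<in>{1..n}. src G (\<alpha> i))" "tgt (PBb G n) = (\<lambda>\<alpha>. \<lambda>i\<in>{1..n}. tgt G (\<alpha> i))"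
  "ident (PBb G n) = (\<lambda>x. \<lambda>i\<in>{1..n}. ident G (x i))" "ginv (PBb G n) = (\<lambda>\<alpha>. \<lambda>i\<in>{1..n}. ginv G (\<alpha> i))"
  "gcomp (PBb G n) = (\<lambda>\<alpha> \<beta>. \<lambda>i\<in>{1..n}. gcomp G (\<alpha> i) (\<beta> i))"
  by (simp_all add: PBb_def)

abbreviation "MBset n \<equiv> {\<alpha>. (\<lambda>i\<in>{1..n}. src G (\<alpha> i)) \<in> pts (PB n) \<and> (\<lambda>i\<in>{1..n}. tgt G (\<alpha> i)) \<in> pts (PB n)}"

lemma MB_def: "MB n = open_submanifold (power_manifold (Mor G) n) (MBset n)"
  by (simp add: PBb_def)

lemma pts_MB_Int: "pts (MB n) = pts (power_manifold (Mor G) n) \<inter> MBset n"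
  unfolding MB_def mtop_open_submanifold topspace_subtopology ..

lemma pts_power_Mor: "pts (power_manifold (Mor G) n) = {1..n} \<rightarrow>\<^sub>E pts (Mor G)"
  by (simp add: mtop_power_manifold)

text \<open>Only the sources need distinct orbits: a morphism does not leave its orbit, so the same
  then holds for the targets.\<close>

lemma MBI:
  assumes "\<alpha> \<in> {1..n} \<rightarrow>\<^sub>E pts (Mor G)" "\<And>i j. i \<in> {1..n} \<Longrightarrow> j \<in> {1..n} \<Longrightarrow> i \<noteq> j \<Longrightarrow> q (src G (\<alpha> i)) \<noteq> q (src G (\<alpha> j))"
  shows "\<alpha> \<in> pts (MB n)"
proof -
  have a: "\<alpha> i \<in> pts (Mor G)" if "i \<in> {1..n}" for i using assms(1) that by (rule PiE_mem)
  have "(\<lambda>i\<in>{1..n}. src G (\<alpha> i)) \<in> pts (PB n)" by (rule PB_tupleI) (use a L(1) assms(2) in blast)+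
  moreover have "(\<lambda>i\<in>{1..n}. tgt G (\<alpha> i)) \<in> pts (PB n)"
  proof (rule PB_tupleI)
    show "tgt G (\<alpha> i) \<in> pts (Ob G)" if "i \<in> {1..n}" for i by (rule L(2)[OF a[OF that]])
    show "q (tgt G (\<alpha> i)) \<noteq> q (tgt G (\<alpha> j))" if "i \<in> {1..n}" "j \<in> {1..n}" "i \<noteq> j" for i j
      using assms(2)[OF that] unfolding q_tgt[OF a[OF that(1)]] q_tgt[OF a[OF that(2)]] .
  qed
  ultimately show ?thesis using assms(1) unfolding pts_MB_Int pts_power_Mor by blast
qed

lemma MB_tupleI:
  "(\<And>i. i \<in> {1..n} \<Longrightarrow> g i \<in> pts (Mor G)) \<Longrightarrow>
    (\<And>i j. i \<in> {1..n} \<Longrightarrow> j \<in> {1..n} \<Longrightarrow> i \<noteq> j \<Longrightarrow> q (src G (g i)) \<noteq> q (src G (g j))) \<Longrightarrow> (\<lambda>i\<in>{1..n}. g i) \<in> pts (MB n)"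
  by (rule MBI) (auto simp del: atLeastAtMost_iff)

lemma MB_src: "\<alpha> \<in> pts (MB n) \<Longrightarrow> (\<lambda>i\<in>{1..n}. src G (\<alpha> i)) \<in> pts (PB n)"
  and MB_tgt: "\<alpha> \<in> pts (MB n) \<Longrightarrow> (\<lambda>i\<in>{1..n}. tgt G (\<alpha> i)) \<in> pts (PB n)"
  and MB_pts: "\<alpha> \<in> pts (MB n) \<Longrightarrow> i \<in> {1..n} \<Longrightarrow> \<alpha> i \<in> pts (Mor G)"
  and MB_ext: "\<alpha> \<in> pts (MB n) \<Longrightarrow> \<alpha> \<in> extensional {1..n}"
  unfolding pts_MB_Int pts_power_Mor by (auto simp: PiE_iff)

lemma MB_distinct:
  "\<alpha> \<in> pts (MB n) \<Longrightarrow> i \<in> {1..n} \<Longrightarrow> j \<in> {1..n} \<Longrightarrow> i \<noteq> j \<Longrightarrow> q (src G (\<alpha> i)) \<noteq> q (src G (\<alpha> j))"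
  using PB_distinct[OF MB_src, of \<alpha> n i j] by simp

lemma MB_eqI: "\<alpha> \<in> pts (MB n) \<Longrightarrow> (\<And>i. i \<in> {1..n} \<Longrightarrow> g i = \<alpha> i) \<Longrightarrow> (\<lambda>i\<in>{1..n}. g i) = \<alpha>"
  by (rule extensionalityI[OF _ MB_ext]) auto

lemma MB_open: "openin (mtop (power_manifold (Mor G) n)) (pts (power_manifold (Mor G) n) \<inter> MBset n)"
proof -
  let ?P = "power_manifold (Mor G) n"
  have o: "openin (mtop ?P) {\<alpha> \<in> pts ?P. (\<lambda>i\<in>{1..n}. f (\<alpha> i)) \<in> pts (PB n)}" if f: "smooth_map (Mor G) (Ob G) f" for f
  proof (rule openin_continuous_map_preimage)
    have "continuous_map (mtop ?P) (product_topology (\<lambda>_. X) {1..n}) (\<lambda>\<alpha>. \<lambda>i\<in>{1..n}. f (\<alpha> i))"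
      unfolding continuous_map_componentwise
    proof (intro conjI ballI)
      fix i assume i: "i \<in> {1..n}"
      have "continuous_map (Mor_top) X f" if "Mor_top = mtop (Mor G)" for Mor_top using f that by (simp add: smooth_map_def)
      from continuous_map_compose[OF continuous_map_product_projection[OF i] this[OF refl]]
      have "continuous_map (mtop ?P) X (\<lambda>\<alpha>. f (\<alpha> i))" by (simp add: mtop_power_manifold o_def)
      then show "continuous_map (mtop ?P) X (\<lambda>\<alpha>. (\<lambda>i\<in>{1..n}. f (\<alpha> i)) i)" using i by simp
    qed auto
    then show "continuous_map (mtop ?P) (mtop (power_manifold (Ob G) n)) (\<lambda>\<alpha>. \<lambda>i\<in>{1..n}. f (\<alpha> i))"
      by (simp add: mtop_power_manifold)
    show "openin (mtop (power_manifold (Ob G) n)) (pts (PB n))"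
      using PB_open[of n] unfolding PB_ob_def mtop_open_submanifold topspace_subtopology .
  qed
  have "pts ?P \<inter> MBset n = {\<alpha> \<in> pts ?P. (\<lambda>i\<in>{1..n}. src G (\<alpha> i)) \<in> pts (PB n)} \<inter> {\<alpha> \<in> pts ?P. (\<lambda>i\<in>{1..n}. tgt G (\<alpha> i)) \<in> pts (PB n)}"
    by blast
  then show ?thesis using openin_Int[OF o[OF src_smooth] o[OF tgt_smooth]] by simp
qed

lemma MB_man: "smooth_manifold (MB n)"
  unfolding MB_def by (rule smooth_manifold_open_submanifold[OF smooth_manifold_power[OF mor] MB_open])

lemma MB_component: "\<alpha> \<in> pts (MB n) \<Longrightarrow> i \<in> {1..n} \<Longrightarrow> smooth_at (MB n) (Mor G) (\<lambda>\<alpha>. \<alpha> i) \<alpha>"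
  unfolding MB_def by (rule open_power_component[OF mor MB_open])

lemma MB_tuple:
  "smooth_manifold P \<Longrightarrow> x \<in> pts P \<Longrightarrow> (\<And>i. i \<in> {1..n} \<Longrightarrow> smooth_at P (Mor G) (f i) x) \<Longrightarrow>
    (\<lambda>i\<in>{1..n}. f i x) \<in> pts (MB n) \<Longrightarrow> smooth_at P (MB n) (\<lambda>y. \<lambda>i\<in>{1..n}. f i y) x"
  unfolding MB_def by (rule open_power_tuple[OF mor MB_open])

lemma MB_src_at: "\<alpha> \<in> pts (MB n) \<Longrightarrow> smooth_at (MB n) (PB n) (\<lambda>\<alpha>. \<lambda>i\<in>{1..n}. src G (\<alpha> i)) \<alpha>"
  by (rule PB_tuple[OF MB_man _ smooth_at_compose[OF MB_man mor MB_component src_at[OF MB_pts]] MB_src])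

lemma groupoid_PBb: "groupoid (PBb G n)"
proof -
  have st: "src G (\<alpha> i) = tgt G (\<beta> i)" if "src (PBb G n) \<alpha> = tgt (PBb G n) \<beta>" "i \<in> {1..n}" for \<alpha> \<beta> i
    using fun_cong[OF that(1), of i] that(2) by simp
  show ?thesis
  proof (rule groupoidI, goal_cases)
    case (1 \<alpha>)
    show ?case using MB_src[OF 1] MB_tgt[OF 1] by simp
  next
    case (2 x)
    then have x: "x \<in> pts (PB n)" by simp
    have "(\<lambda>i\<in>{1..n}. ident G (x i)) \<in> pts (MB n)"
      by (rule MB_tupleI) (use PB_pts[OF x] L(3,4) PB_distinct[OF x] in \<open>simp_all del: atLeastAtMost_iff\<close>)
    moreover have "(\<lambda>i\<in>{1..n}. src G ((\<lambda>i\<in>{1..n}. ident G (x i)) i)) = x" "(\<lambda>i\<in>{1..n}. tgt G ((\<lambda>i\<in>{1..n}. ident G (x i)) i)) = x"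
      by (rule extensionalityI[OF _ PB_ext[OF x]]; use PB_pts[OF x] L(4,5) in simp)+
    ultimately show ?case by simp
  next
    case (3 \<alpha> \<beta>)
    note g = L(13,14,15)[OF MB_pts[OF 3(1)] MB_pts[OF 3(2)] st[OF 3(3)]]
    have "(\<lambda>i\<in>{1..n}. gcomp G (\<alpha> i) (\<beta> i)) \<in> pts (MB n)"
      by (rule MB_tupleI) (use g MB_distinct[OF 3(2)] in \<open>simp_all del: atLeastAtMost_iff\<close>)
    then show ?case using g by (simp cong: restrict_cong)
  next
    case (4 \<alpha> \<beta> \<gamma>)
    show ?case
      using L(16)[OF MB_pts[OF 4(1)] MB_pts[OF 4(2)] MB_pts[OF 4(3)] st[OF 4(4)] st[OF 4(5)]] by (simp cong: restrict_cong)
  next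
    case (5 \<alpha>)
    show ?case using L(11,12)[OF MB_pts[OF 5]] by (auto intro!: MB_eqI[OF 5])
  next
    case (6 \<alpha>)
    note g = L(6-10)[OF MB_pts[OF 6]]
    have "(\<lambda>i\<in>{1..n}. ginv G (\<alpha> i)) \<in> pts (MB n)"
      by (rule MB_tupleI) (use g q_tgt[OF MB_pts[OF 6]] MB_distinct[OF 6] in \<open>simp_all del: atLeastAtMost_iff\<close>)
    then show ?case using g by (simp cong: restrict_cong)
  qed
qed

lemma lie_groupoid_PBb: "lie_groupoid (PBb G n)"
proof (rule lie_groupoidI[OF groupoid_PBb])
  note B = groupoid_laws[OF groupoid_PBb[of n]]
  show "smooth_manifold (Ob (PBb G n))" "smooth_manifold (MB n)" using PB_man MB_man by simp_all
  show "smooth_at (MB n) (Ob (PBb G n)) (src (PBb G n)) \<alpha>" if "\<alpha> \<in> pts (MB n)" for \<alpha>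
    using MB_src_at[OF that] by simp
  show "\<exists>s. local_section (MB n) (Ob (PBb G n)) (src (PBb G n)) \<alpha> s" if a: "\<alpha> \<in> pts (MB n)" for \<alpha>
  proof -
    let ?F = "\<lambda>\<alpha>. \<lambda>i\<in>{1..n}. src G (\<alpha> i)"
    have "\<exists>s. local_section (Mor G) (Ob G) (src G) (\<alpha> i) s" if "i \<in> {1..n}" for i
      using src_section[OF MB_pts[OF a that]] by blast
    then obtain s where s: "\<And>i. i \<in> {1..n} \<Longrightarrow> local_section (Mor G) (Ob G) (src G) (\<alpha> i) (s i)" by metis
    have sa: "smooth_at (Ob G) (Mor G) (s i) (?F \<alpha> i)" "s i (?F \<alpha> i) = \<alpha> i" if "i \<in> {1..n}" for i
      using s[OF that] that by (auto simp: local_section_def)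
    have sF: "(\<lambda>i\<in>{1..n}. s i (?F \<alpha> i)) = \<alpha>" by (rule MB_eqI[OF a sa(2)])
    note Fa = MB_src[OF a]
    have sm: "smooth_at (PB n) (MB n) (\<lambda>x. \<lambda>i\<in>{1..n}. s i (x i)) (?F \<alpha>)"
    proof (rule MB_tuple[OF PB_man Fa])
      show "smooth_at (PB n) (Mor G) (\<lambda>x. s i (x i)) (?F \<alpha>)" if "i \<in> {1..n}" for i
        by (rule smooth_at_compose[where f = "\<lambda>x. x i" and g = "s i", OF PB_man ob PB_component[OF Fa that] sa(1)[OF that]])
    qed (use sF a in simp)
    have "\<exists>W. openin X W \<and> src G (\<alpha> i) \<in> W \<and> (\<forall>y\<in>W. src G (s i y) = y)" if "i \<in> {1..n}" for i
      using s[OF that] by (simp add: local_section_def)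
    then obtain W where W: "\<And>i. i \<in> {1..n} \<Longrightarrow> openin X (W i)" "\<And>i. i \<in> {1..n} \<Longrightarrow> src G (\<alpha> i) \<in> W i"
      "\<And>i y. i \<in> {1..n} \<Longrightarrow> y \<in> W i \<Longrightarrow> src G (s i y) = y" by metis
    let ?W = "\<Inter>(insert (pts (PB n)) ((\<lambda>i. {x \<in> pts (PB n). x i \<in> W i}) ` {1..n}))"
    have "local_section (MB n) (PB n) ?F \<alpha> (\<lambda>x. \<lambda>i\<in>{1..n}. s i (x i))"
    proof (rule local_sectionI[where W = ?W])
      show "smooth_at (PB n) (MB n) (\<lambda>x. \<lambda>i\<in>{1..n}. s i (x i)) (?F \<alpha>)" by (rule sm)
      show "(\<lambda>i\<in>{1..n}. s i (?F \<alpha> i)) = \<alpha>" by (rule sF)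
      show "openin (mtop (PB n)) ?W"
      proof (rule openin_Inter)
        have "openin (mtop (PB n)) {x \<in> pts (PB n). x i \<in> W i}" if "i \<in> {1..n}" for i
          unfolding mtop_PB by (rule openin_continuous_map_preimage[OF continuous_map_configuration_component[OF that] W(1)[OF that]])
        then show "openin (mtop (PB n)) S" if "S \<in> insert (pts (PB n)) ((\<lambda>i. {x \<in> pts (PB n). x i \<in> W i}) ` {1..n})" for S
          using that by blast
      qed auto
      show "?F \<alpha> \<in> ?W" using Fa W(2) by simp
      fix x assume x: "x \<in> ?W"
      then have xp: "x \<in> pts (PB n)" "\<And>i. i \<in> {1..n} \<Longrightarrow> x i \<in> W i" by auto
      show "?F (\<lambda>i\<in>{1..n}. s i (x i)) = x"
        by (rule extensionalityI[OF _ PB_ext[OF xp(1)]]) (use W(3) xp(2) in auto)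
    qed
    then show ?thesis by auto
  qed
  show "smooth_at (Ob (PBb G n)) (MB n) (ident (PBb G n)) x" if "x \<in> pts (Ob (PBb G n))" for x
  proof -
    have x: "x \<in> pts (PB n)" using that by simp
    have "smooth_at (PB n) (MB n) (\<lambda>x. \<lambda>i\<in>{1..n}. ident G (x i)) x"
    proof (rule MB_tuple[OF PB_man x])
      show "smooth_at (PB n) (Mor G) (\<lambda>x. ident G (x i)) x" if i: "i \<in> {1..n}" for i
        by (rule smooth_at_compose[where f = "\<lambda>x. x i" and g = "ident G", OF PB_man ob PB_component[OF x i] ident_at[OF PB_pts[OF x i]]])
    qed (use B(3)[OF that] in simp)
    then show ?thesis by simp
  qed
  show "smooth_at (MB n) (MB n) (ginv (PBb G n)) \<alpha>" if a: "\<alpha> \<in> pts (MB n)" for \<alpha>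
  proof -
    have "smooth_at (MB n) (MB n) (\<lambda>x. \<lambda>i\<in>{1..n}. ginv G (x i)) \<alpha>"
    proof (rule MB_tuple[OF MB_man a])
      show "smooth_at (MB n) (Mor G) (\<lambda>x. ginv G (x i)) \<alpha>" if i: "i \<in> {1..n}" for i
        by (rule smooth_at_compose[where f = "\<lambda>x. x i" and g = "ginv G", OF MB_man mor MB_component[OF a i] ginv_at[OF MB_pts[OF a i]]])
    qed (use B(6)[OF a] in simp)
    then show ?thesis by simp
  qed
  fix Q :: "((nat \<Rightarrow> 'b) \<times> (nat \<Rightarrow> 'b)) manifold" and a b x W
  assume Q: "smooth_manifold Q" and a: "smooth_at Q (MB n) a x" and b: "smooth_at Q (MB n) b x"
    and W: "openin (mtop Q) W" "x \<in> W" "\<And>z. z \<in> W \<Longrightarrow> a z \<in> pts (MB n) \<and> b z \<in> pts (MB n) \<and> src (PBb G n) (a z) = tgt (PBb G n) (b z)"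
  have "smooth_at Q (MB n) (\<lambda>z. \<lambda>i\<in>{1..n}. gcomp G (a z i) (b z i)) x"
  proof (rule MB_tuple[OF Q smooth_at_pts(1)[OF a]])
    fix i assume i: "i \<in> {1..n}"
    show "smooth_at Q (Mor G) (\<lambda>z. gcomp G (a z i) (b z i)) x"
    proof (rule comp_at[OF Q _ _ W(1,2)])
      show "smooth_at Q (Mor G) (\<lambda>z. a z i) x" "smooth_at Q (Mor G) (\<lambda>z. b z i) x"
        using smooth_at_compose[OF Q MB_man a MB_component[OF smooth_at_pts(2)[OF a] i]]
          smooth_at_compose[OF Q MB_man b MB_component[OF smooth_at_pts(2)[OF b] i]] by simp_all
      show "a z i \<in> pts (Mor G) \<and> b z i \<in> pts (Mor G) \<and> src G (a z i) = tgt G (b z i)" if "z \<in> W" for z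
      proof -
        have "src (PBb G n) (a z) i = tgt (PBb G n) (b z) i" using W(3)[OF that] by simp
        then show ?thesis using W(3)[OF that] MB_pts[of _ n i] i by simp
      qed
    qed
  next
    have "gcomp (PBb G n) (a x) (b x) \<in> pts (MB n)" using W(3)[OF W(2)] by (intro B(13)) auto
    then show "(\<lambda>i\<in>{1..n}. gcomp G (a x i) (b x i)) \<in> pts (MB n)" by simp
  qed
  then show "smooth_at Q (MB n) (\<lambda>z. gcomp (PBb G n) (a z) (b z)) x" by simp
qed

text \<open>A point of the fibre product consists of the first \<open>m\<close> morphisms and all
  \<open>m + 1\<close> sources. What is missing is one morphism of \<open>G\<close> with prescribed
  source, and by \<open>MBI\<close> its target is unrestricted. Identities provide it, which gives
  surjectivity, and local sections of the source map provide it smoothly, which gives the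
  submersion.\<close>

lemma b_fibration_PBb:
  "b_fibration TYPE('y) (PBb G (Suc m)) (PBb G m) (\<lambda>x. restrict x {1..m}) (\<lambda>\<alpha>. restrict \<alpha> {1..m})"
proof -
  interpret B: lie_gpd "PBb G m" by unfold_locales (rule lie_groupoid_PBb)
  interpret B': lie_gpd "PBb G (Suc m)" by unfold_locales (rule lie_groupoid_PBb)
  let ?F = "\<lambda>x :: nat \<Rightarrow> 'a. restrict x {1..m}" and ?R = "\<lambda>x :: nat \<Rightarrow> 'b. restrict x {1..m}"
  let ?S = "\<lambda>\<alpha>. \<lambda>i\<in>{1..Suc m}. src G (\<alpha> i)"
  have n: "Suc m \<in> {1..Suc m}" by simp
  have up: "i \<in> {1..m} \<Longrightarrow> i \<in> {1..Suc m}" for i by simp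
  have RM: "?R \<alpha> \<in> pts (MB m)" if "\<alpha> \<in> pts (MB (Suc m))" for \<alpha>
    by (rule MB_tupleI) (use MB_pts[OF that up] MB_distinct[OF that up up] in auto)
  have R_at: "smooth_at (MB (Suc m)) (MB m) ?R \<alpha>" if "\<alpha> \<in> pts (MB (Suc m))" for \<alpha>
    by (rule MB_tuple[where f = "\<lambda>i x. x i", OF MB_man that MB_component[OF that up] RM[OF that]])
  have hom: "lie_homomorphism (PBb G (Suc m)) (PBb G m) ?F ?R"
    unfolding lie_homomorphism_def
  proof (intro conjI ballI impI lie_groupoid_PBb)
    show "smooth_map (Ob (PBb G (Suc m))) (Ob (PBb G m)) ?F" using forget_smooth by simp
    show "smooth_map (MB (Suc m)) (MB m) ?R" using R_at by (simp add: smooth_map_iff_smooth_at[OF MB_man MB_man])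
  qed (auto simp: fun_eq_iff)
  let ?FP = "fibre_product (MB m) (src (PBb G m)) (PB (Suc m)) ?F"
  have FPf: "smooth_manifold (MB m)" "smooth_manifold (PB (Suc m))" "smooth_manifold (PB m)"
    "submersion (MB m) (PB m) (src (PBb G m))" "smooth_map (PB (Suc m)) (PB m) ?F"
    using MB_man PB_man B.src_submersion forget_smooth by simp_all
  note FP = smooth_manifold_fibre_product[OF FPf]
  have pFP: "p \<in> pts ?FP \<longleftrightarrow> fst p \<in> pts (MB m) \<and> snd p \<in> pts (PB (Suc m)) \<and> (\<lambda>i\<in>{1..m}. src G (fst p i)) = ?F (snd p)" for p
    unfolding pts_fibre_product by (cases p) simp
  have pq: "q (src G (fst p i)) = q (snd p i)" "src G (fst p i) = snd p i" if "p \<in> pts ?FP" "i \<in> {1..m}" for p i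
  proof -
    have "(\<lambda>i\<in>{1..m}. src G (fst p i)) i = restrict (snd p) {1..m} i" using that(1) unfolding pFP by metis
    then show "src G (fst p i) = snd p i" using that(2) by simp
    then show "q (src G (fst p i)) = q (snd p i)" by simp
  qed
  let ?T = "\<lambda>\<alpha>. (?R \<alpha>, ?S \<alpha>)"
  have Tp: "?T \<alpha> \<in> pts ?FP" if "\<alpha> \<in> pts (MB (Suc m))" for \<alpha>
    unfolding pFP fst_conv snd_conv by (intro conjI RM[OF that] MB_src[OF that]) (auto simp: fun_eq_iff)
  have T_at: "smooth_at (MB (Suc m)) ?FP ?T \<alpha>" if a: "\<alpha> \<in> pts (MB (Suc m))" for \<alpha>
    by (rule smooth_at_into_fibre_product[OF FPf MB_man R_at[OF a] MB_src_at[OF a] openin_topspace a])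
      (rule Tp[unfolded pts_fibre_product, simplified mem_Collect_eq case_prod_conv])
  \<comment> \<open>Any morphism \<open>\<gamma>\<close> with the prescribed last source completes
    the point \<open>p\<close>.\<close>
  have lift: "(\<lambda>i\<in>{1..Suc m}. if i = Suc m then \<gamma> else fst p i) \<in> pts (MB (Suc m))"
    "?T (\<lambda>i\<in>{1..Suc m}. if i = Suc m then \<gamma> else fst p i) = p"
    if p: "p \<in> pts ?FP" and g: "\<gamma> \<in> pts (Mor G)" "src G \<gamma> = snd p (Suc m)" for p \<gamma>
  proof -
    have p': "fst p \<in> pts (MB m)" "snd p \<in> pts (PB (Suc m))" using p unfolding pFP by auto
    let ?a = "\<lambda>i\<in>{1..Suc m}. if i = Suc m then \<gamma> else fst p i"
    have s: "src G (?a i) = snd p i" "?a i \<in> pts (Mor G)" if "i \<in> {1..Suc m}" for i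
      using that g pq(2)[OF p, of i] MB_pts[OF p'(1), of i] by (auto simp: le_Suc_eq)
    show a: "?a \<in> pts (MB (Suc m))"
    proof (rule MB_tupleI)
      show "q (src G (if i = Suc m then \<gamma> else fst p i)) \<noteq> q (src G (if j = Suc m then \<gamma> else fst p j))"
        if "i \<in> {1..Suc m}" "j \<in> {1..Suc m}" "i \<noteq> j" for i j
        using s(1)[OF that(1)] s(1)[OF that(2)] PB_distinct[OF p'(2) that] that(1,2) by simp
      show "(if i = Suc m then \<gamma> else fst p i) \<in> pts (Mor G)" if "i \<in> {1..Suc m}" for i
        using s(2)[OF that] that by simp
    qed
    have "?R ?a = fst p"
      by (rule extensionalityI[OF _ MB_ext[OF p'(1)]]) auto
    moreover have "?S ?a = snd p"
      by (rule extensionalityI[OF _ PB_ext[OF p'(2)]]) (use s(1) in auto)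
    ultimately show "?T ?a = p" by (simp only: prod.collapse)
  qed
  have sub: "submersion (MB (Suc m)) ?FP ?T"
  proof (rule submersionI[OF MB_man FP T_at])
    fix \<alpha> assume a: "\<alpha> \<in> pts (MB (Suc m))"
    obtain s where s: "local_section (Mor G) (Ob G) (src G) (\<alpha> (Suc m)) s" using src_section[OF MB_pts[OF a n]] by blast
    have sa: "smooth_at (Ob G) (Mor G) s (src G (\<alpha> (Suc m)))" "s (src G (\<alpha> (Suc m))) = \<alpha> (Suc m)"
      using s by (auto simp: local_section_def)
    obtain W where W: "openin X W" "src G (\<alpha> (Suc m)) \<in> W" "\<And>y. y \<in> W \<Longrightarrow> src G (s y) = y" "\<And>y. y \<in> W \<Longrightarrow> s y \<in> pts (Mor G)"
      using local_section_nhd[OF s] by metis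
    \<comment> \<open>The last component comes from the section \<open>s\<close>, the others from
      the first factor, so the section passes through \<open>\<alpha>\<close>.\<close>
    let ?s = "\<lambda>p. \<lambda>i\<in>{1..Suc m}. if i = Suc m then s (snd p (Suc m)) else fst p i"
    note p0 = smooth_at_fibre_product_fst_snd[OF FPf Tp[OF a]]
    have c: "smooth_at ?FP (Ob G) (\<lambda>p. snd p (Suc m)) (?T \<alpha>)"
      using smooth_at_compose[OF FP PB_man p0(2) PB_component[OF smooth_at_pts(2)[OF p0(2)] n]] .
    have "snd (?T \<alpha>) (Suc m) = src G (\<alpha> (Suc m))" by simp
    then have ss: "smooth_at (Ob G) (Mor G) s (snd (?T \<alpha>) (Suc m))" and cW: "snd (?T \<alpha>) (Suc m) \<in> W"
      using sa(1) W(2) by simp_all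
    obtain V where V: "openin (mtop ?FP) V" "?T \<alpha> \<in> V" "\<And>p. p \<in> V \<Longrightarrow> snd p (Suc m) \<in> W" "\<And>p. p \<in> V \<Longrightarrow> p \<in> pts ?FP"
      using smooth_at_nhd[OF c W(1) cW] by metis
    have s0: "?s (?T \<alpha>) = \<alpha>"
      by (rule MB_eqI[OF a]) (use sa(2) in auto)
    have "smooth_at ?FP (MB (Suc m)) ?s (?T \<alpha>)"
    proof (rule MB_tuple[OF FP Tp[OF a]])
      show "(\<lambda>i\<in>{1..Suc m}. if i = Suc m then s (snd (?T \<alpha>) (Suc m)) else fst (?T \<alpha>) i) \<in> pts (MB (Suc m))"
        unfolding s0 by (rule a)
      fix i assume i: "i \<in> {1..Suc m}"
      show "smooth_at ?FP (Mor G) (\<lambda>p. if i = Suc m then s (snd p (Suc m)) else fst p i) (?T \<alpha>)"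
      proof (cases "i = Suc m")
        case True
        have "smooth_at ?FP (Mor G) (\<lambda>p. s (snd p (Suc m))) (?T \<alpha>)"
          by (rule smooth_at_compose[where f = "\<lambda>p. snd p (Suc m)" and g = s, OF FP ob c ss])
        then show ?thesis using True by simp
      next
        case False
        then have "i \<in> {1..m}" using i by auto
        then have h: "smooth_at ?FP (Mor G) (\<lambda>p. fst p i) (?T \<alpha>)"
          by (rule smooth_at_compose[where f = fst and g = "\<lambda>x. x i", OF FP MB_man p0(1) MB_component[OF smooth_at_pts(2)[OF p0(1)]]])
        have eq: "(\<lambda>p. if i = Suc m then s (snd p (Suc m)) else fst p i) = (\<lambda>p. fst p i)" using False by simp
        show ?thesis unfolding eq by (rule h)
      qed
    qed
    then have "local_section (MB (Suc m)) ?FP ?T \<alpha> ?s"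
    proof (rule local_sectionI[where W = V])
      show "?s (?T \<alpha>) = \<alpha>" by (rule s0)
      show "openin (mtop ?FP) V" "?T \<alpha> \<in> V" by (rule V)+
      show "?T (?s p) = p" if "p \<in> V" for p
        by (rule lift(2)[OF V(4)[OF that] W(4)[OF V(3)[OF that]] W(3)[OF V(3)[OF that]]])
    qed
    then show "\<exists>s. local_section (MB (Suc m)) ?FP ?T \<alpha> s" by blast
  qed
  have surj: "?T ` pts (MB (Suc m)) = pts ?FP"
  proof
    show "?T ` pts (MB (Suc m)) \<subseteq> pts ?FP" using Tp by blast
    show "pts ?FP \<subseteq> ?T ` pts (MB (Suc m))"
    proof
      fix p assume p: "p \<in> pts ?FP"
      \<comment> \<open>The identity at the last object of \<open>p\<close> is a morphism with the
        right source.\<close>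
      have x: "snd p (Suc m) \<in> pts (Ob G)" using p PB_pts[OF _ n] unfolding pFP by blast
      note l = lift[OF p L(3)[OF x] L(4)[OF x]]
      show "p \<in> ?T ` pts (MB (Suc m))" by (rule image_eqI[where f = ?T, OF l(2)[symmetric] l(1)])
    qed
  qed
  show ?thesis
    unfolding b_fibration_def using hom forget_submersion forget_fibration sub surj by simp
qed

subsection \<open>The groupoids of type a\<close>

text \<open>Stage 1 is \<open>G\<close> with objects renamed as 1-tuples and morphisms wrapped in
  \<open>Base\<close>; both renamings are smooth in either direction, so the structure is carried
  over.\<close>

lemma lie_groupoid_PBa_1: "lie_groupoid (PBa G (Suc 0))"
proof -
  let ?H = "PBa G (Suc 0)" and ?B = "range (Base :: 'b \<Rightarrow> ('a, 'b) pba_mor)" and ?one = "\<lambda>y. \<lambda>i\<in>{1..1::nat}. y :: 'a"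
  have sel: "Ob ?H = PB 1" "Mor ?H = transport ?B base (Mor G)" "src ?H = (\<lambda>z. ?one (src G (base z)))" "tgt ?H = (\<lambda>z. ?one (tgt G (base z)))"
    "ident ?H = (\<lambda>x. Base (ident G (x 1)))" "ginv ?H = (\<lambda>z. Base (ginv G (base z)))" "gcomp ?H = (\<lambda>z' z. Base (gcomp G (base z') (base z)))"
    by simp_all
  let ?M = "transport ?B base (Mor G)"
  have h: "inj_on base ?B" "pts (Mor G) \<subseteq> base ` ?B" by (auto simp: inj_on_def image_iff)
  have inv: "inv_into ?B base \<alpha> = Base \<alpha>" for \<alpha> using inv_into_f_f[OF h(1), of "Base \<alpha>"] by simp
  have ptsM: "z \<in> pts ?M \<longleftrightarrow> (\<exists>\<alpha>\<in>pts (Mor G). z = Base \<alpha>)" for z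
    unfolding pts_transport[OF mor h] by auto
  have M: "smooth_manifold ?M" by (rule smooth_manifold_transport[OF mor h])
  have base_at: "smooth_at ?M (Mor G) base z" and base_pts: "base z \<in> pts (Mor G)" if "z \<in> pts ?M" for z
    using smooth_at_transport[OF mor h that] that by (auto simp: ptsM)
  have Base_at: "smooth_at P ?M (\<lambda>y. Base (f y)) x" if P: "smooth_manifold P" and f: "smooth_at P (Mor G) f x" for P :: "'c manifold" and f x
    using smooth_at_compose[OF P mor f smooth_at_inv_transport[OF mor h smooth_at_pts(2)[OF f]]] unfolding inv .
  have one: "?one y \<in> pts (PB 1)" if "y \<in> pts (Ob G)" for y by (rule PB_tupleI) (use that in auto)
  have oneE: "x 1 \<in> pts (Ob G)" "?one (x 1) = x" if "x \<in> pts (PB 1)" for x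
    using PB_pts[OF that, of 1] PB_ext[OF that] by (auto simp: extensional_def fun_eq_iff)
  have one_inj: "y = y'" if "?one y = ?one y'" for y y' using fun_cong[OF that, of 1] by simp
  have one_eq: "(\<lambda>i\<in>{1 :: nat}. y) = (\<lambda>i\<in>{1}. y') \<longleftrightarrow> y = y'" for y y' :: 'a using one_inj[of y y'] by auto
  have one_at: "smooth_at P (PB 1) (\<lambda>z. ?one (f z)) x" if P: "smooth_manifold P" and f: "smooth_at P (Ob G) f x" for P :: "'c manifold" and f x
    by (rule PB_tuple[where f = "\<lambda>_. f", OF P smooth_at_pts(1)[OF f] f one[OF smooth_at_pts(2)[OF f]]])
  have grpH: "groupoid ?H"
  proof (rule groupoidI, goal_cases)
    case (1 \<alpha>)
    then show ?case unfolding sel ptsM using one L(1,2) by auto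
  next
    case (2 x)
    then have x: "x \<in> pts (PB 1)" unfolding sel .
    show ?case unfolding sel ptsM using oneE[OF x] L(3,4,5)[OF oneE(1)[OF x]] by simp
  next
    case (3 \<alpha> \<beta>)
    then show ?case unfolding sel ptsM using L(13,14,15) by (auto simp: one_eq)
  next
    case (4 \<alpha> \<beta> \<gamma>)
    then show ?case unfolding sel ptsM using L(16) by (auto simp: one_eq)
  next
    case (5 \<alpha>)
    then show ?case unfolding sel ptsM using L(11,12) by auto
  next
    case (6 \<alpha>)
    then show ?case unfolding sel ptsM using L(6-10) by auto
  qed
  show ?thesis
  proof (rule lie_groupoidI[OF grpH], unfold sel, goal_cases)
    case 1
    show ?case by (rule PB_man)
  next
    case 2
    show ?case by (rule M)
  next
    case (3 z)
    show ?case
      by (rule one_at[OF M smooth_at_compose[where f = base and g = "src G", OF M mor base_at[OF 3] src_at[OF base_pts[OF 3]]]])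
  next
    case (4 z)
    obtain s where s: "local_section (Mor G) (Ob G) (src G) (base z) s" by (rule src_section[OF base_pts[OF 4]])
    have sa: "smooth_at (Ob G) (Mor G) s (?one (src G (base z)) 1)" "s (src G (base z)) = base z"
      using s by (auto simp: local_section_def)
    obtain W where W: "openin X W" "src G (base z) \<in> W" "\<And>y. y \<in> W \<Longrightarrow> src G (s y) = y" "\<And>y. y \<in> W \<Longrightarrow> s y \<in> pts (Mor G)"
      using local_section_nhd[OF s] by metis
    have o: "?one (src G (base z)) \<in> pts (PB 1)" by (rule one[OF L(1)[OF base_pts[OF 4]]])
    have c: "smooth_at (PB 1) (Ob G) (\<lambda>x. x 1) (?one (src G (base z)))" by (rule PB_component[OF o]) simp
    have cW: "?one (src G (base z)) 1 \<in> W" using W(2) by simp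
    obtain V where V: "openin (mtop (PB 1)) V" "?one (src G (base z)) \<in> V" "\<And>x. x \<in> V \<Longrightarrow> x 1 \<in> W" "\<And>x. x \<in> V \<Longrightarrow> x \<in> pts (PB 1)"
      using smooth_at_nhd[where f = "\<lambda>x. x 1", OF c W(1) cW] by metis
    have "local_section ?M (PB 1) (\<lambda>z. ?one (src G (base z))) z (\<lambda>x. Base (s (x 1)))"
    proof (rule local_sectionI[where W = V])
      show "smooth_at (PB 1) ?M (\<lambda>x. Base (s (x 1))) (?one (src G (base z)))"
        by (rule Base_at[OF PB_man smooth_at_compose[where f = "\<lambda>x. x 1" and g = s, OF PB_man ob c sa(1)]])
      show "Base (s (?one (src G (base z)) 1)) = z" using 4 sa(2) by (auto simp: ptsM)
      show "?one (src G (base (Base (s (x 1))))) = x" if "x \<in> V" for x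
        using W(3)[OF V(3)[OF that]] oneE(2)[OF V(4)[OF that]] by simp
    qed (rule V)+
    then show ?case by blast
  next
    case (5 x)
    have c: "smooth_at (PB 1) (Ob G) (\<lambda>x. x 1) x" by (rule PB_component[OF 5]) simp
    show ?case by (rule Base_at[OF PB_man smooth_at_compose[where f = "\<lambda>x. x 1" and g = "ident G", OF PB_man ob c ident_at[OF oneE(1)[OF 5]]]])
  next
    case (6 z)
    show ?case by (rule Base_at[OF M smooth_at_compose[where f = base and g = "ginv G", OF M mor base_at[OF 6] ginv_at[OF base_pts[OF 6]]]])
  next
    case (7 P a b x W)
    have ab: "a z \<in> pts ?M" "b z \<in> pts ?M" "src G (base (a z)) = tgt G (base (b z))" if "z \<in> W" for z
      using 7(6)[OF that] one_inj by blast+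
    show ?case
    proof (rule Base_at[OF 7(1) comp_at[OF 7(1) _ _ 7(4,5)]])
      show "smooth_at P (Mor G) (\<lambda>z. base (a z)) x"
        by (rule smooth_at_compose[where f = a and g = base, OF 7(1) M 7(2) base_at[OF smooth_at_pts(2)[OF 7(2)]]])
      show "smooth_at P (Mor G) (\<lambda>z. base (b z)) x"
        by (rule smooth_at_compose[where f = b and g = base, OF 7(1) M 7(3) base_at[OF smooth_at_pts(2)[OF 7(3)]]])
    qed (use ab base_pts in blast)
  qed
qed

text \<open>An equality, not merely an isomorphism, so that what is known about action groupoids
  applies by rewriting.\<close>

lemma PBa_step:
  "PBa G (Suc (Suc m)) = action_groupoid (PBa G (Suc m)) (PB (Suc (Suc m))) (\<lambda>x. restrict x {1..Suc m})
     (\<lambda>(\<alpha>, x). (tgt (PBa G (Suc m)) \<alpha>)(Suc (Suc m) := x (Suc (Suc m))))"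
  by (simp add: action_groupoid_def Let_def)

text \<open>The action moves the first \<open>k\<close> points and keeps the last one. By
  \<open>orb\<close> the moved points stay in their orbits, which differ from the orbit of the last
  point, so the result is again a configuration.\<close>

lemma left_space_step:
  assumes P: "lie_groupoid P" and OP: "Ob P = PB k"
    and orb: "\<And>\<alpha> i. \<alpha> \<in> pts (Mor P) \<Longrightarrow> i \<in> {1..k} \<Longrightarrow> q (tgt P \<alpha> i) = q (src P \<alpha> i)"
  shows "left_space P (PB (Suc k)) (\<lambda>x. restrict x {1..k}) (\<lambda>(\<alpha>, x). (tgt P \<alpha>)(Suc k := x (Suc k)))"
proof -
  interpret P: lie_gpd P by unfold_locales (rule P)
  let ?F = "\<lambda>x :: nat \<Rightarrow> 'a. restrict x {1..k}" and ?\<mu> = "\<lambda>(\<alpha>, x). (tgt P \<alpha>)(Suc k := x (Suc k))"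
  have n: "Suc k \<in> {1..Suc k}" by simp
  have Fs: "smooth_map (PB (Suc k)) (Ob P) ?F" unfolding OP by (rule forget_smooth)
  note FPf = P.mor PB_man P.ob P.src_submersion Fs
  let ?FP = "fibre_product (Mor P) (src P) (PB (Suc k)) ?F"
  have FP: "smooth_manifold ?FP" by (rule smooth_manifold_fibre_product[OF FPf])
  have tP: "tgt P \<alpha> \<in> pts (PB k)" if "\<alpha> \<in> pts (Mor P)" for \<alpha> using P.L(2)[OF that] unfolding OP .
  have "smooth_at ?FP (PB (Suc k)) (\<lambda>p. (tgt P (fst p))(Suc k := snd p (Suc k))) p" if p: "p \<in> pts ?FP" for p
  proof (rule PB_upd_at[OF FP])
    note fs = smooth_at_fibre_product_fst_snd[OF FPf p]
    have pp: "fst p \<in> pts (Mor P)" "snd p \<in> pts (PB (Suc k))" "src P (fst p) = ?F (snd p)"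
      using p unfolding pts_fibre_product by auto
    have "smooth_at ?FP (Ob P) (\<lambda>p. tgt P (fst p)) p"
      by (rule smooth_at_compose[where f = fst and g = "tgt P", OF FP P.mor fs(1) P.tgt_at[OF pp(1)]])
    then show "smooth_at ?FP (PB k) (\<lambda>p. tgt P (fst p)) p" unfolding OP .
    show "smooth_at ?FP (Ob G) (\<lambda>p. snd p (Suc k)) p"
      by (rule smooth_at_compose[where f = snd and g = "\<lambda>x. x (Suc k)", OF FP PB_man fs(2) PB_component[OF pp(2) n]])
    show "q (snd p (Suc k)) \<noteq> q (tgt P (fst p) i)" if i: "i \<in> {1..k}" for i
    proof -
      have "q (tgt P (fst p) i) = q (snd p i)" using orb[OF pp(1) i] pp(3) i by simp
      moreover have "q (snd p (Suc k)) \<noteq> q (snd p i)" by (rule PB_distinct[OF pp(2) n]) (use i in auto)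
      ultimately show ?thesis by simp
    qed
  qed
  then have "smooth_map ?FP (PB (Suc k)) ?\<mu>"
    unfolding smooth_map_iff_smooth_at[OF FP PB_man] by (simp add: case_prod_beta')
  moreover have "?F (?\<mu> (\<alpha>, x)) = tgt P \<alpha>" if "\<alpha> \<in> pts (Mor P)" for \<alpha> x
    using forget_upd[OF tP[OF that]] by simp
  moreover have "?\<mu> (ident P (?F x), x) = x" if x: "x \<in> pts (PB (Suc k))" for x
  proof -
    have "?F x \<in> pts (Ob P)" unfolding OP by (rule smooth_at_pts(2)[OF forget_at[OF x]])
    then show ?thesis using upd_forget[OF x] P.L(5) by simp
  qed
  moreover have "?\<mu> (\<alpha>, ?\<mu> (\<beta>, x)) = ?\<mu> (gcomp P \<alpha> \<beta>, x)"
    if "\<alpha> \<in> pts (Mor P)" "\<beta> \<in> pts (Mor P)" "src P \<alpha> = tgt P \<beta>" for \<alpha> \<beta> x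
    using P.L(15)[OF that] by simp
  ultimately show ?thesis unfolding left_space_def using PB_man Fs by blast
qed

lemma lie_groupoid_PBa:
  "lie_groupoid (PBa G (Suc m)) \<and> Ob (PBa G (Suc m)) = PB (Suc m) \<and>
    (\<forall>\<alpha>\<in>pts (Mor (PBa G (Suc m))). \<forall>i\<in>{1..Suc m}. q (tgt (PBa G (Suc m)) \<alpha> i) = q (src (PBa G (Suc m)) \<alpha> i))"
proof (induction m)
  case 0
  have "q (tgt (PBa G (Suc 0)) \<alpha> i) = q (src (PBa G (Suc 0)) \<alpha> i)" if a: "\<alpha> \<in> pts (Mor (PBa G (Suc 0)))" and i: "i \<in> {1..Suc 0}" for \<alpha> i
  proof -
    have "base \<alpha> \<in> pts (Mor G)" using a by (auto simp: transport_def topspace_pullback_topology)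
    moreover have "i \<in> {1..1}" using i by (simp add: One_nat_def)
    ultimately show ?thesis using q_tgt by simp
  qed
  then show ?case using lie_groupoid_PBa_1 by (simp add: One_nat_def)
next
  case (Suc m)
  let ?P = "PBa G (Suc m)" and ?k = "Suc m"
  let ?F = "\<lambda>x :: nat \<Rightarrow> 'a. restrict x {1..?k}" and ?\<mu> = "\<lambda>(\<alpha>, x). (tgt ?P \<alpha>)(Suc ?k := x (Suc ?k))"
  from Suc have P: "lie_groupoid ?P" and OP: "Ob ?P = PB ?k"
    and orb: "\<And>\<alpha> i. \<alpha> \<in> pts (Mor ?P) \<Longrightarrow> i \<in> {1..?k} \<Longrightarrow> q (tgt ?P \<alpha> i) = q (src ?P \<alpha> i)" by blast+
  interpret A: groupoid_action ?P "PB (Suc ?k)" ?F ?\<mu>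
    by unfold_locales (rule P, rule left_space_step[OF P OP orb])
  \<comment> \<open>The first coordinates move as one stage earlier, and the new last coordinate
    does not move at all.\<close>
  have "q (tgt A.H z i) = q (src A.H z i)" if z: "z \<in> pts (Mor A.H)" and i: "i \<in> {1..Suc ?k}" for z i
  proof -
    obtain \<beta> x where b: "z = Ext \<beta> x" "\<beta> \<in> pts (Mor ?P)" "src ?P \<beta> = ?F x" using A.HE[OF z] by metis
    show ?thesis
    proof (cases "i = Suc ?k")
      case False
      then have i': "i \<in> {1..?k}" using i by auto
      then show ?thesis using orb[OF b(2) i'] b False by simp
    qed (use b in simp)
  qed
  then show ?case unfolding PBa_step using A.lie_groupoid_H A.H_sel(1) by blast
qed

lemma a_fibration_PBa:
  "a_fibration TYPE('y) (PBa G (Suc (Suc m))) (PBa G (Suc m)) (\<lambda>x. restrict x {1..Suc m}) prev"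
proof -
  let ?P = "PBa G (Suc m)" and ?k = "Suc m"
  have P: "lie_groupoid ?P" and OP: "Ob ?P = PB ?k"
    and orb: "\<And>\<alpha> i. \<alpha> \<in> pts (Mor ?P) \<Longrightarrow> i \<in> {1..?k} \<Longrightarrow> q (tgt ?P \<alpha> i) = q (src ?P \<alpha> i)"
    using lie_groupoid_PBa by blast+
  interpret A: groupoid_action ?P "PB (Suc ?k)" "\<lambda>x. restrict x {1..?k}" "\<lambda>(\<alpha>, x). (tgt ?P \<alpha>)(Suc ?k := x (Suc ?k))"
    by unfold_locales (rule P, rule left_space_step[OF P OP orb])
  show ?thesis unfolding PBa_step
    by (rule A.a_fibration_H) (unfold OP, rule forget_submersion, rule forget_fibration)
qed

end

theorem theorem2p10:
  fixes G :: "('o, 'm) groupoid_data" and d n :: nat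
  assumes "c_groupoid G"
    and "has_dimension (Ob G) d" and "d \<ge> 2"
    and "n \<ge> 2"
  shows "a_fibration TYPE('y) (PBa G n) (PBa G (n - 1)) (Fa_ob n) Fa_mor \<and>
         b_fibration TYPE('y) (PBb G n) (PBb G (n - 1)) (Fb_ob n) (Fb_mor n)"
proof -
  interpret c_gpd G
    using assms(1) by unfold_locales (auto simp: c_groupoid_def hausdorff_groupoid_def)
  obtain m where n: "n = Suc (Suc m)" using assms(4) by (metis Suc_le_D numeral_2_eq_2 Suc_le_mono)
  have e: "Fa_ob n = (\<lambda>x. restrict x {1..Suc m})" "Fb_ob n = (\<lambda>x. restrict x {1..Suc m})" "Fb_mor n = (\<lambda>x. restrict x {1..Suc m})" "Fa_mor = prev"
    by (simp_all add: Fa_ob_def Fb_ob_def Fb_mor_def Fa_mor_def n fun_eq_iff)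
  have m: "n - 1 = Suc m" by (simp add: n)
  show ?thesis unfolding e m unfolding n by (intro conjI a_fibration_PBa b_fibration_PBb)
qed

end
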